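(* Let $N\ge1$, $1<p<\infty$, $0<sp<N$, $\chi>0$ and $m>(p^*_s)'$. (i) The supremum $H^*_{m,s}$ is finite and attained. Every nonnegative maximizer $h\in L^1(\mathbb R^N)\cap L^m(\mathbb R^N)\setminus\{0\}$ of the quotient defining $H^*_{m,s}$ is, up to a translation, radially symmetric and nonincreasing. It has compact support, is Hölder continuous on $\mathbb R^N$, and is $C^\infty$ in the interior of its support. Moreover it satisfies $$h^{m-1}=a\big(\mathcal K_{s,p}(h)-\mathcal C\big)_+\quad\text{in }\mathbb R^N$$ for suitable constants $a>0$, $\mathcal C>0$. (ii) Suppose $m>m_c$. For every nonnegative maximizer $h$, with $M:=\|h\|_1$, there exists a unique $\lambda>0$ such that a translate of $h^\lambda$ is a minimizer of $\mathcal F_{s,p}$ over $\mathcal Y_M$. Conversely, for every $M>0$ minimizers of $\mathcal F_{s,p}$ over $\mathcal Y_M$ exist, and every such minimizer is a maximizer of the quotient defining $H^*_{m,s}$. (iii) Suppose $m=m_c$. Let $h$ be a nonnegative maximizer with $\|h\|_1=M_c$. Then a translate of $h$ lying in $\mathcal Y_{M_c}$ is a minimizer of $\mathcal F_{s,p}$ over $\mathcal Y_{M_c}$, and $\mathcal F_{s,p}(h)=0$. Conversely, minimizers of $\mathcal F_{s,p}$ over $\mathcal Y_M$ exist if and only if $M=M_c$, and every such minimizer is a maximizer of the quotient defining $H^*_{m_c,s}$.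
   Context: Notation. $\omega_N$ denotes the volume of the unit ball of $\mathbb R^N$, and $\|\cdot\|_q$ denotes the $L^q(\mathbb R^N)$ norm. Riesz kernels. For $0<s<N/2$ let $K_s(x)=c_{N,s}|x|^{2s-N}$ with $c_{N,s}=\pi^{-N/2}2^{-2s}\Gamma(N/2-s)/\Gamma(s)$. In particular, for $0<s<N$, $K_{s/2}(x)=c_{N,s/2}|x|^{s-N}$. Exponents. For $1<q<\infty$ write $q'=q/(q-1)$. For $0<sp<N$ let $p^*_s=Np/(N-sp)$, so that its conjugate is $(p^*_s)'=Np/(N(p-1)+sp)$. Set $m_c:=p'-sp'/N$. Nonlinear $(s,p)$ Riesz potential. $\mathcal K_{s,p}(\rho):=K_{s/2}*(K_{s/2}*\rho)^{p'-1}$. HLS constant. For $m>(p^*_s)'$ let $\vartheta_0:=1-m'/p^*_s\in(0,1)$ and $$H^*_{m,s}:=\sup\Big\{\frac{\|K_{s/2}*h\|_{p'}^{p'}}{\|h\|_1^{p'\vartheta_0}\|h\|_m^{p'(1-\vartheta_0)}}:\ h\in L^1(\mathbb R^N)\cap L^m(\mathbb R^N)\setminus\{0\}\Big\}.$$ Admissible class. For $M>0$, $$\mathcal Y_M=\Big\{\rho\in L^1_+(\mathbb R^N)\cap L^m(\mathbb R^N):\ \int\rho=M,\ \int x\rho(x)\,dx=0\Big\}.$$ Free energy. For $m>1$ and $\chi>0$, $$\mathcal F_{s,p}(\rho)=\frac1{m-1}\int_{\mathbb R^N}\rho^m-\frac{\chi}{p'}\int_{\mathbb R^N}(K_{s/2}*\rho)^{p'}.$$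 Dilations. $\rho^\lambda(x):=\lambda^N\rho(\lambda x)$ for $\lambda>0$. Critical mass. $M_c:=\big(p^*_s/(\chi H^*_{m_c,s})\big)^{N/(sp')}$. *)

theory Defs
  imports "HOL-Analysis.Analysis"
begin

definition conj_exp :: "real \<Rightarrow> real" where
  "conj_exp q = q / (q - 1)"

definition riesz_const :: "real \<Rightarrow> real \<Rightarrow> real" where
  "riesz_const N s = pi powr (- N / 2) * 2 powr (- 2 * s) * Gamma (N / 2 - s) / Gamma s"

definition riesz_kernel :: "real \<Rightarrow> 'a::euclidean_space \<Rightarrow> real" where
  "riesz_kernel s x = riesz_const (real DIM('a)) s * norm x powr (2 * s - real DIM('a))"

definition conv :: "('a::euclidean_space \<Rightarrow> real) \<Rightarrow> ('a \<Rightarrow> real) \<Rightarrow> 'a \<Rightarrow> real" where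
  "conv K f x = (LINT y|lebesgue. K (x - y) * f y)"

definition pstar :: "real \<Rightarrow> real \<Rightarrow> real \<Rightarrow> real" where
  "pstar N s p = N * p / (N - s * p)"

definition mcrit :: "real \<Rightarrow> real \<Rightarrow> real \<Rightarrow> real" where
  "mcrit N s p = conj_exp p - s * conj_exp p / N"

definition Lp :: "real \<Rightarrow> ('a::euclidean_space \<Rightarrow> real) \<Rightarrow> bool" where
  "Lp q f \<longleftrightarrow> f \<in> borel_measurable lebesgue \<and> integrable lebesgue (\<lambda>x. \<bar>f x\<bar> powr q)"

definition Lnorm :: "real \<Rightarrow> ('a::euclidean_space \<Rightarrow> real) \<Rightarrow> real" where
  "Lnorm q f = (LINT x|lebesgue. \<bar>f x\<bar> powr q) powr (1 / q)"

definition Kspot :: "real \<Rightarrow> real \<Rightarrow> ('a::euclidean_space \<Rightarrow> real) \<Rightarrow> 'a \<Rightarrow> real" where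
  "Kspot s p \<rho> = conv (riesz_kernel (s / 2))
      (\<lambda>x. (conv (riesz_kernel (s / 2)) \<rho> x) powr (conj_exp p - 1))"

definition hls_adm :: "real \<Rightarrow> ('a::euclidean_space \<Rightarrow> real) \<Rightarrow> bool" where
  "hls_adm m h \<longleftrightarrow> Lp 1 h \<and> Lp m h \<and> \<not> (AE x in lebesgue. h x = 0)"

definition theta0 :: "real \<Rightarrow> real \<Rightarrow> real \<Rightarrow> real \<Rightarrow> real" where
  "theta0 N s p m = 1 - conj_exp m / pstar N s p"

definition hls_quot :: "real \<Rightarrow> real \<Rightarrow> real \<Rightarrow> ('a::euclidean_space \<Rightarrow> real) \<Rightarrow> ennreal" where
  "hls_quot s p m h =
     (\<integral>\<^sup>+ x. ennreal (\<bar>conv (riesz_kernel (s / 2)) h x\<bar> powr conj_exp p) \<partial>lebesgue)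
     * ennreal (1 / (Lnorm 1 h powr (conj_exp p * theta0 (real DIM('a)) s p m)
                     * Lnorm m h powr (conj_exp p * (1 - theta0 (real DIM('a)) s p m))))"

definition Hstar :: "'a::euclidean_space itself \<Rightarrow> real \<Rightarrow> real \<Rightarrow> real \<Rightarrow> ennreal" where
  "Hstar _ s p m = (SUP h \<in> {h :: 'a \<Rightarrow> real. hls_adm m h}. hls_quot s p m h)"

definition hls_maximizer :: "real \<Rightarrow> real \<Rightarrow> real \<Rightarrow> ('a::euclidean_space \<Rightarrow> real) \<Rightarrow> bool" where
  "hls_maximizer s p m h \<longleftrightarrow> hls_adm m h \<and> hls_quot s p m h = Hstar TYPE('a) s p m"

definition Yclass :: "real \<Rightarrow> real \<Rightarrow> ('a::euclidean_space \<Rightarrow> real) \<Rightarrow> bool" where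
  "Yclass m M \<rho> \<longleftrightarrow> Lp 1 \<rho> \<and> (AE x in lebesgue. 0 \<le> \<rho> x) \<and> Lp m \<rho>
     \<and> (LINT x|lebesgue. \<rho> x) = M
     \<and> integrable lebesgue (\<lambda>x. \<rho> x *\<^sub>R x) \<and> (LINT x|lebesgue. \<rho> x *\<^sub>R x) = 0"

definition Fen :: "real \<Rightarrow> real \<Rightarrow> real \<Rightarrow> real \<Rightarrow> ('a::euclidean_space \<Rightarrow> real) \<Rightarrow> real" where
  "Fen s p m chi \<rho> = 1 / (m - 1) * (LINT x|lebesgue. \<rho> x powr m)
     - chi / conj_exp p * (LINT x|lebesgue. (conv (riesz_kernel (s / 2)) \<rho> x) powr conj_exp p)"

definition Fminimizer :: "real \<Rightarrow> real \<Rightarrow> real \<Rightarrow> real \<Rightarrow> real \<Rightarrow> ('a::euclidean_space \<Rightarrow> real) \<Rightarrow> bool" where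
  "Fminimizer s p m chi M \<rho> \<longleftrightarrow> Yclass m M \<rho> \<and> (\<forall>\<sigma> :: 'a \<Rightarrow> real. Yclass m M \<sigma> \<longrightarrow> Fen s p m chi \<rho> \<le> Fen s p m chi \<sigma>)"

definition dilate :: "real \<Rightarrow> ('a::euclidean_space \<Rightarrow> real) \<Rightarrow> 'a \<Rightarrow> real" where
  "dilate lam \<rho> x = lam ^ DIM('a) * \<rho> (lam *\<^sub>R x)"

definition translate :: "'a::euclidean_space \<Rightarrow> ('a \<Rightarrow> real) \<Rightarrow> 'a \<Rightarrow> real" where
  "translate y \<rho> x = \<rho> (x - y)"

definition Mcrit :: "'a::euclidean_space itself \<Rightarrow> real \<Rightarrow> real \<Rightarrow> real \<Rightarrow> real" where
  "Mcrit T s p chi =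
     (pstar (real DIM('a)) s p
        / (chi * enn2real (Hstar T s p (mcrit (real DIM('a)) s p))))
     powr (real DIM('a) / (s * conj_exp p))"

fun Ck :: "nat \<Rightarrow> 'a::euclidean_space set \<Rightarrow> ('a \<Rightarrow> real) \<Rightarrow> bool" where
  "Ck 0 S f = continuous_on S f"
| "Ck (Suc k) S f = ((\<forall>x\<in>S. f differentiable (at x))
      \<and> (\<forall>b\<in>Basis. Ck k S (\<lambda>x. frechet_derivative f (at x) b)))"

definition smooth_on :: "'a::euclidean_space set \<Rightarrow> ('a \<Rightarrow> real) \<Rightarrow> bool" where
  "smooth_on S f \<longleftrightarrow> (\<forall>k. Ck k S f)"

definition holder_continuous :: "('a::euclidean_space \<Rightarrow> real) \<Rightarrow> bool" where
  "holder_continuous g \<longleftrightarrow> (\<exists>\<alpha> C. 0 < \<alpha> \<and> \<alpha> \<le> 1 \<and> (\<forall>x y. \<bar>g x - g y\<bar> \<le> C * dist x y powr \<alpha>))"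

definition radial_nonincr_about :: "'a::euclidean_space \<Rightarrow> ('a \<Rightarrow> real) \<Rightarrow> bool" where
  "radial_nonincr_about x0 g \<longleftrightarrow> (\<exists>\<phi>. (\<forall>x. g x = \<phi> (dist x x0))
      \<and> (\<forall>r t. 0 \<le> r \<longrightarrow> r \<le> t \<longrightarrow> \<phi> t \<le> \<phi> r))"

end

(* The quotient is invariant under translations, dilations and multiplication by constants, and a
   polarization argument reduces its supremum to radially nonincreasing functions of unit L^1 and L^m
   norm. These are dominated by |x|^(-N) and |x|^(-N/m); since (p*_s)' lies strictly between 1 and m,
   a Helly-type selection and dominated convergence give a maximizer. Equality in polarization forces
   symmetry of every maximizer about its median hyperplanes, and the first variation gives the
   Euler-Lagrange equation h^(m-1) = a (K_{s,p} h - C)_+; the decay of the potential at infinity makes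
   C > 0 and the support compact. Interior smoothness is a bootstrap in a dyadic smoothness scale in
   which convolution with the Riesz kernel gains s derivatives. For fixed mass and equality in the
   quotient inequality the free energy is psi(A) = A/(m-1) - b A^tau with A the m-th power of the
   L^m norm; tau < 1 exactly when m > m_c and tau = 1 at m = m_c, and dilations move A freely. *)
theory Submission
  imports Defs "HOL-Probability.Helly_Selection" "HOL-Complex_Analysis.Great_Picard"
begin

text \<open>All decay exponents are measured against \<open>b0\<close>, for which
  \<open>norm x powr - b0\<close> has logarithmically divergent energy. As (p*_s)' = N / b0, the
  hypothesis on m reads N / m < b0, and b0 < N holds by sp < N: the bound from the L^m norm tames
  the origin, the one from the L^1 norm tames infinity. The same inequality, in the form
  \<open>decay_gain\<close>, lets the bootstrap at the origin start. Symmetrization minimizes the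
  second moment over a compact class stable under polarization; the minimizer is fixed by all
  polarizations whose preferred half-space contains the origin in its interior. Mass may drop in the
  limit of a maximizing sequence. The two scaling parameters repair this, because the exponents
  \<open>\<alpha>\<close> and \<open>\<tau>\<close> are positive. Potentials do not see null sets
  and are defined at every point, so a maximizer gets its good representative from its own
  potential. In the variations the energy enters through its tangent inequality from below, which is
  the direction that fits the upper bound \<open>energy_le\<close>. Cutoffs are of class C^k for
  fixed k, since each order of smoothness is proved separately.\<close>

abbreviation NN_lborel :: "('a::euclidean_space => ennreal) => ennreal"  (binder "NN " 10) where
  "NN_lborel f \<equiv> nn_integral lborel f"

abbreviation Borel :: "('a::topological_space => 'b::topological_space) set" where
  "Borel \<equiv> borel_measurable borel"

lemma sets_borel_balls [measurable]:
  "ball (c::'a::euclidean_space) r \<in> sets borel" "cball c r \<in> sets borel"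
  by auto

section \<open>Lebesgue measure under affine maps, linear isometries and hyperplane
  reflections\<close>

lemma nn_integral_lborel_affine:
  fixes f :: "'a::euclidean_space => ennreal"
  assumes [measurable]: "f \<in> Borel" and c: "c ~= 0"
  shows "(NN x. f x) = ennreal (\<bar>c\<bar> ^ DIM('a)) * (NN x. f (t + c *\<^sub>R x))"
  by (subst lborel_affine[OF c, of t])
     (simp add: nn_integral_density nn_integral_distr nn_integral_cmult ennreal_power)

lemma nn_integral_lborel_translate:
  fixes f :: "'a::euclidean_space => ennreal"
  assumes [measurable]: "f \<in> Borel"
  shows "(NN x. f (x + t)) = (NN x. f x)"
  using nn_integral_lborel_affine[of f 1 t] by (simp add: add.commute)

lemma nn_integral_lborel_reflect:
  fixes f :: "'a::euclidean_space => ennreal"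
  assumes [measurable]: "f \<in> Borel"
  shows "(NN x. f (t - x)) = (NN x. f x)"
  using nn_integral_lborel_affine[of f "-1" t] by simp

text \<open>The factor is a real power of \<open>c\<close>, so that it combines directly with the
  real exponents of the kernel and of the norm weights.\<close>

lemma nn_integral_lborel_scale:
  fixes f :: "'a::euclidean_space => ennreal"
  assumes [measurable]: "f \<in> Borel" and c: "0 < c"
  shows "(NN x. f (c *\<^sub>R x)) = ennreal (c powr - real DIM('a)) * (NN x. f x)"
proof -
  have "ennreal (c powr - real DIM('a)) * ennreal (\<bar>c\<bar> ^ DIM('a)) = 1"
    using c by (simp flip: ennreal_mult'' powr_realpow add: powr_add[symmetric])
  then show ?thesis
    using nn_integral_lborel_affine[of f c 0] c
    by (simp add: mult.assoc[symmetric])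
qed

text \<open>Both sides are translation invariant; Fubini applied to \<open>f (x + y) * g y\<close> with \<open>g\<close> the
  indicator of the unit ball, which \<open>T\<close> preserves, identifies them.\<close>

lemma distr_lborel_linear_isometry:
  fixes T :: "'a::euclidean_space => 'a"
  assumes lin: "linear T" and iso: "!!x. norm (T x) = norm x"
  shows "distr lborel borel T = lborel"
proof -
  have Tm[measurable]: "T \<in> Borel"
    using lin by (intro borel_measurable_continuous_onI linear_continuous_on) (simp add: linear_conv_bounded_linear)
  have "inj T"
    using lin iso by (metis linear_injective_0 norm_eq_zero)
  then have surj: "surj T" using lin linear_injective_imp_surjective by blast
  define \<mu> where "\<mu> = distr lborel borel T"
  have [measurable_cong]: "sets \<mu> = sets borel" by (simp add: \<mu>_def)
  have sp: "space \<mu> = UNIV" by (simp add: \<mu>_def)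
  have int\<mu>: "(\<integral>\<^sup>+x. f x \<partial>\<mu>) = (NN x. f (T x))" if [measurable]: "f \<in> Borel" for f :: "'a => ennreal"
    by (simp add: \<mu>_def nn_integral_distr)
  have ball\<mu>: "emeasure \<mu> (ball 0 r) = emeasure lborel (ball (0::'a) r)" for r
  proof -
    have "T -` ball 0 r = ball 0 r" using iso by auto
    then show ?thesis by (simp add: \<mu>_def emeasure_distr)
  qed
  have "sigma_finite_measure \<mu>"
  proof
    show "\<exists>A. countable A \<and> A \<subseteq> sets \<mu> \<and> \<Union> A = space \<mu> \<and> (\<forall>a\<in>A. emeasure \<mu> a ~= \<infinity>)"
    proof (intro exI[of _ "range (%n::nat. ball (0::'a) (real n))"] conjI)
      show "\<Union> (range (%n::nat. ball (0::'a) (real n))) = space \<mu>"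
        unfolding sp using reals_Archimedean2 by (auto simp: dist_norm)
      show "\<forall>a\<in>range (%n. ball (0::'a) (real n)). emeasure \<mu> a ~= \<infinity>"
        using emeasure_lborel_ball_finite by (auto simp: ball\<mu> less_top[symmetric])
    qed auto
  qed
  then interpret M: sigma_finite_measure \<mu> .
  interpret PM: pair_sigma_finite lborel \<mu> ..
  define g :: "'a => ennreal" where "g = indicator (ball 0 1)"
  have [measurable]: "g \<in> Borel" by (auto simp: g_def intro!: borel_measurable_indicator)
  have trans\<mu>: "(\<integral>\<^sup>+y. f (x + y) \<partial>\<mu>) = (\<integral>\<^sup>+y. f y \<partial>\<mu>)" if [measurable]: "f \<in> Borel" for f :: "'a => ennreal" and x
  proof -
    obtain w where w: "x = T w" using surj by (metis surjD)
    have "(\<integral>\<^sup>+y. f (x + y) \<partial>\<mu>) = (NN z. f (T (z + w)))"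
      by (simp add: int\<mu> w linear_add[OF lin] add.commute)
    also have "... = (NN z. f (T z))"
      by (subst nn_integral_lborel_translate[of "%z. f (T z)"]) auto
    finally show ?thesis by (simp add: int\<mu>)
  qed
  have eq: "(NN x. f x) = (\<integral>\<^sup>+x. f x \<partial>\<mu>)" if [measurable]: "f \<in> Borel" for f :: "'a => ennreal"
  proof -
    have "(NN x. f x) * (\<integral>\<^sup>+y. g y \<partial>\<mu>) = (\<integral>\<^sup>+y. (NN x. f x * g y) \<partial>\<mu>)"
      by (simp add: nn_integral_multc nn_integral_cmult)
    also have "... = (\<integral>\<^sup>+y. (NN x. f (x + y) * g y) \<partial>\<mu>)"
      by (simp add: nn_integral_multc nn_integral_lborel_translate)
    also have "... = (NN x. (\<integral>\<^sup>+y. f (x + y) * g ((x + y) - x) \<partial>\<mu>))"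
      by (subst PM.Fubini') auto
    also have "... = (NN x. (\<integral>\<^sup>+y. f y * g (y - x) \<partial>\<mu>))"
      by (subst trans\<mu>[of "%y. f y * g (y - _)"]) auto
    also have "... = (\<integral>\<^sup>+y. (NN x. f y * g (y - x)) \<partial>\<mu>)"
      by (subst PM.Fubini') auto
    also have "... = (\<integral>\<^sup>+y. f y * (NN x. g x) \<partial>\<mu>)"
      by (simp add: nn_integral_cmult nn_integral_lborel_reflect)
    also have "... = (\<integral>\<^sup>+y. f y \<partial>\<mu>) * (NN x. g x)"
      by (simp add: nn_integral_multc)
    finally have e: "(NN x. f x) * (\<integral>\<^sup>+y. g y \<partial>\<mu>) = (\<integral>\<^sup>+y. f y \<partial>\<mu>) * (NN x. g x)" .
    have g1: "(\<integral>\<^sup>+y. g y \<partial>\<mu>) = emeasure lborel (ball (0::'a) 1)" "(NN y. g y) = emeasure lborel (ball (0::'a) 1)"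
      by (simp_all add: g_def ball\<mu>)
    have "emeasure lborel (ball (0::'a) 1) ~= 0" "emeasure lborel (ball (0::'a) 1) ~= \<infinity>"
      using emeasure_lborel_ball_finite[of "0::'a" 1]
      by (auto simp: emeasure_eq_measure2 content_ball_pos less_imp_neq[symmetric] emeasure_ball unit_ball_vol_pos less_imp_neq)
    then show ?thesis using e unfolding g1 by (metis ennreal_mult_cancel_left mult.commute infinity_ennreal_def)
  qed
  show ?thesis
  proof (rule measure_eqI)
    fix A assume "A \<in> sets (distr lborel borel T)"
    then have A[measurable]: "A \<in> sets borel" by simp
    show "emeasure (distr lborel borel T) A = emeasure lborel A"
      using eq[of "indicator A"] by (simp add: \<mu>_def)
  qed simp
qed

text \<open>For unit \<open>e\<close>, the reflection in the hyperplane
  \<open>e \<bullet> x = t\<close>. The orientation of \<open>e\<close> marks a preferred side,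
  \<open>t <= e \<bullet> x\<close>, to which polarization assigns the larger value.\<close>

definition hrefl :: "'a::euclidean_space => real => 'a => 'a" where
  "hrefl e t x = x - (2 * (e \<bullet> x - t)) *\<^sub>R e"

lemma continuous_hrefl [continuous_intros]: "continuous_on A (hrefl e t)"
  unfolding hrefl_def by (intro continuous_intros)

lemma borel_measurable_hrefl [measurable]: "hrefl e t \<in> Borel"
  by (intro borel_measurable_continuous_onI continuous_hrefl)

lemma hrefl_hrefl [simp]: "norm e = 1 ==> hrefl e t (hrefl e t x) = x"
  by (simp add: hrefl_def inner_diff_right algebra_simps norm_eq_1)

lemma inner_refl: "norm e = 1 ==> e \<bullet> hrefl e t x = 2 * t - e \<bullet> x"
  by (simp add: hrefl_def inner_diff_right norm_eq_1)

lemma hrefl_fixed: "e \<bullet> x = t ==> hrefl e t x = x"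
  by (simp add: hrefl_def)

text \<open>The sign of the product carries the geometry of polarization: reflecting one of two
  points on the same side moves them apart, on opposite sides it brings them together.\<close>

lemma norm_diff_refl_sq:
  "norm e = 1 ==> (norm (x - hrefl e t y))\<^sup>2 = (norm (x - y))\<^sup>2 + 4 * (e \<bullet> x - t) * (e \<bullet> y - t)"
  unfolding power2_norm_eq_inner
  by (simp add: hrefl_def inner_diff_right inner_diff_left inner_commute norm_eq_1 algebra_simps power2_eq_square)

lemma dist_hrefl_hrefl: "norm e = 1 ==> norm (hrefl e t x - hrefl e t y) = norm (x - y)"
proof -
  assume e: "norm e = 1"
  have "(norm (hrefl e t x - hrefl e t y))\<^sup>2 = (norm (x - y))\<^sup>2"
    using norm_diff_refl_sq[OF e, of "hrefl e t x" t y] norm_diff_refl_sq[OF e, of y t x] e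
    by (simp add: inner_refl norm_minus_commute algebra_simps)
  then show ?thesis by simp
qed

lemma norm_diff_refl_swap: "norm e = 1 ==> norm (hrefl e t x - y) = norm (x - hrefl e t y)"
  by (metis dist_hrefl_hrefl hrefl_hrefl)

lemma norm_refl_sq: "norm e = 1 ==> (norm (hrefl e t x))\<^sup>2 = (norm x)\<^sup>2 - 4 * t * (e \<bullet> x - t)"
  using norm_diff_refl_sq[of e 0 t x] by (simp add: algebra_simps)

lemma distr_refl:
  fixes e :: "'a::euclidean_space"
  assumes e: "norm e = 1"
  shows "distr lborel borel (hrefl e t) = lborel"
proof -
  have lin: "linear (hrefl e 0)"
    by (rule linearI) (simp_all add: hrefl_def inner_add_right algebra_simps)
  have iso: "norm (hrefl e 0 x) = norm x" for x
    using norm_refl_sq[OF e, of 0 x] by simp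
  have "distr lborel borel (hrefl e t) = distr (distr lborel borel (hrefl e 0)) borel ((+) ((2 * t) *\<^sub>R e))"
    by (subst distr_distr) (auto simp: hrefl_def comp_def algebra_simps intro!: distr_cong)
  then show ?thesis by (simp add: distr_lborel_linear_isometry[OF lin iso] lborel_distr_plus)
qed

lemma nn_integral_refl:
  assumes "norm e = 1" and [measurable]: "f \<in> Borel"
  shows "(NN x. f (hrefl e t x)) = (NN x. f x)"
  by (subst (2) distr_refl[OF assms(1), symmetric, of t]) (simp add: nn_integral_distr)

lemma AE_refl:
  assumes "norm e = 1" "AE x in lborel. P x"
  shows "AE x in lborel. P (hrefl e t x)"
proof -
  have "AE x in distr lborel borel (hrefl e t). P x"
    using assms(2) by (simp only: distr_refl[OF assms(1)])
  then show ?thesis by (rule AE_distrD[rotated]) simp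
qed

text \<open>Turns inequalities for the two values at a mirror pair into integral inequalities; the
  factor 2 stands in for a splitting into half-spaces.\<close>

lemma nn_integral_fold_refl:
  assumes e: "norm e = 1" and [measurable]: "f \<in> Borel"
  shows "2 * (NN x. f x) = (NN x. f x + f (hrefl e t x))"
  by (subst nn_integral_add) (auto simp: nn_integral_refl[OF e] mult_2)

section \<open>Integrals of powers of the norm, and the Riesz convolution of a power\<close>

text \<open>Self-similarity takes the place of polar coordinates. \<open>D (Suc n)\<close> is
  covered by \<open>D 1\<close> and the \<open>\<mu>\<close>-dilate of \<open>D n\<close>, and
  dilation multiplies the integral by a factor less than 1, so all integrals stay below a geometric
  sum. It is applied with \<open>\<mu> = 1/2\<close> near the origin and \<open>\<mu> = 2\<close> at
  infinity.\<close>

lemma nn_integral_power_shells: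
  fixes D :: "nat => 'a::euclidean_space set"
  assumes \<mu>: "0 < \<mu>" "\<mu> powr (real DIM('a) - b) < 1"
    and D[measurable]: "!!n. D n \<in> sets borel" and inc: "incseq D" and D0: "D 0 = {}"
    and fin: "!!x. x \<in> D 1 ==> 1 / 2 <= norm x \<and> norm x <= 2"
    and rec: "!!n x. x \<in> D (Suc n) ==> x \<in> D 1 \<or> (1 / \<mu>) *\<^sub>R x \<in> D n"
  shows "(NN x. ennreal (norm x powr - b) * indicator (\<Union>n. D n) x) < \<infinity>"
proof -
  define I where "I n = (NN x. ennreal (norm x powr - b) * indicator (D n) x)" for n
  define \<theta> where "\<theta> = \<mu> powr (real DIM('a) - b)"
  have \<theta>: "0 < \<theta>" "\<theta> < 1" using \<mu> by (auto simp: \<theta>_def)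
  have step: "I (Suc n) <= I 1 + ennreal \<theta> * I n" for n
  proof -
    have "I (Suc n) <= (NN x. ennreal (norm x powr - b) * indicator (D 1) x
        + ennreal (norm x powr - b) * indicator (D n) ((1 / \<mu>) *\<^sub>R x))"
      unfolding I_def by (intro nn_integral_mono) (use rec in \<open>auto split: split_indicator\<close>)
    also have "... = I 1 + (NN x. ennreal (norm x powr - b) * indicator (D n) ((1 / \<mu>) *\<^sub>R x))"
      unfolding I_def by (subst nn_integral_add) auto
    also have "(NN x. ennreal (norm x powr - b) * indicator (D n) ((1 / \<mu>) *\<^sub>R x))
       = (NN x. ennreal (\<mu> powr - b) * (ennreal (norm ((1 / \<mu>) *\<^sub>R x) powr - b) * indicator (D n) ((1 / \<mu>) *\<^sub>R x)))"
      using \<mu> by (intro nn_integral_cong)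
        (auto simp: powr_divide powr_minus divide_simps mult.assoc[symmetric] ennreal_mult[symmetric] split: split_indicator)
    also have "... = ennreal (\<mu> powr - b) * (ennreal ((1 / \<mu>) powr - real DIM('a)) * I n)"
      unfolding I_def using \<mu> by (subst nn_integral_cmult, simp, subst nn_integral_lborel_scale[of "%x. ennreal (norm x powr - b) * indicator (D n) x"]) auto
    also have "... = ennreal \<theta> * I n"
      using \<mu> by (simp add: mult.assoc[symmetric] ennreal_mult[symmetric] \<theta>_def powr_divide powr_minus divide_simps powr_diff)
    finally show ?thesis .
  qed
  have "I 1 <= (NN x. ennreal (2 powr \<bar>b\<bar>) * indicator (cball (0::'a) 2) x)"
    unfolding I_def
  proof (intro nn_integral_mono)
    fix x :: 'a
    have "norm x powr - b <= 2 powr \<bar>b\<bar>" if "x \<in> D 1"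
    proof (cases "0 <= b")
      case True
      have "norm x powr - b <= (1/2) powr - b" using fin[OF that] True by (intro powr_mono2') auto
      then show ?thesis using True by (simp add: powr_divide powr_minus)
    next
      case False
      then show ?thesis using fin[OF that] by (auto intro: powr_mono2)
    qed
    then show "ennreal (norm x powr - b) * indicator (D 1) x <= ennreal (2 powr \<bar>b\<bar>) * indicator (cball 0 2) x"
      using fin[of x] by (auto split: split_indicator intro: ennreal_leI)
  qed
  also have "... < \<infinity>"
    using emeasure_lborel_cball_finite[of "0::'a" 2] by (subst nn_integral_cmult_indicator) (auto simp: ennreal_mult_less_top)
  finally obtain S where S: "I 1 = ennreal S" "0 <= S"
    by (cases "I 1") auto
  \<comment> \<open>\<open>S / (1 - \<theta>)\<close> is the fixed point of
    \<open>u = S + \<theta> * u\<close>.\<close>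
  have bnd: "I n <= ennreal (S / (1 - \<theta>))" for n
  proof (induction n)
    case 0
    then show ?case by (simp add: I_def D0)
  next
    case (Suc n)
    have "I (Suc n) <= ennreal S + ennreal \<theta> * ennreal (S / (1 - \<theta>))"
      using step[of n] Suc S by (metis add_left_mono mult_left_mono order_trans zero_le)
    also have "... = ennreal (S + \<theta> * (S / (1 - \<theta>)))"
      using \<theta> S by (simp add: ennreal_mult[symmetric] ennreal_plus[symmetric] del: ennreal_plus)
    also have "S + \<theta> * (S / (1 - \<theta>)) = S / (1 - \<theta>)"
      using \<theta> by (simp add: field_simps)
    finally show ?case .
  qed
  \<comment> \<open>With the integrand as a density, continuity of the measure from below passes the
    bound to the union.\<close>
  define \<nu> where "\<nu> = density lborel (%x::'a. ennreal (norm x powr - b))"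
  have e: "emeasure \<nu> A = (NN x. ennreal (norm x powr - b) * indicator A x)" if "A \<in> sets borel" for A
    using that by (simp add: \<nu>_def emeasure_density)
  have "emeasure \<nu> (\<Union>n. D n) = (SUP n. emeasure \<nu> (D n))"
    using inc by (intro SUP_emeasure_incseq[symmetric]) (auto simp: \<nu>_def)
  also have "... <= ennreal (S / (1 - \<theta>))"
    using bnd by (intro SUP_least) (simp add: e I_def)
  finally show ?thesis using e[of "\<Union>n. D n"] by (auto intro: le_less_trans)
qed

text \<open>\<open>C\<close> is the integral over the unit ball; homogeneity of the integrand gives
  every other radius.\<close>

lemma nn_integral_norm_powr_ball:
  assumes b: "b < real DIM('a::euclidean_space)"
  shows "\<exists>C\<ge>0. \<forall>r>0. (NN x. ennreal (norm x powr - b) * indicator (ball (0::'a) r) x)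
           <= ennreal (C * r powr (real DIM('a) - b))"
proof -
  define D where "D n = {x::'a. (1/2)^n <= norm x \<and> norm x < 1}" for n :: nat
  have U: "(\<Union>n. D n) = ball 0 1 - {0}"
  proof -
    have "\<exists>n. (1/2)^n <= norm x" if "x ~= 0" for x :: 'a
      using real_arch_pow_inv[of "norm x" "1/2"] that by (auto intro: less_imp_le)
    then have "x \<in> (\<Union>n. D n) \<longleftrightarrow> x \<in> ball 0 1 - {0}" for x
      by (cases "x = 0") (auto simp: D_def not_le)
    then show ?thesis by blast
  qed
  have fin: "(NN x. ennreal (norm x powr - b) * indicator (\<Union>n. D n) x) < \<infinity>"
  proof (rule nn_integral_power_shells[of "1/2"])
    show "(1/2::real) powr (real DIM('a) - b) < 1"
      using b by (simp add: powr_divide)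
    show "D n \<in> sets borel" for n unfolding D_def by measurable
    show "incseq D"
      by (auto simp: incseq_def D_def intro: order_trans[OF power_decreasing])
    show "!!n x. x \<in> D (Suc n) ==> x \<in> D 1 \<or> (1 / (1/2::real)) *\<^sub>R x \<in> D n"
      by (auto simp: D_def field_simps)
  qed (auto simp: D_def)
  have eq1: "(NN x. ennreal (norm x powr - b) * indicator (ball (0::'a) 1) x) =
     (NN x. ennreal (norm x powr - b) * indicator (\<Union>n. D n) x)"
    unfolding U by (intro nn_integral_cong) (auto split: split_indicator)
  then obtain C where C: "0 <= C" "(NN x. ennreal (norm x powr - b) * indicator (ball (0::'a) 1) x) = ennreal C"
    using fin by (cases "NN x. ennreal (norm x powr - b) * indicator (ball (0::'a) 1) x") auto
  show ?thesis
  proof (intro exI[of _ C] conjI allI impI C(1))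
    fix r :: real assume r: "0 < r"
    have eq: "ennreal (norm (0 + r *\<^sub>R x) powr - b) * indicator (ball (0::'a) r) (0 + r *\<^sub>R x)
        = ennreal (r powr - b) * (ennreal (norm x powr - b) * indicator (ball (0::'a) 1) x)" for x
      using r by (simp add: powr_mult ennreal_mult mult.assoc indicator_def)
    have "(NN x. ennreal (norm x powr - b) * indicator (ball (0::'a) r) x)
       = ennreal (\<bar>r\<bar> ^ DIM('a)) * (NN x. ennreal (r powr - b) * (ennreal (norm x powr - b) * indicator (ball (0::'a) 1) x))"
      unfolding eq[symmetric] by (rule nn_integral_lborel_affine) (use r in auto)
    also have "... = ennreal (C * r powr (real DIM('a) - b))"
      using r C by (subst nn_integral_cmult)
        (auto simp: ennreal_mult[symmetric] powr_diff powr_minus divide_simps powr_realpow)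
    finally show "(NN x. ennreal (norm x powr - b) * indicator (ball (0::'a) r) x)
       <= ennreal (C * r powr (real DIM('a) - b))" by simp
  qed
qed

lemma nn_integral_norm_powr_compl_ball:
  assumes b: "real DIM('a::euclidean_space) < b"
  shows "\<exists>C\<ge>0. \<forall>r>0. (NN x. ennreal (norm x powr - b) * indicator (- ball (0::'a) r) x)
           <= ennreal (C * r powr (real DIM('a) - b))"
proof -
  define D where "D n = {x::'a. 1 <= norm x \<and> norm x < 2^n}" for n :: nat
  have U: "(\<Union>n. D n) = - ball 0 1"
  proof -
    have "\<exists>n. norm x < 2^n" for x :: 'a
      using real_arch_pow[of 2 "norm x"] by auto
    then show ?thesis by (auto simp: D_def)
  qed
  have fin: "(NN x. ennreal (norm x powr - b) * indicator (\<Union>n. D n) x) < \<infinity>"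
  proof (rule nn_integral_power_shells[of 2])
    show "(2::real) powr (real DIM('a) - b) < 1"
      using b by (subst powr_less_one) auto
    show "D n \<in> sets borel" for n unfolding D_def by measurable
    show "incseq D"
      by (auto simp: incseq_def D_def intro: less_le_trans[OF _ power_increasing])
    show "!!n x. x \<in> D (Suc n) ==> x \<in> D 1 \<or> (1 / 2::real) *\<^sub>R x \<in> D n"
      by (auto simp: D_def field_simps)
  qed (auto simp: D_def)
  then obtain C where C: "0 <= C" "(NN x. ennreal (norm x powr - b) * indicator (- ball (0::'a) 1) x) = ennreal C"
    unfolding U by (cases "NN x. ennreal (norm x powr - b) * indicator (- ball (0::'a) 1) x") auto
  show ?thesis
  proof (intro exI[of _ C] conjI allI impI C(1))
    fix r :: real assume r: "0 < r"
    have eq: "ennreal (norm (0 + r *\<^sub>R x) powr - b) * indicator (- ball (0::'a) r) (0 + r *\<^sub>R x)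
        = ennreal (r powr - b) * (ennreal (norm x powr - b) * indicator (- ball (0::'a) 1) x)" for x
      using r by (simp add: powr_mult ennreal_mult mult.assoc indicator_def)
    have "(NN x. ennreal (norm x powr - b) * indicator (- ball (0::'a) r) x)
       = ennreal (\<bar>r\<bar> ^ DIM('a)) * (NN x. ennreal (r powr - b) * (ennreal (norm x powr - b) * indicator (- ball (0::'a) 1) x))"
      unfolding eq[symmetric] by (rule nn_integral_lborel_affine) (use r in auto)
    also have "... = ennreal (C * r powr (real DIM('a) - b))"
      using r C by (subst nn_integral_cmult)
        (auto simp: ennreal_mult[symmetric] powr_diff powr_minus divide_simps powr_realpow)
    finally show "(NN x. ennreal (norm x powr - b) * indicator (- ball (0::'a) r) x)
       <= ennreal (C * r powr (real DIM('a) - b))" by simp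
  qed
qed

text \<open>The three pieces are the ball of radius \<open>norm x / 2\<close> around the origin, the one around
  \<open>x\<close>, and the rest, where \<open>norm (x - y) \<ge> norm y / 4\<close>.\<close>

lemma nn_integral_riesz_powr:
  assumes s: "0 < s" "s < b" and b: "b < real DIM('a::euclidean_space)"
  shows "\<exists>C\<ge>0. \<forall>x::'a. x ~= 0 -->
     (NN y. ennreal (norm (x - y) powr (s - real DIM('a)) * norm y powr - b)) <= ennreal (C * norm x powr (s - b))"
proof -
  let ?N = "real DIM('a)"
  obtain C1 where C1: "0 <= C1" "!!r. 0 < r ==> (NN x. ennreal (norm x powr - b) * indicator (ball (0::'a) r) x) <= ennreal (C1 * r powr (?N - b))"
    using nn_integral_norm_powr_ball[OF b] by metis
  obtain C2 where C2: "0 <= C2" "!!r. 0 < r ==> (NN x. ennreal (norm x powr - (?N - s)) * indicator (ball (0::'a) r) x) <= ennreal (C2 * r powr (?N - (?N - s)))"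
    using nn_integral_norm_powr_ball[where 'a='a and b="?N - s"] s by auto
  obtain C3 where C3: "0 <= C3" "!!r. 0 < r ==> (NN x. ennreal (norm x powr - (?N - s + b)) * indicator (- ball (0::'a) r) x) <= ennreal (C3 * r powr (?N - (?N - s + b)))"
    using nn_integral_norm_powr_compl_ball[where 'a='a and b="?N - s + b"] s by auto
  define a where "a = ?N - s"
  have a: "0 < a" "s - ?N = - a" "?N - a = s" "?N - (a + b) = s - b" using s b by (auto simp: a_def)
  define C where "C = (C1 + C2 + C3 * 4 powr a) * 2 powr (b - s)"
  show ?thesis
  proof (intro exI[of _ C] conjI allI impI)
    show "0 <= C" unfolding C_def using C1(1) C2(1) C3(1) by simp
    fix x :: 'a assume x: "x ~= 0"
    define r where "r = norm x / 2"
    have r: "0 < r" using x by (simp add: r_def)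
    have pt: "norm (x - y) powr - a * norm y powr - b <=
        r powr - a * (norm y powr - b * indicator (ball 0 r) y)
        + r powr - b * (norm (x - y) powr - a * indicator (ball 0 r) (x - y))
        + 4 powr a * (norm y powr - (a + b) * indicator (- ball 0 r) y)" for y
    proof -
      have tri: "2 * r <= norm y + norm (x - y)" unfolding r_def by (simp add: norm_triangle_sub)
      have tri2: "norm y <= 2 * r + norm (x - y)"
        unfolding r_def using norm_triangle_ineq4[of x "x - y"] by simp
      consider "norm y < r" | "norm (x - y) < r" "r <= norm y" | "r <= norm y" "r <= norm (x - y)" by linarith
      then show ?thesis
      proof cases
        case 1
        then have "norm (x - y) powr - a <= r powr - a"
          using tri r a by (intro powr_mono2') auto
        then show ?thesis using 1 by (auto simp: mult_right_mono split: split_indicator intro!: add_increasing2)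
      next
        case 2
        then have "norm y powr - b <= r powr - b"
          using r s by (intro powr_mono2') auto
        then have "norm (x - y) powr - a * norm y powr - b <= r powr - b * norm (x - y) powr - a"
          by (subst mult.commute) (auto intro: mult_right_mono)
        then show ?thesis using 2 by (simp add: add_increasing2)
      next
        case 3
        have "norm (x - y) powr - a <= (norm y / 4) powr - a"
          using 3 r a tri2 by (intro powr_mono2') auto
        also have "... = 4 powr a * norm y powr - a"
          by (simp add: powr_divide powr_minus field_simps)
        finally have "norm (x - y) powr - a * norm y powr - b <= 4 powr a * norm y powr - a * norm y powr - b"
          by (rule mult_right_mono) simp
        also have "... = 4 powr a * norm y powr - (a + b)"
          by (simp add: powr_add[symmetric] mult.assoc)
        finally show ?thesis using 3 by (auto split: split_indicator intro!: add_increasing)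
      qed
    qed
    define F where "F c B y = ennreal (norm y powr - c) * indicator B y" for c B and y :: 'a
    have [measurable]: "F c (ball 0 r) \<in> Borel" "F c (- ball 0 r) \<in> Borel" for c
      unfolding F_def by (auto intro!: borel_measurable_times_ennreal borel_measurable_indicator)
    have "(NN y. ennreal (norm (x - y) powr - a * norm y powr - b)) <=
       (NN y. ennreal (r powr - a) * F b (ball 0 r) y
        + ennreal (r powr - b) * F a (ball 0 r) (x - y)
        + ennreal (4 powr a) * F (a + b) (- ball 0 r) y)"
    proof (intro nn_integral_mono)
      fix y
      show "ennreal (norm (x - y) powr - a * norm y powr - b) <= ennreal (r powr - a) * F b (ball 0 r) y
        + ennreal (r powr - b) * F a (ball 0 r) (x - y)
        + ennreal (4 powr a) * F (a + b) (- ball 0 r) y"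
        using ennreal_leI[OF pt[of y]]
        by (cases "y \<in> ball 0 r"; cases "x - y \<in> ball 0 r") (auto simp: ennreal_mult ennreal_plus indicator_def F_def)
    qed
    also have "... = ennreal (r powr - a) * (NN y. F b (ball 0 r) y)
        + ennreal (r powr - b) * (NN y. F a (ball 0 r) (x - y))
        + ennreal (4 powr a) * (NN y. F (a + b) (- ball 0 r) y)"
      by (subst nn_integral_add, simp, simp)+ (simp add: nn_integral_cmult)
    also have "(NN y. F a (ball 0 r) (x - y)) =
        (NN y. F a (ball 0 r) y)"
      by (rule nn_integral_lborel_reflect) simp
    also have "ennreal (r powr - a) * (NN y. F b (ball 0 r) y)
        + ennreal (r powr - b) * (NN y. F a (ball 0 r) y)
        + ennreal (4 powr a) * (NN y. F (a + b) (- ball 0 r) y)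
       <= ennreal (r powr - a) * ennreal (C1 * r powr (?N - b)) + ennreal (r powr - b) * ennreal (C2 * r powr s)
         + ennreal (4 powr a) * ennreal (C3 * r powr (s - b))"
      using C1(2)[OF r] C2(2)[OF r] C3(2)[OF r] unfolding F_def a_def[symmetric] a(3,4)
      by (intro add_mono mult_left_mono) auto
    also have "... = ennreal (r powr - a * (C1 * r powr (?N - b)) + r powr - b * (C2 * r powr s) + 4 powr a * (C3 * r powr (s - b)))"
      using C1(1) C2(1) C3(1) by (simp add: ennreal_mult[symmetric] ennreal_plus[symmetric] del: ennreal_plus)
    also have "r powr - a * (C1 * r powr (?N - b)) + r powr - b * (C2 * r powr s) + 4 powr a * (C3 * r powr (s - b))
        = (C1 + C2 + C3 * 4 powr a) * r powr (s - b)"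
      by (simp add: a_def powr_diff powr_minus powr_add divide_simps algebra_simps)
    also have "... = C * norm x powr (s - b)"
      by (simp add: C_def r_def powr_divide powr_diff powr_minus divide_simps)
    finally show "(NN y. ennreal (norm (x - y) powr (s - ?N) * norm y powr - b)) <= ennreal (C * norm x powr (s - b))"
      by (simp only: a(2))
  qed
qed

section \<open>Riesz potentials with values in ennreal\<close>

lemma riesz_const_pos: "0 < s ==> s < N / 2 ==> 0 < riesz_const N s"
  by (simp add: riesz_const_def Gamma_real_pos)

text \<open>Taking values in ennreal avoids integrability side conditions. Since
  \<open>ennreal\<close> cuts off negative values, this is the Riesz potential for nonnegative
  \<open>f\<close>; the kernel is homogeneous of degree \<open>s - N\<close>.\<close>

definition rpot :: "real => ('a::euclidean_space => real) => 'a => ennreal" where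
  "rpot s f x = (NN y. ennreal (riesz_kernel (s / 2) (x - y) * f y))"

text \<open>Default value 0 where the potential is infinite; for integrable nonnegative
  \<open>f\<close> this is a null set by \<open>rpot_finite_AE\<close>.\<close>

definition rpotr :: "real => ('a::euclidean_space => real) => 'a => real" where
  "rpotr s f x = enn2real (rpot s f x)"

definition energy :: "real => real => ('a::euclidean_space => real) => ennreal" where
  "energy s q f = (NN x. ennreal (rpotr s f x powr q))"

lemma rpotr_nonneg [simp]: "0 <= rpotr s f x"
  by (simp add: rpotr_def)

lemma rpotr_eq: "rpot s f x < \<infinity> ==> ennreal (rpotr s f x) = rpot s f x"
  by (simp add: rpotr_def less_top)

locale riesz =
  fixes s :: real and T :: "'a::euclidean_space itself" and N :: real
  assumes N_eq: "N = real DIM('a)" and s_pos: "0 < s" and s_less: "s < N"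
begin

abbreviation K :: "'a => real" where "K \<equiv> riesz_kernel (s / 2)"

definition kc :: real where "kc = riesz_const N (s / 2)"

lemma kc_pos: "0 < kc"
  unfolding kc_def using s_pos s_less by (intro riesz_const_pos) auto

lemma K_eq: "K x = kc * norm x powr - (N - s)"
  unfolding riesz_kernel_def kc_def N_eq[symmetric] by simp

lemma K_nonneg [simp]: "0 <= K x"
  using kc_pos by (simp add: K_eq)

lemma K_pos: "x ~= 0 ==> 0 < K x"
  using kc_pos by (simp add: K_eq)

lemma K_measurable [measurable]: "K \<in> Borel"
  unfolding K_eq[abs_def] by measurable

lemma K_norm_cong: "norm x = norm y ==> K x = K y"
  by (simp add: K_eq)

lemma K_minus [simp]: "K (x - y) = K (y - x)"
  by (rule K_norm_cong) (simp add: norm_minus_commute)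

lemma K_antimono: "x ~= 0 ==> norm x <= norm y ==> K y <= K x"
  using kc_pos s_less by (auto simp: K_eq intro!: mult_left_mono powr_mono2')

lemma K_strict_antimono: "x ~= 0 ==> norm x < norm y ==> K y < K x"
  using kc_pos s_less by (auto simp: K_eq powr_less_mono2_neg)

declare K_minus [simp del]

lemma rpot_measurable [measurable]:
  assumes [measurable]: "f \<in> Borel"
  shows "rpot s (f :: 'a => real) \<in> Borel"
  unfolding rpot_def[abs_def] by measurable

lemma rpotr_measurable [measurable]:
  assumes [measurable]: "f \<in> Borel"
  shows "rpotr s (f :: 'a => real) \<in> Borel"
  unfolding rpotr_def[abs_def] by measurable

lemma rpot_mono_AE:
  assumes "AE y in lborel. f y <= g y"
  shows "rpot s f (x::'a) <= rpot s g x"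
  unfolding rpot_def
  by (rule nn_integral_mono_AE) (use assms in \<open>auto intro!: ennreal_leI mult_left_mono\<close>)

lemma rpot_cong_AE:
  assumes "AE y in lborel. f y = g y"
  shows "rpot s f (x::'a) = rpot s g x"
  by (intro antisym rpot_mono_AE) (use assms in auto)

lemma rpot_add:
  assumes [measurable]: "f \<in> Borel" "g \<in> Borel"
    and "!!x. 0 <= f x" "!!x. 0 <= g x"
  shows "rpot s (%x. f x + g x) (x::'a) = rpot s f x + rpot s g x"
  unfolding rpot_def using assms by (simp add: distrib_left ennreal_plus nn_integral_add)

lemma rpot_cmult:
  assumes [measurable]: "f \<in> Borel" and "0 <= c"
  shows "rpot s (%x. c * f x) (x::'a) = ennreal c * rpot s f x"
  unfolding rpot_def using assms
  by (simp add: ennreal_mult' nn_integral_cmult[symmetric] mult.left_commute)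

lemma rpot_translate:
  assumes [measurable]: "f \<in> Borel"
  shows "rpot s (%x. f (x - t)) (x::'a) = rpot s f (x - t)"
  unfolding rpot_def
  by (subst nn_integral_lborel_translate[symmetric, of _ t]) (auto simp: algebra_simps)

lemma rpot_scale:
  assumes [measurable]: "f \<in> Borel" and l: "0 < l"
  shows "rpot s (%x. f (l *\<^sub>R x)) (x::'a) = ennreal (l powr - s) * rpot s f (l *\<^sub>R x)"
proof -
  have eq: "ennreal (K (x - y) * f (l *\<^sub>R y)) = ennreal (l powr (N - s)) * ennreal (K (l *\<^sub>R x - l *\<^sub>R y) * f (l *\<^sub>R y))" for y
  proof -
    have "l powr (N - s) * l powr (s - N) = 1" using l by (simp add: powr_add[symmetric])
    then have "K (x - y) = l powr (N - s) * K (l *\<^sub>R x - l *\<^sub>R y)"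
      using l by (simp add: K_eq scaleR_diff_right[symmetric] powr_mult)
    then show ?thesis by (simp add: ennreal_mult'[symmetric] mult.assoc)
  qed
  show ?thesis
    unfolding rpot_def eq using l
    by (subst nn_integral_cmult, simp, subst nn_integral_lborel_scale[of "%y. ennreal (K (l *\<^sub>R x - y) * f y)"])
      (auto simp: mult.assoc[symmetric] ennreal_mult[symmetric] powr_add[symmetric] N_eq)
qed

text \<open>Tonelli and evenness of the kernel. This self-adjointness moves a potential from an
  unknown function onto a test function.\<close>

lemma rpot_symmetric:
  fixes f g :: "'a => real"
  assumes [measurable]: "f \<in> Borel" "g \<in> Borel"
    and "!!x. 0 <= f x" "!!x. 0 <= g x"
  shows "(NN x. rpot s f x * ennreal (g x)) = (NN x. ennreal (f x) * rpot s g (x::'a))"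
proof -
  have "(NN x. rpot s f x * ennreal (g x)) = (NN x. (NN y. ennreal (K (x - y) * f y) * ennreal (g x)))"
    unfolding rpot_def by (simp add: nn_integral_multc)
  also have "... = (NN y. (NN x. ennreal (K (x - y) * f y) * ennreal (g x)))"
    by (subst lborel_pair.Fubini') auto
  also have "... = (NN y. (NN x. ennreal (f y) * ennreal (K (y - x) * g x)))"
    using assms by (intro nn_integral_cong) (simp add: ennreal_mult[symmetric] K_minus[of x y for x y] ac_simps K_norm_cong[OF norm_minus_commute])
  also have "... = (NN x. ennreal (f x) * rpot s g x)"
    unfolding rpot_def by (simp add: nn_integral_cmult)
  finally show ?thesis .
qed

lemma K_nn_integral_ball: "(NN x. ennreal (K x) * indicator (ball (0::'a) r) x) < \<infinity>"
proof (cases "0 < r")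
  case True
  obtain C where C: "0 <= C" "!!r. 0 < r ==> (NN x. ennreal (norm x powr - (N - s)) * indicator (ball (0::'a) r) x) <= ennreal (C * r powr (N - (N - s)))"
    using nn_integral_norm_powr_ball[where 'a='a and b="N - s", folded N_eq] s_pos by auto
  have "(NN x. ennreal (K x) * indicator (ball (0::'a) r) x)
     = ennreal kc * (NN x. ennreal (norm x powr - (N - s)) * indicator (ball (0::'a) r) x)"
    using kc_pos by (subst nn_integral_cmult[symmetric]) (auto simp: K_eq ennreal_mult mult.assoc)
  also have "... < \<infinity>"
    using C(2)[OF True] by (auto simp: ennreal_mult_less_top intro: le_less_trans)
  finally show ?thesis .
next
  case False
  then have "indicator (ball (0::'a) r) x = (0 :: ennreal)" for x
    using norm_ge_zero[of x] by (auto simp: indicator_def simp del: norm_ge_zero)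
  then show ?thesis by simp
qed

text \<open>Pairing with the indicator of a ball and moving the potential onto the ball leaves a
  bounded function: near the pole \<open>K\<close> is locally integrable, at distance at least 1 it
  is at most \<open>kc\<close>.\<close>

lemma rpot_finite_AE:
  assumes [measurable]: "f \<in> Borel" and nn: "!!x. 0 <= f x"
    and int: "(NN x. ennreal (f x)) < \<infinity>"
  shows "AE x in lborel. rpot s f (x::'a) < \<infinity>"
proof -
  have on_ball: "AE x in lborel. x \<in> ball 0 (real n) --> rpot s f (x::'a) < \<infinity>" for n :: nat
  proof -
    define C where "C = (NN x. ennreal (K x) * indicator (ball (0::'a) 1) x) + ennreal kc * emeasure lborel (ball (0::'a) n)"
    have C: "C < \<infinity>"
      unfolding C_def using K_nn_integral_ball emeasure_lborel_ball_finite[of "0::'a" "real n"]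
      by (simp add: ennreal_mult_less_top)
    have inner: "(NN x. ennreal (K (y - x)) * indicator (ball 0 (real n)) x) <= C" for y :: 'a
    proof -
      have "K z <= kc" if "1 <= norm z" for z :: 'a
      proof -
        have "norm z powr - (N - s) <= 1 powr - (N - s)" using that s_less by (intro powr_mono2') auto
        then show ?thesis using kc_pos by (simp add: K_eq)
      qed
      then have "(NN x. ennreal (K (y - x)) * indicator (ball 0 (real n)) x) <=
         (NN x. ennreal (K (y - x)) * indicator (ball (0::'a) 1) (y - x) + ennreal kc * indicator (ball 0 (real n)) x)"
        by (intro nn_integral_mono) (auto split: split_indicator intro!: ennreal_leI simp: not_less)
      also have "... = (NN x. ennreal (K (y - x)) * indicator (ball (0::'a) 1) (y - x)) + ennreal kc * emeasure lborel (ball (0::'a) n)"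
        by (subst nn_integral_add) (auto simp: nn_integral_cmult_indicator)
      also have "(NN x. ennreal (K (y - x)) * indicator (ball (0::'a) 1) (y - x)) = (NN x. ennreal (K x) * indicator (ball (0::'a) 1) x)"
        by (rule nn_integral_lborel_reflect) simp
      finally show ?thesis by (simp add: C_def)
    qed
    have "(NN x. rpot s f x * ennreal (indicator (ball (0::'a) (real n)) x))
        = (NN x. ennreal (f x) * rpot s (indicator (ball (0::'a) (real n))) x)"
      by (rule rpot_symmetric) (use nn in auto)
    also have "... <= (NN x. ennreal (f x) * C)"
      using inner by (intro nn_integral_mono mult_left_mono) (auto simp: rpot_def ennreal_mult' ennreal_indicator)
    also have "... < \<infinity>"
      using int C by (simp add: nn_integral_multc ennreal_mult_less_top)
    finally have "AE x in lborel. rpot s f x * ennreal (indicator (ball (0::'a) (real n)) x) ~= \<infinity>"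
      by (intro nn_integral_PInf_AE) auto
    then show ?thesis
      by eventually_elim (auto simp: indicator_def less_top)
  qed
  then have "AE x in lborel. \<forall>n::nat. x \<in> ball 0 (real n) --> rpot s f (x::'a) < \<infinity>"
    by (simp only: AE_all_countable) simp
  then show ?thesis
  proof eventually_elim
    case (elim x)
    obtain n :: nat where "norm x < n" using reals_Archimedean2 by blast
    then show ?case using elim by auto
  qed
qed

text \<open>\<open>C'\<close> is chosen before \<open>f\<close>. This uniformity over all dominated
  functions is what later yields majorants for dominated convergence.\<close>

lemma rpot_powr_bound:
  assumes b: "s < b" "b < N" and C: "0 <= C"
  shows "\<exists>C'\<ge>0. \<forall>f :: 'a => real. (\<forall>x. x ~= 0 --> f x <= C * norm x powr - b) -->
     (\<forall>x::'a. x ~= 0 --> rpot s f x <= ennreal (C' * norm x powr (s - b)))"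
proof -
  obtain D where D: "0 <= D" "!!x::'a. x ~= 0 ==>
     (NN y. ennreal (norm (x - y) powr (s - N) * norm y powr - b)) <= ennreal (D * norm x powr (s - b))"
    using nn_integral_riesz_powr[where 'a='a, folded N_eq, OF s_pos b] by metis
  show ?thesis
  proof (intro exI[of _ "kc * C * D"] conjI allI impI)
    show "0 <= kc * C * D" using kc_pos C D by simp
    fix f :: "'a => real" and x :: 'a assume f: "\<forall>x. x ~= 0 --> f x <= C * norm x powr - b" and x: "x ~= 0"
    have "rpot s f x <= (NN y. ennreal (kc * C) * ennreal (norm (x - y) powr (s - N) * norm y powr - b))"
      unfolding rpot_def
    proof (rule nn_integral_mono_AE)
      show "AE y in lborel. ennreal (K (x - y) * f y) <= ennreal (kc * C) * ennreal (norm (x - y) powr (s - N) * norm y powr - b)"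
        using AE_lborel_singleton[of "0::'a"]
      proof eventually_elim
        case (elim y)
        have "K (x - y) * f y <= K (x - y) * (C * norm y powr - b)"
          using f elim by (intro mult_left_mono) auto
        then show ?case using kc_pos C
          by (simp add: ennreal_mult'[symmetric] K_eq ac_simps ennreal_leI)
      qed
    qed
    also have "... = ennreal (kc * C) * (NN y. ennreal (norm (x - y) powr (s - N) * norm y powr - b))"
      by (rule nn_integral_cmult) measurable
    also have "... <= ennreal (kc * C) * ennreal (D * norm x powr (s - b))"
      by (intro mult_left_mono D x) auto
    also have "... = ennreal (kc * C * D * norm x powr (s - b))"
      using kc_pos C D by (simp add: ennreal_mult[symmetric] mult.assoc)
    finally show "rpot s f x <= ennreal (kc * C * D * norm x powr (s - b))" .
  qed
qed

end

subsection \<open>Polarization\<close>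

text \<open>Two-point rearrangement: of the two values at a mirror pair the larger goes to the
  preferred side. On the hyperplane both values coincide, so the choice there is immaterial.\<close>

definition pol :: "'a::euclidean_space => real => ('a => real) => 'a => real" where
  "pol e t f x = (if t <= e \<bullet> x then max (f x) (f (hrefl e t x)) else min (f x) (f (hrefl e t x)))"

lemma pol_measurable [measurable]:
  assumes [measurable]: "f \<in> Borel"
  shows "pol e t f \<in> Borel"
  unfolding pol_def[abs_def] by measurable

text \<open>Polarization keeps or swaps the two values of each mirror pair; equimeasurability and
  conservation of pair sums follow from this alone.\<close>

lemma pol_pair:
  assumes "norm e = 1"
  shows "pol e t f x = f x \<and> pol e t f (hrefl e t x) = f (hrefl e t x) \<or>
         pol e t f x = f (hrefl e t x) \<and> pol e t f (hrefl e t x) = f x"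
  using assms hrefl_fixed[of e x t]
  by (cases "e \<bullet> x" t rule: linorder_cases) (auto simp: pol_def inner_refl max_def min_def)

lemma pol_hrefl: "norm e = 1 ==> t <= e \<bullet> x ==> pol e t f (hrefl e t x) = min (f x) (f (hrefl e t x))"
  using hrefl_fixed[of e x t]
  by (cases "e \<bullet> x = t") (auto simp: pol_def inner_refl min_def)

lemma pol_range: "pol e t f x = f x \<or> pol e t f x = f (hrefl e t x)"
  by (auto simp: pol_def max_def min_def)

lemma ennreal_double_cancel: "2 * (a::ennreal) = 2 * b \<longleftrightarrow> a = b"
  by (simp add: ennreal_mult_cancel_left)

lemma ennreal_double_mono: "2 * (a::ennreal) <= 2 * b \<longleftrightarrow> a <= b"
  by (metis ennreal_double_cancel linorder_le_cases mult_left_mono order_antisym zero_le)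

lemma nn_integral_pol:
  fixes f :: "'a::euclidean_space => real" and \<Phi> :: "real => ennreal"
  assumes e: "norm e = 1" and [measurable]: "f \<in> Borel" "\<Phi> \<in> Borel"
  shows "(NN x. \<Phi> (pol e t f x)) = (NN x. \<Phi> (f x))"
proof -
  have "\<Phi> (pol e t f x) + \<Phi> (pol e t f (hrefl e t x)) = \<Phi> (f x) + \<Phi> (f (hrefl e t x))" for x
    using pol_pair[OF e, of t f x] by (auto simp: add.commute)
  then have "2 * (NN x. \<Phi> (pol e t f x)) = 2 * (NN x. \<Phi> (f x))"
    using nn_integral_fold_refl[OF e, of "%x. \<Phi> (pol e t f x)" t] nn_integral_fold_refl[OF e, of "%x. \<Phi> (f x)" t]
    by simp
  then show ?thesis by (simp only: ennreal_double_cancel)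
qed

text \<open>Convexity of the power: for a fixed sum, the pair with the larger maximum has the larger
  sum of powers, strictly unless the maxima agree.\<close>

lemma powr_spread:
  fixes a b A B q :: real
  assumes q: "1 < q" and sum: "a + b = A + B" and A: "a <= A" "b <= A" and nn: "0 <= a" "0 <= b" "0 <= B"
  shows "a powr q + b powr q <= A powr q + B powr q"
    and "A powr q + B powr q <= a powr q + b powr q ==> A = a \<or> A = b"
proof -
  have mvt: "\<exists>z. x < z \<and> z < y \<and> y powr q - x powr q = (y - x) * (q * z powr (q - 1))"
    if "0 <= x" "x < y" for x y :: real
  proof -
    have "\<exists>l z. x < z \<and> z < y \<and> DERIV (%u. u powr q) z :> l \<and> y powr q - x powr q = (y - x) * l"
    proof (rule MVT)
      show "continuous_on {x..y} (%u. u powr q)"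
        using that q by (intro continuous_on_powr' continuous_intros) auto
      show "(%u. u powr q) differentiable (at z)" if "x < z" "z < y" for z
        using has_real_derivative_powr[of z q] that \<open>0 <= x\<close> unfolding real_differentiable_def by auto
    qed (use that in auto)
    then obtain l z where z: "x < z" "z < y" "DERIV (%u. u powr q) z :> l" "y powr q - x powr q = (y - x) * l"
      by blast
    moreover have "l = q * z powr (q - 1)"
      using z(1) that by (intro DERIV_unique[OF z(3) has_real_derivative_powr]) auto
    ultimately show ?thesis by blast
  qed
  \<comment> \<open>The increments \<open>A - a\<close> and \<open>b - B\<close> are equal, but the
    first is taken over an interval to the right of the second, where the derivative is
    larger.\<close>
  have strict: "a powr q + b powr q < A powr q + B powr q" if h: "b <= a" "a < A" "a + b = A + B" "0 <= b" "0 <= B" for a b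
  proof -
    have "0 <= a" using h by simp
    then obtain z where z: "a < z" "z < A" "A powr q - a powr q = (A - a) * (q * z powr (q - 1))"
      using mvt[of a A] h by auto
    obtain w where w: "B < w" "w < b" "b powr q - B powr q = (b - B) * (q * w powr (q - 1))"
      using mvt[of B b] h by auto
    have "w powr (q - 1) < z powr (q - 1)"
      using that z w q by (intro powr_less_mono2) auto
    moreover have AB: "b - B = A - a" using that by simp
    ultimately have "(b - B) * (q * w powr (q - 1)) < (A - a) * (q * z powr (q - 1))"
      unfolding AB using that q by (intro mult_strict_left_mono) auto
    then show ?thesis using z w by simp
  qed
  have "A = a \<or> A = b \<or> a powr q + b powr q < A powr q + B powr q"
    using strict[of b a] strict[of a b] A sum nn by (cases "b <= a"; cases "A = a"; cases "A = b") (auto simp: add.commute)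
  moreover have "a powr q + b powr q = A powr q + B powr q" if "A = a \<or> A = b"
    using that sum by auto
  ultimately show "a powr q + b powr q <= A powr q + B powr q"
    and "A powr q + B powr q <= a powr q + b powr q ==> A = a \<or> A = b"
    by auto
qed

context riesz
begin

lemma rpot_fold:
  fixes e :: 'a and f :: "'a => real"
  assumes e: "norm e = 1" and [measurable]: "f \<in> Borel" and nn: "!!y. 0 <= f y"
  shows "2 * rpot s f x = (NN y. ennreal (K (x - y) * f y + K (x - hrefl e t y) * f (hrefl e t y)))"
  unfolding rpot_def
  by (subst nn_integral_fold_refl[OF e, of _ t]) (use nn in \<open>auto simp: ennreal_plus\<close>)

lemma rpot_fold_hrefl:
  fixes e :: 'a and f :: "'a => real"
  assumes e: "norm e = 1" and [measurable]: "f \<in> Borel" and nn: "!!y. 0 <= f y"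
  shows "2 * rpot s f (hrefl e t x) = (NN y. ennreal (K (x - hrefl e t y) * f y + K (x - y) * f (hrefl e t y)))"
proof -
  have "K (hrefl e t x - y) = K (x - hrefl e t y)" "K (hrefl e t x - hrefl e t y) = K (x - y)" for y
    by (rule K_norm_cong[OF norm_diff_refl_swap[OF e]], rule K_norm_cong[OF dist_hrefl_hrefl[OF e]])
  then show ?thesis using rpot_fold[OF assms, of "hrefl e t x" t] by simp
qed

lemma AE_neq_hrefl:
  assumes e: "norm e = 1"
  shows "AE y in lborel. y ~= x \<and> hrefl e t y ~= x"
  using AE_lborel_singleton[of x] AE_refl[OF e AE_lborel_singleton[of x], of t]
  by eventually_elim auto

lemma K_hrefl_le:
  assumes e: "norm e = 1" and "t <= e \<bullet> x" "t <= e \<bullet> y" "y ~= x"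
  shows "K (x - hrefl e t y) <= K (x - y)"
proof (rule K_antimono)
  have "0 <= 4 * (e \<bullet> x - t) * (e \<bullet> y - t)" using assms by simp
  then have "(norm (x - y))\<^sup>2 <= (norm (x - hrefl e t y))\<^sup>2"
    unfolding norm_diff_refl_sq[OF e] by linarith
  then show "norm (x - y) <= norm (x - hrefl e t y)"
    by (rule power2_le_imp_le) simp
qed (use assms in auto)

lemma K_hrefl_less:
  assumes e: "norm e = 1" and "t < e \<bullet> x" "t < e \<bullet> y" "y ~= x"
  shows "K (x - hrefl e t y) < K (x - y)"
proof (rule K_strict_antimono)
  have "0 < 4 * (e \<bullet> x - t) * (e \<bullet> y - t)" using assms by simp
  then have "(norm (x - y))\<^sup>2 < (norm (x - hrefl e t y))\<^sup>2"
    unfolding norm_diff_refl_sq[OF e] by linarith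
  then show "norm (x - y) < norm (x - hrefl e t y)"
    by (rule power2_less_imp_less) simp
qed (use assms in auto)

lemma two_point_rearrange:
  fixes k1 k2 a b :: real
  assumes "k2 <= k1"
  shows "k1 * a + k2 * b <= k1 * max a b + k2 * min a b" "k2 * a + k1 * b <= k1 * max a b + k2 * min a b"
proof -
  have "0 <= (k1 - k2) * (b - a)" if "a <= b" using assms that by simp
  moreover have "0 <= (k1 - k2) * (a - b)" if "b <= a" using assms that by simp
  ultimately show "k1 * a + k2 * b <= k1 * max a b + k2 * min a b" "k2 * a + k1 * b <= k1 * max a b + k2 * min a b"
    by (auto simp: max_def min_def algebra_simps)
qed

text \<open>The larger kernel weight meets the larger function value. Both original values, at
  \<open>x\<close> and at its mirror image, are compared with the polarized one at \<open>x\<close>.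
  The poles are excluded because \<open>K 0 = 0\<close> breaks the monotonicity of the kernel
  there.\<close>

lemma pol_kernel_le:
  assumes e: "norm e = 1" and x: "t <= e \<bullet> x" and y: "y ~= x" "hrefl e t y ~= x"
  shows "K (x - y) * f y + K (x - hrefl e t y) * f (hrefl e t y)
       <= K (x - y) * pol e t f y + K (x - hrefl e t y) * pol e t f (hrefl e t y)" (is "?A <= ?C")
    and "K (x - hrefl e t y) * f y + K (x - y) * f (hrefl e t y)
       <= K (x - y) * pol e t f y + K (x - hrefl e t y) * pol e t f (hrefl e t y)" (is "?B <= ?C")
proof -
  have "?A <= ?C \<and> ?B <= ?C"
  proof (cases "t <= e \<bullet> y")
    case True
    show ?thesis
      using two_point_rearrange[OF K_hrefl_le[OF e x True y(1)], of "f y" "f (hrefl e t y)"] True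
      by (simp add: pol_hrefl[OF e True]) (simp add: pol_def)
  next
    case False
    then have T: "t <= e \<bullet> hrefl e t y" by (simp add: inner_refl[OF e])
    have r: "hrefl e t (hrefl e t y) = y" using e by simp
    show ?thesis
      using two_point_rearrange[OF K_hrefl_le[OF e x T y(2)], of "f (hrefl e t y)" "f y"] False T
      unfolding r by (simp add: pol_def r max.commute min.commute add.commute)
  qed
  then show "?A <= ?C" "?B <= ?C" by auto
qed

lemma pol_nonneg: "(!!y. 0 <= f y) ==> 0 <= pol e t f y"
  by (auto simp: pol_def max_def min_def)

text \<open>On the preferred side the polarized potential dominates both original values while the
  pair sum is unchanged. These are the hypotheses of \<open>powr_spread\<close>, which is why
  polarization does not lower the energy.\<close>

lemma rpot_pol:
  fixes e :: 'a and f :: "'a => real"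
  assumes e: "norm e = 1" and [measurable]: "f \<in> Borel" and nn: "!!y. 0 <= f y"
    and x: "t <= e \<bullet> x"
  shows "rpot s f x <= rpot s (pol e t f) x"
    and "rpot s f (hrefl e t x) <= rpot s (pol e t f) x"
    and "rpot s (pol e t f) x + rpot s (pol e t f) (hrefl e t x) = rpot s f x + rpot s f (hrefl e t x)"
proof -
  note nn' = pol_nonneg[of f, OF nn]
  note F = rpot_fold[OF e, of f, OF _ nn] rpot_fold_hrefl[OF e, of f, OF _ nn]
    rpot_fold[OF e, of "pol e t f", OF _ nn'] rpot_fold_hrefl[OF e, of "pol e t f", OF _ nn']
  have "2 * rpot s f x <= 2 * rpot s (pol e t f) x"
    unfolding F(1)[of x t, OF assms(2)] F(3)[of x t, OF pol_measurable[OF assms(2)]]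
    by (rule nn_integral_mono_AE) (use AE_neq_hrefl[OF e, of x t] in eventually_elim, intro ennreal_leI pol_kernel_le[OF e x], simp_all)
  then show "rpot s f x <= rpot s (pol e t f) x" by (simp only: ennreal_double_mono)
  have "2 * rpot s f (hrefl e t x) <= 2 * rpot s (pol e t f) x"
    unfolding F(2)[of t x, OF assms(2)] F(3)[of x t, OF pol_measurable[OF assms(2)]]
    by (rule nn_integral_mono_AE) (use AE_neq_hrefl[OF e, of x t] in eventually_elim, intro ennreal_leI pol_kernel_le[OF e x], simp_all)
  then show "rpot s f (hrefl e t x) <= rpot s (pol e t f) x" by (simp only: ennreal_double_mono)
  have eq: "(K (x - y) * pol e t f y + K (x - hrefl e t y) * pol e t f (hrefl e t y))
      + (K (x - hrefl e t y) * pol e t f y + K (x - y) * pol e t f (hrefl e t y))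
      = (K (x - y) * f y + K (x - hrefl e t y) * f (hrefl e t y)) + (K (x - hrefl e t y) * f y + K (x - y) * f (hrefl e t y))" for y
    using pol_pair[OF e, of t f y] by (auto simp: algebra_simps)
  have "2 * (rpot s (pol e t f) x + rpot s (pol e t f) (hrefl e t x)) = 2 * (rpot s f x + rpot s f (hrefl e t x))"
    unfolding distrib_left F(1)[of x t, OF assms(2)] F(2)[of t x, OF assms(2)]
      F(3)[of x t, OF pol_measurable[OF assms(2)]] F(4)[of t x, OF pol_measurable[OF assms(2)]]
    using nn nn' by (subst (1 2) nn_integral_add[symmetric]) (auto simp flip: ennreal_plus simp: eq)
  then show "rpot s (pol e t f) x + rpot s (pol e t f) (hrefl e t x) = rpot s f x + rpot s f (hrefl e t x)"
    by (simp only: ennreal_double_cancel)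
qed

lemma rpotr_pol:
  fixes e :: 'a and f :: "'a => real"
  assumes e: "norm e = 1" and f: "f \<in> Borel" and nn: "!!y. 0 <= f y"
    and x: "t <= e \<bullet> x" and fin: "rpot s f x < \<infinity>" "rpot s f (hrefl e t x) < \<infinity>"
  shows "rpotr s f x <= rpotr s (pol e t f) x"
    and "rpotr s f (hrefl e t x) <= rpotr s (pol e t f) x"
    and "rpotr s f x + rpotr s f (hrefl e t x) = rpotr s (pol e t f) x + rpotr s (pol e t f) (hrefl e t x)"
proof -
  note P = rpot_pol[OF e f nn x]
  have sum: "rpot s (pol e t f) x + rpot s (pol e t f) (hrefl e t x) < \<infinity>"
    using P(3) fin by simp
  then have fin': "rpot s (pol e t f) x < \<infinity>" "rpot s (pol e t f) (hrefl e t x) < \<infinity>"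
    by auto
  show "rpotr s f x <= rpotr s (pol e t f) x" "rpotr s f (hrefl e t x) <= rpotr s (pol e t f) x"
    using P(1,2) fin' by (auto simp: rpotr_def intro!: enn2real_mono)
  show "rpotr s f x + rpotr s f (hrefl e t x) = rpotr s (pol e t f) x + rpotr s (pol e t f) (hrefl e t x)"
    using P(3) fin fin' unfolding rpotr_def by (subst (1 2) enn2real_plus[symmetric]) auto
qed

lemma energy_pol_pointwise:
  fixes e :: 'a and f :: "'a => real"
  assumes e: "norm e = 1" and f: "f \<in> Borel" and nn: "!!y. 0 <= f y" and q: "1 < q"
    and fin: "rpot s f x < \<infinity>" "rpot s f (hrefl e t x) < \<infinity>"
  shows "rpotr s f x powr q + rpotr s f (hrefl e t x) powr q
       <= rpotr s (pol e t f) x powr q + rpotr s (pol e t f) (hrefl e t x) powr q"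
proof (cases "t <= e \<bullet> x")
  case True
  show ?thesis
    using rpotr_pol[OF e f nn True fin] q by (intro powr_spread(1)) auto
next
  case False
  then have T: "t <= e \<bullet> hrefl e t x" by (simp add: inner_refl[OF e])
  have r: "hrefl e t (hrefl e t x) = x" using e by simp
  show ?thesis
    using powr_spread(1)[OF q rpotr_pol(3)[OF e f nn T] rpotr_pol(1,2)[OF e f nn T]] fin unfolding r
    by (auto simp: add.commute)
qed

lemma AE_rpot_finite_pair:
  assumes e: "norm e = 1" and "AE x in lborel. rpot s f x < \<infinity>"
  shows "AE x in lborel. rpot s f x < \<infinity> \<and> rpot s f (hrefl e t x) < \<infinity>"
  using assms(2) AE_refl[OF assms, of t] by eventually_elim auto

lemma energy_fold:
  fixes e :: 'a and f :: "'a => real"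
  assumes e: "norm e = 1" and [measurable]: "f \<in> Borel"
  shows "2 * energy s q f = (NN x. ennreal (rpotr s f x powr q + rpotr s f (hrefl e t x) powr q))"
  unfolding energy_def by (subst nn_integral_fold_refl[OF e, of _ t]) (auto simp: ennreal_plus)

lemma energy_pol_ge:
  fixes e :: 'a and f :: "'a => real"
  assumes e: "norm e = 1" and [measurable]: "f \<in> Borel" and nn: "!!y. 0 <= f y" and q: "1 < q"
    and fin: "AE x in lborel. rpot s f x < \<infinity>"
  shows "energy s q f <= energy s q (pol e t f)"
proof -
  have "2 * energy s q f <= 2 * energy s q (pol e t f)"
    unfolding energy_fold[OF e assms(2), where q=q and t=t] energy_fold[OF e pol_measurable[OF assms(2)], where q=q and t=t]
    by (rule nn_integral_mono_AE) (use AE_rpot_finite_pair[OF e fin, of t] in eventually_elim,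
        intro ennreal_leI energy_pol_pointwise[OF e assms(2) nn q], simp_all)
  then show ?thesis by (simp only: ennreal_double_mono)
qed

lemma AE_eq_of_nn_integral_le:
  assumes [measurable]: "f \<in> borel_measurable M" "g \<in> borel_measurable M"
    and fin: "integral\<^sup>N M f ~= \<infinity>" and le: "AE x in M. f x <= g x" and ge: "integral\<^sup>N M g <= integral\<^sup>N M f"
  shows "AE x in M. f x = (g x :: ennreal)"
proof -
  have "AE x in M. g x <= f x"
    using nn_integral_less[OF assms(1,2) fin le] ge by (metis not_less)
  with le show ?thesis by eventually_elim auto
qed

text \<open>Equal energies give equality in \<open>powr_spread\<close> for almost every mirror pair,
  and a single point \<open>x\<close> strictly inside the half-space is enough: there the polarized
  potential equals the original one at \<open>x\<close> or at its image, and strict monotonicity of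
  the kernel orders \<open>f\<close> on almost all pairs. The two cases are the two alternatives of
  the conclusion.\<close>

lemma energy_pol_eq:
  fixes e :: 'a and f :: "'a => real"
  assumes e: "norm e = 1" and [measurable]: "f \<in> Borel" and nn: "!!y. 0 <= f y" and q: "1 < q"
    and fin: "AE x in lborel. rpot s f x < \<infinity>" and E: "energy s q f < \<infinity>" and le: "energy s q (pol e t f) <= energy s q f"
  shows "(AE x in lborel. t <= e \<bullet> x --> f (hrefl e t x) <= f x) \<or> (AE x in lborel. t <= e \<bullet> x --> f x <= f (hrefl e t x))"
proof -
  have "AE x in lborel. ennreal (rpotr s f x powr q + rpotr s f (hrefl e t x) powr q)
       = ennreal (rpotr s (pol e t f) x powr q + rpotr s (pol e t f) (hrefl e t x) powr q)"
  proof (rule AE_eq_of_nn_integral_le)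
    show "AE x in lborel. ennreal (rpotr s f x powr q + rpotr s f (hrefl e t x) powr q)
       <= ennreal (rpotr s (pol e t f) x powr q + rpotr s (pol e t f) (hrefl e t x) powr q)"
      using AE_rpot_finite_pair[OF e fin, of t]
      by eventually_elim (intro ennreal_leI energy_pol_pointwise[OF e assms(2) nn q], simp_all)
  next
    show "(NN x. ennreal (rpotr s (pol e t f) x powr q + rpotr s (pol e t f) (hrefl e t x) powr q))
       <= (NN x. ennreal (rpotr s f x powr q + rpotr s f (hrefl e t x) powr q))"
      unfolding energy_fold[OF e assms(2), where q=q and t=t, symmetric] energy_fold[OF e pol_measurable[OF assms(2)], where q=q and t=t, symmetric]
      using le by (rule mult_left_mono) simp
    show "(NN x. ennreal (rpotr s f x powr q + rpotr s f (hrefl e t x) powr q)) ~= \<infinity>"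
      unfolding energy_fold[OF e assms(2), where q=q and t=t, symmetric] using E
      by (simp add: ennreal_mult_eq_top_iff)
  qed auto
  with AE_rpot_finite_pair[OF e fin, of t]
  have ae: "AE x in lborel. (rpot s f x < \<infinity> \<and> rpot s f (hrefl e t x) < \<infinity>) \<and>
     ennreal (rpotr s f x powr q + rpotr s f (hrefl e t x) powr q)
       = ennreal (rpotr s (pol e t f) x powr q + rpotr s (pol e t f) (hrefl e t x) powr q)"
    by eventually_elim auto
  \<comment> \<open>Otherwise almost every point would lie in the closed complement of the
    half-space, hence every point would.\<close>
  have "\<exists>x. t < e \<bullet> x \<and> (rpot s f x < \<infinity> \<and> rpot s f (hrefl e t x) < \<infinity>) \<and>
     ennreal (rpotr s f x powr q + rpotr s f (hrefl e t x) powr q)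
       = ennreal (rpotr s (pol e t f) x powr q + rpotr s (pol e t f) (hrefl e t x) powr q)"
  proof (rule ccontr)
    assume n: "\<not> ?thesis"
    from ae have "AE x in lborel. x \<in> - {x. t < e \<bullet> x}" by eventually_elim (use n in blast)
    then have "AE x in lebesgue. x \<in> - {x. t < e \<bullet> x}" by (rule AE_completion)
    moreover have "closed (- {x. t < e \<bullet> x})"
      by (intro closed_Compl open_Collect_less continuous_intros)
    ultimately have "(t + 1) *\<^sub>R e \<in> - {x. t < e \<bullet> x}"
      by (intro mem_closed_if_AE_lebesgue)
    moreover have "t < e \<bullet> ((t + 1) *\<^sub>R e)" using e by (simp add: norm_eq_1)
    ultimately show False by blast
  qed
  then obtain x where x: "t < e \<bullet> x" and fx: "rpot s f x < \<infinity>" "rpot s f (hrefl e t x) < \<infinity>"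
    and eq: "rpotr s f x powr q + rpotr s f (hrefl e t x) powr q
       = rpotr s (pol e t f) x powr q + rpotr s (pol e t f) (hrefl e t x) powr q"
    by (auto simp del: ennreal_plus)
  have x': "t <= e \<bullet> x" using x by simp
  note nn' = pol_nonneg[of f, OF nn]
  note P = rpotr_pol[OF e assms(2) nn x' fx]
  have finP: "rpot s (pol e t f) x < \<infinity>"
  proof -
    have "rpot s (pol e t f) x + rpot s (pol e t f) (hrefl e t x) < \<infinity>"
      unfolding rpot_pol(3)[OF e assms(2) nn x'] using fx by simp
    then show ?thesis by auto
  qed
  have "rpotr s (pol e t f) x = rpotr s f x \<or> rpotr s (pol e t f) x = rpotr s f (hrefl e t x)"
    using powr_spread(2)[OF q P(3,1,2)] eq by auto
  then consider "rpot s (pol e t f) x = rpot s f x" | "rpot s (pol e t f) x = rpot s f (hrefl e t x)"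
    using fx finP by (metis rpotr_eq)
  then show ?thesis
  proof cases
    case 1
    have "AE y in lborel. ennreal (K (x - y) * f y + K (x - hrefl e t y) * f (hrefl e t y))
       = ennreal (K (x - y) * pol e t f y + K (x - hrefl e t y) * pol e t f (hrefl e t y))"
    proof (rule AE_eq_of_nn_integral_le)
      show "AE y in lborel. ennreal (K (x - y) * f y + K (x - hrefl e t y) * f (hrefl e t y))
       <= ennreal (K (x - y) * pol e t f y + K (x - hrefl e t y) * pol e t f (hrefl e t y))"
        using AE_neq_hrefl[OF e, of x t] by eventually_elim (intro ennreal_leI pol_kernel_le[OF e x'], simp_all)
    next
      show "(NN y. ennreal (K (x - y) * pol e t f y + K (x - hrefl e t y) * pol e t f (hrefl e t y)))
         <= (NN y. ennreal (K (x - y) * f y + K (x - hrefl e t y) * f (hrefl e t y)))"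
        unfolding rpot_fold[OF e assms(2) nn, symmetric] rpot_fold[OF e pol_measurable[OF assms(2)] nn', symmetric]
        using 1 by simp
      show "(NN y. ennreal (K (x - y) * f y + K (x - hrefl e t y) * f (hrefl e t y))) ~= \<infinity>"
        unfolding rpot_fold[OF e assms(2) nn, symmetric] using fx by (simp add: ennreal_mult_eq_top_iff)
    qed measurable
    then have "AE y in lborel. t <= e \<bullet> y --> f (hrefl e t y) <= f y"
      using AE_neq_hrefl[OF e, of x t]
    proof eventually_elim
      case (elim y)
      show ?case
      proof
        assume y: "t <= e \<bullet> y"
        show "f (hrefl e t y) <= f y"
        proof (rule ccontr)
          assume n: "\<not> f (hrefl e t y) <= f y"
          then have "t < e \<bullet> y" using y hrefl_fixed[of e y t] by (cases "e \<bullet> y = t") auto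
          \<comment> \<open>A misordered pair off the hyperplane makes the rearrangement inequality
            strict, against the equality just obtained.\<close>
          then have k: "0 < (K (x - y) - K (x - hrefl e t y)) * (f (hrefl e t y) - f y)"
            using K_hrefl_less[OF e x] elim n by simp
          have "K (x - y) * f y + K (x - hrefl e t y) * f (hrefl e t y) = K (x - y) * pol e t f y + K (x - hrefl e t y) * pol e t f (hrefl e t y)"
            using elim nn nn' by (simp del: ennreal_plus)
          also have "... = K (x - y) * f (hrefl e t y) + K (x - hrefl e t y) * f y"
            using n y by (simp add: pol_hrefl[OF e y]) (simp add: pol_def)
          finally show False using k by (simp add: algebra_simps)
        qed
      qed
    qed
    then show ?thesis by blast
  next
    case 2
    have "AE y in lborel. ennreal (K (x - hrefl e t y) * f y + K (x - y) * f (hrefl e t y))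
       = ennreal (K (x - y) * pol e t f y + K (x - hrefl e t y) * pol e t f (hrefl e t y))"
    proof (rule AE_eq_of_nn_integral_le)
      show "AE y in lborel. ennreal (K (x - hrefl e t y) * f y + K (x - y) * f (hrefl e t y))
       <= ennreal (K (x - y) * pol e t f y + K (x - hrefl e t y) * pol e t f (hrefl e t y))"
        using AE_neq_hrefl[OF e, of x t] by eventually_elim (intro ennreal_leI pol_kernel_le[OF e x'], simp_all)
    next
      show "(NN y. ennreal (K (x - y) * pol e t f y + K (x - hrefl e t y) * pol e t f (hrefl e t y)))
         <= (NN y. ennreal (K (x - hrefl e t y) * f y + K (x - y) * f (hrefl e t y)))"
        unfolding rpot_fold_hrefl[OF e assms(2) nn, symmetric] rpot_fold[OF e pol_measurable[OF assms(2)] nn', symmetric]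
        using 2 by simp
      show "(NN y. ennreal (K (x - hrefl e t y) * f y + K (x - y) * f (hrefl e t y))) ~= \<infinity>"
        unfolding rpot_fold_hrefl[OF e assms(2) nn, symmetric] using fx by (simp add: ennreal_mult_eq_top_iff)
    qed measurable
    then have "AE y in lborel. t <= e \<bullet> y --> f y <= f (hrefl e t y)"
      using AE_neq_hrefl[OF e, of x t]
    proof eventually_elim
      case (elim y)
      show ?case
      proof
        assume y: "t <= e \<bullet> y"
        show "f y <= f (hrefl e t y)"
        proof (rule ccontr)
          assume n: "\<not> f y <= f (hrefl e t y)"
          then have "t < e \<bullet> y" using y hrefl_fixed[of e y t] by (cases "e \<bullet> y = t") auto
          then have k: "0 < (K (x - y) - K (x - hrefl e t y)) * (f y - f (hrefl e t y))"
            using K_hrefl_less[OF e x] elim n by simp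
          have "K (x - hrefl e t y) * f y + K (x - y) * f (hrefl e t y) = K (x - y) * pol e t f y + K (x - hrefl e t y) * pol e t f (hrefl e t y)"
            using elim nn nn' by (simp del: ennreal_plus)
          also have "... = K (x - y) * f y + K (x - hrefl e t y) * f (hrefl e t y)"
            using n y by (simp add: pol_hrefl[OF e y]) (simp add: pol_def)
          finally show False using k by (simp add: algebra_simps)
        qed
      qed
    qed
    then show ?thesis by blast
  qed
qed

end

subsection \<open>Dominated convergence for the energy\<close>

locale hls = riesz s T N for s :: real and T :: "'a::euclidean_space itself" and N :: real +
  fixes p m :: real
  assumes p_gt_1: "1 < p" and sp_less: "s * p < N" and m_gt: "conj_exp (pstar N s p) < m"
begin

definition q :: real where "q = conj_exp p"

text \<open>The exponent for which \<open>norm x powr - b0\<close> just fails to have finite energy.\<close>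

definition b0 :: real where "b0 = s + N / q"

lemma N_pos: "0 < N" using s_pos s_less by simp

lemma q_eq: "q = p / (p - 1)" by (simp add: q_def conj_exp_def)

lemma q_gt_1: "1 < q" using p_gt_1 by (simp add: q_eq)

lemma q_minus_1: "q - 1 = 1 / (p - 1)" using p_gt_1 by (simp add: q_eq field_simps)

lemma b0_eq: "b0 = (N * (p - 1) + s * p) / p"
  using p_gt_1 by (simp add: b0_def q_eq field_simps)

lemma s_less_b0: "s < b0" using N_pos q_gt_1 by (simp add: b0_def)

lemma b0_less_N: "b0 < N" using p_gt_1 sp_less by (simp add: b0_eq field_simps)

text \<open>Turns the hypothesis on \<open>m\<close> into a comparison of decay exponents,
  \<open>N / m < b0\<close>.\<close>

lemma conj_exp_pstar: "conj_exp (pstar N s p) = N / b0"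
proof -
  have "0 < s * p" "N < N * p" using p_gt_1 s_pos N_pos by simp_all
  moreover from this have "N * p - (N - s * p) > 0" "N - s * p > 0"
    using sp_less by linarith+
  ultimately show ?thesis
    using p_gt_1 by (simp add: conj_exp_def pstar_def b0_eq divide_simps) (auto simp: algebra_simps)
qed

lemma m_b0: "N / m < b0" and m_gt_1: "1 < m"
proof -
  have "1 < N / b0" using b0_less_N s_less_b0 s_pos by simp
  then show "1 < m" using m_gt by (simp add: conj_exp_pstar)
  then show "N / m < b0" using m_gt s_less_b0 s_pos by (simp add: conj_exp_pstar field_simps)
qed

text \<open>Used with \<open>b1 < b0 < b2\<close>: the first power controls the origin, the second
  infinity. The origin is left out since \<open>0 powr - b\<close> is 0.\<close>

definition pdom :: "real => real => real => ('a => real) => bool" where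
  "pdom C b1 b2 f \<longleftrightarrow> (\<forall>x. x ~= 0 --> f x <= C * norm x powr - b1 \<and> f x <= C * norm x powr - b2)"

text \<open>The potential lowers the decay exponent by \<open>s\<close>; its \<open>q\<close>-th
  power is integrable at 0 because \<open>q * (b1 - s) < N\<close>, and at infinity because
  \<open>q * (b2 - s) > N\<close>. One \<open>w\<close> serves the whole class.\<close>

lemma energy_pdom_majorant:
  assumes b: "s < b1" "b1 < b0" "b0 < b2" "b2 < N" and C: "0 <= C"
  shows "\<exists>w\<in>Borel. (NN x. w x) < \<infinity> \<and>
     (\<forall>f x. pdom C b1 b2 f --> (x::'a) ~= 0 --> rpot s f x < \<infinity> \<and> ennreal (rpotr s f x powr q) <= w x)"
proof -
  obtain C1 where C1: "0 <= C1" "!!f x. [|!!x. x ~= 0 ==> f x <= C * norm x powr - b1; (x::'a) ~= 0|] ==> rpot s f x <= ennreal (C1 * norm x powr (s - b1))"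
    using rpot_powr_bound[of b1 C] b C b0_less_N by auto
  obtain C2 where C2: "0 <= C2" "!!f x. [|!!x. x ~= 0 ==> f x <= C * norm x powr - b2; (x::'a) ~= 0|] ==> rpot s f x <= ennreal (C2 * norm x powr (s - b2))"
    using rpot_powr_bound[of b2 C] b C s_less_b0 by auto
  define e1 e2 where "e1 = q * (b1 - s)" and "e2 = q * (b2 - s)"
  have e: "e1 < N" "N < e2"
    using b q_gt_1 by (auto simp: e1_def e2_def b0_def field_simps)
  define w :: "'a => ennreal" where "w x = ennreal (C1 powr q) * (ennreal (norm x powr - e1) * indicator (ball 0 1) x)
      + ennreal (C2 powr q) * (ennreal (norm x powr - e2) * indicator (- ball 0 1) x)" for x
  have m1: "(%x::'a. ennreal (norm x powr - e1) * indicator (ball 0 1) x) \<in> Borel"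
    and m2: "(%x::'a. ennreal (norm x powr - e2) * indicator (- ball 0 1) x) \<in> Borel"
    by (auto intro!: borel_measurable_times_ennreal borel_measurable_indicator)
  show ?thesis
  proof (intro bexI[of _ w] conjI allI impI)
    show "w \<in> Borel" unfolding w_def[abs_def] using m1 m2 by measurable
    have "(NN x. w x) = ennreal (C1 powr q) * (NN x. ennreal (norm x powr - e1) * indicator (ball (0::'a) 1) x)
       + ennreal (C2 powr q) * (NN x. ennreal (norm x powr - e2) * indicator (- ball (0::'a) 1) x)"
      unfolding w_def using m1 m2 by (subst nn_integral_add) (auto simp: nn_integral_cmult)
    also have "... < \<infinity>"
    proof -
      have "(NN x. ennreal (norm x powr - e1) * indicator (ball (0::'a) 1) x) < \<infinity>"
        using nn_integral_norm_powr_ball[where 'a='a, folded N_eq, OF e(1)]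
        by (metis ennreal_less_top infinity_ennreal_def le_less_trans zero_less_one)
      moreover have "(NN x. ennreal (norm x powr - e2) * indicator (- ball (0::'a) 1) x) < \<infinity>"
        using nn_integral_norm_powr_compl_ball[where 'a='a, folded N_eq, OF e(2)]
        by (metis ennreal_less_top infinity_ennreal_def le_less_trans zero_less_one)
      ultimately show ?thesis
        by (simp add: ennreal_mult_less_top)
    qed
    finally show "(NN x. w x) < \<infinity>" .
    fix f and x :: 'a assume f: "pdom C b1 b2 f" and x: "x ~= 0"
    have r1: "rpot s f x <= ennreal (C1 * norm x powr (s - b1))" and r2: "rpot s f x <= ennreal (C2 * norm x powr (s - b2))"
      using f by (auto intro!: C1(2)[OF _ x] C2(2)[OF _ x] simp: pdom_def)
    show "rpot s f x < \<infinity>" using r1 by (auto intro: le_less_trans)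
    have "rpotr s f x <= C1 * norm x powr (s - b1)" "rpotr s f x <= C2 * norm x powr (s - b2)"
      unfolding rpotr_def using r1 r2 C1(1) C2(1) by (auto intro: enn2real_leI)
    then have "rpotr s f x powr q <= (C1 * norm x powr (s - b1)) powr q" "rpotr s f x powr q <= (C2 * norm x powr (s - b2)) powr q"
      using q_gt_1 by (auto intro!: powr_mono2)
    then have "rpotr s f x powr q <= C1 powr q * norm x powr - e1" "rpotr s f x powr q <= C2 powr q * norm x powr - e2"
      using C1 C2 by (auto simp: powr_mult powr_powr e1_def e2_def algebra_simps)
    then show "ennreal (rpotr s f x powr q) <= w x"
      by (auto simp: w_def ennreal_mult[symmetric] indicator_def intro: ennreal_leI)
  qed
qed

lemma energy_pdom_bound:
  assumes b: "s < b1" "b1 < b0" "b0 < b2" "b2 < N" and C: "0 <= C"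
  shows "\<exists>E<\<infinity>. \<forall>f::'a => real. pdom C b1 b2 f --> energy s q f <= E"
proof -
  obtain w where w: "(NN x. w x) < \<infinity>"
     "!!f x. pdom C b1 b2 f ==> (x::'a) ~= 0 ==> ennreal (rpotr s f x powr q) <= w x"
    using energy_pdom_majorant[OF assms] by blast
  have "energy s q f <= (NN x. w x)" if "pdom C b1 b2 f" for f :: "'a => real"
    unfolding energy_def
    by (rule nn_integral_mono_AE) (use AE_lborel_singleton[of "0::'a"] in eventually_elim, use w that in auto)
  with w(1) show ?thesis by blast
qed

text \<open>Dominated convergence twice: for the potential at a fixed \<open>x ~= 0\<close> with the
  kernel times the \<open>b1\<close> power as majorant, then for the outer integral with the
  \<open>w\<close> of \<open>energy_pdom_majorant\<close>.\<close>

lemma energy_pdom_tendsto: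
  fixes f :: "nat => 'a => real"
  assumes b: "s < b1" "b1 < b0" "b0 < b2" "b2 < N" and C: "0 <= C"
    and [measurable]: "!!n. f n \<in> Borel" "g \<in> Borel"
    and dom: "!!n. pdom C b1 b2 (f n)" "pdom C b1 b2 g" and nn: "!!n x. 0 <= f n x"
    and lim: "AE x in lborel. (%n. f n x) \<longlonglongrightarrow> g x"
  shows "(%n. energy s q (f n)) \<longlonglongrightarrow> energy s q g"
proof -
  obtain w where [measurable]: "w \<in> Borel" and w: "(NN x. w x) < \<infinity>"
     "!!f x. pdom C b1 b2 f ==> (x::'a) ~= 0 ==> rpot s f x < \<infinity>"
     "!!f x. pdom C b1 b2 f ==> (x::'a) ~= 0 ==> ennreal (rpotr s f x powr q) <= w x"
    using energy_pdom_majorant[OF b C] by blast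
  have pot: "(%n. rpot s (f n) x) \<longlonglongrightarrow> rpot s g x" if x: "x ~= 0" for x
    unfolding rpot_def
  proof (rule nn_integral_dominated_convergence)
    show "AE y in lborel. ennreal (K (x - y) * f j y) <= ennreal (K (x - y) * (C * norm y powr - b1))" for j
      using AE_lborel_singleton[of "0::'a"]
      by eventually_elim (use dom(1)[of j] in \<open>auto simp: pdom_def intro!: ennreal_leI mult_left_mono\<close>)
    show "(NN y. ennreal (K (x - y) * (C * norm y powr - b1))) < \<infinity>"
    proof -
      obtain D where "\<forall>f::'a => real. (\<forall>x. x ~= 0 --> f x <= C * norm x powr - b1) --> (\<forall>x. x ~= 0 --> rpot s f x <= ennreal (D * norm x powr (s - b1)))"
        using rpot_powr_bound[of b1 C] b C b0_less_N by auto
      then have "rpot s (%y. C * norm y powr - b1) x <= ennreal (D * norm x powr (s - b1))"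
        using x by (elim allE[of _ "%y. C * norm y powr - b1"] impE) auto
      then show ?thesis unfolding rpot_def by (auto intro: le_less_trans)
    qed
    show "AE y in lborel. (%i. ennreal (K (x - y) * f i y)) \<longlonglongrightarrow> ennreal (K (x - y) * g y)"
      using lim by eventually_elim (intro tendsto_ennrealI tendsto_mult tendsto_const)
  qed measurable
  show ?thesis unfolding energy_def
  proof (rule nn_integral_dominated_convergence[where w=w])
    show "AE x in lborel. ennreal (rpotr s (f j) x powr q) <= w x" for j
      using AE_lborel_singleton[of "0::'a"] by eventually_elim (use w dom in auto)
    show "AE x in lborel. (%i. ennreal (rpotr s (f i) x powr q)) \<longlonglongrightarrow> ennreal (rpotr s g x powr q)"
      using AE_lborel_singleton[of "0::'a"]
    proof eventually_elim
      case (elim x)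
      have "(%i. rpotr s (f i) x) \<longlonglongrightarrow> rpotr s g x"
        unfolding rpotr_def using pot[OF elim] w(2)[OF dom(2) elim]
        by (intro tendsto_enn2real) (auto simp: less_top)
      then show ?case using q_gt_1
        by (intro tendsto_ennrealI tendsto_powr2) auto
    qed
  qed (use w in auto)
qed

lemma pdom_bounded_support:
  assumes R: "0 < R" and f: "!!x. f x <= M" "!!x. R < norm x ==> f x = 0" and M: "0 <= M" and b: "0 <= b1" "0 <= b2"
  shows "pdom (M * (R powr b1 + R powr b2)) b1 b2 (f :: 'a => real)"
  unfolding pdom_def
proof (intro allI impI)
  fix x :: 'a assume x: "x ~= 0"
  have *: "f x <= M * (R powr b1 + R powr b2) * norm x powr - b" if "b = b1 \<or> b = b2" for b
  proof (cases "norm x <= R")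
    case True
    have "0 <= b" using b that by auto
    have "1 = R powr b * R powr - b" using R by (simp add: powr_minus)
    also have "... <= R powr b * norm x powr - b"
      using True x \<open>0 <= b\<close> by (intro mult_left_mono powr_mono2') auto
    also have "... <= (R powr b1 + R powr b2) * norm x powr - b"
      using that by (intro mult_right_mono) auto
    finally have "M * 1 <= M * ((R powr b1 + R powr b2) * norm x powr - b)" using M by (intro mult_left_mono) auto
    then show ?thesis using f(1)[of x] by (simp add: mult.assoc)
  next
    case False
    then show ?thesis using f(2)[of x] M by simp
  qed
  show "f x <= M * (R powr b1 + R powr b2) * norm x powr - b1 \<and> f x <= M * (R powr b1 + R powr b2) * norm x powr - b2"
    using *[of b1] *[of b2] by simp
qed

end

subsection \<open>Symmetrization by repeated polarization\<close>

lemma dist_hrefl_le: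
  assumes e: "norm e = 1" and "(e \<bullet> x - t) * (e \<bullet> y - t) <= 0"
  shows "dist x (hrefl e t y) <= dist x y"
proof -
  have "4 * ((e \<bullet> x - t) * (e \<bullet> y - t)) <= 0" using assms by linarith
  then have "(norm (x - hrefl e t y))\<^sup>2 <= (norm (x - y))\<^sup>2"
    unfolding norm_diff_refl_sq[OF e] mult.assoc by linarith
  then show ?thesis unfolding dist_norm by (rule power2_le_imp_le) simp
qed

text \<open>When \<open>x\<close> and \<open>y\<close> lie on opposite sides, polarization may
  exchange values across the hyperplane, but then \<open>x\<close> is at least as close to the image
  of \<open>y\<close> as to \<open>y\<close> itself. So the modulus of continuity survives.\<close>

lemma pol_modulus:
  fixes f :: "'a::euclidean_space => real"
  assumes e: "norm e = 1" and f: "!!x y. dist x y < d ==> \<bar>f x - f y\<bar> <= \<epsilon>" and xy: "dist x y < d"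
  shows "\<bar>pol e t f x - pol e t f y\<bar> <= \<epsilon>"
proof -
  let ?\<sigma> = "hrefl e t"
  have dd: "dist (?\<sigma> x) (?\<sigma> y) = dist x y" "dist (?\<sigma> x) y = dist x (?\<sigma> y)"
    unfolding dist_norm by (rule dist_hrefl_hrefl[OF e], rule norm_diff_refl_swap[OF e])
  have a: "\<bar>f x - f y\<bar> <= \<epsilon>" "\<bar>f (?\<sigma> x) - f (?\<sigma> y)\<bar> <= \<epsilon>" using f xy dd by auto
  have b: "\<bar>f x - f (?\<sigma> y)\<bar> <= \<epsilon>" "\<bar>f (?\<sigma> x) - f y\<bar> <= \<epsilon>" if "(e \<bullet> x - t) * (e \<bullet> y - t) <= 0"
    using f dist_hrefl_le[OF e that] xy dd by auto
  consider "t <= e \<bullet> x" "t <= e \<bullet> y" | "\<not> t <= e \<bullet> x" "\<not> t <= e \<bullet> y"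
    | "t <= e \<bullet> x" "\<not> t <= e \<bullet> y" | "\<not> t <= e \<bullet> x" "t <= e \<bullet> y" by blast
  then show ?thesis
  proof cases
    case 3
    then have "(e \<bullet> x - t) * (e \<bullet> y - t) <= 0" by (intro mult_nonneg_nonpos) auto
    then show ?thesis using a b 3 by (auto simp: pol_def max_def min_def)
  next
    case 4
    then have "(e \<bullet> x - t) * (e \<bullet> y - t) <= 0" by (intro mult_nonpos_nonneg) auto
    then show ?thesis using a b 4 by (auto simp: pol_def max_def min_def)
  qed (use a in \<open>auto simp: pol_def max_def min_def\<close>)
qed

text \<open>For \<open>t <= 0\<close> the origin lies on the preferred side and reflection moves
  preferred points outward, so no value is carried out of a centred ball.\<close>

lemma pol_support:
  fixes f :: "'a::euclidean_space => real"
  assumes e: "norm e = 1" and t: "t <= 0" and f: "!!x. R < norm x ==> f x = 0" "!!x. 0 <= f x" and x: "R < norm x"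
  shows "pol e t f x = 0"
proof (cases "t <= e \<bullet> x")
  case True
  then have "t * (e \<bullet> x - t) <= 0" using t by (intro mult_nonpos_nonneg) auto
  then have "(norm x)\<^sup>2 <= (norm (hrefl e t x))\<^sup>2" unfolding norm_refl_sq[OF e] mult.assoc by linarith
  then have "norm x <= norm (hrefl e t x)" by (rule power2_le_imp_le) simp
  then show ?thesis using f x by (simp add: pol_def)
next
  case False
  then show ?thesis using f x by (simp add: pol_def min_def)
qed

text \<open>For \<open>norm y < norm z\<close> the perpendicular bisector of \<open>y\<close> and
  \<open>z\<close> has \<open>t < 0\<close>. Equal norms would require \<open>t = 0\<close>, which
  the hypothesis does not cover; continuity along the outward ray settles that case.\<close>

lemma radial_nonincr_of_reflections:
  fixes g :: "'a::euclidean_space => real"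
  assumes cont: "continuous_on UNIV g"
    and refl: "!!e t x. [|norm e = 1; t < 0; t <= e \<bullet> x|] ==> g (hrefl e t x) <= g x"
    and le: "norm y <= norm z"
  shows "g z <= g y"
proof -
  have strict: "g z <= g y" if "norm y < norm z" for y z :: 'a
  proof -
    define d where "d = norm (y - z)"
    have d: "0 < d" using that by (auto simp: d_def)
    define e where "e = (1 / d) *\<^sub>R (y - z)"
    \<comment> \<open>This value puts the hyperplane through the midpoint of \<open>y\<close> and
      \<open>z\<close>.\<close>
    define t where "t = ((norm y)\<^sup>2 - (norm z)\<^sup>2) / (2 * d)"
    have e: "norm e = 1" using d by (simp add: e_def d_def)
    have t: "t < 0" using that d by (auto simp: t_def divide_less_0_iff power_strict_mono)
    have d2: "d\<^sup>2 = (norm y)\<^sup>2 - 2 * (y \<bullet> z) + (norm z)\<^sup>2"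
      unfolding d_def power2_norm_eq_inner by (simp add: inner_diff_left inner_diff_right inner_commute)
    have ey: "e \<bullet> y - t = d / 2"
    proof -
      have "e \<bullet> y - t = ((norm y)\<^sup>2 - 2 * (y \<bullet> z) + (norm z)\<^sup>2) / (2 * d)"
      proof -
        have "e \<bullet> y = ((norm y)\<^sup>2 - y \<bullet> z) / d"
          by (simp add: e_def inner_diff_left inner_commute[of z y] power2_norm_eq_inner)
        then show ?thesis using d by (simp add: t_def field_simps)
      qed
      also have "... = d / 2" using d by (subst d2[symmetric]) (simp add: power2_eq_square)
      finally show ?thesis .
    qed
    have "hrefl e t y = z" using d by (simp add: hrefl_def ey) (simp add: e_def)
    then show ?thesis using refl[OF e t, of y] ey d by simp
  qed
  show ?thesis
  proof (cases "norm y < norm z")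
    case False
    then have eq: "norm y = norm z" using le by simp
    show ?thesis
    proof (cases "z = 0")
      case False
      have "(%n. g ((1 + 1 / real (Suc n)) *\<^sub>R z)) \<longlonglongrightarrow> g ((1 + 0) *\<^sub>R z)"
        by (intro isCont_tendsto_compose[of _ g] tendsto_intros LIMSEQ_Suc[OF lim_1_over_n])
           (use cont in \<open>simp add: continuous_on_eq_continuous_at\<close>)
      then have "g ((1 + 0) *\<^sub>R z) <= g y"
        by (rule LIMSEQ_le_const2) (use False eq in \<open>auto intro!: strict simp: field_simps\<close>)
      then show ?thesis by simp
    qed (use eq in auto)
  qed (use strict in auto)
qed

context hls
begin

text \<open>Polarization with \<open>t < 0\<close> moves mass towards the origin, so a minimizer of
  the second moment over a class stable under these polarizations is left unchanged by each of them
  and is radially nonincreasing. Compactness of the class \<open>P\<close> rests on a common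
  support, bound and modulus of continuity, all respected by polarization.\<close>

lemma symmetrization:
  fixes f :: "'a => real"
  assumes cont: "continuous_on UNIV f" and nn: "!!x. 0 <= f x" and R: "0 < R" and supp: "!!x. R < norm x ==> f x = 0"
  shows "\<exists>g::'a => real. continuous_on UNIV g \<and> (\<forall>x. 0 <= g x) \<and> (\<forall>x y. norm x <= norm y --> g y <= g x)
     \<and> (NN x. ennreal (g x)) = (NN x. ennreal (f x))
     \<and> (NN x. ennreal (g x powr m)) = (NN x. ennreal (f x powr m))
     \<and> energy s q f <= energy s q g"
proof -
  define S where "S = cball (0::'a) (R + 1)"
  have compS: "compact S" by (simp add: S_def)
  have "bounded (f ` S)"
    by (intro compact_imp_bounded compact_continuous_image[OF continuous_on_subset[OF cont subset_UNIV] compS])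
  then obtain M where M0: "\<forall>y\<in>f ` S. norm y <= M" by (auto simp: bounded_iff)
  have "0 \<in> S" using R by (simp add: S_def)
  then have M_nn: "0 <= M" using M0 nn[of 0] by (meson imageI norm_ge_zero order_trans)
  have M: "f x <= M" for x
  proof (cases "x \<in> S")
    case True
    then have "norm (f x) <= M" using M0 by blast
    then show ?thesis by simp
  qed (use supp[of x] M_nn in \<open>simp add: S_def\<close>)
  have "\<exists>d>0. \<forall>x y. dist x y < d --> \<bar>f x - f y\<bar> <= \<epsilon>" if "0 < \<epsilon>" for \<epsilon>
  proof -
    have "uniformly_continuous_on S f"
      by (rule compact_uniformly_continuous[OF continuous_on_subset[OF cont subset_UNIV] compS])
    then obtain d where d: "d > 0" "!!x y. x \<in> S ==> y \<in> S ==> dist y x < d ==> dist (f y) (f x) < \<epsilon>"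
      using \<open>0 < \<epsilon>\<close> unfolding uniformly_continuous_on_def by metis
    have "\<bar>f x - f y\<bar> <= \<epsilon>" if xy: "dist x y < min d 1" for x y
    proof (cases "x \<in> S \<and> y \<in> S")
      case True
      then show ?thesis using d(2)[of y x] xy by (auto simp: dist_real_def)
    next
      case False
      have "norm x <= norm y + dist x y" "norm y <= norm x + dist x y"
        unfolding dist_norm by (rule norm_triangle_sub, metis norm_minus_commute norm_triangle_sub)
      then have "R < norm x" "R < norm y" using False xy by (auto simp: S_def)
      then show ?thesis using supp \<open>0 < \<epsilon>\<close> by simp
    qed
    then show ?thesis using d(1) by (intro exI[of _ "min d 1"]) auto
  qed
  \<comment> \<open>Choosing \<open>\<delta>\<close> as a function of \<open>\<epsilon>\<close>
    fixes one modulus of continuity for all of \<open>P\<close>.\<close>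
  then obtain \<delta> where \<delta>: "!!\<epsilon>. 0 < \<epsilon> ==> 0 < \<delta> \<epsilon>" "!!\<epsilon> x y. 0 < \<epsilon> ==> dist x y < \<delta> \<epsilon> ==> \<bar>f x - f y\<bar> <= \<epsilon>"
    by metis
  obtain b1 b2 where b: "s < b1" "b1 < b0" "b0 < b2" "b2 < N"
    using dense[OF s_less_b0] dense[OF b0_less_N] by blast
  define UC :: "('a => real) => bool" where "UC g \<longleftrightarrow> (\<forall>\<epsilon>>0. \<forall>x y. dist x y < \<delta> \<epsilon> --> \<bar>g x - g y\<bar> <= \<epsilon>)" for g
  define P where "P = {g. (\<forall>x. 0 <= g x \<and> g x <= M) \<and> (\<forall>x. R < norm x --> g x = 0) \<and> UC g
     \<and> (NN x. ennreal (g x)) = (NN x. ennreal (f x))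
     \<and> (NN x. ennreal (g x powr m)) = (NN x. ennreal (f x powr m))
     \<and> energy s q f <= energy s q g}"
  have UC_cont: "continuous_on UNIV g" if "UC g" for g
    unfolding continuous_on_iff
  proof (intro ballI allI impI)
    fix x :: 'a and \<epsilon> :: real assume "0 < \<epsilon>"
    then have "\<forall>y. dist y x < \<delta> (\<epsilon> / 2) --> dist (g y) (g x) < \<epsilon>"
      using that[unfolded UC_def, rule_format, of "\<epsilon> / 2"] by (fastforce simp: dist_real_def)
    then show "\<exists>d>0. \<forall>x'\<in>UNIV. dist x' x < d --> dist (g x') (g x) < \<epsilon>"
      using \<delta>(1)[of "\<epsilon> / 2"] \<open>0 < \<epsilon>\<close> by auto
  qed
  have P_meas: "g \<in> Borel" if "g \<in> P" for g
    using that UC_cont by (auto simp: P_def intro: borel_measurable_continuous_onI)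
  define C where "C = M * (R powr b1 + R powr b2)"
  have C: "0 <= C" using M_nn by (simp add: C_def)
  have P_dom: "pdom C b1 b2 g" if "!!x. g x <= M" "!!x. R < norm x ==> g x = 0" for g
    unfolding C_def using that M_nn R b s_pos by (intro pdom_bounded_support) auto
  have fP: "f \<in> P" using nn M supp \<delta> by (auto simp: P_def UC_def)
  define J where "J g = (NN x. ennreal ((norm x)\<^sup>2 * g x))" for g :: "'a => real"
  have dominated: "(NN x. ennreal c * indicator (cball (0::'a) R) x) < \<infinity>" for c
    using emeasure_lborel_cball_finite[of "0::'a" R] by (subst nn_integral_cmult_indicator) (auto simp: ennreal_mult_less_top)
  have J_dom: "ennreal ((norm x)\<^sup>2 * g x) <= ennreal (R\<^sup>2 * M) * indicator (cball 0 R) x" if "g \<in> P" for g x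
  proof (cases "norm x <= R")
    case True
    then have "(norm x)\<^sup>2 * g x <= R\<^sup>2 * M" using that by (intro mult_mono power_mono) (auto simp: P_def)
    then show ?thesis using True by (simp add: ennreal_leI)
  next
    case False
    then show ?thesis using that by (simp add: P_def)
  qed
  have J_fin: "J g < \<infinity>" if "g \<in> P" for g
    unfolding J_def using J_dom[OF that] dominated by (metis (no_types, lifting) le_less_trans nn_integral_mono)
  have P_pol: "pol e t g \<in> P" if g: "g \<in> P" and e: "norm e = 1" and t: "t < 0" for e t g
  proof -
    note [measurable] = P_meas[OF g]
    have g': "!!x. 0 <= g x" "!!x. g x <= M" "!!x. R < norm x ==> g x = 0" "UC g" using g by (auto simp: P_def)
    have "(NN x. ennreal (g x)) < \<infinity>"
    proof -
      have "(NN x. ennreal (g x)) <= (NN x. ennreal M * indicator (cball (0::'a) R) x)"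
        using g' by (intro nn_integral_mono) (auto simp: indicator_def intro!: ennreal_leI)
      then show ?thesis using dominated by (rule le_less_trans)
    qed
    then have "energy s q g <= energy s q (pol e t g)"
      by (intro energy_pol_ge e g' q_gt_1 rpot_finite_AE) auto
    moreover have "UC (pol e t g)"
      unfolding UC_def using g'(4) by (auto simp: UC_def intro!: pol_modulus[OF e])
    moreover have "pol e t g x <= M" for x using pol_range[of e t g x] g' by auto
    moreover have "pol e t g x = 0" if "R < norm x" for x
      using t g' that by (intro pol_support[OF e, of t R]) auto
    ultimately show ?thesis
      using g pol_nonneg[OF g'(1)] nn_integral_pol[OF e, of g ennreal t] nn_integral_pol[OF e, of g "%u. ennreal (u powr m)" t]
      by (auto simp: P_def)
  qed
  obtain g where g: "g \<in> P" and gmin: "!!h. h \<in> P ==> J g <= J h"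
  proof -
    define I where "I = (INF g\<in>P. J g)"
    have "I < \<infinity>" unfolding I_def using J_fin[OF fP] fP by (auto simp: INF_less_iff)
    then obtain r where r: "I = ennreal r" "0 <= r" by (cases I) auto
    have "\<exists>g\<in>P. J g < ennreal (r + 1 / real (Suc n))" for n
    proof -
      have "I < ennreal (r + 1 / real (Suc n))" unfolding r(1) using r(2) by (intro ennreal_lessI add_nonneg_pos) auto
      then show ?thesis by (simp add: I_def INF_less_iff)
    qed
    then obtain G where G: "!!n. G n \<in> P" "!!n. J (G n) < ennreal (r + 1 / real (Suc n))" by metis
    have Gp: "0 <= G n x" "G n x <= M" "R < norm x ==> G n x = 0" "UC (G n)" for n x using G(1)[of n] by (auto simp: P_def)
    \<comment> \<open>Equicontinuity is the shared modulus; all members of \<open>P\<close> vanish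
      off the compact set \<open>S\<close>, so convergence on \<open>S\<close> suffices.\<close>
    obtain h k where h: "continuous_on S h" and k: "strict_mono (k :: nat => nat)"
      and conv: "!!e. 0 < e ==> \<exists>N. \<forall>n x. n \<ge> N \<and> x \<in> S --> norm (G (k n) x - h x) < e"
    proof (rule Arzela_Ascoli[OF compS, of G M])
      show "norm (G n x) <= M" for n x using Gp(1,2)[of n x] by simp
      show "\<exists>d>0. \<forall>n y. y \<in> S \<and> norm (x - y) < d --> norm (G n x - G n y) < e" if "0 < e" for x e
      proof (intro exI[of _ "\<delta> (e / 2)"] conjI allI impI)
        show "0 < \<delta> (e / 2)" using \<delta>(1) that by simp
        fix n y assume "y \<in> S \<and> norm (x - y) < \<delta> (e / 2)"
        then have "\<bar>G n x - G n y\<bar> <= e / 2" using Gp(4)[of n, unfolded UC_def, rule_format, of "e / 2" x y] that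
          by (simp add: dist_norm)
        then show "norm (G n x - G n y) < e" using that by simp
      qed
    qed (rule that)
    define g where "g x = (if x \<in> S then h x else 0)" for x
    have lim: "(%n. G (k n) x) \<longlonglongrightarrow> g x" for x
    proof (cases "x \<in> S")
      case True
      then show ?thesis using conv unfolding LIMSEQ_iff g_def by (metis (full_types))
    next
      case False
      then show ?thesis using Gp(3)[of x] by (simp add: g_def S_def)
    qed
    have g1: "0 <= g x" for x by (rule LIMSEQ_le_const[OF lim]) (use Gp in auto)
    have g2: "g x <= M" for x by (rule LIMSEQ_le_const2[OF lim]) (use Gp in auto)
    have g3: "g x = 0" if "R < norm x" for x
      using lim[of x] Gp(3)[OF that] by (simp add: LIMSEQ_const_iff)
    have g4: "UC g"
      unfolding UC_def
    proof (intro allI impI)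
      fix e and x y :: 'a assume "0 < e" "dist x y < \<delta> e"
      then have "\<bar>G (k n) x - G (k n) y\<bar> <= e" for n using Gp(4)[of "k n"] by (auto simp: UC_def)
      then show "\<bar>g x - g y\<bar> <= e"
        by (intro LIMSEQ_le_const2[of "%n. \<bar>G (k n) x - G (k n) y\<bar>"] tendsto_rabs tendsto_diff lim) auto
    qed
    have gm[measurable]: "g \<in> Borel" using UC_cont[OF g4] by (rule borel_measurable_continuous_onI)
    have Gm[measurable]: "G n \<in> Borel" for n using P_meas G(1) by blast
    have int: "(%n. (NN x. ennreal (\<Phi> x (G (k n) x)))) \<longlonglongrightarrow> (NN x. ennreal (\<Phi> x (g x)))"
      if cont: "!!x. (%n. \<Phi> x (G (k n) x)) \<longlonglongrightarrow> \<Phi> x (g x)"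
        and [measurable]: "!!n. (%x. \<Phi> x (G n x)) \<in> Borel" "(%x. \<Phi> x (g x)) \<in> Borel"
        and bnd: "!!n x. ennreal (\<Phi> x (G n x)) <= ennreal c * indicator (cball 0 R) x" for \<Phi> :: "'a => real => real" and c :: real
      by (rule nn_integral_dominated_convergence[where w="%x. ennreal c * indicator (cball 0 R) x"])
        (use dominated bnd cont in \<open>auto intro: tendsto_ennrealI\<close>)
    have i1: "(NN x. ennreal (g x)) = (NN x. ennreal (f x))"
    proof -
      have "(%n. (NN x. ennreal (G (k n) x))) \<longlonglongrightarrow> (NN x. ennreal (g x))"
        by (rule int[of "%x u. u" M]) (use lim Gp in \<open>auto simp: indicator_def intro!: ennreal_leI\<close>)
      moreover have "(NN x. ennreal (G (k n) x)) = (NN x. ennreal (f x))" for n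
        using G(1)[of "k n"] by (simp add: P_def)
      ultimately show ?thesis by (simp add: LIMSEQ_const_iff)
    qed
    have i2: "(NN x. ennreal (g x powr m)) = (NN x. ennreal (f x powr m))"
    proof -
      have "(%n. (NN x. ennreal (G (k n) x powr m))) \<longlonglongrightarrow> (NN x. ennreal (g x powr m))"
        by (rule int[of "%x u. u powr m" "M powr m"])
          (use lim Gp m_gt_1 in \<open>auto simp: indicator_def intro!: ennreal_leI powr_mono2 tendsto_powr2\<close>)
      moreover have "(NN x. ennreal (G (k n) x powr m)) = (NN x. ennreal (f x powr m))" for n
        using G(1)[of "k n"] by (simp add: P_def)
      ultimately show ?thesis by (simp add: LIMSEQ_const_iff)
    qed
    have i3: "energy s q f <= energy s q g"
    proof (rule LIMSEQ_le_const)
      show "(%n. energy s q (G (k n))) \<longlonglongrightarrow> energy s q g"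
        by (rule energy_pdom_tendsto[OF b C]) (use lim Gp g2 g3 in \<open>auto intro!: P_dom\<close>)
      show "\<exists>N. \<forall>n\<ge>N. energy s q f <= energy s q (G (k n))" using G(1) by (auto simp: P_def)
    qed
    have gP: "g \<in> P" using g1 g2 g3 g4 i1 i2 i3 by (simp add: P_def)
    have "J g <= ennreal r"
    proof (rule LIMSEQ_le)
      show "(%n. J (G (k n))) \<longlonglongrightarrow> J g" unfolding J_def
        by (rule int[of "%x u. (norm x)\<^sup>2 * u" "R\<^sup>2 * M"]) (use lim J_dom[OF G(1)] in \<open>auto intro!: tendsto_intros\<close>)
      have "(%n. ennreal (r + 1 / real (Suc (k n)))) \<longlonglongrightarrow> ennreal (r + 0)"
        by (intro tendsto_ennrealI tendsto_intros LIMSEQ_subseq_LIMSEQ[OF LIMSEQ_Suc[OF lim_1_over_n] k, unfolded comp_def])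
      then show "(%n. ennreal (r + 1 / real (Suc (k n)))) \<longlonglongrightarrow> ennreal r" by simp
      show "\<exists>N. \<forall>n\<ge>N. J (G (k n)) <= ennreal (r + 1 / real (Suc (k n)))" using G(2) by (auto intro: less_imp_le)
    qed
    then have "J g <= J h" if "h \<in> P" for h
      using that unfolding r(1)[symmetric] I_def by (meson INF_lower order_trans)
    then show thesis using gP that by blast
  qed
  have g1: "0 <= g x" and g_cont: "continuous_on UNIV g" for x using g UC_cont by (auto simp: P_def)
  \<comment> \<open>Equal second moments of \<open>g\<close> and \<open>pol e t g\<close> force
    equality on almost every mirror pair. Both functions are continuous, so it holds on every pair,
    and a misordered pair strictly inside the half-space is impossible.\<close>
  have key: "g (hrefl e t x) <= g x" if e: "norm e = 1" and t: "t < 0" and x: "t <= e \<bullet> x" for e t x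
  proof -
    have PP: "pol e t g \<in> P" by (rule P_pol[OF g e t])
    have p_cont: "continuous_on UNIV (pol e t g)" using PP UC_cont by (auto simp: P_def)
    note [measurable] = P_meas[OF g] P_meas[OF PP]
    define F where "F h y = (norm y)\<^sup>2 * h y + (norm (hrefl e t y))\<^sup>2 * h (hrefl e t y)" for h y
    have nn': "0 <= pol e t g y" for y using g1 by (rule pol_nonneg)
    have JF: "2 * J h = (NN y. ennreal (F h y))" if [measurable]: "h \<in> Borel" and "!!y. 0 <= h y" for h
      unfolding J_def F_def by (subst nn_integral_fold_refl[OF e, of _ t]) (use that in \<open>auto simp: ennreal_plus\<close>)
    have sq: "(norm y)\<^sup>2 <= (norm (hrefl e t y))\<^sup>2" if "t <= e \<bullet> y" for y
    proof -
      have "t * (e \<bullet> y - t) <= 0" using that t by (intro mult_nonpos_nonneg) auto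
      then show ?thesis unfolding norm_refl_sq[OF e] mult.assoc by linarith
    qed
    have F_le: "F (pol e t g) y <= F g y" for y
    proof (cases "t <= e \<bullet> y")
      case True
      have "0 <= ((norm (hrefl e t y))\<^sup>2 - (norm y)\<^sup>2) * (max (g y) (g (hrefl e t y)) - g y)"
        using sq[OF True] by (intro mult_nonneg_nonneg) auto
      moreover have "max (g y) (g (hrefl e t y)) + min (g y) (g (hrefl e t y)) = g y + g (hrefl e t y)" by auto
      ultimately show ?thesis unfolding F_def pol_hrefl[OF e True] using True
        by (auto simp: pol_def max_def min_def algebra_simps split: if_splits)
    next
      case False
      then have T: "t <= e \<bullet> hrefl e t y" by (simp add: inner_refl[OF e])
      have "0 <= ((norm y)\<^sup>2 - (norm (hrefl e t y))\<^sup>2) * (max (g y) (g (hrefl e t y)) - g (hrefl e t y))"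
        using sq[OF T] e by (intro mult_nonneg_nonneg) auto
      then show ?thesis unfolding F_def using False T e
        by (auto simp: pol_def max_def min_def algebra_simps split: if_splits)
    qed
    have "AE y in lborel. ennreal (F (pol e t g) y) = ennreal (F g y)"
    proof (rule AE_eq_of_nn_integral_le)
      show "(NN y. ennreal (F (pol e t g) y)) ~= \<infinity>"
        using J_fin[OF PP] JF[of "pol e t g"] nn' by (simp flip: JF add: ennreal_mult_eq_top_iff)
      show "(NN y. ennreal (F g y)) <= (NN y. ennreal (F (pol e t g) y))"
        using gmin[OF PP] g1 nn' by (simp flip: JF add: mult_left_mono)
    qed (use F_le in \<open>auto simp: F_def intro!: ennreal_leI\<close>)
    then have "AE y in lborel. y \<in> {y. F (pol e t g) y = F g y}"
      by eventually_elim (use g1 nn' in \<open>simp add: F_def del: ennreal_plus\<close>)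
    then have "AE y in lebesgue. y \<in> {y. F (pol e t g) y = F g y}" by (rule AE_completion)
    moreover have "closed {y. F (pol e t g) y = F g y}"
      unfolding F_def
      by (intro closed_Collect_eq continuous_intros continuous_on_compose2[OF p_cont] continuous_on_compose2[OF g_cont]) auto
    ultimately have "F (pol e t g) x = F g x" using mem_closed_if_AE_lebesgue by blast
    then have eq: "(norm x)\<^sup>2 * max (g x) (g (hrefl e t x)) + (norm (hrefl e t x))\<^sup>2 * min (g x) (g (hrefl e t x))
       = (norm x)\<^sup>2 * g x + (norm (hrefl e t x))\<^sup>2 * g (hrefl e t x)"
      unfolding F_def pol_hrefl[OF e x] using x by (simp add: pol_def)
    show ?thesis
    proof (rule ccontr)
      assume n: "\<not> g (hrefl e t x) <= g x"
      then have "t < e \<bullet> x" using x hrefl_fixed[of e x t] by (cases "e \<bullet> x = t") auto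
      then have "t * (e \<bullet> x - t) < 0" using t by (intro mult_neg_pos) auto
      then have "(norm x)\<^sup>2 < (norm (hrefl e t x))\<^sup>2" unfolding norm_refl_sq[OF e] mult.assoc by linarith
      then have "0 < ((norm (hrefl e t x))\<^sup>2 - (norm x)\<^sup>2) * (g (hrefl e t x) - g x)" using n by simp
      then show False using eq n by (simp add: max_def min_def algebra_simps)
    qed
  qed
  have "g y <= g x" if "norm x <= norm y" for x y
    using g_cont key that by (rule radial_nonincr_of_reflections)
  then show ?thesis
    using g g_cont unfolding P_def by blast
qed

end

subsection \<open>Existence of a maximizer\<close>

lemma AE_lborel_ex:
  fixes P :: "'a::euclidean_space => bool"
  assumes "AE x in lborel. P x"
  shows "\<exists>x. P x"
proof (rule ccontr)
  assume n: "\<nexists>x. P x"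
  from assms have "AE x in lborel. (x::'a) \<in> {}" by eventually_elim (use n in blast)
  then have "AE x in lebesgue. (x::'a) \<in> {}" by (rule AE_completion)
  then have "(0::'a) \<in> {}" by (intro mem_closed_if_AE_lebesgue) simp
  then show False by simp
qed

context hls
begin

text \<open>\<open>\<tau>\<close> is the power of \<open>mpow\<close>, the m-th power of the L^m
  norm, in the denominator of the quotient: \<open>m * \<tau> = q * (1 - theta0)\<close> and
  \<open>\<alpha> = q * theta0\<close>, as \<open>theta0_exponents\<close> records.\<close>

definition \<tau> :: real where "\<tau> = q * (N - b0) / (N * (m - 1))"

definition \<alpha> :: real where "\<alpha> = q - m * \<tau>"

definition mass :: "('a => real) => ennreal" where
  "mass f = (NN x. ennreal (f x))"

definition mpow :: "('a => real) => ennreal" where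
  "mpow f = (NN x. ennreal (f x powr m))"

text \<open>Borel measurable and nonnegative at every point; the a.e. classes of the statement are
  reached through \<open>rep\<close>.\<close>

definition adm :: "('a => real) => bool" where
  "adm f \<longleftrightarrow> f \<in> Borel \<and> (\<forall>x. 0 <= f x) \<and> mass f < \<infinity> \<and> mpow f < \<infinity>"

definition nrm :: "('a => real) => real" where
  "nrm f = enn2real (mass f) powr \<alpha> * enn2real (mpow f) powr \<tau>"

lemma tau_pos: "0 < \<tau>"
  using q_gt_1 b0_less_N N_pos m_gt_1 by (simp add: \<tau>_def)

text \<open>Scaling balance. Under a mass preserving dilation by \<open>l\<close> the energy is
  multiplied by \<open>l\<close> to N times the left side, and \<open>nrm\<close> by
  \<open>l\<close> to N times the right side.\<close>

lemma q_tau: "q * (N - s) / N - 1 = \<tau> * (m - 1)"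
  using q_gt_1 N_pos m_gt_1 by (simp add: \<tau>_def b0_def field_simps)

lemma alpha_eq: "\<alpha> = s * q / N + 1 - \<tau>"
  using q_tau N_pos by (simp add: \<alpha>_def field_simps)

text \<open>Equivalent to \<open>N < m * b0\<close>, so the hypothesis on \<open>m\<close> is what
  makes the power of the mass positive.\<close>

lemma alpha_pos: "0 < \<alpha>"
proof -
  have "N < m * b0" using m_b0 m_gt_1 by (simp add: field_simps)
  then have "m * (N - b0) < N * (m - 1)" by (simp add: algebra_simps)
  then have "q * (m * (N - b0)) < q * (N * (m - 1))" using q_gt_1 by (intro mult_strict_left_mono) auto
  then have "m * \<tau> < q" using N_pos m_gt_1 by (simp add: \<tau>_def field_simps)
  then show ?thesis by (simp add: \<alpha>_def)
qed

lemma nrm_nonneg [simp]: "0 <= nrm f" by (simp add: nrm_def)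

lemma mass_0_iff: "adm f ==> mass f = 0 \<longleftrightarrow> (AE x in lborel. f x = 0)"
  unfolding mass_def adm_def by (subst nn_integral_0_iff_AE) (auto simp: antisym intro: eventually_mono)

lemma mpow_0_iff: "adm f ==> mpow f = 0 \<longleftrightarrow> (AE x in lborel. f x = 0)"
  unfolding mpow_def adm_def by (subst nn_integral_0_iff_AE) (auto simp: powr_eq_0_iff)

lemma energy_cong_AE: "AE x in lborel. f x = g x ==> energy s q (f::'a => real) = energy s q g"
  unfolding energy_def rpotr_def using rpot_cong_AE by presburger

lemma energy_zero: "energy s q (%x::'a. 0) = 0"
  by (simp add: energy_def rpotr_def rpot_def)

lemma adm_dilation:
  assumes f: "adm f" and c: "0 < c" and l: "0 < l"
  defines "g \<equiv> %x. c * f (l *\<^sub>R x)"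
  shows "adm g" and "mass g = ennreal (c * l powr - N) * mass f"
    and "mpow g = ennreal (c powr m * l powr - N) * mpow f"
    and "energy s q g = ennreal (c powr q * l powr - (s * q + N)) * energy s q f"
proof -
  have [measurable]: "f \<in> Borel" and nn: "!!x. 0 <= f x" using f by (auto simp: adm_def)
  show mg: "mass g = ennreal (c * l powr - N) * mass f"
    unfolding mass_def g_def using c l
    by (simp add: ennreal_mult' nn_integral_cmult nn_integral_lborel_scale[of "%x. ennreal (f x)"] mult.assoc N_eq)
  show pg: "mpow g = ennreal (c powr m * l powr - N) * mpow f"
    unfolding mpow_def g_def using c l nn
    by (simp add: powr_mult ennreal_mult' nn_integral_cmult nn_integral_lborel_scale[of "%x. ennreal (f x powr m)"] mult.assoc N_eq)
  show "adm g"
    unfolding adm_def mg pg using f c nn by (auto simp: adm_def g_def ennreal_mult_less_top)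
  have pot: "rpotr s g x = c * l powr - s * rpotr s f (l *\<^sub>R x)" for x
    unfolding rpotr_def g_def using c l
    by (simp add: rpot_cmult rpot_scale enn2real_mult)
  have "energy s q g = (NN x. ennreal (c powr q * l powr - (s * q)) * ennreal (rpotr s f (l *\<^sub>R x) powr q))"
    unfolding energy_def pot using c l
    by (intro nn_integral_cong) (simp add: ennreal_mult'[symmetric] powr_mult powr_powr)
  also have "... = ennreal (c powr q * l powr - (s * q)) * (ennreal (l powr - N) * energy s q f)"
    unfolding energy_def using l
    by (subst nn_integral_cmult, simp, subst nn_integral_lborel_scale[of "%x. ennreal (rpotr s f x powr q)"]) (auto simp: N_eq)
  also have "... = ennreal (c powr q * l powr - (s * q + N)) * energy s q f"
  proof -
    have e: "c powr q * l powr - (s * q + N) = c powr q * l powr - (s * q) * l powr - N"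
      by (simp add: powr_add[symmetric] mult.assoc)
    show ?thesis unfolding e by (simp add: ennreal_mult' mult.assoc)
  qed
  finally show "energy s q g = ennreal (c powr q * l powr - (s * q + N)) * energy s q f" .
qed

lemma normalization:
  assumes f: "adm f" and nz: "mass f ~= 0"
  shows "\<exists>c l. 0 < c \<and> 0 < l \<and> adm (%x. c * f (l *\<^sub>R x)) \<and> mass (%x. c * f (l *\<^sub>R x)) = 1
    \<and> mpow (%x. c * f (l *\<^sub>R x)) = 1 \<and> energy s q f = ennreal (nrm f) * energy s q (%x. c * f (l *\<^sub>R x))"
proof -
  obtain A where A: "mass f = ennreal A" "0 < A"
    using f nz by (cases "mass f") (auto simp: adm_def less_le)
  have "mpow f ~= 0" using nz f by (simp add: mass_0_iff mpow_0_iff)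
  then obtain P where P: "mpow f = ennreal P" "0 < P"
    using f by (cases "mpow f") (auto simp: adm_def less_le)
  \<comment> \<open>Solves \<open>c * A = l powr N\<close> and
    \<open>c powr m * P = l powr N\<close> for the two scaling parameters.\<close>
  define c l where "c = (A / P) powr (1 / (m - 1))" and "l = (c * A) powr (1 / N)"
  have c: "0 < c" and l: "0 < l" using A P by (auto simp: c_def l_def)
  have lN: "l powr - N = 1 / (c * A)" "l powr - (s * q + N) = (c * A) powr - (s * q / N + 1)"
  proof -
    have "1 / N * - (s * q + N) = - (s * q / N + 1)" using N_pos by (simp add: field_simps)
    then show "l powr - (s * q + N) = (c * A) powr - (s * q / N + 1)"
      unfolding l_def powr_powr by (rule arg_cong)
  qed (use c A N_pos in \<open>auto simp: l_def powr_powr powr_minus_divide\<close>)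
  have cm: "c powr (m - 1) = A / P" using A P m_gt_1 by (simp add: c_def powr_powr)
  note D = adm_dilation[OF f c l]
  have 1: "mass (%x. c * f (l *\<^sub>R x)) = 1"
    unfolding D(2) lN A using c A by (simp add: ennreal_mult'[symmetric] divide_simps)
  have "c powr m = c * (A / P)" using cm c by (simp add: powr_diff field_simps)
  then have 2: "mpow (%x. c * f (l *\<^sub>R x)) = 1"
    unfolding D(3) lN P using c A P by (simp add: ennreal_mult'[symmetric] divide_simps)
  have "c powr (q - s * q / N - 1) = c powr q * c powr - (s * q / N + 1)"
    unfolding powr_add[symmetric] by (rule arg_cong) simp
  then have "c powr q * l powr - (s * q + N) = c powr (q - s * q / N - 1) * A powr - (s * q / N + 1)"
    unfolding lN(2) using c A by (simp add: powr_mult)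
  also have "q - s * q / N - 1 = (m - 1) * \<tau>" using q_tau N_pos by (simp add: field_simps)
  also have "c powr ((m - 1) * \<tau>) = (A / P) powr \<tau>" by (simp add: powr_powr[symmetric] cm)
  also have "(A / P) powr \<tau> * A powr - (s * q / N + 1) = 1 / (A powr \<alpha> * P powr \<tau>)"
    using A P by (simp add: alpha_eq powr_divide powr_diff powr_minus powr_add divide_simps)
  finally have e: "c powr q * l powr - (s * q + N) = 1 / nrm f"
    using A P by (simp add: nrm_def)
  have "0 < nrm f" using A P by (simp add: nrm_def)
  then have "ennreal (nrm f) * energy s q (%x. c * f (l *\<^sub>R x)) = energy s q f"
    unfolding D(4) e by (simp add: mult.assoc[symmetric] ennreal_mult'[symmetric])
  then show ?thesis using c l D(1) 1 2 by metis
qed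

text \<open>Monotonicity in the norm includes radial symmetry, since equal norms give both
  inequalities.\<close>

definition profiles :: "('a => real) set" where
  "profiles = {g. adm g \<and> mass g = 1 \<and> mpow g = 1 \<and> continuous_on UNIV g \<and> (\<forall>x y. norm x <= norm y --> g y <= g x)}"

text \<open>On the ball of radius \<open>norm x\<close>, off its centre, values are at least
  \<open>g x\<close>, so \<open>g x powr e\<close> times its volume is at most the integral.
  Monotonicity is assumed away from the origin because the representative in
  \<open>maximizer_regular\<close> is not yet controlled there.\<close>

lemma radial_decay:
  fixes g :: "'a => real"
  assumes nn: "!!x. 0 <= g x" and mono: "!!x y. x ~= 0 ==> norm x <= norm y ==> g y <= g x"
    and e: "0 < e" and int: "(NN x. ennreal (g x powr e)) <= ennreal A" and A: "0 <= A" and x: "x ~= 0"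
  shows "g x <= (A / measure lborel (ball (0::'a) 1)) powr (1 / e) * norm x powr - (N / e)"
proof -
  define \<omega> where "\<omega> = measure lborel (ball (0::'a) 1)"
  have \<omega>: "0 < \<omega>" by (simp add: \<omega>_def content_ball_pos)
  have vol: "emeasure lborel (ball (0::'a) (norm x)) = ennreal (\<omega> * norm x powr N)"
    using x by (simp add: emeasure_lborel_ball_finite \<omega>_def content_ball emeasure_ball powr_realpow N_eq)
  have "ennreal (g x powr e) * emeasure lborel (ball (0::'a) (norm x)) = (NN y. ennreal (g x powr e) * indicator (ball (0::'a) (norm x)) y)"
    by (simp add: nn_integral_cmult_indicator)
  also have "... <= (NN x. ennreal (g x powr e))"
    by (rule nn_integral_mono_AE, use AE_lborel_singleton[of "0::'a"] in eventually_elim)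
      (use mono nn e in \<open>auto simp: indicator_def intro!: ennreal_leI powr_mono2\<close>)
  also note int
  finally have "g x powr e * (\<omega> * norm x powr N) <= A"
    unfolding vol using A \<omega> by (simp add: ennreal_mult[symmetric])
  then have "g x powr e <= (A / \<omega>) * norm x powr - N"
    using \<omega> x by (simp add: powr_minus field_simps)
  then have "(g x powr e) powr (1 / e) <= ((A / \<omega>) * norm x powr - N) powr (1 / e)"
    using e by (intro powr_mono2) auto
  then show ?thesis
    using nn[of x] e A \<omega> by (simp add: powr_powr powr_mult \<omega>_def powr_divide)
qed

lemma profiles_decay:
  "\<exists>D\<ge>0. \<forall>g\<in>profiles. \<forall>x. x ~= 0 --> (\<forall>b. N / m <= b --> b <= N --> g x <= D * norm x powr - b)"
proof -
  define \<omega> where "\<omega> = measure lborel (ball (0::'a) 1)"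
  define D where "D = (1 / \<omega>) powr (1 / 1) + (1 / \<omega>) powr (1 / m)"
  show ?thesis
  proof (intro exI[of _ D] conjI ballI allI impI)
    show "0 <= D" by (simp add: D_def)
    fix g x b assume g: "g \<in> profiles" and x: "x ~= (0::'a)" and b: "N / m <= b" "b <= N"
    have nn: "!!x. 0 <= g x" and mono: "!!x y. norm x <= norm y ==> g y <= g x"
      using g by (auto simp: profiles_def adm_def)
    have "g x <= (1 / \<omega>) powr (1 / 1) * norm x powr - (N / 1)"
      unfolding \<omega>_def using g nn by (intro radial_decay mono x) (auto simp: profiles_def mass_def)
    also have "... <= D * norm x powr - (N / 1)" by (intro mult_right_mono) (auto simp: D_def)
    finally have 1: "g x <= D * norm x powr - N" by simp
    have "g x <= (1 / \<omega>) powr (1 / m) * norm x powr - (N / m)"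
      unfolding \<omega>_def using g nn m_gt_1 by (intro radial_decay mono x) (auto simp: profiles_def mpow_def)
    also have "... <= D * norm x powr - (N / m)" by (intro mult_right_mono) (auto simp: D_def)
    finally have 2: "g x <= D * norm x powr - (N / m)" .
    have "norm x powr - N <= norm x powr - b \<or> norm x powr - (N / m) <= norm x powr - b"
    proof (cases "1 <= norm x")
      case True
      then show ?thesis using b by (intro disjI1 powr_mono) auto
    next
      case False
      then show ?thesis using b x by (intro disjI2 powr_mono') auto
    qed
    moreover have "0 <= D" by (simp add: D_def)
    ultimately show "g x <= D * norm x powr - b"
      using 1 2 by (metis mult_left_mono order_trans)
  qed
qed

lemma exponents_between: "\<exists>b1 b2. s < b1 \<and> N / m < b1 \<and> b1 < b0 \<and> b0 < b2 \<and> b2 < N"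
  using dense[of "max s (N / m)" b0] dense[OF b0_less_N] s_less_b0 m_b0 by auto

lemma profiles_energy_bounded: "(SUP g\<in>profiles. energy s q g) < \<infinity>"
proof -
  obtain b1 b2 where b: "s < b1" "N / m < b1" "b1 < b0" "b0 < b2" "b2 < N" using exponents_between by blast
  obtain D where D: "0 <= D" "!!g x b. [|g \<in> profiles; x ~= 0; N / m <= b; b <= N|] ==> g x <= D * norm x powr - b"
    using profiles_decay by metis
  obtain E where E: "E < \<infinity>" "!!f::'a => real. pdom D b1 b2 f ==> energy s q f <= E"
    using energy_pdom_bound[OF b(1,3,4,5) D(1)] by blast
  have "energy s q g <= E" if "g \<in> profiles" for g
    using D(2)[OF that] b by (intro E(2)) (auto simp: pdom_def)
  then have "(SUP g\<in>profiles. energy s q g) <= E" by (intro SUP_least)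
  with E(1) show ?thesis by (rule le_less_trans[rotated])
qed

text \<open>Supremum over the symmetric normalized class, finite by the decay of its members;
  \<open>Hstar_eq\<close> identifies it with the supremum over all functions.\<close>

definition Hr :: real where "Hr = enn2real (SUP g\<in>profiles. energy s q g)"

lemma Hr_nonneg [simp]: "0 <= Hr" by (simp add: Hr_def)

lemma Hr_eq: "ennreal Hr = (SUP g\<in>profiles. energy s q g)"
  using profiles_energy_bounded by (simp add: Hr_def less_top)

lemma energy_bound_continuous:
  assumes cont: "continuous_on UNIV f" and nn: "!!x. 0 <= f x" and R: "0 < R" and supp: "!!x. R < norm x ==> f x = 0"
    and f: "adm f"
  shows "energy s q f <= ennreal (nrm f * Hr)"
proof (cases "mass f = 0")
  case True
  then have "energy s q f = 0"
    using energy_cong_AE[of f "%x. 0"] f by (simp add: mass_0_iff energy_zero)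
  then show ?thesis by simp
next
  case False
  obtain g :: "'a => real" where g: "continuous_on UNIV g" "!!x. 0 <= g x" "!!x y. norm x <= norm y ==> g y <= g x"
     "mass g = mass f" "mpow g = mpow f" "energy s q f <= energy s q g"
    using symmetrization[OF cont nn R supp] unfolding mass_def mpow_def by metis
  have ag: "adm g" using g f by (auto simp: adm_def borel_measurable_continuous_onI)
  then obtain c l where cl: "0 < c" "0 < l" "adm (%x. c * g (l *\<^sub>R x))" "mass (%x. c * g (l *\<^sub>R x)) = 1"
    "mpow (%x. c * g (l *\<^sub>R x)) = 1" "energy s q g = ennreal (nrm g) * energy s q (%x. c * g (l *\<^sub>R x))"
    using normalization[of g] False g by auto
  have "(%x. c * g (l *\<^sub>R x)) \<in> profiles"
    unfolding profiles_def using cl g(3) by (auto intro!: continuous_intros continuous_on_compose2[OF g(1)])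
  then have "energy s q (%x. c * g (l *\<^sub>R x)) <= ennreal Hr" unfolding Hr_eq by (rule SUP_upper)
  then have "energy s q g <= ennreal (nrm g) * ennreal Hr" unfolding cl(6) by (rule mult_left_mono) simp
  moreover have "nrm g = nrm f" using g by (simp add: nrm_def)
  ultimately show ?thesis using g(6) by (simp add: ennreal_mult)
qed

text \<open>\<open>measurable_on\<close> supplies continuous functions that converge off a
  negligible set; clamping to values between 0 and \<open>M\<close> and the factor \<open>ct\<close>
  restore the bounds and a bounded support without disturbing the limit.\<close>

lemma bounded_approximation:
  fixes f :: "'a => real"
  assumes [measurable]: "f \<in> Borel" and f: "!!x. 0 <= f x" "!!x. f x <= M" and supp: "!!x. R < norm x ==> f x = 0" and R: "0 < R"
  shows "\<exists>g. (\<forall>n. continuous_on UNIV (g n)) \<and> (\<forall>n x. 0 <= g n x \<and> g n x <= M) \<and> (\<forall>n x. R + 1 < norm x --> g n x = 0)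
    \<and> (AE x in lborel. (%n::nat. g n x) \<longlonglongrightarrow> f x)"
proof -
  have M: "0 <= M" using f order_trans by blast
  have "f \<in> borel_measurable lebesgue" by (rule measurable_completion) simp
  then have "f measurable_on UNIV" by (rule lebesgue_measurable_imp_measurable_on_real) (use sets.top[of lebesgue] in simp)
  then obtain Z h where Z: "negligible Z" and h: "!!n. continuous_on UNIV (h n)" and lim: "!!x. x \<notin> Z ==> (%n::nat. h n x) \<longlonglongrightarrow> f x"
    unfolding measurable_on_def by (auto simp only: UNIV_I if_True)
  have "AE x in lebesgue. x \<notin> Z" using Z unfolding negligible_iff_null_sets by (rule AE_not_in)
  then have ae: "AE x in lborel. x \<notin> Z" unfolding AE_completion_iff .
  define ct where "ct x = max 0 (min 1 (R + 1 - norm x))" for x :: 'a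
  define g where "g n x = max 0 (min M (h n x)) * ct x" for n x
  show ?thesis
  proof (intro exI[of _ g] conjI allI impI)
    show "continuous_on UNIV (g n)" for n
      unfolding g_def ct_def by (intro continuous_intros h)
    show "0 <= g n x" for n x by (simp add: g_def ct_def)
    have "max 0 (min M (h n x)) * ct x <= M * 1" for n x using M by (intro mult_mono) (auto simp: ct_def)
    then show "g n x <= M" for n x by (simp add: g_def)
    show "g n x = 0" if "R + 1 < norm x" for n x using that by (simp add: g_def ct_def)
    show "AE x in lborel. (%n. g n x) \<longlonglongrightarrow> f x"
      using ae
    proof eventually_elim
      case (elim x)
      have "(%n. g n x) \<longlonglongrightarrow> max 0 (min M (f x)) * ct x"
        unfolding g_def by (intro tendsto_intros lim elim)
      also have "max 0 (min M (f x)) * ct x = f x"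
        using f supp[of x] by (cases "R < norm x") (auto simp: ct_def)
      finally show ?case .
    qed
  qed
qed

lemma energy_bound_bounded:
  fixes f :: "'a => real"
  assumes [measurable]: "f \<in> Borel" and f: "!!x. 0 <= f x" "!!x. f x <= M" and supp: "!!x. R < norm x ==> f x = 0" and R: "0 < R"
  shows "energy s q f <= ennreal (nrm f * Hr)" and "adm f"
proof -
  have M: "0 <= M" using f order_trans by blast
  obtain g where g: "!!n. continuous_on UNIV (g n)" "!!n x. 0 <= g n x" "!!n x. g n x <= M"
     "!!n x. R + 1 < norm x ==> g n x = 0" and lim: "AE x in lborel. (%n::nat. g n x) \<longlonglongrightarrow> f x"
    using bounded_approximation[OF assms] by metis
  have [measurable]: "g n \<in> Borel" for n using g(1) by (rule borel_measurable_continuous_onI)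
  have dominated: "(NN x. ennreal c * indicator (cball (0::'a) (R + 1)) x) < \<infinity>" for c
    using emeasure_lborel_cball_finite[of "0::'a" "R + 1"] by (subst nn_integral_cmult_indicator) (auto simp: ennreal_mult_less_top)
  have b1: "ennreal (h x) <= ennreal M * indicator (cball 0 (R + 1)) x"
    and b2: "ennreal (h x powr m) <= ennreal (M powr m) * indicator (cball 0 (R + 1)) x"
    if "!!x. 0 <= h x" "!!x. h x <= M" "!!x. R + 1 < norm x ==> h x = 0" for h and x :: 'a
  proof -
    have "h x powr m <= M powr m" using that m_gt_1 by (intro powr_mono2) auto
    then show "ennreal (h x) <= ennreal M * indicator (cball 0 (R + 1)) x"
      "ennreal (h x powr m) <= ennreal (M powr m) * indicator (cball 0 (R + 1)) x"
      using that(2)[of x] that(3)[of x] by (cases "norm x <= R + 1"; simp add: ennreal_leI)+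
  qed
  have adm: "adm h" if h: "h \<in> Borel" "!!x. 0 <= h x" "!!x. h x <= M" "!!x. R + 1 < norm x ==> h x = 0" for h
  proof -
    have "mass h < \<infinity>" unfolding mass_def
      by (rule le_less_trans[OF nn_integral_mono dominated], rule b1) (use h in auto)
    moreover have "mpow h < \<infinity>" unfolding mpow_def
      by (rule le_less_trans[OF nn_integral_mono dominated], rule b2) (use h in auto)
    ultimately show ?thesis using h by (simp add: adm_def)
  qed
  show af: "adm f" by (rule adm) (use f supp in auto)
  have ag: "adm (g n)" for n by (rule adm) (use g in auto)
  obtain b1' b2' where b: "s < b1'" "b1' < b0" "b0 < b2'" "b2' < N" using exponents_between by blast
  have "(%n. energy s q (g n)) \<longlonglongrightarrow> energy s q f"
    by (rule energy_pdom_tendsto[OF b, where C="M * ((R + 1) powr b1' + (R + 1) powr b2')"])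
      (use M R b s_pos f supp g lim in \<open>auto intro!: pdom_bounded_support\<close>)
  moreover have "(%n. ennreal (nrm (g n) * Hr)) \<longlonglongrightarrow> ennreal (nrm f * Hr)"
  proof -
    have "(%n. mass (g n)) \<longlonglongrightarrow> mass f" unfolding mass_def
      by (rule nn_integral_dominated_convergence[where w="%x. ennreal M * indicator (cball 0 (R + 1)) x"])
        (use dominated b1[of "g _"] g lim in \<open>auto intro: tendsto_ennrealI elim!: eventually_mono\<close>)
    then have m1: "(%n. enn2real (mass (g n))) \<longlonglongrightarrow> enn2real (mass f)"
      using af by (intro tendsto_enn2real) (auto simp: adm_def less_top)
    have "(%n. mpow (g n)) \<longlonglongrightarrow> mpow f" unfolding mpow_def
      by (rule nn_integral_dominated_convergence[where w="%x. ennreal (M powr m) * indicator (cball 0 (R + 1)) x"])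
        (use dominated b2[of "g _"] g lim m_gt_1 in \<open>auto intro!: tendsto_ennrealI tendsto_powr2 elim!: eventually_mono\<close>)
    then have m2: "(%n. enn2real (mpow (g n))) \<longlonglongrightarrow> enn2real (mpow f)"
      using af by (intro tendsto_enn2real) (auto simp: adm_def less_top)
    show ?thesis unfolding nrm_def
      by (intro tendsto_ennrealI tendsto_mult tendsto_const tendsto_powr2 m1 m2) (auto simp: alpha_pos tau_pos)
  qed
  moreover have "energy s q (g n) <= ennreal (nrm (g n) * Hr)" for n
    using R by (intro energy_bound_continuous[where R="R + 1"] g ag) auto
  ultimately show "energy s q f <= ennreal (nrm f * Hr)"
    using LIMSEQ_le by blast
qed

lemma mass_mono: "(!!x. f x <= g x) ==> mass f <= mass g"
  unfolding mass_def by (intro nn_integral_mono ennreal_leI)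

lemma mpow_mono: "(!!x. 0 <= f x) ==> (!!x. f x <= g x) ==> mpow f <= mpow g"
  unfolding mpow_def using m_gt_1 by (intro nn_integral_mono ennreal_leI powr_mono2) auto

lemma nrm_mono:
  assumes "!!x. 0 <= f x" "!!x. f x <= g x" "adm g"
  shows "nrm f <= nrm g"
  unfolding nrm_def using mass_mono[of f g] mpow_mono[of f g] assms alpha_pos tau_pos
  by (intro mult_mono powr_mono2 enn2real_mono) (auto simp: adm_def less_top)

lemma adm_rpot_finite: "adm f ==> AE x in lborel. rpot s f x < \<infinity>"
  by (intro rpot_finite_AE) (auto simp: adm_def mass_def)

text \<open>Truncations in height and space increase to \<open>f\<close>: their potentials converge
  monotonically, the energy passes by Fatou, and their \<open>nrm\<close> stays below
  \<open>nrm f\<close>.\<close>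

theorem energy_le:
  assumes f: "adm f"
  shows "energy s q f <= ennreal (nrm f * Hr)"
proof -
  have [measurable]: "f \<in> Borel" and nn: "!!x. 0 <= f x" using f by (auto simp: adm_def)
  define g where "g n x = min (f x) (real n) * indicator (cball (0::'a) (real n)) x" for n :: nat and x
  have g: "0 <= g n x" "g n x <= f x" for n x using nn by (auto simp: g_def indicator_def)
  have [measurable]: "g n \<in> Borel" for n unfolding g_def[abs_def] by measurable
  have mono: "g n x <= g n' x" if "n <= n'" for n n' x
    using that nn[of x] by (auto simp: g_def indicator_def)
  have lim: "(%n. g n x) \<longlonglongrightarrow> f x" for x
  proof (rule tendsto_eventually)
    obtain n0 :: nat where "max (f x) (norm x) < n0" using reals_Archimedean2 by blast
    then show "\<forall>\<^sub>F n in sequentially. g n x = f x"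
      by (intro eventually_sequentiallyI[of n0]) (auto simp: g_def indicator_def)
  qed
  have le: "energy s q (g n) <= ennreal (nrm f * Hr)" for n
  proof -
    have "energy s q (g n) <= ennreal (nrm (g n) * Hr)"
      by (rule energy_bound_bounded[where M=n and R="real n + 1"]) (auto simp: g_def indicator_def nn)
    also have "... <= ennreal (nrm f * Hr)"
      using g f by (intro ennreal_leI mult_right_mono nrm_mono) auto
    finally show ?thesis .
  qed
  have pot_mono: "rpot s (g n) x <= rpot s (g n') x" if "n <= n'" for n n' x
    using mono[OF that] by (intro rpot_mono_AE) auto
  have pot_lim: "(%n. rpot s (g n) x) \<longlonglongrightarrow> rpot s f x" for x
    unfolding rpot_def
  proof (rule nn_integral_LIMSEQ)
    show "incseq (%n y. ennreal (K (x - y) * g n y))"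
      using mono by (auto simp: incseq_def le_fun_def intro!: ennreal_leI mult_left_mono)
    show "(%n. ennreal (K (x - y) * g n y)) \<longlonglongrightarrow> ennreal (K (x - y) * f y)" for y
      by (intro tendsto_ennrealI tendsto_mult tendsto_const lim)
  qed measurable
  have "(NN x. ennreal (rpotr s f x powr q)) = (NN x. liminf (%n. ennreal (rpotr s (g n) x powr q)))"
  proof (rule nn_integral_cong_AE)
    show "AE x in lborel. ennreal (rpotr s f x powr q) = liminf (%n. ennreal (rpotr s (g n) x powr q))"
      using adm_rpot_finite[OF f]
    proof eventually_elim
      case (elim x)
      have "(%n. rpotr s (g n) x) \<longlonglongrightarrow> rpotr s f x"
        unfolding rpotr_def using pot_lim elim by (intro tendsto_enn2real) (auto simp: less_top)
      then have "(%n. ennreal (rpotr s (g n) x powr q)) \<longlonglongrightarrow> ennreal (rpotr s f x powr q)"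
        using q_gt_1 by (intro tendsto_ennrealI tendsto_powr2) auto
      then show ?case by (rule lim_imp_Liminf[OF sequentially_bot, symmetric])
    qed
  qed
  also have "... <= liminf (%n. energy s q (g n))"
    unfolding energy_def by (intro nn_integral_liminf) measurable
  also have "... <= ennreal (nrm f * Hr)"
    using le by (intro Liminf_le) auto
  finally show ?thesis by (simp add: energy_def)
qed

lemma energy_finite: "adm f ==> energy s q f < \<infinity>"
  using energy_le le_less_trans by fastforce

text \<open>The kernel is positive, so a potential that vanishes at a single point forces
  \<open>f = 0\<close> almost everywhere.\<close>

lemma energy_pos:
  assumes f: "adm f" and nz: "mass f ~= 0"
  shows "0 < energy s q f"
proof (rule ccontr)
  have [measurable]: "f \<in> Borel" and nn: "!!x. 0 <= f x" using f by (auto simp: adm_def)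
  assume "\<not> 0 < energy s q f"
  then have "AE x in lborel. ennreal (rpotr s f x powr q) = 0"
    unfolding energy_def by (subst nn_integral_0_iff_AE[symmetric]) auto
  with adm_rpot_finite[OF f] have "AE x in lborel. rpot s f x = 0"
  proof eventually_elim
    case (elim x)
    then have "rpotr s f x powr q <= 0" by (simp add: ennreal_eq_0_iff)
    then have "rpotr s f x powr q = 0" by (rule antisym) simp
    then show ?case using rpotr_eq[of s f x] elim by simp
  qed
  then have "\<exists>x. rpot s f x = 0" by (rule AE_lborel_ex)
  then obtain x where "rpot s f x = 0" by blast
  then have "AE y in lborel. ennreal (K (x - y) * f y) = 0"
    unfolding rpot_def by (subst nn_integral_0_iff_AE[symmetric]) auto
  with AE_lborel_singleton[of x] have "AE y in lborel. f y = 0"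
  proof eventually_elim
    case (elim y)
    then have "K (x - y) * f y <= 0" "0 < K (x - y)" using K_pos[of "x - y"] by (auto simp: ennreal_eq_0_iff)
    then show ?case using nn[of y] by (simp add: mult_le_0_iff)
  qed
  then show False using nz mass_0_iff[OF f] by simp
qed

end

context hls
begin

lemma Hr_pos: "0 < Hr"
proof -
  have f: "adm (indicator (ball (0::'a) 1))"
    by (rule energy_bound_bounded[where M=1 and R=1]) (auto simp: indicator_def)
  have "mass (indicator (ball (0::'a) 1)) = emeasure lborel (ball (0::'a) 1)"
    by (simp add: mass_def ennreal_indicator)
  also have "... ~= 0"
    by (simp add: emeasure_ball unit_ball_vol_pos less_imp_neq[symmetric])
  finally have "0 < energy s q (indicator (ball (0::'a) 1))" using f by (intro energy_pos) auto
  then have "0 < ennreal (nrm (indicator (ball (0::'a) 1)) * Hr)" using energy_le[OF f] by (rule less_le_trans)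
  then have "Hr ~= 0" by auto
  then show ?thesis using Hr_nonneg by (simp add: less_le)
qed

text \<open>Helly selection works with uniformly bounded, increasing, right continuous functions on
  the line. The logarithm of the radius maps the half-line onto the line, and the map from
  \<open>u\<close> to \<open>- u / (1 + u)\<close> turns unbounded nonincreasing values into bounded
  nondecreasing ones.\<close>

lemma profiles_limit:
  assumes g: "!!n. g n \<in> profiles" and b: "s < b1" "N / m < b1" "b1 < b0" "b0 < b2" "b2 < N"
  shows "\<exists>k h D. strict_mono (k :: nat => nat) \<and> h \<in> Borel \<and> (\<forall>x. 0 <= h x) \<and> 0 <= D
    \<and> pdom D b1 b2 h \<and> (\<forall>n. pdom D b1 b2 (g n)) \<and> (AE x in lborel. (%n. g (k n) x) \<longlonglongrightarrow> h x)"
proof -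
  have cont: "continuous_on UNIV (g n)" and nn: "0 <= g n x" and mono: "norm x <= norm y ==> g n y <= g n x" for n x y
    using g[of n] by (auto simp: profiles_def adm_def)
  obtain D where D: "0 <= D" "!!n x b. [|x ~= 0; N / m <= b; b <= N|] ==> g n x <= D * norm x powr - b"
    using profiles_decay g by metis
  obtain e :: 'a where e: "norm e = 1" using vector_choose_size[of 1] by auto
  define \<psi> where "\<psi> n t = - g n (exp t *\<^sub>R e) / (1 + g n (exp t *\<^sub>R e))" for n t
  have frac: "a / (1 + a) <= c / (1 + c)" if "0 <= a" "a <= c" for a c :: real
    using that by (simp add: divide_simps algebra_simps)
  have \<psi>_cont: "continuous_on UNIV (\<psi> n)" for n
    unfolding \<psi>_def
    by (intro continuous_intros continuous_on_compose2[OF cont] ) (use nn in \<open>auto simp: add_nonneg_eq_0_iff\<close>)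
  have \<psi>_mono: "mono (\<psi> n)" for n
  proof (rule monoI)
    fix t u :: real assume "t <= u"
    then have "g n (exp u *\<^sub>R e) <= g n (exp t *\<^sub>R e)" using e by (intro mono) simp
    from frac[OF nn this] show "\<psi> n t <= \<psi> n u" by (simp add: \<psi>_def)
  qed
  have \<psi>_bdd: "\<bar>\<psi> n t\<bar> <= 1" for n t
    using nn[of n "exp t *\<^sub>R e"] by (simp add: \<psi>_def abs_if divide_simps)
  obtain k F where k: "strict_mono (k :: nat => nat)" and F: "mono F"
    "!!t. continuous (at t) F ==> (%n. \<psi> (k n) t) \<longlonglongrightarrow> F t"
    using Helly_selection[of \<psi> 1] \<psi>_cont \<psi>_mono \<psi>_bdd
    by (metis continuous_at_imp_continuous_at_within continuous_on_eq_continuous_at open_UNIV UNIV_I)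
  \<comment> \<open>Inverse of the substitution: \<open>v = - u / (1 + u)\<close> gives
    \<open>u = - v / (1 + v)\<close>.\<close>
  define h0 where "h0 x = - F (ln (norm x)) / (1 + F (ln (norm x)))" for x :: 'a
  \<comment> \<open>Clamping makes \<open>h\<close> nonnegative everywhere and dominated off the
    origin, also at points where the selected sequence need not converge.\<close>
  define h where "h x = max 0 (min (h0 x) (min (D * norm x powr - b1) (D * norm x powr - b2)))" for x :: 'a
  have [measurable]: "F \<in> Borel" using F(1) by (rule borel_measurable_mono)
  have hm: "h \<in> Borel" unfolding h_def[abs_def] h0_def[abs_def] by measurable
  have lim: "(%n. g (k n) x) \<longlonglongrightarrow> h x" if x: "x ~= 0" and c: "continuous (at (ln (norm x))) F" for x
  proof -
    define t where "t = ln (norm x)"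
    have g\<psi>: "\<psi> n t = - g n x / (1 + g n x)" for n
    proof -
      have "norm (exp t *\<^sub>R e) = norm x" using e x by (simp add: t_def)
      then have "g n (exp t *\<^sub>R e) = g n x" by (intro antisym mono) auto
      then show ?thesis by (simp add: \<psi>_def)
    qed
    have lim\<psi>: "(%n. \<psi> (k n) t) \<longlonglongrightarrow> F t" using F(2) c by (simp add: t_def)
    \<comment> \<open>The uniform bound keeps \<open>F t\<close> above -1, so the inverse
      substitution is continuous at the limit.\<close>
    define L where "L = D * norm x powr - N"
    have L: "0 <= L" "g n x <= L" for n using D(1) D(2)[OF x, of N n] m_gt_1 N_pos by (auto simp: L_def field_simps)
    have "- (L / (1 + L)) <= F t"
      by (rule LIMSEQ_le_const[OF lim\<psi>]) (use frac[OF nn L(2)] in \<open>auto simp: g\<psi>\<close>)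
    moreover have "L / (1 + L) < 1" using L by simp
    ultimately have ne: "1 + F t ~= 0" by linarith
    have "(%n. - \<psi> (k n) t / (1 + \<psi> (k n) t)) \<longlonglongrightarrow> - F t / (1 + F t)"
      by (intro tendsto_intros lim\<psi> ne)
    also have "(%n. - \<psi> (k n) t / (1 + \<psi> (k n) t)) = (%n. g (k n) x)"
    proof
      fix n show "- \<psi> (k n) t / (1 + \<psi> (k n) t) = g (k n) x"
        unfolding g\<psi> using nn[of "k n" x] by (simp add: field_simps add_nonneg_eq_0_iff)
    qed
    finally have l: "(%n. g (k n) x) \<longlonglongrightarrow> h0 x" by (simp add: h0_def t_def)
    have "0 <= h0 x" by (rule LIMSEQ_le_const[OF l]) (use nn in auto)
    moreover have "h0 x <= D * norm x powr - b" if "b = b1 \<or> b = b2" for b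
      by (rule LIMSEQ_le_const2[OF l]) (use D(2)[OF x] b that s_less_b0 b0_less_N in auto)
    ultimately have "h x = h0 x" by (simp add: h_def)
    with l show ?thesis by simp
  qed
  have "AE x in lborel. x ~= (0::'a) \<and> continuous (at (ln (norm x))) F"
  proof -
    \<comment> \<open>The monotone \<open>F\<close> has countably many discontinuities, which
      correspond to countably many null spheres.\<close>
    define Z where "Z = (\<Union>t\<in>{t. \<not> isCont F t}. sphere (0::'a) (exp t))"
    have "sphere (0::'a) r \<in> null_sets lborel" for r
      using negligible_sphere[of "0::'a" r] by (auto simp: null_sets_completion_iff negligible_iff_null_sets)
    then have "Z \<in> null_sets lborel"
      unfolding Z_def using mono_ctble_discont[OF F(1)] by (intro null_sets_UN') auto
    then have "AE x in lborel. x \<notin> Z" by (rule AE_not_in)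
    with AE_lborel_singleton[of 0] show ?thesis
    proof eventually_elim
      case (elim x)
      then have "exp (ln (norm x)) = norm x" by simp
      then show ?case using elim by (auto simp: Z_def)
    qed
  qed
  then have "AE x in lborel. (%n. g (k n) x) \<longlonglongrightarrow> h x"
    by eventually_elim (use lim in blast)
  moreover have "pdom D b1 b2 (g n)" for n
    using D(2) b b0_less_N by (auto simp: pdom_def)
  moreover have "pdom D b1 b2 h" using D(1) by (auto simp: pdom_def h_def)
  ultimately show ?thesis using k hm D(1) by (intro exI[of _ k] exI[of _ h] exI[of _ D]) (auto simp: h_def)
qed

text \<open>Mass and \<open>mpow\<close> may drop in the limit, but the energies converge to
  \<open>Hr > 0\<close>, so the limit is not zero. Both quantities are at most 1, hence
  \<open>nrm h <= 1\<close>, and normalizing cannot lower the energy.\<close>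

theorem maximizer_exists: "\<exists>f. adm f \<and> mass f = 1 \<and> mpow f = 1 \<and> energy s q f = ennreal Hr"
proof -
  have "profiles ~= {}"
  proof
    assume "profiles = {}"
    then have "ennreal Hr = 0" unfolding Hr_eq by (simp add: bot_ennreal)
    then show False using Hr_pos by simp
  qed
  then obtain g where g: "!!n::nat. g n \<in> profiles" and gl: "(%n. energy s q (g n)) \<longlonglongrightarrow> ennreal Hr"
  proof -
    obtain f where f: "incseq f" "range f \<subseteq> energy s q ` profiles" "(SUP g\<in>profiles. energy s q g) = (SUP i::nat. f i)"
      using ennreal_Sup_countable_SUP[of "energy s q ` profiles"] \<open>profiles ~= {}\<close> by auto
    have "\<forall>n. \<exists>g\<in>profiles. f n = energy s q g" using f(2) by auto
    then obtain g where g: "!!n. g n \<in> profiles" "!!n. f n = energy s q (g n)" by metis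
    have "(%n. energy s q (g n)) \<longlonglongrightarrow> ennreal Hr"
      unfolding Hr_eq f(3) g(2)[symmetric] by (rule LIMSEQ_SUP[OF f(1)])
    then show thesis using that g(1) by blast
  qed
  obtain b1 b2 where b: "s < b1" "N / m < b1" "b1 < b0" "b0 < b2" "b2 < N" using exponents_between by blast
  obtain k h D where kh: "strict_mono (k :: nat => nat) \<and> h \<in> Borel \<and> (\<forall>x. 0 <= h x) \<and> 0 <= D
    \<and> pdom D b1 b2 h \<and> (\<forall>n. pdom D b1 b2 (g n)) \<and> (AE x in lborel. (%n. g (k n) x) \<longlonglongrightarrow> h x)"
    using profiles_limit[of g, OF g b] by (elim exE) (rule that)
  then have k: "strict_mono k" and hm[measurable]: "h \<in> Borel" and hn: "!!x. 0 <= h x" and D: "0 <= D"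
    and dom: "pdom D b1 b2 h" "!!n. pdom D b1 b2 (g n)" and lim: "AE x in lborel. (%n. g (k n) x) \<longlonglongrightarrow> h x"
    by blast+
  have gn: "adm (g n)" "mass (g n) = 1" "mpow (g n) = 1" "!!x. 0 <= g n x" for n using g[of n] by (auto simp: profiles_def adm_def)
  have [measurable]: "g n \<in> Borel" for n using gn(1) by (simp add: adm_def)
  have "(%n. energy s q (g (k n))) \<longlonglongrightarrow> energy s q h"
    by (rule energy_pdom_tendsto[OF b(1,3,4,5) D]) (use dom gn lim in auto)
  moreover have "(%n. energy s q (g (k n))) \<longlonglongrightarrow> ennreal Hr"
    using LIMSEQ_subseq_LIMSEQ[OF gl k] by (simp add: comp_def)
  ultimately have E: "energy s q h = ennreal Hr" by (rule LIMSEQ_unique)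
  have fatou: "(NN x. ennreal (\<Phi> (h x))) <= 1"
    if [measurable]: "\<Phi> \<in> Borel" and l: "!!u v. (!!n. 0 <= u n) ==> u \<longlonglongrightarrow> v ==> (%n::nat. \<Phi> (u n)) \<longlonglongrightarrow> \<Phi> v"
      and i: "!!n. (NN x. ennreal (\<Phi> (g n x))) = 1" for \<Phi> :: "real => real"
  proof -
    have "(NN x. ennreal (\<Phi> (h x))) = (NN x. liminf (%n. ennreal (\<Phi> (g (k n) x))))"
    proof (rule nn_integral_cong_AE)
      show "AE x in lborel. ennreal (\<Phi> (h x)) = liminf (%n. ennreal (\<Phi> (g (k n) x)))"
        using lim
      proof eventually_elim
        case (elim x)
        have "(%n. ennreal (\<Phi> (g (k n) x))) \<longlonglongrightarrow> ennreal (\<Phi> (h x))"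
          using gn(4) elim by (intro tendsto_ennrealI l) auto
        then show ?case by (rule lim_imp_Liminf[OF sequentially_bot, symmetric])
      qed
    qed
    also have "... <= liminf (%n. (NN x. ennreal (\<Phi> (g (k n) x))))"
      by (intro nn_integral_liminf) measurable
    finally show ?thesis by (simp add: i Liminf_const)
  qed
  have m1: "mass h <= 1"
    unfolding mass_def by (rule fatou[of "%u. u"]) (use gn(2) in \<open>auto simp: mass_def\<close>)
  have m2: "mpow h <= 1"
    unfolding mpow_def by (rule fatou[of "%u. u powr m"]) (use gn(3) m_gt_1 in \<open>auto simp: mpow_def intro!: tendsto_powr2\<close>)
  have ah: "adm h" using m1 m2 hn by (auto simp: adm_def intro: le_less_trans)
  have nz: "mass h ~= 0"
  proof
    assume "mass h = 0"
    then have "energy s q h = 0"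
      using energy_cong_AE[of h "%x. 0"] ah by (simp add: mass_0_iff energy_zero)
    then show False using E Hr_pos by simp
  qed
  obtain c l where cl: "adm (%x. c * h (l *\<^sub>R x))" "mass (%x. c * h (l *\<^sub>R x)) = 1"
    "mpow (%x. c * h (l *\<^sub>R x)) = 1" "energy s q h = ennreal (nrm h) * energy s q (%x. c * h (l *\<^sub>R x))"
    using normalization[OF ah nz] by blast
  let ?f = "%x. c * h (l *\<^sub>R x)"
  have "nrm h <= 1 * 1"
    unfolding nrm_def using m1 m2 alpha_pos tau_pos
    by (intro mult_mono powr_le1) (auto intro: enn2real_leI simp: )
  then have "ennreal Hr <= 1 * energy s q ?f"
    unfolding E[symmetric] cl(4) by (intro mult_right_mono) (auto simp flip: ennreal_1 intro: ennreal_leI)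
  moreover have "energy s q ?f <= ennreal Hr"
    using energy_le[OF cl(1)] cl by (simp add: nrm_def)
  ultimately show ?thesis using cl by (intro exI[of _ ?f]) auto
qed

end

subsection \<open>The Euler--Lagrange equation\<close>

context hls
begin

text \<open>Equality in \<open>energy_le\<close>; \<open>rep_maximizer\<close> translates this into
  the maximizer property of the quotient.\<close>

definition ismax :: "('a => real) => bool" where
  "ismax h \<longleftrightarrow> adm h \<and> mass h ~= 0 \<and> energy s q h = ennreal (nrm h * Hr)"

definition dens :: "('a => real) => 'a => real" where
  "dens h x = rpotr s h x powr (q - 1)"

text \<open>The nonlinear potential K_{s,p}(h) in ennreal. It depends only on the a.e. class of
  \<open>h\<close>, yet is defined at every point.\<close>

definition Psi :: "('a => real) => 'a => ennreal" where
  "Psi h = rpot s (dens h)"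

lemma dens_measurable [measurable]: "h \<in> Borel ==> dens h \<in> Borel"
  unfolding dens_def[abs_def] by measurable

lemma Psi_measurable [measurable]: "h \<in> Borel ==> Psi h \<in> Borel"
  unfolding Psi_def by measurable

lemma dens_nonneg [simp]: "0 <= dens h x" by (simp add: dens_def)

text \<open>Young's inequality read as the tangent inequality of the convex function
  \<open>u powr q\<close> at \<open>a\<close>.\<close>

lemma powr_tangent:
  fixes a b :: real
  assumes "0 <= a" "0 <= b"
  shows "q * a powr (q - 1) * b <= (q - 1) * a powr q + b powr q"
proof -
  have pq: "1 / p + 1 / q = 1" "(q - 1) * p = q" "q / p = q - 1"
    using p_gt_1 by (simp_all add: q_eq field_simps)
  have "a powr (q - 1) * b <= (a powr (q - 1)) powr p / p + b powr q / q"
    using p_gt_1 q_gt_1 pq assms by (intro Youngs_inequality) auto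
  then have "q * (a powr (q - 1) * b) <= q * (a powr q / p + b powr q / q)"
    using q_gt_1 pq by (intro mult_left_mono) (auto simp: powr_powr)
  also have "... = (q / p) * a powr q + b powr q" using q_gt_1 by (simp add: distrib_left)
  finally show ?thesis by (simp add: pq mult.assoc)
qed

lemma Psi_integral:
  assumes f: "adm f" and h: "adm h"
  shows "(NN x. Psi h x * ennreal (f x)) = (NN x. ennreal (dens h x * rpotr s f x))"
proof -
  have [measurable]: "f \<in> Borel" "h \<in> Borel" and nn: "!!x. 0 <= f x"
    using f h by (auto simp: adm_def)
  have "(NN x. Psi h x * ennreal (f x)) = (NN x. ennreal (dens h x) * rpot s f x)"
    unfolding Psi_def by (rule rpot_symmetric) (use nn in auto)
  also have "... = (NN x. ennreal (dens h x * rpotr s f x))"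
    by (rule nn_integral_cong_AE) (use adm_rpot_finite[OF f] in eventually_elim, simp add: ennreal_mult rpotr_eq)
  finally show ?thesis .
qed

lemma rpotr_add_cmult:
  assumes f: "adm f" and h: "adm h" and t: "0 <= t"
  shows "AE x in lborel. rpotr s (%x. h x + t * f x) x = rpotr s h x + t * rpotr s f x"
  using adm_rpot_finite[OF f] adm_rpot_finite[OF h]
proof eventually_elim
  case (elim x)
  have [measurable]: "f \<in> Borel" "h \<in> Borel" and nn: "!!x. 0 <= f x" "!!x. 0 <= h x"
    using f h by (auto simp: adm_def)
  have "rpot s (%x. h x + t * f x) x = rpot s h x + ennreal t * rpot s f x"
    using t nn by (simp add: rpot_add rpot_cmult)
  then show ?case using elim t
    by (simp add: rpotr_def enn2real_plus enn2real_mult ennreal_mult_less_top)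
qed

lemma adm_add_cmult:
  assumes f: "adm f" and h: "adm h" and t: "0 <= t"
  shows "adm (%x. h x + t * f x)"
    and "mass (%x. h x + t * f x) = mass h + ennreal t * mass f"
proof -
  have [measurable]: "f \<in> Borel" "h \<in> Borel" and nn: "!!x. 0 <= f x" "!!x. 0 <= h x"
    using f h by (auto simp: adm_def)
  show mm: "mass (%x. h x + t * f x) = mass h + ennreal t * mass f"
    unfolding mass_def using nn t by (simp add: ennreal_plus ennreal_mult nn_integral_add nn_integral_cmult)
  have "mpow (%x. h x + t * f x) <= (NN x. ennreal (2 powr m) * (ennreal (h x powr m) + ennreal (t powr m) * ennreal (f x powr m)))"
    unfolding mpow_def
  proof (intro nn_integral_mono)
    fix x
    have "(h x + t * f x) powr m <= (2 * max (h x) (t * f x)) powr m"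
      using nn t m_gt_1 by (intro powr_mono2) auto
    also have "... <= 2 powr m * (h x powr m + t powr m * f x powr m)"
      using nn t by (auto simp: max_def powr_mult mult_left_mono intro!: mult_left_mono)
    finally show "ennreal ((h x + t * f x) powr m) <= ennreal (2 powr m) * (ennreal (h x powr m) + ennreal (t powr m) * ennreal (f x powr m))"
      by (simp add: ennreal_mult[symmetric] ennreal_plus[symmetric] ennreal_leI del: ennreal_plus)
  qed
  also have "... = ennreal (2 powr m) * (mpow h + ennreal (t powr m) * mpow f)"
    unfolding mpow_def by (simp add: nn_integral_cmult nn_integral_add)
  also have "... < \<infinity>" using f h by (simp add: adm_def ennreal_mult_less_top)
  finally show "adm (%x. h x + t * f x)"
    using f h nn t mm by (auto simp: adm_def ennreal_mult_less_top)
qed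

text \<open>Convexity places the energy above its linearization, which is the direction to be
  confronted with the upper bound \<open>energy_le\<close>.\<close>

lemma energy_tangent_pos:
  assumes f: "adm f" and h: "adm h" and t: "0 <= t"
  shows "energy s q h + ennreal (q * t) * (NN x. Psi h x * ennreal (f x)) <= energy s q (%x. h x + t * f x)"
proof -
  have [measurable]: "f \<in> Borel" "h \<in> Borel" using f h by (auto simp: adm_def)
  have "energy s q h + ennreal (q * t) * (NN x. Psi h x * ennreal (f x))
     = (NN x. ennreal (rpotr s h x powr q) + ennreal (q * t) * ennreal (dens h x * rpotr s f x))"
    unfolding Psi_integral[OF f h] energy_def by (simp add: nn_integral_add nn_integral_cmult)
  also have "... <= energy s q (%x. h x + t * f x)"
    unfolding energy_def
  proof (rule nn_integral_mono_AE, use rpotr_add_cmult[OF f h t] in eventually_elim)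
    fix x assume e: "rpotr s (%x. h x + t * f x) x = rpotr s h x + t * rpotr s f x"
    have "rpotr s h x powr (q - 1) * rpotr s h x = rpotr s h x powr q"
      by (cases "rpotr s h x = 0") (auto simp: powr_diff less_le)
    then have "rpotr s h x powr q + q * t * (dens h x * rpotr s f x) <= (rpotr s h x + t * rpotr s f x) powr q"
      using powr_tangent[of "rpotr s h x" "rpotr s h x + t * rpotr s f x"] t by (simp add: dens_def algebra_simps)
    then show "ennreal (rpotr s h x powr q) + ennreal (q * t) * ennreal (dens h x * rpotr s f x) <= ennreal (rpotr s (%x. h x + t * f x) x powr q)"
      using t q_gt_1 unfolding e by (simp add: ennreal_mult[symmetric] ennreal_plus[symmetric] ennreal_leI del: ennreal_plus)
  qed
  finally show ?thesis .
qed

text \<open>The same tangent bound in the direction \<open>- f\<close>. The term with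
  \<open>Psi\<close> stands on the right because subtraction in ennreal truncates.\<close>

lemma energy_tangent_neg:
  assumes f: "adm f" and h: "adm h" and t: "0 <= t" and le: "!!x. t * f x <= h x"
  shows "energy s q h <= energy s q (%x. h x - t * f x) + ennreal (q * t) * (NN x. Psi h x * ennreal (f x))"
    and "adm (%x. h x - t * f x)"
proof -
  have [measurable]: "f \<in> Borel" "h \<in> Borel" and nn: "!!x. 0 <= f x" using f h by (auto simp: adm_def)
  let ?g = "%x. h x - t * f x"
  have gle: "?g x <= h x" "0 <= ?g x" for x using nn t le by auto
  have "mass ?g <= mass h" "mpow ?g <= mpow h" using gle by (auto intro: mass_mono mpow_mono)
  then show g: "adm ?g" using h gle by (auto simp: adm_def)
  have gh: "(%x. ?g x + t * f x) = h" by auto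
  have "energy s q h <= (NN x. ennreal (rpotr s ?g x powr q) + ennreal (q * t) * ennreal (dens h x * rpotr s f x))"
    unfolding energy_def
  proof (rule nn_integral_mono_AE, use rpotr_add_cmult[OF f g t, unfolded gh] in eventually_elim)
    fix x assume e: "rpotr s h x = rpotr s ?g x + t * rpotr s f x"
    have 1: "rpotr s h x powr (q - 1) * rpotr s h x = rpotr s h x powr q"
      by (cases "rpotr s h x = 0") (auto simp: powr_diff less_le)
    have 2: "rpotr s ?g x = rpotr s h x - t * rpotr s f x" using e by simp
    have "rpotr s h x powr q <= rpotr s ?g x powr q + q * t * (dens h x * rpotr s f x)"
    proof -
      have "q * rpotr s h x powr (q - 1) * rpotr s ?g x <= (q - 1) * rpotr s h x powr q + rpotr s ?g x powr q"
        by (rule powr_tangent) simp_all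
      then show ?thesis using 1 unfolding dens_def 2 by (simp add: algebra_simps)
    qed
    then show "ennreal (rpotr s h x powr q) <= ennreal (rpotr s ?g x powr q) + ennreal (q * t) * ennreal (dens h x * rpotr s f x)"
      using t q_gt_1 by (simp add: ennreal_mult[symmetric] ennreal_plus[symmetric] ennreal_leI del: ennreal_plus)
  qed
  also have "... = energy s q ?g + ennreal (q * t) * (NN x. Psi h x * ennreal (f x))"
    unfolding Psi_integral[OF f h] energy_def by (simp add: nn_integral_add nn_integral_cmult)
  finally show "energy s q h <= energy s q ?g + ennreal (q * t) * (NN x. Psi h x * ennreal (f x))" .
qed

text \<open>The difference of the two sides of \<open>le\<close> vanishes at 0 and is nonnegative to
  the right, so its derivative at 0 is nonnegative. \<open>\<gamma>\<close> records the change of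
  \<open>mpow\<close>, which need not be linear in \<open>t\<close>.\<close>

lemma variation_ineq:
  fixes \<gamma> :: "real => real"
  assumes pos: "0 < B" "0 < A" "0 < P" and \<delta>: "0 < \<delta>" and \<gamma>: "\<gamma> 0 = 0" "DERIV \<gamma> 0 :> g"
    and le: "!!t. 0 < t ==> t < \<delta> ==> B + t * L <= B * ((1 + t * a / A) powr \<alpha> * (1 + \<gamma> t * J / P) powr \<tau>)"
  shows "L <= B * (\<alpha> * a / A + \<tau> * g * J / P)"
proof (rule ccontr)
  assume n: "\<not> ?thesis"
  define F where "F t = B * ((1 + t * a / A) powr \<alpha> * (1 + \<gamma> t * J / P) powr \<tau>) - B - t * L" for t
  have "DERIV F 0 :> B * (\<alpha> * a / A + \<tau> * g * J / P) - L"
    unfolding F_def using pos by (auto intro!: derivative_eq_intros \<gamma>(2) simp: \<gamma>(1))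
  then obtain d where d: "0 < d" "!!h. 0 < h ==> h < d ==> F (0 + h) < F 0"
    using DERIV_neg_dec_right n by (metis diff_less_0_iff_less not_le)
  define t where "t = min d \<delta> / 2"
  have t: "0 < t" "t < d" "t < \<delta>" using d \<delta> by (auto simp: t_def)
  have "F t < 0" using d(2)[OF t(1,2)] by (simp add: F_def \<gamma>(1))
  moreover have "0 <= F t" using le[OF t(1,3)] by (simp add: F_def)
  ultimately show False by simp
qed

lemma ismax_constants:
  assumes h: "ismax h"
  obtains A P where "mass h = ennreal A" "mpow h = ennreal P" "0 < A" "0 < P"
    "energy s q h = ennreal (A powr \<alpha> * P powr \<tau> * Hr)" "0 < A powr \<alpha> * P powr \<tau> * Hr"
proof -
  have a: "adm h" "mass h ~= 0" and e: "energy s q h = ennreal (nrm h * Hr)" using h by (auto simp: ismax_def)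
  obtain A where A: "mass h = ennreal A" "0 < A"
    using a by (cases "mass h") (auto simp: adm_def less_le)
  have "mpow h ~= 0" using a by (simp add: mass_0_iff mpow_0_iff)
  then obtain P where P: "mpow h = ennreal P" "0 < P"
    using a by (cases "mpow h") (auto simp: adm_def less_le)
  show thesis using that[OF A(1) P(1) A(2) P(2)] e A P Hr_pos by (simp add: nrm_def)
qed

text \<open>The tangent bound for \<open>h + t * f\<close> is confronted with
  \<open>energy_le\<close>; the mass is affine in \<open>t\<close>, and \<open>mpow\<close> enters
  through an upper bound.\<close>

lemma first_variation:
  assumes h: "ismax h" and A: "mass h = ennreal A" "0 < A" and P: "mpow h = ennreal P" "0 < P"
    and f: "adm f" and \<delta>: "0 < \<delta>" and \<gamma>: "\<gamma> 0 = 0" "DERIV \<gamma> 0 :> g"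
    and mf: "mass f = ennreal a" "0 <= a" and J: "0 <= J"
    and mp: "!!t. 0 < t ==> t < \<delta> ==> 0 <= \<gamma> t \<and> mpow (%x. h x + t * f x) <= ennreal (P + \<gamma> t * J)"
    and I: "(NN x. Psi h x * ennreal (f x)) = ennreal I" "0 <= I"
  shows "q * I <= nrm h * Hr * (\<alpha> * a / A + \<tau> * g * J / P)"
proof (rule variation_ineq[OF _ A(2) P(2) \<delta> \<gamma>])
  have ah: "adm h" and e: "energy s q h = ennreal (nrm h * Hr)" using h by (auto simp: ismax_def)
  have nh: "nrm h = A powr \<alpha> * P powr \<tau>" using A P by (simp add: nrm_def)
  show Bp: "0 < nrm h * Hr" using A P Hr_pos by (simp add: nh)
  fix t assume t: "0 < t" "t < \<delta>"
  have t0: "0 <= t" using t by simp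
  let ?g = "%x. h x + t * f x"
  note ag = adm_add_cmult[OF f ah t0]
  have "ennreal (nrm h * Hr + q * t * I) = energy s q h + ennreal (q * t) * (NN x. Psi h x * ennreal (f x))"
    using t q_gt_1 I Bp by (simp add: e ennreal_mult ennreal_plus)
  also have "... <= energy s q ?g" by (rule energy_tangent_pos[OF f ah t0])
  also have "... <= ennreal (nrm ?g * Hr)" by (rule energy_le[OF ag(1)])
  finally have 1: "nrm h * Hr + q * t * I <= nrm ?g * Hr"
    using Hr_pos by (simp add: ennreal_le_iff)
  have "mass ?g = ennreal (A + t * a)" using ag(2) A mf t by (simp add: ennreal_mult ennreal_plus)
  then have "enn2real (mass ?g) = A + t * a" using A mf t by (simp del: ennreal_plus)
  moreover have "enn2real (mpow ?g) <= P + \<gamma> t * J" using mp[OF t] P J by (intro enn2real_leI) auto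
  ultimately have "nrm ?g <= (A + t * a) powr \<alpha> * (P + \<gamma> t * J) powr \<tau>"
    unfolding nrm_def using tau_pos alpha_pos A mf t by (intro mult_mono powr_mono2) auto
  also have "... = (A * (1 + t * a / A)) powr \<alpha> * (P * (1 + \<gamma> t * J / P)) powr \<tau>"
    using A P by (simp add: distrib_left right_diff_distrib)
  also have "... = nrm h * ((1 + t * a / A) powr \<alpha> * (1 + \<gamma> t * J / P) powr \<tau>)"
    using A P t mf mp[OF t] J by (simp add: nh powr_mult)
  finally have "nrm ?g * Hr <= nrm h * ((1 + t * a / A) powr \<alpha> * (1 + \<gamma> t * J / P) powr \<tau>) * Hr"
    using Hr_pos by (intro mult_right_mono) auto
  with 1 show "nrm h * Hr + t * (q * I) <= nrm h * Hr * ((1 + t * a / A) powr \<alpha> * (1 + \<gamma> t * J / P) powr \<tau>)"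
    by (simp add: ac_simps)
qed

lemma first_variation_neg:
  assumes h: "ismax h" and A: "mass h = ennreal A" "0 < A" and P: "mpow h = ennreal P" "0 < P"
    and f: "adm f" and \<gamma>: "\<gamma> 0 = 0" "DERIV \<gamma> 0 :> g"
    and mf: "mass f = ennreal a" "0 <= a" and le: "!!x. f x <= h x"
    and mp: "!!t. 0 < t ==> t < 1 ==> 0 <= P + \<gamma> t * J \<and> mpow (%x. h x - t * f x) <= ennreal (P + \<gamma> t * J)"
    and I: "(NN x. Psi h x * ennreal (f x)) = ennreal I" "0 <= I"
  shows "- (q * I) <= nrm h * Hr * (\<alpha> * (- a) / A + \<tau> * g * J / P)"
proof (rule variation_ineq[OF _ A(2) P(2) zero_less_one \<gamma>])
  have ah: "adm h" and e: "energy s q h = ennreal (nrm h * Hr)" using h by (auto simp: ismax_def)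
  have fn: "!!x. 0 <= f x" using f by (simp add: adm_def)
  have nh: "nrm h = A powr \<alpha> * P powr \<tau>" using A P by (simp add: nrm_def)
  show Bp: "0 < nrm h * Hr" using A P Hr_pos by (simp add: nh)
  have "mass f <= mass h" using le by (rule mass_mono)
  then have aA: "a <= A" using A mf by simp
  fix t :: real assume t: "0 < t" "t < 1"
  have t0: "0 <= t" using t by simp
  have le': "t * f x <= h x" for x
    using mult_right_mono[of t 1 "f x"] t fn[of x] le[of x] by simp
  let ?g = "%x. h x - t * f x"
  note ag = energy_tangent_neg[OF f ah t0 le']
  have "ennreal (nrm h * Hr) = energy s q h" by (simp add: e)
  also have "... <= energy s q ?g + ennreal (q * t) * ennreal I" using ag(1) by (simp add: I)
  also have "... <= ennreal (nrm ?g * Hr) + ennreal (q * t) * ennreal I" by (intro add_right_mono energy_le[OF ag(2)])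
  also have "... = ennreal (nrm ?g * Hr + q * t * I)"
    using t q_gt_1 I Hr_pos by (simp add: ennreal_mult ennreal_plus)
  finally have 1: "nrm h * Hr <= nrm ?g * Hr + q * t * I"
    using Hr_pos t q_gt_1 I by (simp add: ennreal_le_iff del: ennreal_plus)
  have "mass ?g + ennreal t * mass f = mass h"
    using adm_add_cmult(2)[OF f ag(2) t0] by simp
  then have "mass ?g + ennreal (t * a) = ennreal A"
    using A mf t by (simp add: ennreal_mult)
  also have "ennreal A = ennreal (A - t * a) + ennreal (t * a)"
    using A mf t aA mult_right_mono[of t 1 a] by (simp add: ennreal_plus[symmetric] del: ennreal_plus)
  finally have "mass ?g + ennreal (t * a) = ennreal (A - t * a) + ennreal (t * a)" .
  then have "mass ?g = ennreal (A - t * a)" by (simp add: add.commute[of _ "ennreal (t * a)"] ennreal_add_left_cancel)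
  then have "enn2real (mass ?g) = A - t * a" using A mf t aA mult_right_mono[of t 1 a] by simp
  moreover have "enn2real (mpow ?g) <= P + \<gamma> t * J" using mp[OF t] by (intro enn2real_leI) auto
  ultimately have "nrm ?g <= (A - t * a) powr \<alpha> * (P + \<gamma> t * J) powr \<tau>"
    unfolding nrm_def using tau_pos alpha_pos A mf t aA mult_right_mono[of t 1 a] by (intro mult_mono powr_mono2) auto
  also have "... = (A * (1 + t * (- a) / A)) powr \<alpha> * (P * (1 + \<gamma> t * J / P)) powr \<tau>"
    using A P by (simp add: distrib_left right_diff_distrib)
  also have "... = nrm h * ((1 + t * (- a) / A) powr \<alpha> * (1 + \<gamma> t * J / P) powr \<tau>)"
  proof -
    have "0 <= 1 + t * (- a) / A" using aA A mf t mult_right_mono[of t 1 a] by (simp add: field_simps)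
    moreover have "0 <= 1 + \<gamma> t * J / P" using mp[OF t] P by (simp add: field_simps)
    ultimately show ?thesis using A P by (simp only: nh powr_mult less_imp_le) (simp add: ac_simps)
  qed
  finally have "nrm ?g * Hr <= nrm h * ((1 + t * (- a) / A) powr \<alpha> * (1 + \<gamma> t * J / P) powr \<tau>) * Hr"
    using Hr_pos by (intro mult_right_mono) auto
  with 1 show "nrm h * Hr + t * (- (q * I)) <= nrm h * Hr * ((1 + t * (- a) / A) powr \<alpha> * (1 + \<gamma> t * J / P) powr \<tau>)"
    by (simp add: ac_simps)
qed

lemma Psi_test_finite:
  assumes "adm f" "adm h"
  shows "(NN x. Psi h x * ennreal (f x)) < \<infinity>"
proof -
  have "ennreal q * (NN x. Psi h x * ennreal (f x)) <= energy s q (%x. h x + 1 * f x)"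
    using energy_tangent_pos[OF assms, of 1] by (auto intro: order_trans[rotated])
  also have "... < \<infinity>" by (intro energy_finite adm_add_cmult assms) simp
  finally show ?thesis using q_gt_1 by (auto simp: ennreal_mult_less_top)
qed

lemma DERIV_one_plus_powr: "DERIV (%t::real. (1 + c * t) powr m - 1) 0 :> m * c"
  by (auto intro!: derivative_eq_intros)

text \<open>Along \<open>f = h * indicator E\<close> both signs of \<open>t\<close> are admissible
  and \<open>mpow\<close> is explicit, \<open>P + ((1 + c) powr m - 1) * J\<close>. The two
  one-sided variations combine to an equality for every Borel set \<open>E\<close>.\<close>

lemma euler_lagrange_on_support:
  assumes h: "ismax h" and A: "mass h = ennreal A" "0 < A" and P: "mpow h = ennreal P" "0 < P" and E[measurable]: "E \<in> sets borel"
  shows "(NN x. ennreal q * Psi h x * ennreal (h x) * indicator E x)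
     = (NN x. ennreal (nrm h * Hr * (\<alpha> / A * h x + \<tau> * m / P * h x powr m)) * indicator E x)"
proof -
  have ah: "adm h" using h by (simp add: ismax_def)
  then have [measurable]: "h \<in> Borel" and nn: "!!x. 0 <= h x" by (auto simp: adm_def)
  define f where "f x = h x * indicator E x" for x
  have fh: "0 <= f x" "f x <= h x" for x using nn[of x] by (auto simp: f_def indicator_def)
  have [measurable]: "f \<in> Borel" unfolding f_def[abs_def] by measurable
  have mfh: "mass f <= mass h" "mpow f <= mpow h" using fh by (auto intro: mass_mono mpow_mono)
  have f: "adm f" using ah mfh fh by (auto simp: adm_def)
  obtain a where a: "mass f = ennreal a" "0 <= a" using f by (cases "mass f") (auto simp: adm_def)
  obtain J where J: "mpow f = ennreal J" "0 <= J" using f by (cases "mpow f") (auto simp: adm_def)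
  have JP: "J <= P" using mfh(2) J P by simp
  obtain I where I: "(NN x. Psi h x * ennreal (f x)) = ennreal I" "0 <= I"
    using Psi_test_finite[OF f ah] by (cases "NN x. Psi h x * ennreal (f x)") auto
  have mp: "mpow (%x. h x + c * f x) = ennreal (P + ((1 + c) powr m - 1) * J)" if c: "-1 < c" for c
  proof -
    define g where "g x = h x * indicator (- E) x" for x
    have [measurable]: "g \<in> Borel" unfolding g_def[abs_def] by measurable
    have "0 <= g x" "g x <= h x" for x using nn[of x] by (auto simp: g_def indicator_def)
    then have "mass g <= mass h" "mpow g <= mpow h" "!!x. 0 <= g x" by (auto intro: mass_mono mpow_mono)
    then have "adm g" using ah by (auto simp: adm_def)
    then obtain G where G: "mpow g = ennreal G" "0 <= G" by (cases "mpow g") (auto simp: adm_def)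
    have split: "mpow (%x. h x + d * f x) = mpow g + ennreal ((1 + d) powr m) * mpow f" if "-1 < d" for d
    proof -
      have "ennreal ((h x + d * f x) powr m) = ennreal (g x powr m) + ennreal ((1 + d) powr m) * ennreal (f x powr m)" for x
      proof (cases "x \<in> E")
        case True
        then have "h x + d * f x = (1 + d) * f x" by (simp add: f_def algebra_simps)
        then show ?thesis using True that fh(1)[of x] by (simp add: g_def powr_mult ennreal_mult)
      qed (simp add: f_def g_def)
      then show ?thesis unfolding mpow_def by (simp add: nn_integral_add nn_integral_cmult)
    qed
    have "P = G + J" using split[of 0] P G J by (simp add: ennreal_plus[symmetric] del: ennreal_plus)
    then show ?thesis using split[OF c] G J
      by (simp add: ennreal_mult[symmetric] ennreal_plus[symmetric] algebra_simps del: ennreal_plus)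
  qed
  have 1: "q * I <= nrm h * Hr * (\<alpha> * a / A + \<tau> * (m * 1) * J / P)"
  proof (rule first_variation[OF h A P f zero_less_one _ DERIV_one_plus_powr a J(2) _ I])
    show "0 <= (1 + 1 * t) powr m - 1 \<and> mpow (%x. h x + t * f x) <= ennreal (P + ((1 + 1 * t) powr m - 1) * J)" if "0 < t" "t < 1" for t
      using mp[of t] that m_gt_1 by (auto intro: ge_one_powr_ge_zero)
  qed simp
  have 2: "- (q * I) <= nrm h * Hr * (\<alpha> * (- a) / A + \<tau> * (m * (-1)) * J / P)"
  proof (rule first_variation_neg[OF h A P f _ DERIV_one_plus_powr a fh(2) _ I])
    fix t :: real assume t: "0 < t" "t < 1"
    have "0 <= P - J + (1 - t) powr m * J" using JP J by simp
    then show "0 <= P + ((1 + - 1 * t) powr m - 1) * J \<and> mpow (%x. h x - t * f x) <= ennreal (P + ((1 + - 1 * t) powr m - 1) * J)"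
      using mp[of "- t"] t by (simp add: algebra_simps)
  qed simp
  have eq: "q * I = nrm h * Hr * (\<alpha> / A * a + \<tau> * m / P * J)"
    using 1 2 by (simp add: algebra_simps)
  have "(NN x. ennreal q * Psi h x * ennreal (h x) * indicator E x) = (NN x. ennreal q * (Psi h x * ennreal (f x)))"
    by (intro nn_integral_cong) (auto simp: f_def indicator_def mult.assoc)
  also have "... = ennreal (q * I)" using q_gt_1 I by (subst nn_integral_cmult) (auto simp: ennreal_mult)
  also have "... = ennreal (nrm h * Hr * (\<alpha> / A)) * mass f + ennreal (nrm h * Hr * (\<tau> * m / P)) * mpow f"
    unfolding eq a J using a(2) J(2) A P alpha_pos tau_pos m_gt_1
    by (simp add: ennreal_mult[symmetric] ennreal_plus[symmetric] distrib_left mult.assoc del: ennreal_plus)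
  also have "... = (NN x. ennreal (nrm h * Hr * (\<alpha> / A)) * ennreal (f x) + ennreal (nrm h * Hr * (\<tau> * m / P)) * ennreal (f x powr m))"
    unfolding mass_def mpow_def by (simp add: nn_integral_add nn_integral_cmult)
  also have "... = (NN x. ennreal (nrm h * Hr * (\<alpha> / A * h x + \<tau> * m / P * h x powr m)) * indicator E x)"
    using nn A P alpha_pos tau_pos m_gt_1
    by (intro nn_integral_cong) (auto simp: f_def indicator_def ennreal_mult[symmetric] ennreal_plus[symmetric] distrib_left mult.assoc simp del: ennreal_plus)
  finally show ?thesis .
qed

text \<open>Adding \<open>t * indicator E\<close> where \<open>h\<close> vanishes raises
  \<open>mpow\<close> by \<open>t powr m\<close> times the volume, of higher order since
  \<open>m > 1\<close>. For \<open>t < \<eta>\<close> this is at most linear with slope proportional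
  to \<open>\<eta> powr (m - 1)\<close>, and then \<open>\<eta>\<close> tends to 0.\<close>

lemma euler_lagrange_off_support:
  assumes h: "ismax h" and A: "mass h = ennreal A" "0 < A" and P: "mpow h = ennreal P" "0 < P" and E[measurable]: "E \<in> sets borel"
    and Ez: "!!x. x \<in> E ==> h x = 0" and Eb: "E \<subseteq> ball 0 r"
  shows "ennreal q * (NN x. Psi h x * indicator E x) <= ennreal (nrm h * Hr * \<alpha> / A) * emeasure lborel E"
proof -
  have ah: "adm h" using h by (simp add: ismax_def)
  then have [measurable]: "h \<in> Borel" and nn: "!!x. 0 <= h x" by (auto simp: adm_def)
  have f: "adm (indicator E)"
    by (rule energy_bound_bounded(2)[where M=1 and R="\<bar>r\<bar> + 1"]) (use Eb in \<open>auto simp: indicator_def subset_eq\<close>)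
  have "emeasure lborel E <= emeasure lborel (ball (0::'a) r)" by (rule emeasure_mono[OF Eb]) simp
  then obtain a where a: "emeasure lborel E = ennreal a" "0 <= a"
    using emeasure_lborel_ball_finite[of "0::'a" r] by (cases "emeasure lborel E") (auto simp: top_unique)
  have mf: "mass (indicator E) = ennreal a" by (simp add: mass_def ennreal_indicator a)
  obtain I where I: "(NN x. Psi h x * ennreal (indicator E x)) = ennreal I" "0 <= I"
    using Psi_test_finite[OF f ah] by (cases "NN x. Psi h x * ennreal (indicator E x)") auto
  have bnd: "q * I <= nrm h * Hr * (\<alpha> * a / A + \<tau> * \<eta> powr (m - 1) * a / P)" if \<eta>: "0 < \<eta>" for \<eta>
  proof (rule first_variation[OF h A P f \<eta> _ _ mf a(2) a(2) _ I])
    show "DERIV (%t. t * \<eta> powr (m - 1)) 0 :> \<eta> powr (m - 1)" by (auto intro!: derivative_eq_intros)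
    fix t assume t: "0 < t" "t < \<eta>"
    have "mpow (%x. h x + t * indicator E x) = (NN x. ennreal (h x powr m) + ennreal (t powr m) * indicator E x)"
      unfolding mpow_def using Ez by (intro nn_integral_cong) (auto simp: indicator_def)
    also have "... = ennreal P + ennreal (t powr m) * ennreal a"
      using P a by (subst nn_integral_add) (auto simp: mpow_def nn_integral_cmult_indicator)
    also have "... = ennreal (P + t powr m * a)"
      using P a by (simp add: ennreal_mult[symmetric] ennreal_plus[symmetric] del: ennreal_plus)
    also have "... <= ennreal (P + t * \<eta> powr (m - 1) * a)"
    proof -
      have "t powr m = t * t powr (m - 1)" using t by (simp add: powr_diff)
      also have "... <= t * \<eta> powr (m - 1)" using t m_gt_1 by (intro mult_left_mono powr_mono2) auto
      finally show ?thesis using a by (intro ennreal_leI add_left_mono mult_right_mono) auto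
    qed
    finally show "0 <= t * \<eta> powr (m - 1) \<and> mpow (%x. h x + t * indicator E x) <= ennreal (P + t * \<eta> powr (m - 1) * a)"
      using t by simp
  qed simp
  have "q * I <= nrm h * Hr * (\<alpha> * a / A)"
  proof -
    have "((%\<eta>. nrm h * Hr * (\<alpha> * a / A + \<tau> * \<eta> powr (m - 1) * a / P)) \<longlongrightarrow> nrm h * Hr * (\<alpha> * a / A + \<tau> * 0 powr (m - 1) * a / P)) (at_right 0)"
      using m_gt_1 P by (intro tendsto_intros tendsto_powr2) (auto simp: eventually_at_right_less eventually_at_filter)
    then have "((%\<eta>. nrm h * Hr * (\<alpha> * a / A + \<tau> * \<eta> powr (m - 1) * a / P)) \<longlongrightarrow> nrm h * Hr * (\<alpha> * a / A)) (at_right 0)" by simp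
    then show ?thesis
      by (rule tendsto_lowerbound) (use bnd in \<open>auto simp: eventually_at_filter\<close>)
  qed
  then have "ennreal (q * I) <= ennreal (nrm h * Hr * (\<alpha> * a / A))" by (rule ennreal_leI)
  then show ?thesis
    using q_gt_1 I A a alpha_pos by (simp add: ennreal_indicator ennreal_mult[symmetric] mult.assoc)
qed

theorem euler_lagrange:
  assumes h: "ismax h"
  shows "\<exists>a C. 0 < a \<and> 0 < C \<and> (AE x in lborel. Psi h x < \<infinity> \<and> h x powr (m - 1) = a * max 0 (enn2real (Psi h x) - C))"
proof -
  obtain A P where A: "mass h = ennreal A" and P: "mpow h = ennreal P" and pos: "0 < A" "0 < P"
    and B: "0 < A powr \<alpha> * P powr \<tau> * Hr" using ismax_constants[OF h] by metis
  define B where "B = nrm h * Hr"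
  have Bp: "0 < B" using B A P pos by (simp add: B_def nrm_def)
  \<comment> \<open>\<open>C\<close> and \<open>a\<close> are read off from \<open>q * Psi = B *
    (\<alpha> / A + \<tau> * m / P * h powr (m - 1))\<close>, the equation where
    \<open>h > 0\<close>.\<close>
  define C where "C = B * \<alpha> / (q * A)"
  define a where "a = q * P / (B * \<tau> * m)"
  have C: "0 < C" and a: "0 < a" using Bp q_gt_1 pos alpha_pos tau_pos m_gt_1 by (simp_all add: C_def a_def)
  have ah: "adm h" using h by (simp add: ismax_def)
  then have [measurable]: "h \<in> Borel" and nn: "!!x. 0 <= h x" by (auto simp: adm_def)
  note on = euler_lagrange_on_support[OF h A pos(1) P pos(2)]
  \<comment> \<open>The set integrals agree over all Borel sets, so the two densities agree almost
    everywhere.\<close>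
  have "AE x in lborel. ennreal q * Psi h x * ennreal (h x) = ennreal (nrm h * Hr * (\<alpha> / A * h x + \<tau> * m / P * h x powr m))"
  proof (rule finite_density_unique[THEN iffD1])
    show "(NN x. ennreal q * Psi h x * ennreal (h x)) ~= \<infinity>"
      using Psi_test_finite[OF ah ah] q_gt_1 by (simp add: mult.assoc nn_integral_cmult ennreal_mult_eq_top_iff)
    show "density lborel (%x. ennreal q * Psi h x * ennreal (h x)) = density lborel (%x. ennreal (nrm h * Hr * (\<alpha> / A * h x + \<tau> * m / P * h x powr m)))"
      by (rule measure_eqI) (auto simp: emeasure_density on)
  qed auto
  then have 1: "AE x in lborel. 0 < h x --> Psi h x < \<infinity> \<and> h x powr (m - 1) = a * (enn2real (Psi h x) - C)"
  proof eventually_elim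
    case (elim x)
    show ?case
    proof
      assume hx: "0 < h x"
      have fin: "Psi h x < \<infinity>"
      proof (rule ccontr)
        assume "\<not> Psi h x < \<infinity>"
        then have "Psi h x = \<infinity>" by (simp add: not_less top_unique)
        then show False using elim hx q_gt_1 by (simp add: ennreal_mult_eq_top_iff ennreal_mult_top ennreal_top_mult)
      qed
      then obtain u where u: "Psi h x = ennreal u" "0 <= u" by (cases "Psi h x") auto
      have "ennreal (q * u * h x) = ennreal (B * (\<alpha> / A * h x + \<tau> * m / P * h x powr m))"
        using elim u hx q_gt_1 by (simp add: B_def ennreal_mult)
      then have "q * u * h x = B * (\<alpha> / A * h x + \<tau> * m / P * h x powr m)"
        using u hx q_gt_1 Bp alpha_pos tau_pos m_gt_1 pos by (subst (asm) ennreal_inj) auto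
      also have "h x powr m = h x powr (m - 1) * h x" using hx by (simp add: powr_diff)
      finally have "(q * u) * h x = (B * (\<alpha> / A + \<tau> * m / P * h x powr (m - 1))) * h x"
        by (simp add: algebra_simps)
      then have "q * u = B * (\<alpha> / A + \<tau> * m / P * h x powr (m - 1))" using hx by simp
      then have "q * u - B * \<alpha> / A = B * \<tau> * m / P * h x powr (m - 1)" by (simp add: algebra_simps)
      moreover have "a * (u - C) = P / (B * \<tau> * m) * (q * u - B * \<alpha> / A)"
        using q_gt_1 Bp by (simp add: a_def C_def right_diff_distrib diff_divide_distrib ac_simps)
      ultimately have "h x powr (m - 1) = a * (u - C)"
        using pos Bp tau_pos m_gt_1 by simp
      then show "Psi h x < \<infinity> \<and> h x powr (m - 1) = a * (enn2real (Psi h x) - C)"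
        using fin u by simp
    qed
  qed
  have 2: "AE x in lborel. h x = 0 --> Psi h x <= ennreal C"
  proof -
    have "AE x in lborel. x \<notin> {x. h x = 0 \<and> ennreal C < Psi h x} \<inter> ball 0 (real n)" for n :: nat
    proof -
      \<comment> \<open>Intersecting with a ball keeps the volume finite; on such a set
        \<open>Psi > C\<close> contradicts the integrated bound unless the set is null.\<close>
      define E where "E = {x. h x = 0 \<and> ennreal C < Psi h x} \<inter> ball 0 (real n)"
      have E[measurable]: "E \<in> sets borel" unfolding E_def by measurable
      have "ennreal q * (NN x. Psi h x * indicator E x) <= ennreal (nrm h * Hr * \<alpha> / A) * emeasure lborel E"
        by (rule euler_lagrange_off_support[OF h A pos(1) P pos(2) E, of n]) (auto simp: E_def)
      also have "nrm h * Hr * \<alpha> / A = q * C" using q_gt_1 by (simp add: C_def B_def)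
      also have "ennreal (q * C) * emeasure lborel E = ennreal q * (NN x. ennreal C * indicator E x)"
        using q_gt_1 C by (simp add: ennreal_mult mult.assoc nn_integral_cmult_indicator)
      finally have le: "(NN x. Psi h x * indicator E x) <= (NN x. ennreal C * indicator E x)"
        using q_gt_1 by (subst (asm) ennreal_mult_le_mult_iff) auto
      have "emeasure lborel E <= emeasure lborel (ball (0::'a) (real n))" by (rule emeasure_mono) (auto simp: E_def)
      then have "emeasure lborel E < \<infinity>" using emeasure_lborel_ball_finite[of "0::'a" "real n"] by (rule le_less_trans)
      then have "(NN x. ennreal C * indicator E x) ~= \<infinity>"
        by (simp add: nn_integral_cmult_indicator ennreal_mult_eq_top_iff)
      then have "AE x in lborel. ennreal C * indicator E x = Psi h x * indicator E x"
        by (intro AE_eq_of_nn_integral_le le) (auto simp: E_def indicator_def)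
      then show ?thesis unfolding E_def[symmetric]
        by eventually_elim (auto simp: E_def indicator_def)
    qed
    then have "AE x in lborel. \<forall>n::nat. x \<notin> {x. h x = 0 \<and> ennreal C < Psi h x} \<inter> ball 0 (real n)"
      by (simp only: AE_all_countable) simp
    then show ?thesis
    proof eventually_elim
      case (elim x)
      obtain n :: nat where n: "norm x < n" using reals_Archimedean2 by blast
      have "x \<notin> {x. h x = 0 \<and> ennreal C < Psi h x} \<inter> ball 0 (real n)" using elim by blast
      then show ?case using n by (auto simp: not_less)
    qed
  qed
  from 1 2 have "AE x in lborel. Psi h x < \<infinity> \<and> h x powr (m - 1) = a * max 0 (enn2real (Psi h x) - C)"
  proof eventually_elim
    case (elim x)
    show ?case
    proof (cases "h x = 0")
      case True
      then have "Psi h x <= ennreal C" using elim by simp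
      then have "Psi h x < \<infinity>" "enn2real (Psi h x) <= C" using C by (auto intro: le_less_trans enn2real_leI)
      then show ?thesis using True by simp
    next
      case False
      then have hx: "0 < h x" using nn[of x] by simp
      then have e: "Psi h x < \<infinity>" "h x powr (m - 1) = a * (enn2real (Psi h x) - C)" using elim by auto
      moreover have "0 < a * (enn2real (Psi h x) - C)" using hx unfolding e(2)[symmetric] by simp
      ultimately show ?thesis using a by (simp add: zero_less_mult_iff)
    qed
  qed
  then show ?thesis using a C by blast
qed

end

subsection \<open>Radial symmetry\<close>

text \<open>Equal norms are allowed here, at the price of \<open>t = 0\<close>; the reflections
  available for a centred maximizer include that case.\<close>

lemma bisecting_reflection:
  fixes y z :: "'a::euclidean_space"
  assumes "y ~= z" "norm y <= norm z"
  obtains e t where "norm e = 1" "t <= 0" "norm y < norm z ==> t < 0" "t <= e \<bullet> y" "hrefl e t y = z"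
proof -
  define d where "d = norm (y - z)"
  have d: "0 < d" using assms by (auto simp: d_def)
  define e where "e = (1 / d) *\<^sub>R (y - z)"
  define t where "t = ((norm y)\<^sup>2 - (norm z)\<^sup>2) / (2 * d)"
  have e: "norm e = 1" using d by (simp add: e_def d_def)
  have t: "t <= 0" "norm y < norm z ==> t < 0"
    using assms d by (auto simp: t_def divide_less_0_iff divide_le_0_iff power_strict_mono power_mono)
  have d2: "d\<^sup>2 = (norm y)\<^sup>2 - 2 * (y \<bullet> z) + (norm z)\<^sup>2"
    unfolding d_def power2_norm_eq_inner by (simp add: inner_diff_left inner_diff_right inner_commute)
  have "e \<bullet> y = ((norm y)\<^sup>2 - y \<bullet> z) / d"
    by (simp add: e_def inner_diff_left inner_commute[of z y] power2_norm_eq_inner)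
  then have "e \<bullet> y - t = ((norm y)\<^sup>2 - 2 * (y \<bullet> z) + (norm z)\<^sup>2) / (2 * d)"
    using d by (simp add: t_def field_simps)
  also have "... = d / 2" using d by (subst d2[symmetric]) (simp add: power2_eq_square)
  finally have ey: "e \<bullet> y - t = d / 2" .
  have "hrefl e t y = z" using d by (simp add: hrefl_def ey) (simp add: e_def)
  with e t ey d show thesis by (intro that) auto
qed

lemma AE_translate:
  fixes a :: "'a::euclidean_space"
  assumes "AE x in lborel. P x"
  shows "AE x in lborel. P (x + a)"
proof -
  have "AE x in distr lborel borel ((+) a). P x" using assms by (simp only: lborel_distr_plus)
  then have "AE x in lborel. P (a + x)" by (rule AE_distrD[rotated]) simp
  then show ?thesis by (simp add: add.commute)
qed

lemma AE_not_hyperplane: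
  assumes "norm (e::'a::euclidean_space) = 1"
  shows "AE x in lborel. e \<bullet> x ~= t"
proof -
  have "negligible {x. e \<bullet> x = t}" using assms by (intro negligible_hyperplane) auto
  moreover have "{x. e \<bullet> x = t} \<in> sets lborel" by measurable
  ultimately have "{x. e \<bullet> x = t} \<in> null_sets lborel"
    by (simp add: negligible_iff_null_sets null_sets_completion_iff)
  then show ?thesis by (auto dest: AE_not_in)
qed

context hls
begin

text \<open>Polarization changes neither mass nor \<open>mpow\<close>, so it cannot raise the energy
  of a maximizer, and the equality case \<open>energy_pol_eq\<close> applies.\<close>

lemma maximizer_dichotomy:
  assumes h: "ismax h" and e: "norm e = 1"
  shows "(AE x in lborel. t <= e \<bullet> x --> h (hrefl e t x) <= h x) \<or> (AE x in lborel. t <= e \<bullet> x --> h x <= h (hrefl e t x))"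
proof -
  have ah: "adm h" using h by (simp add: ismax_def)
  then have [measurable]: "h \<in> Borel" and nn: "!!x. 0 <= h x" by (auto simp: adm_def)
  have mm: "mass (pol e t h) = mass h" "mpow (pol e t h) = mpow h"
    unfolding mass_def mpow_def by (rule nn_integral_pol[OF e]; simp)+
  then have "adm (pol e t h)" using ah pol_nonneg[OF nn] by (auto simp: adm_def)
  then have "energy s q (pol e t h) <= energy s q h"
    using energy_le[of "pol e t h"] h mm by (simp add: ismax_def nrm_def)
  then show ?thesis
    using energy_finite[OF ah] by (intro energy_pol_eq[OF e _ nn q_gt_1 adm_rpot_finite[OF ah]]) auto
qed

definition hmass :: "('a => real) => 'a => real => ennreal" where
  "hmass h e t = (NN x. ennreal (h x) * indicator {x. t < e \<bullet> x} x)"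

lemma hmass_add:
  assumes [measurable]: "h \<in> Borel" and e: "norm e = 1"
  shows "hmass h e t + (NN x. ennreal (h x) * indicator {x. e \<bullet> x < t} x) = mass h"
  unfolding hmass_def mass_def
  by (subst nn_integral_add[symmetric], measurable, rule nn_integral_cong_AE)
    (use AE_not_hyperplane[OF e, of t] in eventually_elim, auto simp: indicator_def)

lemma hmass_hrefl:
  assumes [measurable]: "h \<in> Borel" and e: "norm e = 1"
  shows "(NN x. ennreal (h (hrefl e t x)) * indicator {x. t < e \<bullet> x} x)
      = (NN x. ennreal (h x) * indicator {x. e \<bullet> x < t} x)"
proof -
  have "(NN x. ennreal (h x) * indicator {x. e \<bullet> x < t} x)
    = (NN x. ennreal (h (hrefl e t x)) * indicator {x. e \<bullet> x < t} (hrefl e t x))"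
    by (rule nn_integral_refl[OF e, symmetric]) measurable
  also have "... = (NN x. ennreal (h (hrefl e t x)) * indicator {x. t < e \<bullet> x} x)"
    by (intro nn_integral_cong) (auto simp: indicator_def inner_refl[OF e])
  finally show ?thesis by simp
qed

text \<open>If both sides carry the same mass, the dichotomy compares two functions of equal finite
  integral, so they agree.\<close>

lemma half_mass_symmetric:
  assumes h: "ismax h" and e: "norm e = 1"
    and half: "hmass h e t = (NN x. ennreal (h x) * indicator {x. e \<bullet> x < t} x)"
  shows "AE x in lborel. h (hrefl e t x) = h x"
proof -
  have ah: "adm h" using h by (simp add: ismax_def)
  then have [measurable]: "h \<in> Borel" and nn: "!!x. 0 <= h x" by (auto simp: adm_def)
  have "hmass h e t <= mass h" unfolding hmass_def mass_def by (intro nn_integral_mono) (auto simp: indicator_def)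
  then have fin: "hmass h e t ~= \<infinity>" using ah by (auto simp: adm_def top_unique)
  have eq: "(NN x. ennreal (h (hrefl e t x)) * indicator {x. t < e \<bullet> x} x) = hmass h e t"
    using hmass_hrefl[OF _ e, of h t] half by simp
  have "AE x in lborel. ennreal (h (hrefl e t x)) * indicator {x. t < e \<bullet> x} x = ennreal (h x) * indicator {x. t < e \<bullet> x} x"
    using maximizer_dichotomy[OF h e, of t]
  proof
    assume "AE x in lborel. t <= e \<bullet> x --> h (hrefl e t x) <= h x"
    then have "AE x in lborel. ennreal (h (hrefl e t x)) * indicator {x. t < e \<bullet> x} x <= ennreal (h x) * indicator {x. t < e \<bullet> x} x"
      by eventually_elim (auto simp: indicator_def intro: ennreal_leI)
    then show ?thesis using eq fin by (intro AE_eq_of_nn_integral_le) (auto simp: hmass_def)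
  next
    assume "AE x in lborel. t <= e \<bullet> x --> h x <= h (hrefl e t x)"
    then have "AE x in lborel. ennreal (h x) * indicator {x. t < e \<bullet> x} x <= ennreal (h (hrefl e t x)) * indicator {x. t < e \<bullet> x} x"
      by eventually_elim (auto simp: indicator_def intro: ennreal_leI)
    then have "AE x in lborel. ennreal (h x) * indicator {x. t < e \<bullet> x} x = ennreal (h (hrefl e t x)) * indicator {x. t < e \<bullet> x} x"
      using eq fin by (intro AE_eq_of_nn_integral_le) (auto simp: hmass_def)
    then show ?thesis by eventually_elim simp
  qed
  then have 1: "AE x in lborel. t < e \<bullet> x --> h (hrefl e t x) = h x"
    by eventually_elim (use nn in auto)
  from 1 AE_refl[OF e 1, of t] AE_not_hyperplane[OF e, of t] show ?thesis
  proof eventually_elim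
    case (elim x)
    then show ?case using e by (cases "t < e \<bullet> x") (auto simp: inner_refl)
  qed
qed

text \<open>Intermediate value theorem for the mass of a half-space as a function of
  \<open>t\<close>, continuous because hyperplanes are null.\<close>

lemma half_mass_hyperplane:
  assumes h: "ismax h" and e: "norm e = 1"
  shows "\<exists>t. AE x in lborel. h (hrefl e t x) = h x"
proof -
  have ah: "adm h" using h by (simp add: ismax_def)
  then have [measurable]: "h \<in> Borel" and nn: "!!x. 0 <= h x" by (auto simp: adm_def)
  obtain A where A: "mass h = ennreal A" "0 < A" using ismax_constants[OF h] by metis
  have le: "hmass h e t <= ennreal A" for t
    unfolding hmass_def A(1)[symmetric] mass_def by (intro nn_integral_mono) (auto simp: indicator_def)
  define G where "G t = enn2real (hmass h e t)" for t
  have "hmass h e t < \<infinity>" for t using le[of t] by (auto intro: le_less_trans)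
  then have Geq: "hmass h e t = ennreal (G t)" for t by (simp add: G_def)
  have G0: "0 <= G t" for t by (simp add: G_def)
  have lim: "(%n. hmass h e (u n)) \<longlonglongrightarrow> (NN x. ennreal (h x) * i x)"
    if "AE x in lborel. (%n::nat. indicator {x. u n < e \<bullet> x} x :: ennreal) \<longlonglongrightarrow> i x" and [measurable]: "i \<in> Borel" and i: "!!x. i x ~= \<infinity>" for u i
    unfolding hmass_def
  proof (rule nn_integral_dominated_convergence[where w="%x. ennreal (h x)"])
    show "AE x in lborel. (%n. ennreal (h x) * indicator {x. u n < e \<bullet> x} x) \<longlonglongrightarrow> ennreal (h x) * i x"
      using that(1) by eventually_elim (intro tendsto_mult_ennreal tendsto_const; use i in simp)
    show "(NN x. ennreal (h x)) < \<infinity>" using A by (simp add: mass_def)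
  qed (auto simp: indicator_def)
  have "continuous_on UNIV G"
  proof (rule continuous_at_imp_continuous_on, rule ballI)
    fix t
    show "isCont G t"
      unfolding continuous_at_sequentially comp_def
    proof (intro allI impI)
      fix u :: "nat => real" assume u: "u \<longlonglongrightarrow> t"
      have "(%n. hmass h e (u n)) \<longlonglongrightarrow> (NN x. ennreal (h x) * indicator {x. t < e \<bullet> x} x)"
      proof (rule lim)
        show "AE x in lborel. (%n. indicator {x. u n < e \<bullet> x} x :: ennreal) \<longlonglongrightarrow> indicator {x. t < e \<bullet> x} x"
          using AE_not_hyperplane[OF e, of t]
        proof eventually_elim
          case (elim x)
          have "eventually (%n. u n < e \<bullet> x \<longleftrightarrow> t < e \<bullet> x) sequentially"
            using order_tendstoD[OF u, of "e \<bullet> x"] elim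
            by (cases "t < e \<bullet> x") (auto elim!: eventually_mono)
          then show ?case by (intro tendsto_eventually) (auto elim!: eventually_mono simp: indicator_def)
        qed
      qed (auto simp: indicator_def)
      then have "(%n. hmass h e (u n)) \<longlonglongrightarrow> ennreal (G t)" by (simp add: Geq[symmetric] hmass_def)
      then show "(%n. G (u n)) \<longlonglongrightarrow> G t" unfolding G_def using G0[of t] by (intro tendsto_enn2real) (auto simp: G_def)
    qed
  qed
  moreover have "\<exists>t. G t < A / 2"
  proof -
    have "(%n. hmass h e (real n)) \<longlonglongrightarrow> (NN x. ennreal (h x) * 0)"
    proof (rule lim)
      show "AE x in lborel. (%n. indicator {x. real n < e \<bullet> x} x :: ennreal) \<longlonglongrightarrow> 0"
      proof (intro AE_I2 tendsto_eventually)
        fix x obtain n0 :: nat where "e \<bullet> x <= n0" using real_arch_simple by blast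
        then show "\<forall>\<^sub>F n in sequentially. indicator {x. real n < e \<bullet> x} x = (0::ennreal)"
          by (intro eventually_sequentiallyI[of n0]) (auto simp: indicator_def)
      qed
    qed auto
    then have "\<forall>\<^sub>F n in sequentially. hmass h e (real n) < ennreal (A / 2)"
      using A by (intro order_tendstoD(2)[where y="NN x. ennreal (h x) * 0"]) auto
    then show ?thesis using A by (auto simp: eventually_sequentially Geq ennreal_less_iff G0)
  qed
  moreover have "\<exists>t. A / 2 < G t"
  proof -
    have "(%n. hmass h e (- real n)) \<longlonglongrightarrow> (NN x. ennreal (h x) * 1)"
    proof (rule lim)
      show "AE x in lborel. (%n. indicator {x. - real n < e \<bullet> x} x :: ennreal) \<longlonglongrightarrow> 1"
      proof (intro AE_I2 tendsto_eventually)
        fix x obtain n0 :: nat where "- (e \<bullet> x) < n0" using reals_Archimedean2 by blast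
        then show "\<forall>\<^sub>F n in sequentially. indicator {x. - real n < e \<bullet> x} x = (1::ennreal)"
          by (intro eventually_sequentiallyI[of n0]) (auto simp: indicator_def)
      qed
    qed auto
    then have "(%n. hmass h e (- real n)) \<longlonglongrightarrow> ennreal A" by (simp add: A(1)[symmetric] mass_def)
    moreover have "ennreal (A / 2) < ennreal A" using A by (intro ennreal_lessI) auto
    ultimately have "\<forall>\<^sub>F n in sequentially. ennreal (A / 2) < hmass h e (- real n)" by (rule order_tendstoD)
    then show ?thesis using A by (auto simp: eventually_sequentially Geq ennreal_less_iff)
  qed
  ultimately obtain t0 t1 where G01: "continuous_on UNIV G" "G t0 < A / 2" "A / 2 < G t1" by blast
  have "A / 2 \<in> range G"
    by (rule connectedD_interval[OF connected_continuous_image[OF G01(1) connected_UNIV], of "G t0" "G t1"]) (use G01 in auto)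
  then obtain t where t: "G t = A / 2" by (metis imageE)
  have "ennreal (A / 2) + (NN x. ennreal (h x) * indicator {x. e \<bullet> x < t} x) = ennreal (A / 2) + ennreal (A / 2)"
    using hmass_add[of h e t] e A t by (simp add: Geq ennreal_plus[symmetric] del: ennreal_plus)
  then have "hmass h e t = (NN x. ennreal (h x) * indicator {x. e \<bullet> x < t} x)"
    by (simp add: ennreal_add_left_cancel Geq t)
  then show ?thesis using half_mass_symmetric[OF h e] by blast
qed

lemma ismax_translate:
  assumes h: "ismax h"
  shows "ismax (%x. h (x + a))"
proof -
  have ah: "adm h" using h by (simp add: ismax_def)
  then have [measurable]: "h \<in> Borel" and nn: "!!x. 0 <= h x" by (auto simp: adm_def)
  have mm: "mass (%x. h (x + a)) = mass h" "mpow (%x. h (x + a)) = mpow h"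
    unfolding mass_def mpow_def
    using nn_integral_lborel_translate[of "%x. ennreal (h x)" a] nn_integral_lborel_translate[of "%x. ennreal (h x powr m)" a] by simp_all
  have "rpotr s (%x. h (x + a)) x = rpotr s h (x + a)" for x
    using rpot_translate[of h "- a" x] by (simp add: rpotr_def)
  then have "energy s q (%x. h (x + a)) = energy s q h"
    unfolding energy_def using nn_integral_lborel_translate[of "%x. ennreal (rpotr s h x powr q)" a] by simp
  then show ?thesis using h mm nn by (simp add: ismax_def adm_def nrm_def)
qed

text \<open>The reflections in the median hyperplanes of the coordinate directions compose to the
  point reflection about their common point \<open>a\<close>.\<close>

lemma maximizer_centered:
  assumes h: "ismax h"
  shows "\<exists>a. AE x in lborel. h (a - x) = h (a + x)"
proof -
  have "\<forall>b\<in>Basis. \<exists>t. AE x in lborel. h (hrefl b t x) = h x" using half_mass_hyperplane[OF h] by simp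
  then obtain t where t: "!!b. b \<in> Basis ==> AE x in lborel. h (hrefl b (t b) x) = h x" by metis
  define a where "a = (\<Sum>b\<in>Basis. t b *\<^sub>R b)"
  have ab: "b \<bullet> a = t b" if "b \<in> Basis" for b using that by (subst inner_commute) (simp add: a_def)
  \<comment> \<open>\<open>R F\<close> flips the coordinates in \<open>F\<close>. The induction also
    carries preservation of null sets, which permits substitution into a.e. statements.\<close>
  define R where "R F x = x - (\<Sum>b\<in>F. (2 * (b \<bullet> x)) *\<^sub>R b)" for F and x :: 'a
  have "(\<forall>P. (AE x in lborel. P x) --> (AE x in lborel. P (R F x))) \<and> (AE x in lborel. h (a + R F x) = h (a + x))"
    if "finite F" "F \<subseteq> Basis" for F
    using that
  proof (induction F rule: finite_induct)
    case empty
    then show ?case by (simp add: R_def)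
  next
    case (insert b F)
    have b: "b \<in> Basis" "norm b = 1" using insert by auto
    have RR: "R (insert b F) x = hrefl b 0 (R F x)" for x
    proof -
      have "b \<bullet> R F x = b \<bullet> x - (\<Sum>c\<in>F. 2 * (c \<bullet> x) * (b \<bullet> c))"
        by (simp add: R_def inner_diff_right inner_sum_right)
      also have "(\<Sum>c\<in>F. 2 * (c \<bullet> x) * (b \<bullet> c)) = 0"
      proof (intro sum.neutral ballI)
        fix c assume "c \<in> F"
        then have "c \<in> Basis" "c ~= b" using insert by auto
        then show "2 * (c \<bullet> x) * (b \<bullet> c) = 0" using b by (simp add: inner_Basis)
      qed
      finally show ?thesis using insert by (simp add: R_def hrefl_def)
    qed
    have 1: "AE x in lborel. P (R (insert b F) x)" if P: "AE x in lborel. P x" for P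
      using insert AE_refl[OF b(2) P, of 0] unfolding RR by blast
    have "AE x in lborel. h (hrefl b (t b) (x + a)) = h (x + a)" by (rule AE_translate[OF t[OF b(1)]])
    then have "AE x in lborel. h (a + hrefl b 0 x) = h (a + x)"
      by eventually_elim (simp add: hrefl_def inner_add_right ab[OF b(1)] algebra_simps)
    then have "AE x in lborel. h (a + hrefl b 0 (R F x)) = h (a + R F x)" using insert by blast
    moreover have "AE x in lborel. h (a + R F x) = h (a + x)" using insert by blast
    ultimately have "AE x in lborel. h (a + R (insert b F) x) = h (a + x)"
      unfolding RR by eventually_elim simp
    with 1 show ?case by blast
  qed
  from this[of Basis] have "AE x in lborel. h (a + R Basis x) = h (a + x)" by simp
  moreover have "R Basis x = - x" for x
  proof -
    have "(\<Sum>b\<in>Basis. (2 * (b \<bullet> x)) *\<^sub>R b) = 2 *\<^sub>R x"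
      using euclidean_representation[of x]
      unfolding scaleR_scaleR[symmetric] scaleR_sum_right[symmetric] inner_commute[of _ x] by simp
    then show ?thesis by (simp add: R_def scaleR_2)
  qed
  ultimately show ?thesis by auto
qed

text \<open>By evenness every hyperplane through 0 halves the mass, so for \<open>t <= 0\<close> the
  preferred side has at least half of it. The wrong alternative of the dichotomy then squeezes both
  sides to equal mass, and \<open>half_mass_symmetric\<close> gives equality.\<close>

lemma maximizer_reflections:
  assumes h: "ismax h" and even: "AE x in lborel. h (- x) = h x" and e: "norm e = 1" and t: "t <= 0"
  shows "AE x in lborel. t <= e \<bullet> x --> h (hrefl e t x) <= h x"
proof -
  have ah: "adm h" using h by (simp add: ismax_def)
  then have [measurable]: "h \<in> Borel" and nn: "!!x. 0 <= h x" by (auto simp: adm_def)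
  let ?L = "%t. (NN x. ennreal (h x) * indicator {x. e \<bullet> x < t} x)"
  have "?L 0 = (NN x. ennreal (h (0 - x)) * indicator {x. e \<bullet> x < 0} (0 - x))"
    by (rule nn_integral_lborel_reflect[symmetric]) measurable
  also have "... = hmass h e 0"
    unfolding hmass_def by (rule nn_integral_cong_AE, use even in eventually_elim) (auto simp: indicator_def)
  finally have half: "?L 0 = hmass h e 0" .
  have mono: "hmass h e 0 <= hmass h e t" "?L t <= ?L 0"
    unfolding hmass_def using t by (intro nn_integral_mono; auto simp: indicator_def)+
  show ?thesis
    using maximizer_dichotomy[OF h e, of t]
  proof
    assume "AE x in lborel. t <= e \<bullet> x --> h x <= h (hrefl e t x)"
    then have "hmass h e t <= (NN x. ennreal (h (hrefl e t x)) * indicator {x. t < e \<bullet> x} x)"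
      unfolding hmass_def by (intro nn_integral_mono_AE, elim eventually_mono) (auto simp: indicator_def intro: ennreal_leI)
    also have "... = ?L t" by (rule hmass_hrefl) (use e in simp_all)
    finally have "hmass h e t = ?L t" using mono half by auto
    then have "AE x in lborel. h (hrefl e t x) = h x" by (rule half_mass_symmetric[OF h e])
    then show ?thesis by eventually_elim simp
  qed
qed

text \<open>\<open>f\<close> agrees a.e. with its own polarization, so \<open>rpot_pol\<close>
  applies to \<open>f\<close> itself, at every point of the half-space.\<close>

lemma rpot_reflection_mono:
  assumes [measurable]: "f \<in> Borel" and nn: "!!x. 0 <= f x" and e: "norm e = 1"
    and f: "AE x in lborel. t <= e \<bullet> x --> f (hrefl e t x) <= f x" and x: "t <= e \<bullet> (x::'a)"
  shows "rpot s f (hrefl e t x) <= rpot s f x"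
proof -
  have "AE x in lborel. pol e t f x = f x"
    using f AE_refl[OF e f, of t]
    by eventually_elim (use e in \<open>auto simp: pol_def max_def min_def inner_refl\<close>)
  then have "rpot s (pol e t f) x = rpot s f x" by (rule rpot_cong_AE)
  then show ?thesis using rpot_pol(2)[OF e assms(1) nn x] by simp
qed

text \<open>Reflection monotonicity passes through the inner potential, the increasing power and the
  outer potential. The result holds for every pair of points, which is what singles out a good
  representative of \<open>h\<close>.\<close>

theorem Psi_radial_nonincr:
  assumes h: "ismax h" and even: "AE x in lborel. h (- x) = h x" and le: "norm y <= norm z"
  shows "Psi h z <= Psi h y"
proof (cases "y = z")
  case False
  have ah: "adm h" using h by (simp add: ismax_def)
  then have [measurable]: "h \<in> Borel" and nn: "!!x. 0 <= h x" by (auto simp: adm_def)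
  obtain e t where e: "norm e = 1" and t: "t <= 0" and y: "t <= e \<bullet> y" "hrefl e t y = z"
    using bisecting_reflection[OF False le] by metis
  have le: "rpot s h (hrefl e t x) <= rpot s h x" if "t <= e \<bullet> x" for x
    by (rule rpot_reflection_mono[OF _ nn e maximizer_reflections[OF h even e t] that]) simp
  have "AE x in lborel. t <= e \<bullet> x --> dens h (hrefl e t x) <= dens h x"
    using adm_rpot_finite[OF ah]
    by eventually_elim (use le q_gt_1 in \<open>auto simp: dens_def rpotr_def intro!: powr_mono2 enn2real_mono\<close>)
  then have "rpot s (dens h) (hrefl e t y) <= rpot s (dens h) y"
    by (intro rpot_reflection_mono e y) auto
  then show ?thesis by (simp add: y Psi_def)
qed simp

end

subsection \<open>Hoelder continuity of Riesz potentials\<close>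

text \<open>With \<open>\<rho> = r * (1 + \<tau>)\<close> the relative difference is at most 1 and
  at most \<open>a * \<tau>\<close>; interpolation between the two bounds gives the power
  \<open>\<alpha>\<close>.\<close>

lemma powr_neg_diff_le:
  fixes r \<rho> :: real
  assumes r: "0 < r" "r <= \<rho>" and a: "0 < a" and \<alpha>: "0 < \<alpha>" "\<alpha> <= 1"
  shows "r powr - a - \<rho> powr - a <= max 1 a * (\<rho> - r) powr \<alpha> * r powr - (a + \<alpha>)"
proof -
  define \<tau> where "\<tau> = (\<rho> - r) / r"
  have \<tau>: "0 <= \<tau>" "\<rho> = r * (1 + \<tau>)" using r by (auto simp: \<tau>_def field_simps)
  have "1 - a * \<tau> <= 1 + (- a * ln (1 + \<tau>))"
    using \<tau> a ln_add_one_self_le_self[of \<tau>] by simp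
  also have "... <= exp (- a * ln (1 + \<tau>))" by (rule exp_ge_add_one_self)
  also have "... = (1 + \<tau>) powr - a" using \<tau> by (simp add: powr_def)
  finally have 1: "1 - (1 + \<tau>) powr - a <= a * \<tau>" by simp
  have "1 - (1 + \<tau>) powr - a <= max 1 a * \<tau> powr \<alpha>"
  proof (cases "\<tau> <= 1")
    case True
    have "\<tau> <= \<tau> powr \<alpha>"
    proof (cases "\<tau> = 0")
      case False
      then have "\<tau> powr 1 <= \<tau> powr \<alpha>" using True \<tau> \<alpha> by (intro powr_mono') auto
      then show ?thesis using \<tau> by simp
    qed simp
    then have "a * \<tau> <= max 1 a * \<tau> powr \<alpha>" using a \<tau> by (intro mult_mono) auto
    with 1 show ?thesis by simp
  next
    case False
    then have "1 <= \<tau> powr \<alpha>" using \<alpha> by (intro ge_one_powr_ge_zero) auto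
    then have "1 * 1 <= max 1 a * \<tau> powr \<alpha>" by (intro mult_mono) auto
    moreover have "1 - (1 + \<tau>) powr - a <= 1" by simp
    ultimately show ?thesis by linarith
  qed
  then have "r powr - a * (1 - (1 + \<tau>) powr - a) <= r powr - a * (max 1 a * \<tau> powr \<alpha>)"
    by (intro mult_left_mono) auto
  also have "r powr - a * (1 - (1 + \<tau>) powr - a) = r powr - a - \<rho> powr - a"
    using r \<tau> by (simp add: \<tau>(2) powr_mult right_diff_distrib)
  also have "r powr - a * (max 1 a * \<tau> powr \<alpha>) = max 1 a * (\<rho> - r) powr \<alpha> * r powr - (a + \<alpha>)"
  proof -
    have "\<tau> powr \<alpha> = (\<rho> - r) powr \<alpha> * r powr - \<alpha>"
      using r by (simp add: \<tau>_def powr_divide powr_minus divide_simps)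
    moreover have "r powr - (a + \<alpha>) = r powr - a * r powr - \<alpha>" by (simp add: powr_add[symmetric])
    ultimately show ?thesis by simp
  qed
  finally show ?thesis .
qed

lemma norm_powr_diff_le:
  fixes x y :: "'a::real_normed_vector"
  assumes xy: "x ~= 0" "y ~= 0" and a: "0 < a" and \<alpha>: "0 < \<alpha>" "\<alpha> <= 1"
  shows "\<bar>norm x powr - a - norm y powr - a\<bar> <= max 1 a * norm (x - y) powr \<alpha> * (norm x powr - (a + \<alpha>) + norm y powr - (a + \<alpha>))"
proof -
  have *: "\<bar>norm x powr - a - norm y powr - a\<bar> <= max 1 a * norm (x - y) powr \<alpha> * (norm x powr - (a + \<alpha>) + norm y powr - (a + \<alpha>))"
    if "norm x <= norm y" "x ~= 0" for x y :: 'a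
  proof -
    have "norm y powr - a <= norm x powr - a" using that a by (intro powr_mono2') auto
    then have "\<bar>norm x powr - a - norm y powr - a\<bar> = norm x powr - a - norm y powr - a" by simp
    also have "... <= max 1 a * (norm y - norm x) powr \<alpha> * norm x powr - (a + \<alpha>)"
      using that a \<alpha> by (intro powr_neg_diff_le) auto
    also have "... <= max 1 a * norm (x - y) powr \<alpha> * norm x powr - (a + \<alpha>)"
      using that \<alpha> norm_triangle_ineq2[of y x]
      by (intro mult_right_mono mult_left_mono powr_mono2) (auto simp: norm_minus_commute)
    also have "... <= max 1 a * norm (x - y) powr \<alpha> * (norm x powr - (a + \<alpha>) + norm y powr - (a + \<alpha>))"
      by (intro mult_left_mono) auto
    finally show ?thesis .
  qed
  show ?thesis
  proof (cases "norm x <= norm y")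
    case False
    then show ?thesis using *[of y x] xy(2)
      by (simp only: norm_minus_commute[of y x] abs_minus_commute[of "norm y powr - a"] add.commute[of "norm y powr - (a + \<alpha>)"]) simp
  qed (rule * [OF _ xy(1)])
qed

context riesz
begin

lemma nn_integral_powr_unit_ball:
  assumes "b < N"
  shows "(NN x. ennreal (norm x powr - b) * indicator (ball (0::'a) 1) x) < \<infinity>"
proof -
  obtain C where "\<forall>r>0. (NN x. ennreal (norm x powr - b) * indicator (ball (0::'a) r) x) <= ennreal (C * r powr (N - b))"
    using nn_integral_norm_powr_ball[where 'a='a, folded N_eq, OF assms] by blast
  from this[rule_format, of 1] show ?thesis by (simp add: le_less_trans)
qed

lemma nn_integral_powr_compl_unit_ball:
  assumes "N < b"
  shows "(NN x. ennreal (norm x powr - b) * indicator (- ball (0::'a) 1) x) < \<infinity>"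
proof -
  obtain C where "\<forall>r>0. (NN x. ennreal (norm x powr - b) * indicator (- ball (0::'a) r) x) <= ennreal (C * r powr (N - b))"
    using nn_integral_norm_powr_compl_ball[where 'a='a, folded N_eq, OF assms] by blast
  from this[rule_format, of 1] show ?thesis by (simp add: le_less_trans)
qed

text \<open>\<open>\<alpha> = 0\<close> serves for boundedness, \<open>\<alpha> > 0\<close> for
  Hoelder estimates, where a difference of kernels is more singular by \<open>\<alpha>\<close>. The
  condition \<open>\<alpha> < s\<close> keeps the pole integrable,
  \<open>s - \<alpha> < \<gamma>\<close> the tail.\<close>

lemma potential_uniform_bound:
  assumes \<alpha>: "0 <= \<alpha>" "\<alpha> < s" and \<gamma>: "s - \<alpha> < \<gamma>" and M: "0 <= M" "0 <= D"
  shows "\<exists>C\<ge>0. \<forall>f::'a => real. (\<forall>x. f x <= M) --> (\<forall>x. x ~= 0 --> f x <= D * norm x powr - \<gamma>) -->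
    (\<forall>x. (NN z. ennreal (norm (x - z) powr - (N - s + \<alpha>) * f z)) <= ennreal C)"
proof -
  define e where "e = N - s + \<alpha>"
  have e: "0 < e" "e < N" "N < e + \<gamma>" using \<alpha> \<gamma> s_less by (auto simp: e_def)
  define F where "F c B y = ennreal (norm y powr - c) * indicator B y" for c B and y :: 'a
  have [measurable]: "F c (ball 0 r) \<in> Borel" "F c (- ball 0 r) \<in> Borel" for c r
    unfolding F_def by (auto intro!: borel_measurable_times_ennreal borel_measurable_indicator)
  have "(NN y. F e (ball 0 1) y) < \<infinity>"
    unfolding F_def by (rule nn_integral_powr_unit_ball[OF e(2)])
  then obtain I1 where I1: "(NN y. F e (ball 0 1) y) = ennreal I1" "0 <= I1"
    by (cases "NN y. F e (ball 0 1) y") auto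
  have "(NN y. F (e + \<gamma>) (- ball 0 1) y) < \<infinity>"
    unfolding F_def by (rule nn_integral_powr_compl_unit_ball[OF e(3)])
  then obtain I2 where I2: "(NN y. F (e + \<gamma>) (- ball 0 1) y) = ennreal I2" "0 <= I2"
    by (cases "NN y. F (e + \<gamma>) (- ball 0 1) y") auto
  obtain I3 where I3: "emeasure lborel (ball (0::'a) 1) = ennreal I3" "0 <= I3"
    using emeasure_lborel_ball_finite[of "0::'a" 1] by (cases "emeasure lborel (ball (0::'a) 1)") auto
  show ?thesis
  proof (intro exI[of _ "M * I1 + M * I3 + D * I2 + D * I2"] conjI allI impI)
    show "0 <= M * I1 + M * I3 + D * I2 + D * I2" using M I1 I2 I3 by simp
    fix f :: "'a => real" and x :: 'a
    assume fM: "\<forall>x. f x <= M" and fD: "\<forall>x. x ~= 0 --> f x <= D * norm x powr - \<gamma>"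
    have "(NN z. ennreal (norm (x - z) powr - e * f z)) <=
      (NN z. ennreal M * F e (ball 0 1) (x - z) + ennreal M * indicator (ball 0 1) z
        + ennreal D * F (e + \<gamma>) (- ball 0 1) (x - z) + ennreal D * F (e + \<gamma>) (- ball 0 1) z)"
    proof (intro nn_integral_mono)
      fix z
      show "ennreal (norm (x - z) powr - e * f z) <= ennreal M * F e (ball 0 1) (x - z) + ennreal M * indicator (ball 0 1) z
        + ennreal D * F (e + \<gamma>) (- ball 0 1) (x - z) + ennreal D * F (e + \<gamma>) (- ball 0 1) z"
      proof (cases "norm (x - z) < 1")
        case True
        have "norm (x - z) powr - e * f z <= norm (x - z) powr - e * M" using fM by (intro mult_left_mono) auto
        then have "ennreal (norm (x - z) powr - e * f z) <= ennreal M * F e (ball 0 1) (x - z)"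
          using True M by (simp add: F_def ennreal_mult[symmetric] mult.commute ennreal_leI)
        then show ?thesis by (simp add: add_increasing2 add.assoc)
      next
        case far: False
        then have le1: "norm (x - z) powr - e <= 1" using powr_mono2'[of "- e" 1 "norm (x - z)"] e by simp
        show ?thesis
        proof (cases "norm z < 1")
          case True
          have "norm (x - z) powr - e * f z <= norm (x - z) powr - e * M" using fM by (intro mult_left_mono) auto
          also have "... <= 1 * M" using le1 M by (intro mult_right_mono) auto
          finally have "ennreal (norm (x - z) powr - e * f z) <= ennreal M * indicator (ball 0 1) z"
            using True by (simp add: ennreal_leI)
          then show ?thesis by (simp add: add_increasing2 add_increasing add.assoc)
        next
          case False
          then have z: "z ~= 0" "1 <= norm z" by auto
          have "0 < \<gamma>" using \<alpha> \<gamma> by simp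
          \<comment> \<open>Away from both poles the product of powers is at most one power of the
            smaller distance, hence at most a sum of two integrable tails.\<close>
          define r where "r = min (norm (x - z)) (norm z)"
          have r: "0 < r" "r <= norm (x - z)" "r <= norm z" using far z by (auto simp: r_def)
          have "norm (x - z) powr - e * f z <= norm (x - z) powr - e * (D * norm z powr - \<gamma>)"
            using fD z by (intro mult_left_mono) auto
          also have "... <= r powr - e * (D * r powr - \<gamma>)"
            using r e \<open>0 < \<gamma>\<close> M by (intro mult_mono powr_mono2') auto
          also have "... = D * r powr - (e + \<gamma>)" by (simp add: powr_add[symmetric])
          also have "... <= D * (norm (x - z) powr - (e + \<gamma>) + norm z powr - (e + \<gamma>))"
            using M by (intro mult_left_mono) (auto simp: r_def min_def)
          finally have "ennreal (norm (x - z) powr - e * f z) <= ennreal D * F (e + \<gamma>) (- ball 0 1) (x - z) + ennreal D * F (e + \<gamma>) (- ball 0 1) z"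
            using far False M by (simp add: F_def ennreal_mult[symmetric] ennreal_plus[symmetric] distrib_left ennreal_leI del: ennreal_plus)
          then show ?thesis by (simp add: add_increasing add.assoc)
        qed
      qed
    qed
    also have "... = ennreal M * (NN z. F e (ball 0 1) (x - z)) + ennreal M * emeasure lborel (ball (0::'a) 1)
        + ennreal D * (NN z. F (e + \<gamma>) (- ball 0 1) (x - z)) + ennreal D * (NN z. F (e + \<gamma>) (- ball 0 1) z)"
    proof -
      have [measurable]: "(%z::'a. indicator (ball 0 1) z :: ennreal) \<in> Borel" by (intro borel_measurable_indicator) simp
      show ?thesis
        by (subst nn_integral_add, simp, simp)+ (simp add: nn_integral_cmult nn_integral_cmult_indicator)
    qed
    also have "(NN z. F e (ball 0 1) (x - z)) = ennreal I1"
      unfolding I1(1)[symmetric] by (rule nn_integral_lborel_reflect) simp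
    also have "(NN z. F (e + \<gamma>) (- ball 0 1) (x - z)) = ennreal I2"
      unfolding I2(1)[symmetric] by (rule nn_integral_lborel_reflect) simp
    finally show "(NN z. ennreal (norm (x - z) powr - (N - s + \<alpha>) * f z)) <= ennreal (M * I1 + M * I3 + D * I2 + D * I2)"
      using M I1 I2 I3 by (simp add: e_def[symmetric] ennreal_mult[symmetric] ennreal_plus[symmetric] del: ennreal_plus)
  qed
qed

lemma rpot_bounded:
  assumes M: "0 <= M" "0 <= D" and \<gamma>: "s < \<gamma>" and f: "!!x. f x <= M" "!!x. x ~= 0 ==> f x <= D * norm x powr - \<gamma>"
    and fm: "f \<in> Borel"
  shows "\<exists>C\<ge>0. \<forall>x::'a. rpot s f x <= ennreal C"
proof -
  obtain C where C: "0 <= C" "!!x. (NN z. ennreal (norm (x - z) powr - (N - s + 0) * f z)) <= ennreal C"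
    using potential_uniform_bound[of 0 \<gamma> M D] s_pos \<gamma> M f by (auto simp: simp del: )
  have [measurable]: "f \<in> Borel" by fact
  have "rpot s f x <= ennreal (kc * C)" for x :: 'a
  proof -
    have "rpot s f x = ennreal kc * (NN z. ennreal (norm (x - z) powr - (N - s + 0) * f z))"
      unfolding rpot_def using kc_pos
      by (subst nn_integral_cmult[symmetric]) (auto simp: K_eq ennreal_mult'[symmetric] mult.assoc)
    also have "... <= ennreal kc * ennreal C" by (intro mult_left_mono C) simp
    finally show ?thesis using kc_pos C by (simp add: ennreal_mult)
  qed
  then show ?thesis using kc_pos C by (intro exI[of _ "kc * C"]) auto
qed

lemma rpotr_eq_integral:
  assumes [measurable]: "f \<in> Borel" and nn: "!!x. 0 <= f x" and fin: "rpot s f (x::'a) < \<infinity>"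
  shows "integrable lborel (%y. K (x - y) * f y)" "rpotr s f x = (LINT y|lborel. K (x - y) * f y)"
proof -
  show "integrable lborel (%y. K (x - y) * f y)"
    by (rule integrableI_nonneg) (use nn fin in \<open>auto simp: rpot_def\<close>)
  show "rpotr s f x = (LINT y|lborel. K (x - y) * f y)"
    unfolding rpotr_def rpot_def by (rule integral_eq_nn_integral[symmetric]) (use nn in auto)
qed

text \<open>The kernel difference is estimated by \<open>norm_powr_diff_le\<close> and then
  integrated with \<open>potential_uniform_bound\<close>, once with pole \<open>x\<close> and once
  with pole \<open>y\<close>.\<close>

lemma rpotr_holder:
  assumes M: "0 <= M" "0 <= D" and \<gamma>: "s < \<gamma>" and f: "!!x. 0 <= f x" "!!x. f x <= M" "!!x. x ~= 0 ==> f x <= D * norm x powr - \<gamma>"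
    and [measurable]: "f \<in> Borel" and \<alpha>: "0 < \<alpha>" "\<alpha> <= 1" "\<alpha> < s"
  shows "\<exists>C\<ge>0. \<forall>x y::'a. \<bar>rpotr s f x - rpotr s f y\<bar> <= C * dist x y powr \<alpha>"
proof -
  obtain C0 where C0: "!!x::'a. rpot s f x <= ennreal C0"
    using rpot_bounded[OF M \<gamma> f(2,3)] by auto
  have fin: "rpot s f x < \<infinity>" for x :: 'a using C0[of x] by (auto intro: le_less_trans)
  note int = rpotr_eq_integral[OF assms(7) f(1) fin]
  obtain C1 where C1: "0 <= C1" "!!x::'a. (NN z. ennreal (norm (x - z) powr - (N - s + \<alpha>) * f z)) <= ennreal C1"
    using potential_uniform_bound[of \<alpha> \<gamma> M D] \<alpha> \<gamma> M f by auto
  define c where "c = kc * max 1 (N - s)"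
  have c: "0 < c" using kc_pos by (simp add: c_def)
  have "\<bar>rpotr s f x - rpotr s f y\<bar> <= (c * (C1 + C1)) * dist x y powr \<alpha>" for x y :: 'a
  proof -
    let ?W = "%x z. norm (x - z) powr - (N - s + \<alpha>) * f z"
    have "ennreal \<bar>rpotr s f x - rpotr s f y\<bar> = ennreal (norm (LINT z|lborel. K (x - z) * f z - K (y - z) * f z))"
      by (simp add: int)
    also have "... <= (NN z. ennreal (norm (K (x - z) * f z - K (y - z) * f z)))"
      by (rule integral_norm_bound_ennreal) (use int in auto)
    also have "... <= (NN z. ennreal (c * norm (x - y) powr \<alpha>) * (ennreal (?W x z) + ennreal (?W y z)))"
    proof (rule nn_integral_mono_AE, use AE_lborel_singleton[of x] AE_lborel_singleton[of y] in eventually_elim)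
      fix z assume z: "z ~= x" "z ~= y"
      have "\<bar>K (x - z) - K (y - z)\<bar> = kc * \<bar>norm (x - z) powr - (N - s) - norm (y - z) powr - (N - s)\<bar>"
        using kc_pos by (simp add: K_eq abs_mult right_diff_distrib[symmetric])
      also have "... <= kc * (max 1 (N - s) * norm ((x - z) - (y - z)) powr \<alpha> * (norm (x - z) powr - (N - s + \<alpha>) + norm (y - z) powr - (N - s + \<alpha>)))"
        using z s_less \<alpha> kc_pos by (intro mult_left_mono norm_powr_diff_le) auto
      finally have "\<bar>K (x - z) - K (y - z)\<bar> * f z <= c * norm (x - y) powr \<alpha> * (norm (x - z) powr - (N - s + \<alpha>) + norm (y - z) powr - (N - s + \<alpha>)) * f z"
        using f(1) by (intro mult_right_mono) (auto simp: c_def mult.assoc)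
      then have "norm (K (x - z) * f z - K (y - z) * f z) <= c * norm (x - y) powr \<alpha> * (?W x z + ?W y z)"
      proof -
        have "K (x - z) * f z - K (y - z) * f z = (K (x - z) - K (y - z)) * f z" by (simp add: left_diff_distrib)
        then have "norm (K (x - z) * f z - K (y - z) * f z) = \<bar>K (x - z) - K (y - z)\<bar> * f z"
          using f(1)[of z] by (simp add: abs_mult)
        then show ?thesis using \<open>\<bar>K (x - z) - K (y - z)\<bar> * f z <= _\<close> by (simp add: algebra_simps)
      qed
      then show "ennreal (norm (K (x - z) * f z - K (y - z) * f z)) <= ennreal (c * norm (x - y) powr \<alpha>) * (ennreal (?W x z) + ennreal (?W y z))"
        using f(1)[of z] c by (simp add: ennreal_mult[symmetric] ennreal_plus[symmetric] ennreal_leI del: ennreal_plus)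
    qed
    also have "... = ennreal (c * norm (x - y) powr \<alpha>) * ((NN z. ennreal (?W x z)) + (NN z. ennreal (?W y z)))"
      by (simp add: nn_integral_cmult nn_integral_add)
    also have "... <= ennreal (c * norm (x - y) powr \<alpha>) * (ennreal C1 + ennreal C1)"
      by (intro mult_left_mono add_mono C1) simp
    also have "... = ennreal ((c * (C1 + C1)) * dist x y powr \<alpha>)"
      using c C1(1) by (simp add: ennreal_mult[symmetric] ennreal_plus[symmetric] dist_norm ac_simps del: ennreal_plus)
    finally show ?thesis using c C1(1) by (subst (asm) ennreal_le_iff) auto
  qed
  then show ?thesis using c C1(1) by (intro exI[of _ "c * (C1 + C1)"]) auto
qed

end

subsection \<open>Decay, boundedness and compact support\<close>

context hls
begin

text \<open>For large \<open>b\<close> a statement about infinity, for small \<open>b\<close> about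
  a weak singularity at 0; \<open>decays_between\<close> interpolates.\<close>

definition decays :: "real => ('a => real) => bool" where
  "decays b g \<longleftrightarrow> (\<exists>C\<ge>0. \<forall>x. x ~= 0 --> g x <= C * norm x powr - b)"

lemma decays_between:
  assumes "decays b1 g" "decays b2 g" "b1 <= b" "b <= b2"
  shows "decays b g"
proof -
  obtain C1 where C1: "0 <= C1" "!!x. x ~= 0 ==> g x <= C1 * norm x powr - b1" using assms by (auto simp: decays_def)
  obtain C2 where C2: "0 <= C2" "!!x. x ~= 0 ==> g x <= C2 * norm x powr - b2" using assms by (auto simp: decays_def)
  have "g x <= (C1 + C2) * norm x powr - b" if x: "x ~= 0" for x
  proof (cases "1 <= norm x")
    case True
    have "g x <= C2 * norm x powr - b"
      using C2(2)[OF x] C2(1) True assms by (meson mult_left_mono neg_le_iff_le order_trans powr_mono)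
    also have "... <= (C1 + C2) * norm x powr - b" using C1 by (intro mult_right_mono) auto
    finally show ?thesis .
  next
    case False
    then have "norm x powr - b1 <= norm x powr - b" using x assms by (intro powr_mono') auto
    then have "g x <= C1 * norm x powr - b"
      using C1(2)[OF x] C1(1) by (meson mult_left_mono order_trans)
    also have "... <= (C1 + C2) * norm x powr - b" using C2 by (intro mult_right_mono) auto
    finally show ?thesis .
  qed
  then show ?thesis using C1(1) C2(1) unfolding decays_def by (intro exI[of _ "C1 + C2"]) auto
qed

lemma rpot_decays:
  assumes "decays b f" "s < b" "b < N"
  shows "\<exists>C\<ge>0. \<forall>x. x ~= 0 --> rpot s f x <= ennreal (C * norm x powr (s - b))"
proof -
  obtain C where C: "0 <= C" "\<forall>x. x ~= 0 --> f x <= C * norm x powr - b" using assms by (auto simp: decays_def)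
  show ?thesis using rpot_powr_bound[OF assms(2,3) C(1)] C(2) by blast
qed

lemma dens_decays:
  assumes "decays b f" "s < b" "b < N"
  shows "decays ((b - s) / (p - 1)) (dens f)"
proof -
  obtain C where C: "0 <= C" "!!x. x ~= 0 ==> rpot s f x <= ennreal (C * norm x powr (s - b))"
    using rpot_decays[OF assms] by blast
  have "dens f x <= C powr (q - 1) * norm x powr - ((b - s) / (p - 1))" if x: "x ~= 0" for x
  proof -
    have "rpotr s f x <= C * norm x powr (s - b)"
      unfolding rpotr_def using C x by (intro enn2real_leI) auto
    then have "dens f x <= (C * norm x powr (s - b)) powr (q - 1)"
      unfolding dens_def using q_gt_1 by (intro powr_mono2) auto
    also have "... = C powr (q - 1) * norm x powr - ((b - s) / (p - 1))"
      using C by (simp add: powr_mult powr_powr q_minus_1 diff_divide_distrib)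
    finally show ?thesis .
  qed
  then show ?thesis unfolding decays_def by (intro exI[of _ "C powr (q - 1)"]) auto
qed

text \<open>Product of the two powers by which decay exponents are divided: \<open>p - 1\<close> in
  passing to \<open>dens\<close>, \<open>m - 1\<close> in solving the Euler-Lagrange equation for
  \<open>h\<close>.\<close>

definition \<kappa> :: real where "\<kappa> = (m - 1) * (p - 1)"

lemma kappa_pos: "0 < \<kappa>" using m_gt_1 p_gt_1 by (simp add: \<kappa>_def)

lemma sp_less_b0: "s * p < b0"
proof -
  have "s * (p - 1) < N / p * (p - 1)" using sp_less p_gt_1 by (intro mult_strict_right_mono) (auto simp: field_simps)
  then show ?thesis using p_gt_1 by (simp add: b0_def q_eq algebra_simps)
qed

lemma b0_bound: "b0 < s + N * (p - 1)"
proof -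
  have "N * (p - 1) / p < N * (p - 1) / 1" using p_gt_1 N_pos by (intro divide_strict_left_mono) auto
  then show ?thesis by (simp add: b0_def q_eq)
qed

text \<open>The hypothesis \<open>m > N / b0\<close> once more, now as the statement that one round
  of the Euler-Lagrange equation improves the exponent \<open>b0\<close> at the origin.\<close>

lemma decay_gain: "(b0 - s * p) / \<kappa> < b0"
proof -
  have b0p: "b0 * p = N * (p - 1) + s * p" using p_gt_1 by (simp add: b0_eq)
  have "N < m * b0" using m_b0 m_gt_1 by (simp add: field_simps)
  then have "(N - b0) * (p - 1) < (m * b0 - b0) * (p - 1)" using p_gt_1 by (intro mult_strict_right_mono) auto
  also have "... = b0 * \<kappa>" by (simp add: \<kappa>_def algebra_simps)
  also have "(N - b0) * (p - 1) = b0 - s * p" using b0p by (simp add: algebra_simps)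
  finally show ?thesis using kappa_pos by (simp add: field_simps)
qed

text \<open>The exponent \<open>b\<close> drops by \<open>s\<close> under the potential, is divided
  by \<open>p - 1\<close>, drops by \<open>s\<close> again and is divided by \<open>m - 1\<close>,
  altogether \<open>(b - s * p) / \<kappa>\<close>. The subtracted \<open>C\<close> only
  helps.\<close>

lemma maximizer_decay_step:
  assumes g: "!!x. x ~= 0 ==> g x <= (a * max 0 (enn2real (Psi g x) - C)) powr (1 / (m - 1))" and aC: "0 < a" "0 < C"
    and D: "decays b g" and b: "s * p < b" "b <= b0"
  shows "decays ((b - s * p) / \<kappa>) g"
proof -
  have "s < s * p" using s_pos p_gt_1 by simp
  then have sb: "s < b" using b by linarith
  have bN: "b < N" using b b0_less_N by simp
  define b' where "b' = (b - s) / (p - 1)"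
  have b': "s < b'" "b' < N"
    using b b0_bound p_gt_1 by (auto simp: b'_def field_simps)
  have "decays b' (dens g)" unfolding b'_def by (rule dens_decays[OF D sb bN])
  then obtain E where E: "0 <= E" "!!x. x ~= 0 ==> Psi g x <= ennreal (E * norm x powr (s - b'))"
    using rpot_decays[OF _ b'] unfolding Psi_def by blast
  have "g x <= (a * E) powr (1 / (m - 1)) * norm x powr - ((b - s * p) / \<kappa>)" if x: "x ~= 0" for x
  proof -
    have "enn2real (Psi g x) <= E * norm x powr (s - b')" using E x by (intro enn2real_leI) auto
    moreover have "0 <= E * norm x powr (s - b')" using E by simp
    ultimately have "max 0 (enn2real (Psi g x) - C) <= E * norm x powr (s - b')" using aC by linarith
    then have "(a * max 0 (enn2real (Psi g x) - C)) powr (1 / (m - 1)) <= (a * (E * norm x powr (s - b'))) powr (1 / (m - 1))"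
      using aC m_gt_1 by (intro powr_mono2 mult_left_mono) auto
    also have "... = (a * E) powr (1 / (m - 1)) * norm x powr ((s - b') / (m - 1))"
      using aC E by (simp add: powr_mult powr_powr)
    also have "(s - b') / (m - 1) = - ((b - s * p) / \<kappa>)"
    proof -
      have "s - b' = - (b - s * p) / (p - 1)" using p_gt_1 by (simp add: b'_def field_simps)
      then show ?thesis
        by (simp only: \<kappa>_def divide_divide_eq_left mult.commute[of "m - 1"] minus_divide_left)
    qed
    finally show ?thesis using g[OF x] by simp
  qed
  then show ?thesis unfolding decays_def by (intro exI[of _ "(a * E) powr (1 / (m - 1))"]) auto
qed

text \<open>Every positive exponent up to \<open>b0\<close> is reached, so the singularity at 0 may
  be taken as weak as desired. An infimum over the attained exponents above \<open>s * p\<close>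
  replaces an iteration count.\<close>

lemma maximizer_decay:
  assumes g: "!!x. x ~= 0 ==> g x <= (a * max 0 (enn2real (Psi g x) - C)) powr (1 / (m - 1))" and aC: "0 < a" "0 < C"
    and D: "decays b0 g" and b: "0 < b" "b <= b0"
  shows "decays b g"
proof -
  define f where "f b = (b - s * p) / \<kappa>" for b
  note step = maximizer_decay_step[OF g aC, folded f_def]
  have sp0: "0 < s * p" using s_pos p_gt_1 by simp
  define S where "S = {b. s * p < b \<and> b <= b0 \<and> decays b g}"
  have bS: "b0 \<in> S" using D sp_less_b0 by (simp add: S_def)
  have bdd: "bdd_below S" by (rule bdd_belowI[of _ "s * p"]) (auto simp: S_def)
  \<comment> \<open>\<open>b - f b\<close> is affine in \<open>b\<close> with the values
    \<open>s * p\<close> and \<open>b0 - f b0\<close> at the ends of the interval, so the smaller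
    one bounds it below.\<close>
  define \<delta> where "\<delta> = min (s * p) (b0 - f b0)"
  have \<delta>: "0 < \<delta>" using sp0 decay_gain by (simp add: \<delta>_def f_def)
  have drop: "\<delta> <= b - f b" if "s * p <= b" "b <= b0" for b
  proof -
    define \<theta> where "\<theta> = (b - s * p) / (b0 - s * p)"
    have \<theta>: "0 <= \<theta>" "\<theta> <= 1" using that sp_less_b0 by (auto simp: \<theta>_def)
    have "b = s * p + \<theta> * (b0 - s * p)" using sp_less_b0 by (simp add: \<theta>_def)
    moreover from this have "f b = \<theta> * f b0" by (simp add: f_def)
    ultimately have "b - f b = (1 - \<theta>) * (s * p) + \<theta> * (b0 - f b0)"
      by (simp add: algebra_simps)
    moreover have "(1 - \<theta>) * \<delta> + \<theta> * \<delta> <= (1 - \<theta>) * (s * p) + \<theta> * (b0 - f b0)"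
      using \<theta> by (intro add_mono mult_left_mono) (auto simp: \<delta>_def)
    ultimately show ?thesis by (simp add: algebra_simps)
  qed
  have Inf_S: "Inf S <= s * p"
  proof (rule ccontr)
    assume n: "\<not> Inf S <= s * p"
    have "\<exists>b\<in>S. b < Inf S + \<delta>" using cInf_lessD[of S "Inf S + \<delta>"] bS \<delta> by auto
    then obtain b where b: "b \<in> S" "b < Inf S + \<delta>" by blast
    have fb: "decays (f b) g" using b by (intro step) (auto simp: S_def)
    have "f b < Inf S" using drop[of b] b by (auto simp: S_def)
    define b'' where "b'' = max (f b) ((s * p + Inf S) / 2)"
    have hle: "Inf S <= b" using b(1) bdd by (rule cInf_lower)
    then have b'': "b'' < Inf S" "s * p < b''" "f b <= b''" "b'' <= b"
    proof -
      define X I where "X = s * p" and "I = Inf S"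
      have "X < I" "I <= b" "f b < I" using n hle \<open>f b < Inf S\<close> by (auto simp: X_def I_def)
      then show "b'' < Inf S" "s * p < b''" "f b <= b''" "b'' <= b"
        unfolding b''_def X_def[symmetric] I_def[symmetric] by (auto simp: less_max_iff_disj)
    qed
    have "decays b'' g" by (rule decays_between[OF fb _ b''(3,4)]) (use b in \<open>simp add: S_def\<close>)
    then have "b'' \<in> S" using b b'' by (simp add: S_def)
    then show False using cInf_lower[OF _ bdd, of b''] b''(1) by simp
  qed
  have above: "decays b g" if "s * p < b" "b <= b0" for b
  proof -
    have "Inf S < b" using Inf_S that by linarith
    then obtain b' where "b' \<in> S" "b' < b" using cInf_lessD[of S b] bS by blast
    then show ?thesis using decays_between[of b' g b0 b] D that by (simp add: S_def)
  qed
  show ?thesis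
  proof (cases "s * p < b")
    case False
    \<comment> \<open>Chosen so that one last step from just above \<open>s * p\<close> lands at or
      below \<open>b\<close>.\<close>
    define b1 where "b1 = min b0 (s * p + \<kappa> * b)"
    have b1: "s * p < b1" "b1 <= b0" using sp_less_b0 kappa_pos b by (auto simp: b1_def)
    have "f b1 <= b" using kappa_pos by (simp add: f_def b1_def field_simps)
    moreover have "decays (f b1) g" using above[OF b1] b1 by (intro step)
    ultimately show ?thesis using decays_between[of "f b1" g b0 b] D b by blast
  qed (use above b in auto)
qed

end

lemma powr_diff_le_tangent:
  fixes a b e :: real
  assumes e: "1 < e" and "0 <= a" "0 <= b"
  shows "a powr e - b powr e <= e * a powr (e - 1) * (a - b)"
proof -
  define e' where "e' = e / (e - 1)"
  have e': "1 < e'" "1 / e' + 1 / e = 1" "(e - 1) * e' = e" "e / e' = e - 1"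
    using e by (simp_all add: e'_def field_simps)
  have "a powr (e - 1) * b <= (a powr (e - 1)) powr e' / e' + b powr e / e"
    using e e' assms by (intro Youngs_inequality) auto
  then have "e * (a powr (e - 1) * b) <= e * (a powr e / e' + b powr e / e)"
    using e e' by (intro mult_left_mono) (auto simp: powr_powr)
  also have "... = (e / e') * a powr e + b powr e" using e by (simp add: distrib_left)
  finally have 1: "e * (a powr (e - 1) * b) <= (e - 1) * a powr e + b powr e" by (simp add: e'(4))
  have "a powr (e - 1) * a = a powr e"
    using assms by (cases "a = 0") (auto simp: powr_diff)
  with 1 show ?thesis by (simp add: algebra_simps)
qed

text \<open>For \<open>e <= 1\<close> the power is Hoelder continuous by concavity, for
  \<open>e > 1\<close> Lipschitz up to \<open>L\<close>; the constant covers both. It carries the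
  continuity of \<open>Psi\<close> through the power \<open>1 / (m - 1)\<close>.\<close>

lemma powr_holder:
  fixes A B L e :: real
  assumes AB: "0 <= A" "0 <= B" "A <= L" "B <= L" and e: "0 < e"
  shows "\<bar>A powr e - B powr e\<bar> <= (1 + e * L powr (e - 1)) * \<bar>A - B\<bar> powr (min 1 e)"
proof -
  have *: "\<bar>A powr e - B powr e\<bar> <= (1 + e * L powr (e - 1)) * \<bar>A - B\<bar> powr (min 1 e)"
    if "0 <= B" "B <= A" "A <= L" for A B
  proof (cases "A = 0")
    case False
    then have A: "0 < A" using that by simp
    have nn: "0 <= e * L powr (e - 1)" using e by simp
    have abs: "\<bar>A powr e - B powr e\<bar> = A powr e - B powr e"
      using that e by (simp add: powr_mono2)
    show ?thesis
    proof (cases "e <= 1")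
      case True
      define x where "x = B / A"
      have x: "0 <= x" "x <= 1" "B = A * x" using that A by (auto simp: x_def)
      have le: "t <= t powr e" if "0 <= t" "t <= 1" for t :: real
        using powr_mono'[of e 1 t] True that by (cases "t = 0") auto
      have "1 - x powr e <= (1 - x) powr e" using le[of x] le[of "1 - x"] x by simp
      then have "A powr e * (1 - x powr e) <= A powr e * (1 - x) powr e" by (intro mult_left_mono) auto
      also have "... = (A - B) powr e" using x A by (simp add: powr_mult[symmetric] right_diff_distrib)
      also have "A powr e * (1 - x powr e) = A powr e - B powr e" using x A by (simp add: powr_mult right_diff_distrib)
      finally have "A powr e - B powr e <= 1 * \<bar>A - B\<bar> powr e" using that by simp
      also have "... <= (1 + e * L powr (e - 1)) * \<bar>A - B\<bar> powr e" using nn by (intro mult_right_mono) auto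
      finally show ?thesis using abs True by (simp add: min_def)
    next
      case False
      then have "A powr e - B powr e <= e * A powr (e - 1) * (A - B)"
        using that A by (intro powr_diff_le_tangent) auto
      also have "... <= e * L powr (e - 1) * (A - B)"
        using that A False by (intro mult_right_mono mult_left_mono powr_mono2) auto
      also have "... <= (1 + e * L powr (e - 1)) * \<bar>A - B\<bar>"
        using that nn by (intro mult_mono) auto
      finally show ?thesis using abs False that by (simp add: min_def)
    qed
  qed (use that in simp)
  show ?thesis
    using *[of A B] *[of B A] AB by (cases "A <= B") (auto simp: abs_minus_commute)
qed

context hls
begin

text \<open>Finiteness almost everywhere gives a finite value in every centred ball, and
  monotonicity spreads it outward.\<close>

lemma Psi_finite_off_origin:
  assumes fin: "AE x in lborel. Psi h x < \<infinity>" and mono: "!!x y. norm x <= norm y ==> Psi h y <= Psi h x" and x: "x ~= 0"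
  shows "Psi h x < \<infinity>"
proof -
  have "\<exists>y\<in>ball 0 (norm x). Psi h y < \<infinity>"
  proof (rule ccontr)
    assume n: "\<not> ?thesis"
    from fin have "AE y in lborel. y \<in> - ball (0::'a) (norm x)" by eventually_elim (use n in auto)
    then have "AE y in lebesgue. y \<in> - ball (0::'a) (norm x)" by (rule AE_completion)
    then have "0 \<in> - ball (0::'a) (norm x)" by (rule mem_closed_if_AE_lebesgue[rotated]) auto
    then show False using x by simp
  qed
  then obtain y where y: "norm y < norm x" "Psi h y < \<infinity>" by auto
  have "Psi h x <= Psi h y" using y by (intro mono) simp
  then show ?thesis using y(2) by (rule le_less_trans)
qed

text \<open>Against the kernel with pole 0, an exponent below \<open>s\<close> is integrable near
  the origin and one above \<open>s\<close> at infinity.\<close>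

lemma rpot_zero_finite:
  assumes D: "decays b1 f" "decays b2 f" and b: "b1 < s" "s < b2"
  shows "rpot s f 0 < \<infinity>"
proof -
  obtain C1 where C1: "0 <= C1" "!!x. x ~= 0 ==> f x <= C1 * norm x powr - b1" using D by (auto simp: decays_def)
  obtain C2 where C2: "0 <= C2" "!!x. x ~= 0 ==> f x <= C2 * norm x powr - b2" using D by (auto simp: decays_def)
  have [measurable]: "(%x::'a. ennreal (norm x powr - c) * indicator (ball 0 1) x) \<in> Borel"
     "(%x::'a. ennreal (norm x powr - c) * indicator (- ball 0 1) x) \<in> Borel" for c
    by (auto intro!: borel_measurable_times_ennreal borel_measurable_indicator)
  have "rpot s f 0 <= (NN y. ennreal (kc * C1) * (ennreal (norm y powr - (N - s + b1)) * indicator (ball (0::'a) 1) y)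
     + ennreal (kc * C2) * (ennreal (norm y powr - (N - s + b2)) * indicator (- ball (0::'a) 1) y))"
    unfolding rpot_def
  proof (rule nn_integral_mono_AE, use AE_lborel_singleton[of "0::'a"] in eventually_elim)
    fix y :: 'a assume y: "y ~= 0"
    have K0: "K (0 - y) = kc * norm y powr - (N - s)" by (simp add: K_eq)
    have *: "K (0 - y) * f y <= kc * C * norm y powr - (N - s + b)" if "f y <= C * norm y powr - b" for C b
    proof -
      have "K (0 - y) * f y <= K (0 - y) * (C * norm y powr - b)" using that by (intro mult_left_mono) auto
      also have "... = kc * C * (norm y powr - (N - s) * norm y powr - b)" by (simp only: K0 ac_simps)
      also have "norm y powr - (N - s) * norm y powr - b = norm y powr - (N - s + b)" by (simp add: powr_add[symmetric])
      finally show ?thesis .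
    qed
    show "ennreal (K (0 - y) * f y) <= ennreal (kc * C1) * (ennreal (norm y powr - (N - s + b1)) * indicator (ball (0::'a) 1) y)
     + ennreal (kc * C2) * (ennreal (norm y powr - (N - s + b2)) * indicator (- ball (0::'a) 1) y)"
      using *[OF C1(2)[OF y]] *[OF C2(2)[OF y]] kc_pos C1(1) C2(1)
      by (auto simp: indicator_def ennreal_mult[symmetric] intro: ennreal_leI)
  qed
  also have "... = ennreal (kc * C1) * (NN y. ennreal (norm y powr - (N - s + b1)) * indicator (ball (0::'a) 1) y)
     + ennreal (kc * C2) * (NN y. ennreal (norm y powr - (N - s + b2)) * indicator (- ball (0::'a) 1) y)"
    by (subst nn_integral_add, simp, simp) (subst nn_integral_cmult, simp, subst nn_integral_cmult, simp, simp)
  also have "... < \<infinity>"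
    using nn_integral_powr_unit_ball[of "N - s + b1"] nn_integral_powr_compl_unit_ball[of "N - s + b2"] b
    by (simp add: ennreal_mult_less_top)
  finally show ?thesis .
qed

text \<open>The properties on which the continuity, support and smoothness arguments draw. The
  equation holds at every point and so fixes the representative.\<close>

definition regular_profile :: "('a => real) => real => real => bool" where
  "regular_profile g a C \<longleftrightarrow> g \<in> Borel \<and> (\<forall>x. 0 <= g x) \<and> (\<exists>M. \<forall>x. g x <= M) \<and> (\<exists>R>0. \<forall>x. R < norm x --> g x = 0)
    \<and> (\<forall>x y. norm x <= norm y --> g y <= g x) \<and> 0 < a \<and> 0 < C \<and> mass g ~= 0
    \<and> (\<exists>B. \<forall>x. rpot s g x <= ennreal B) \<and> decays (N / p) (dens g) \<and> (\<exists>B. \<forall>x. Psi g x <= ennreal B)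
    \<and> (\<forall>x. g x powr (m - 1) = a * max 0 (enn2real (Psi g x) - C))"

text \<open>\<open>g\<close> is the Euler-Lagrange equation solved for \<open>h\<close>, read at
  every point. Potentials ignore null sets, so \<open>Psi g = Psi h\<close> and \<open>g\<close>
  satisfies its own equation everywhere.\<close>

theorem maximizer_regular:
  assumes h: "ismax h" and even: "AE x in lborel. h (- x) = h x"
  shows "\<exists>g a C. (AE x in lborel. h x = g x) \<and> regular_profile g a C"
proof -
  have ah: "adm h" using h by (simp add: ismax_def)
  then have [measurable]: "h \<in> Borel" and nn: "!!x. 0 <= h x" by (auto simp: adm_def)
  obtain a C where aC: "0 < a" "0 < C" and EL: "AE x in lborel. Psi h x < \<infinity> \<and> h x powr (m - 1) = a * max 0 (enn2real (Psi h x) - C)"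
    using euler_lagrange[OF h] by blast
  note mono = Psi_radial_nonincr[OF h even]
  define g where "g x = (a * max 0 (enn2real (Psi h x) - C)) powr (1 / (m - 1))" for x
  have [measurable]: "g \<in> Borel" unfolding g_def[abs_def] by measurable
  have g_nn: "0 <= g x" for x by (simp add: g_def)
  have hg: "AE x in lborel. h x = g x"
    using EL
  proof eventually_elim
    case (elim x)
    have "h x = (h x powr (m - 1)) powr (1 / (m - 1))" using nn[of x] m_gt_1 by (simp add: powr_powr)
    then show ?case using elim by (simp add: g_def)
  qed
  have pot: "rpot s h x = rpot s g x" for x using hg by (rule rpot_cong_AE)
  have dens_eq: "dens h = dens g" by (simp add: dens_def fun_eq_iff rpotr_def pot)
  have Psi_eq: "Psi h = Psi g" by (simp add: Psi_def dens_eq)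
  have gP: "g x = (a * max 0 (enn2real (Psi g x) - C)) powr (1 / (m - 1))" for x
    unfolding Psi_eq[symmetric] by (rule g_def)
  have mass_eq: "mass g = mass h" "mpow g = mpow h"
    unfolding mass_def mpow_def by (rule nn_integral_cong_AE, use hg in eventually_elim, simp)+
  have fin0: "Psi h x < \<infinity>" if "x ~= 0" for x
    by (rule Psi_finite_off_origin[OF _ mono that]) (use EL in eventually_elim, simp_all)
  have g_mono: "g y <= g x" if "Psi h x < \<infinity>" "norm x <= norm y" for x y
    unfolding g_def using that aC m_gt_1 mono[OF that(2)]
    by (intro powr_mono2 mult_left_mono max.mono diff_right_mono enn2real_mono) auto
  have dN: "decays N g" and dNm: "decays (N / m) g"
  proof -
    obtain A where A: "mass h = ennreal A" "0 <= A" using ah by (cases "mass h") (auto simp: adm_def)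
    obtain P where P: "mpow h = ennreal P" "0 <= P" using ah by (cases "mpow h") (auto simp: adm_def)
    have "g x <= (A / measure lborel (ball (0::'a) 1)) powr (1 / 1) * norm x powr - (N / 1)" if "x ~= 0" for x
      using A that g_nn mass_eq fin0 by (intro radial_decay g_mono) (auto simp: mass_def)
    then show "decays N g" unfolding decays_def by (intro exI[of _ "(A / measure lborel (ball (0::'a) 1)) powr (1 / 1)"]) auto
    have "g x <= (P / measure lborel (ball (0::'a) 1)) powr (1 / m) * norm x powr - (N / m)" if "x ~= 0" for x
      using P that g_nn mass_eq m_gt_1 fin0 by (intro radial_decay g_mono) (auto simp: mpow_def)
    then show "decays (N / m) g" unfolding decays_def by (intro exI[of _ "(P / measure lborel (ball (0::'a) 1)) powr (1 / m)"]) auto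
  qed
  have db0: "decays b0 g" using decays_between[OF dNm dN] m_b0 b0_less_N by simp
  have decay: "decays b g" if "0 < b" "b <= b0" for b
    by (rule maximizer_decay[OF eq_refl[OF gP] aC db0 that])
  have ssp: "s < s * p" using s_pos p_gt_1 by simp
  \<comment> \<open>\<open>b1 < s * p\<close> means \<open>(b1 - s) / (p - 1) < s\<close>, which
    makes the potential of \<open>dens g\<close> finite at the origin.\<close>
  obtain b1 where b1: "s < b1" and b1': "b1 < s * p" using dense[OF ssp] by blast
  have d1: "decays ((b1 - s) / (p - 1)) (dens g)"
    using b1 b1' sp_less_b0 s_pos b0_less_N by (intro dens_decays decay) auto
  have Np: "(b0 - s) / (p - 1) = N / p" using p_gt_1 by (simp add: b0_def q_eq)
  have d2: "decays (N / p) (dens g)"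
    unfolding Np[symmetric] using s_less_b0 b0_less_N db0 by (intro dens_decays) auto
  have sNp: "s < N / p" "N / p < N" using sp_less p_gt_1 N_pos by (auto simp: field_simps)
  have Psi0: "Psi g 0 < \<infinity>"
    unfolding Psi_def by (rule rpot_zero_finite[OF d1 d2]) (use b1 b1' p_gt_1 sNp in \<open>auto simp: field_simps\<close>)
  have fin: "Psi h x < \<infinity>" for x
    using mono[of 0 x] Psi0 unfolding Psi_eq by (auto intro: le_less_trans)
  have PsiB: "\<exists>B. \<forall>x. Psi g x <= ennreal B"
    using mono[of 0] Psi0 unfolding Psi_eq by (intro exI[of _ "enn2real (Psi g 0)"]) (auto simp: less_top)
  have g_le: "g x <= g 0" for x by (rule g_mono[OF fin]) simp
  have supp: "\<exists>R>0. \<forall>x. R < norm x --> g x = 0"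
  proof -
    obtain E where E: "0 <= E" "!!x. x ~= 0 ==> Psi g x <= ennreal (E * norm x powr (s - N / p))"
      using rpot_decays[OF d2 sNp] unfolding Psi_def by blast
    \<comment> \<open>At radius \<open>R\<close> the decay bound of \<open>Psi g\<close> equals
      \<open>C\<close>, with \<open>E + 1\<close> for \<open>E\<close> to keep the base positive;
      beyond it the positive part vanishes.\<close>
    define R where "R = ((E + 1) / C) powr (1 / (N / p - s))"
    have R: "0 < R" using E aC by (simp add: R_def)
    have RC: "(E + 1) * R powr (s - N / p) = C"
    proof -
      have "R powr (s - N / p) = ((E + 1) / C) powr - 1"
        unfolding R_def powr_powr using sNp by (intro arg_cong2[where f="(powr)"] refl) (simp add: field_simps)
      then show ?thesis using E aC by (simp add: powr_minus)
    qed
    have "g x = 0" if x: "R < norm x" for x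
    proof -
      have x0: "x ~= 0" using x R by auto
      have "E * norm x powr (s - N / p) <= (E + 1) * R powr (s - N / p)"
        using x R E sNp by (intro mult_mono powr_mono2') auto
      then have "Psi g x <= ennreal C" using E(2)[OF x0] RC by (metis ennreal_leI order_trans)
      then have "enn2real (Psi g x) <= C" using aC by (intro enn2real_leI) auto
      then show ?thesis unfolding gP[of x] by simp
    qed
    then show ?thesis using R by blast
  qed
  have rpotB: "\<exists>B. \<forall>x. rpot s g x <= ennreal B"
  proof -
    obtain D where D: "0 <= D" "!!x. x ~= 0 ==> g x <= D * norm x powr - b0" using db0 by (auto simp: decays_def)
    show ?thesis using rpot_bounded[OF g_nn[of 0] D(1) s_less_b0 g_le D(2)] by auto
  qed
  have "g x powr (m - 1) = a * max 0 (enn2real (Psi g x) - C)" for x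
    unfolding gP[of x] using aC m_gt_1 by (simp add: powr_powr)
  moreover have "\<exists>M. \<forall>x. g x <= M" using g_le by blast
  ultimately have "regular_profile g a C"
    unfolding regular_profile_def using g_nn supp aC h mass_eq rpotB d2 PsiB g_mono[OF fin]
    by (auto simp: ismax_def)
  with hg show ?thesis by blast
qed

lemma regular_profile_dens:
  assumes g: "regular_profile g a C"
  shows "\<exists>M D. 0 <= M \<and> 0 <= D \<and> (\<forall>x. dens g x <= M) \<and> (\<forall>x. x ~= 0 --> dens g x <= D * norm x powr - (N / p))"
proof -
  obtain B where B: "!!x. rpot s g x <= ennreal B" using g by (auto simp: regular_profile_def)
  have "rpotr s g x <= max 0 B" for x
    unfolding rpotr_def using B[of x] by (intro enn2real_leI) (auto intro: order_trans ennreal_leI)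
  then have "dens g x <= max 0 B powr (q - 1)" for x
    unfolding dens_def using q_gt_1 by (intro powr_mono2) auto
  moreover obtain D where "0 <= D" "!!x. x ~= 0 ==> dens g x <= D * norm x powr - (N / p)"
    using g by (auto simp: regular_profile_def decays_def)
  ultimately show ?thesis by (intro exI[of _ "max 0 B powr (q - 1)"] exI[of _ D]) auto
qed

lemma regular_profile_holder:
  assumes g: "regular_profile g a C"
  shows "holder_continuous g"
proof -
  have [measurable]: "g \<in> Borel" and aC: "0 < a" "0 < C" and g_nn: "!!x. 0 <= g x"
    and EL: "!!x. g x powr (m - 1) = a * max 0 (enn2real (Psi g x) - C)"
    using g by (auto simp: regular_profile_def)
  obtain M D where MD: "0 <= M" "0 <= D" "!!x. dens g x <= M" "!!x. x ~= 0 ==> dens g x <= D * norm x powr - (N / p)"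
    using regular_profile_dens[OF g] by blast
  define \<alpha>0 where "\<alpha>0 = min 1 s / 2"
  have \<alpha>0: "0 < \<alpha>0" "\<alpha>0 <= 1" "\<alpha>0 < s" using s_pos by (auto simp: \<alpha>0_def min_def)
  have sNp: "s < N / p" using sp_less p_gt_1 by (auto simp: field_simps)
  obtain H where H: "0 <= H" "!!x y. \<bar>rpotr s (dens g) x - rpotr s (dens g) y\<bar> <= H * dist x y powr \<alpha>0"
    using rpotr_holder[OF MD(1,2) sNp _ MD(3,4) _ \<alpha>0] by auto
  obtain L0 where L0: "!!x. Psi g x <= ennreal L0" using g by (auto simp: regular_profile_def)
  define A where "A x = a * max 0 (enn2real (Psi g x) - C)" for x
  define L where "L = a * max 0 L0"
  define e where "e = 1 / (m - 1)"
  have e: "0 < e" using m_gt_1 by (simp add: e_def)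
  have gA: "g x = A x powr e" for x
    using arg_cong[OF EL[of x], of "%u. u powr e"] g_nn[of x] m_gt_1 by (simp add: A_def e_def powr_powr)
  have AL: "0 <= A x" "A x <= L" for x
  proof -
    have "enn2real (Psi g x) <= max 0 L0" using L0[of x] by (intro enn2real_leI) (auto intro: order_trans ennreal_leI)
    then have "max 0 (enn2real (Psi g x) - C) <= max 0 L0" using aC by auto
    then show "0 <= A x" "A x <= L" using aC by (auto simp: A_def L_def)
  qed
  have AH: "\<bar>A x - A y\<bar> <= a * H * dist x y powr \<alpha>0" for x y
  proof -
    have "\<bar>A x - A y\<bar> = a * \<bar>max 0 (enn2real (Psi g x) - C) - max 0 (enn2real (Psi g y) - C)\<bar>"
      using aC by (simp add: A_def abs_mult right_diff_distrib[symmetric])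
    also have "... <= a * \<bar>rpotr s (dens g) x - rpotr s (dens g) y\<bar>"
      using aC by (intro mult_left_mono) (auto simp: rpotr_def Psi_def[symmetric])
    also have "... <= a * (H * dist x y powr \<alpha>0)" using aC by (intro mult_left_mono H) auto
    finally show ?thesis by simp
  qed
  define c where "c = (1 + e * L powr (e - 1)) * (a * H) powr (min 1 e)"
  have "\<bar>g x - g y\<bar> <= c * dist x y powr (\<alpha>0 * min 1 e)" for x y
  proof -
    have "\<bar>g x - g y\<bar> <= (1 + e * L powr (e - 1)) * \<bar>A x - A y\<bar> powr (min 1 e)"
      unfolding gA using AL e by (intro powr_holder) auto
    also have "... <= (1 + e * L powr (e - 1)) * (a * H * dist x y powr \<alpha>0) powr (min 1 e)"
      using AH e by (intro mult_left_mono powr_mono2) auto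
    also have "... = c * dist x y powr (\<alpha>0 * min 1 e)"
      using aC H by (simp add: c_def powr_mult powr_powr)
    finally show ?thesis .
  qed
  moreover have "0 < \<alpha>0 * min 1 e" "\<alpha>0 * min 1 e <= 1" using \<alpha>0 e by (auto intro: mult_le_one)
  ultimately show ?thesis unfolding holder_continuous_def by blast
qed

lemma holder_continuous_imp_continuous:
  assumes "holder_continuous (g :: 'a => real)"
  shows "continuous_on UNIV g"
proof -
  obtain \<alpha>0 c where \<alpha>0: "0 < \<alpha>0" and c: "!!x y. \<bar>g x - g y\<bar> <= c * dist x y powr \<alpha>0"
    using assms by (auto simp: holder_continuous_def)
  have "isCont g x" for x
  proof -
    have "((%y. dist y x) \<longlongrightarrow> 0) (at x)"
      using tendsto_dist[OF tendsto_ident_at[of x] tendsto_const[of x]] by simp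
    then have "((%y. dist y x powr \<alpha>0) \<longlongrightarrow> 0 powr \<alpha>0) (at x)"
      by (rule tendsto_powr2[OF _ tendsto_const _ \<alpha>0]) simp
    then have "((%y. c * dist y x powr \<alpha>0) \<longlongrightarrow> 0) (at x)"
      by (intro tendsto_mult_right_zero) simp
    then have "((%y. g y - g x) \<longlongrightarrow> 0) (at x)"
      by (rule Lim_null_comparison[rotated]) (simp add: c)
    then show ?thesis unfolding isCont_def by (simp add: LIM_zero_iff)
  qed
  then show ?thesis by (simp add: continuous_at_imp_continuous_on)
qed

text \<open>The set is open by continuity and contains with a point all points of smaller norm;
  openness keeps the supremum \<open>R\<close> of the norms from being attained.\<close>

lemma regular_profile_support:
  assumes g: "regular_profile g a C"
  shows "\<exists>R>0. {x. g x ~= 0} = ball 0 R"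
proof -
  have g_nn: "!!x. 0 <= g x" and mono: "!!x y. norm x <= norm y ==> g y <= g x" and nz: "mass g ~= 0"
    using g by (auto simp: regular_profile_def)
  obtain R1 where R1: "!!x. R1 < norm x ==> g x = 0" using g by (auto simp: regular_profile_def)
  have cont: "continuous_on UNIV g" by (rule holder_continuous_imp_continuous[OF regular_profile_holder[OF g]])
  define Z where "Z = {x. g x ~= 0}"
  have oZ: "open Z" unfolding Z_def by (intro open_Collect_neq cont continuous_intros)
  have "Z ~= {}"
  proof
    assume "Z = {}"
    then have "g x = 0" for x by (auto simp: Z_def)
    then show False using nz by (simp add: mass_def)
  qed
  have bdd: "bdd_above (norm ` Z)" using R1 by (intro bdd_aboveI[of _ R1]) (force simp: Z_def not_less[symmetric])
  define R where "R = Sup (norm ` Z)"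
  have "x \<in> ball 0 R" if x: "x \<in> Z" for x
  proof -
    obtain d where d: "0 < d" "ball x d \<subseteq> Z" using oZ x openE by blast
    obtain y where y: "y \<in> Z" "norm x < norm y"
    proof (cases "x = 0")
      case True
      obtain v :: 'a where "norm v = d / 2" using vector_choose_size[of "d / 2"] d by auto
      then show thesis using that[of v] d True by (auto simp: subset_eq)
    next
      case False
      define y where "y = (1 + d / (2 * norm x)) *\<^sub>R x"
      have "y - x = (d / (2 * norm x)) *\<^sub>R x" by (simp add: y_def scaleR_left_distrib)
      then have "norm (y - x) = d / 2" using False d by simp
      then have "y \<in> Z" using d by (auto simp: subset_eq dist_norm norm_minus_commute)
      moreover have "norm y = norm x + d / 2"
      proof -
        have "norm y = \<bar>1 + d / (2 * norm x)\<bar> * norm x" by (simp add: y_def)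
        also have "... = norm x + d / 2" using False d by (simp add: field_simps)
        finally show ?thesis .
      qed
      ultimately show thesis using that[of y] d by auto
    qed
    have "norm y <= R" unfolding R_def using y bdd by (intro cSup_upper) auto
    then show ?thesis using y by simp
  qed
  moreover have "x \<in> Z" if x: "norm x < R" for x
  proof -
    obtain y where "y \<in> Z" "norm x < norm y"
      using x \<open>Z ~= {}\<close> bdd unfolding R_def by (auto simp: less_cSup_iff)
    then show ?thesis using mono[of x y] g_nn[of y] by (auto simp: Z_def)
  qed
  ultimately have "Z = ball 0 R" by auto
  moreover from this have "0 < R" using \<open>Z ~= {}\<close> by (auto simp: not_less)
  ultimately show ?thesis by (auto simp: Z_def)
qed

end

subsection \<open>Weighted bounds on iterated derivatives\<close>

abbreviation fd :: "('a::euclidean_space => real) => 'a => 'a => real" where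
  "fd f x \<equiv> frechet_derivative f (at x)"

text \<open>\<open>wbnd k l A w S f\<close>: on \<open>S\<close> the derivatives of \<open>f\<close> of order \<open>j <= k\<close> exist and are
  bounded by \<open>A * l ^ j * w\<close>.\<close>

fun wbnd :: "nat => real => real => ('a::euclidean_space => real) => 'a set => ('a => real) => bool" where
  "wbnd 0 l A w S f \<longleftrightarrow> continuous_on S f \<and> (\<forall>x\<in>S. \<bar>f x\<bar> <= A * w x)"
| "wbnd (Suc k) l A w S f \<longleftrightarrow> (\<forall>x\<in>S. f differentiable (at x)) \<and> (\<forall>x\<in>S. \<bar>f x\<bar> <= A * w x)
     \<and> (\<forall>b\<in>Basis. wbnd k l (A * l) w S (%x. fd f x b))"

abbreviation cbnd :: "nat => real => real => 'a::euclidean_space set => ('a => real) => bool" where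
  "cbnd k l A \<equiv> wbnd k l A (%_. 1)"

lemma wbnd_Ck: "wbnd k l A w S f ==> Ck k S f"
  by (induction k arbitrary: A f) auto

lemma wbnd_bound: "wbnd k l A w S f ==> x \<in> S ==> \<bar>f x\<bar> <= A * w x"
  by (cases k) auto

lemma wbnd_continuous: "wbnd k l A w S f ==> continuous_on S f"
proof (cases k)
  case (Suc j)
  assume "wbnd k l A w S f"
  then have "f differentiable (at x)" if "x \<in> S" for x using that Suc by simp
  then show ?thesis
    by (intro continuous_at_imp_continuous_on ballI differentiable_imp_continuous_within)
qed simp

lemma wbnd_has_derivative:
  "wbnd (Suc k) l A w S f ==> x \<in> S ==> (f has_derivative fd f x) (at x)"
  by (simp add: frechet_derivative_works)

lemma wbnd_SucI:
  assumes "open S" and der: "!!x. x \<in> S ==> (f has_derivative D x) (at x)" and "!!x. x \<in> S ==> \<bar>f x\<bar> <= A * w x"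
    and D: "!!b. b \<in> Basis ==> wbnd k l (A * l) w S (%x. fd f x b)"
  shows "wbnd (Suc k) l A w S f"
  using assms by (auto simp: differentiable_def)

lemma wbnd_cong:
  assumes S: "open S" and eq: "!!x. x \<in> S ==> f x = g x" and f: "wbnd k l A w S f"
  shows "wbnd k l A w S g"
  using eq f
proof (induction k arbitrary: A f g)
  case 0
  then show ?case by (auto cong: continuous_on_cong)
next
  case (Suc k)
  have d: "(g has_derivative fd f x) (at x)" if "x \<in> S" for x
    by (rule has_derivative_transform_within_open[OF wbnd_has_derivative[OF Suc.prems(2) that] S that]) (use Suc.prems in auto)
  have "wbnd k l (A * l) w S (%x. fd g x b)" if "b \<in> Basis" for b
    by (rule Suc.IH[of "%x. fd f x b"])
      (use Suc.prems that frechet_derivative_at[OF d] in auto)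
  then show ?case using d Suc.prems by (intro wbnd_SucI[OF S d]) auto
qed

lemma wbnd_Suc_has_derivativeI:
  assumes S: "open S" and der: "!!x. x \<in> S ==> (f has_derivative D x) (at x)" and bd: "!!x. x \<in> S ==> \<bar>f x\<bar> <= A * w x"
    and D: "!!b. b \<in> Basis ==> wbnd k l (A * l) w S (%x. D x b)"
  shows "wbnd (Suc k) l A w S f"
proof (rule wbnd_SucI[OF S der bd])
  fix b :: 'a assume b: "b \<in> Basis"
  show "wbnd k l (A * l) w S (%x. fd f x b)"
    by (rule wbnd_cong[OF S _ D[OF b]]) (use frechet_derivative_at[OF der] in auto)
qed

lemma wbnd_mono:
  assumes "wbnd k l A w S f" "0 <= l" "S' \<subseteq> S" "!!x. x \<in> S' ==> A * w x <= A' * w' x"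
  shows "wbnd k l A' w' S' f"
  using assms
proof (induction k arbitrary: A A' f)
  case 0
  then show ?case by (auto intro: continuous_on_subset order_trans)
next
  case (Suc k)
  have "wbnd k l (A' * l) w' S' (%x. fd f x b)" if "b \<in> Basis" for b
  proof (rule Suc.IH)
    show "wbnd k l (A * l) w S (%x. fd f x b)" using Suc.prems that by simp
    show "A * l * w x <= A' * l * w' x" if "x \<in> S'" for x
      using mult_left_mono[OF Suc.prems(4)[OF that] Suc.prems(2)] by (simp add: ac_simps)
  qed (use Suc.prems in auto)
  moreover have "\<bar>f x\<bar> <= A' * w' x" if "x \<in> S'" for x
    using wbnd_bound[OF Suc.prems(1), of x] Suc.prems(3) Suc.prems(4)[OF that] that by (auto intro: order_trans)
  ultimately show ?case using Suc.prems by auto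
qed

lemma wbnd_Suc_D: "wbnd (Suc k) l A w S f ==> wbnd k l A w S f"
proof (induction k arbitrary: A f)
  case 0
  then show ?case using wbnd_continuous[of "Suc 0" l A w S f] by simp
qed simp

text \<open>Exchanging the scale \<open>l\<close> for \<open>l'\<close> costs one factor
  \<open>c\<close> per derivative.\<close>

lemma wbnd_rescale:
  assumes "wbnd k l A w S f" and l: "0 <= l" "l <= c * l'" "1 <= c" "0 <= l'" and w: "!!x. x \<in> S ==> 0 <= w x" and "0 <= A"
  shows "wbnd k l' (A * c ^ k) w S f"
  using assms(1) \<open>0 <= A\<close>
proof (induction k arbitrary: A f)
  case (Suc k)
  have c: "1 <= c ^ j" for j using l(3) by (rule one_le_power)
  have "wbnd k l' (A * c ^ Suc k * l') w S (%x. fd f x b)" if "b \<in> Basis" for b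
  proof (rule wbnd_mono[OF Suc.IH])
    show "wbnd k l (A * l) w S (%x. fd f x b)" using Suc.prems that by simp
    show "A * l * c ^ k * w x <= A * c ^ Suc k * l' * w x" if "x \<in> S" for x
    proof (rule mult_right_mono[OF _ w[OF that]])
      have "A * c ^ k * l <= A * c ^ k * (c * l')" using l(2) c[of k] Suc.prems by (intro mult_left_mono) auto
      then show "A * l * c ^ k <= A * c ^ Suc k * l'" by (simp add: ac_simps)
    qed
  qed (use Suc.prems l in auto)
  moreover have "\<bar>f x\<bar> <= A * c ^ Suc k * w x" if "x \<in> S" for x
  proof -
    have "\<bar>f x\<bar> <= A * 1 * w x" using Suc.prems that by simp
    also have "... <= A * c ^ Suc k * w x" using c[of "Suc k"] Suc.prems w[OF that] by (intro mult_right_mono mult_left_mono) auto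
    finally show ?thesis .
  qed
  ultimately show ?case using Suc.prems by simp
qed simp

lemma wbnd_scale_mono:
  assumes "wbnd k l A w S f" "0 <= l" "l <= l'" "!!x. x \<in> S ==> 0 <= w x" "0 <= A"
  shows "wbnd k l' A w S f"
  using wbnd_rescale[of k l A w S f 1 l'] assms by simp

lemma wbnd_zero: "open S ==> 0 <= A ==> 0 <= l ==> (!!x. x \<in> S ==> 0 <= w x) ==> wbnd k l A w S (%x. 0)"
proof (induction k arbitrary: A)
  case (Suc k)
  show ?case by (rule wbnd_Suc_has_derivativeI[where D="%x h. 0"]) (use Suc in auto)
qed auto

lemma wbnd_const:
  assumes S: "open S" and "0 <= l" "!!x. x \<in> S ==> \<bar>c\<bar> <= A * w x" "0 <= A" "!!x. x \<in> S ==> 0 <= w x"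
  shows "wbnd k l A w S (%x. c)"
proof (cases k)
  case (Suc j)
  show ?thesis unfolding Suc
    by (rule wbnd_Suc_has_derivativeI[where D="%x h. 0"]) (use assms in \<open>auto intro!: wbnd_zero\<close>)
qed (use assms in auto)

lemma wbnd_add:
  assumes S: "open S" and "wbnd k l A w S f" "wbnd k l B w S g"
  shows "wbnd k l (A + B) w S (%x. f x + g x)"
  using assms(2,3)
proof (induction k arbitrary: A B f g)
  case 0
  then show ?case by (fastforce intro!: continuous_intros simp: distrib_right)
next
  case (Suc k)
  show ?case
  proof (rule wbnd_Suc_has_derivativeI[OF S])
    show "((%x. f x + g x) has_derivative (%h. fd f x h + fd g x h)) (at x)" if "x \<in> S" for x
      by (intro has_derivative_add wbnd_has_derivative[OF Suc.prems(1) that] wbnd_has_derivative[OF Suc.prems(2) that])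
    show "\<bar>f x + g x\<bar> <= (A + B) * w x" if "x \<in> S" for x
      using wbnd_bound[OF Suc.prems(1) that] wbnd_bound[OF Suc.prems(2) that] by (simp add: distrib_right)
    show "wbnd k l ((A + B) * l) w S (%x. fd f x b + fd g x b)" if "b \<in> Basis" for b
      unfolding distrib_right using Suc.prems that by (intro Suc.IH) auto
  qed
qed

text \<open>Leibniz rule; each order doubles the number of terms, hence
  \<open>2 ^ k\<close>.\<close>

lemma wbnd_mult:
  assumes S: "open S" and "wbnd k l A w S f" "wbnd k l B v S g"
    and "0 <= A" "0 <= B" "0 <= l" "!!x. x \<in> S ==> 0 <= w x" "!!x. x \<in> S ==> 0 <= v x"
  shows "wbnd k l (2 ^ k * A * B) (%x. w x * v x) S (%x. f x * g x)"
  using assms(2-5)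
proof (induction k arbitrary: A B f g)
  case 0
  have "\<bar>f x * g x\<bar> <= A * B * (w x * v x)" if "x \<in> S" for x
  proof -
    have "\<bar>f x\<bar> * \<bar>g x\<bar> <= (A * w x) * (B * v x)"
      using 0 that assms(7)[OF that] by (intro mult_mono) auto
    then show ?thesis by (simp add: abs_mult ac_simps)
  qed
  then show ?case using 0 by (auto intro!: continuous_intros)
next
  case (Suc k)
  have bnd: "\<bar>f x * g x\<bar> <= 2 ^ Suc k * A * B * (w x * v x)" if "x \<in> S" for x
  proof -
    have "\<bar>f x\<bar> * \<bar>g x\<bar> <= (A * w x) * (B * v x)"
      using wbnd_bound[OF Suc.prems(1) that] wbnd_bound[OF Suc.prems(2) that] Suc.prems(3) assms(7)[OF that] by (intro mult_mono) auto
    also have "... = 1 * (A * B * (w x * v x))" by simp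
    also have "... <= 2 ^ Suc k * (A * B * (w x * v x))"
      using Suc.prems assms(7,8)[OF that] by (intro mult_right_mono) (auto intro: one_le_power simp del: power_Suc)
    finally show ?thesis by (simp add: abs_mult ac_simps)
  qed
  have D: "wbnd k l (2 ^ Suc k * A * B * l) (%x. w x * v x) S (%x. f x * fd g x b + fd f x b * g x)"
    if "b \<in> Basis" for b
  proof -
    have "wbnd k l (2 ^ k * A * (B * l) + 2 ^ k * (A * l) * B) (%x. w x * v x) S (%x. f x * fd g x b + fd f x b * g x)"
      using Suc.prems that assms(6) by (intro wbnd_add[OF S] Suc.IH wbnd_Suc_D[OF Suc.prems(1)] wbnd_Suc_D[OF Suc.prems(2)]) auto
    then show ?thesis by (simp add: algebra_simps)
  qed
  show ?case
    by (rule wbnd_Suc_has_derivativeI[OF S has_derivative_mult[OF wbnd_has_derivative[OF Suc.prems(1)] wbnd_has_derivative[OF Suc.prems(2)]] bnd D])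
qed

lemma wbnd_cmult:
  assumes S: "open S" and "wbnd k l A w S f"
  shows "wbnd k l (\<bar>c\<bar> * A) w S (%x. c * f x)"
  using assms(2)
proof (induction k arbitrary: A f)
  case 0
  then show ?case by (auto intro!: continuous_intros simp: abs_mult mult_left_mono mult.assoc)
next
  case (Suc k)
  have D: "wbnd k l (\<bar>c\<bar> * A * l) w S (%x. c * fd f x b)" if "b \<in> Basis" for b
    using Suc.IH[of "A * l" "%x. fd f x b"] Suc.prems that by (simp add: mult.assoc)
  show ?case
    by (rule wbnd_Suc_has_derivativeI[OF S has_derivative_mult_right[OF wbnd_has_derivative[OF Suc.prems]] _ D])
       (use wbnd_bound[OF Suc.prems] in \<open>auto simp: abs_mult mult_left_mono mult.assoc\<close>)
qed

lemma wbnd_diff: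
  assumes S: "open S" and "wbnd k l A w S f" "wbnd k l B w S g"
  shows "wbnd k l (A + B) w S (%x. f x - g x)"
  using wbnd_add[OF S assms(2) wbnd_cmult[OF S assms(3), of "-1"]] by simp

text \<open>Each derivative brings out one factor \<open>l\<close>; scales other than 1 originate
  here.\<close>

lemma wbnd_dilate:
  assumes "wbnd k 1 A w UNIV f" and l: "0 < l"
  shows "wbnd k l A (%x. w (l *\<^sub>R x)) UNIV (%x. f (l *\<^sub>R x))"
  using assms(1)
proof (induction k arbitrary: A f)
  case 0
  then show ?case by (auto intro!: continuous_on_compose2[of UNIV f] continuous_intros)
next
  case (Suc k)
  show ?case
  proof (rule wbnd_Suc_has_derivativeI[OF open_UNIV])
    show "((%x. f (l *\<^sub>R x)) has_derivative (%h. frechet_derivative f (at (l *\<^sub>R x)) (l *\<^sub>R h))) (at x)" for x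
      by (rule has_derivative_compose[OF has_derivative_scaleR_right[OF has_derivative_ident] wbnd_has_derivative[OF Suc.prems UNIV_I]])
    show "\<bar>f (l *\<^sub>R x)\<bar> <= A * w (l *\<^sub>R x)" for x using wbnd_bound[OF Suc.prems] by simp
    fix b :: 'a assume b: "b \<in> Basis"
    have eq: "fd f x (l *\<^sub>R b) = l * fd f x b" for x
      using linear_scale[OF has_derivative_linear[OF wbnd_has_derivative[OF Suc.prems UNIV_I]]] by simp
    have "wbnd k 1 A w UNIV (%x. fd f x b)" using Suc.prems b by simp
    from wbnd_cmult[OF open_UNIV Suc.IH[OF this], of l]
    show "wbnd k l (A * l) (%x. w (l *\<^sub>R x)) UNIV (%x. frechet_derivative f (at (l *\<^sub>R x)) (l *\<^sub>R b))"
      using l by (simp add: eq mult.commute)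
  qed
qed

lemma wbnd_glue:
  assumes "open S" "open T" "wbnd k l A w S f" "wbnd k l A w T f"
  shows "wbnd k l A w (S \<union> T) f"
  using assms(3,4)
proof (induction k arbitrary: A f)
  case 0
  then show ?case using assms(1,2) by (auto intro: continuous_on_open_Un)
qed auto

text \<open>On an open set where \<open>f\<close> vanishes all its derivatives vanish too, so the
  weight can be cut off there.\<close>

lemma wbnd_restrict_weight:
  assumes T: "open T" and f: "wbnd k l A w UNIV f" "!!x. x \<in> T ==> f x = 0"
  shows "wbnd k l A (%x. w x * indicator (- T) x) UNIV f"
  using f
proof (induction k arbitrary: A f)
  case 0
  then show ?case by (auto simp: indicator_def)
next
  case (Suc k)
  have "fd f x = (%h. 0)" if "x \<in> T" for x
  proof -
    have "((%x. 0) has_derivative fd f x) (at x)"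
      by (rule has_derivative_transform_within_open[OF wbnd_has_derivative[OF Suc.prems(1) UNIV_I] T that]) (use Suc.prems in auto)
    then show ?thesis using has_derivative_unique has_derivative_const by blast
  qed
  then have "wbnd k l (A * l) (%x. w x * indicator (- T) x) UNIV (%x. fd f x b)" if "b \<in> Basis" for b
    using Suc.prems that by (intro Suc.IH) auto
  then show ?case using Suc.prems by (auto simp: indicator_def)
qed

lemma abs_frechet_le:
  fixes f :: "'a::euclidean_space => real"
  assumes "linear D" "!!b. b \<in> Basis ==> \<bar>D b\<bar> <= B"
  shows "\<bar>D h\<bar> <= real DIM('a) * B * norm (h::'a)"
proof -
  have "D h = (\<Sum>b\<in>Basis. (h \<bullet> b) * D b)"
    by (subst euclidean_representation[of h, symmetric], subst linear_sum[OF assms(1)]) (simp add: linear_scale[OF assms(1)])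
  then have "\<bar>D h\<bar> <= (\<Sum>b\<in>Basis. \<bar>(h \<bullet> b) * D b\<bar>)" by simp
  also have "... <= (\<Sum>b\<in>(Basis::'a set). norm h * B)"
    using assms(2) by (intro sum_mono) (auto simp: abs_mult intro!: mult_mono Basis_le_norm)
  finally show ?thesis by (simp add: ac_simps)
qed

subsection \<open>Differentiation of convolutions\<close>

text \<open>All derivatives fall on \<open>F\<close>, so \<open>f\<close> may be merely measurable.
  \<open>dom\<close> supplies local majorants for dominated convergence, \<open>bd\<close> the bound
  \<open>W\<close> that enters the constant, and \<open>sub\<close> confines the information on
  \<open>F\<close> to \<open>S'\<close>.\<close>

lemma wbnd_conv:
  fixes f F :: "'a::euclidean_space => real"
  assumes S: "open S" and S': "open S'" and w: "!!x. 0 <= w x" and [measurable]: "w \<in> Borel" and f[measurable]: "f \<in> Borel"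
    and sub: "!!x z. x \<in> S ==> f z ~= 0 ==> x - z \<in> S'"
    and dom: "!!x. x \<in> S ==> \<exists>d>0. \<exists>G. integrable lborel G \<and> ball x d \<subseteq> S \<and> (\<forall>y\<in>ball x d. \<forall>z. \<bar>f z\<bar> * w (y - z) <= G z)"
    and bd: "!!x. x \<in> S ==> (NN z. ennreal (\<bar>f z\<bar> * w (x - z))) <= ennreal W"
    and W: "0 <= W" and l: "0 <= l"
    and F: "wbnd k l A w S' F" "0 <= A"
  shows "cbnd k l (A * W) S (%x. LINT z|lborel. f z * F (x - z))"
  using F
proof (induction k arbitrary: A F)
  have meas: "(%z. f z * F (x - z)) \<in> Borel" if "continuous_on S' F" "x \<in> S" for F :: "'a => real" and x
  proof -
    have [measurable]: "(%y. indicator S' y *\<^sub>R F y) \<in> Borel"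
      using that(1) S' by (intro borel_measurable_continuous_on_indicator) auto
    have "(%z. f z * F (x - z)) = (%z. f z * (indicator S' (x - z) *\<^sub>R F (x - z)))"
      using sub[OF that(2)] by (auto simp: indicator_def fun_eq_iff)
    also have "... \<in> Borel" by measurable
    finally show ?thesis .
  qed
  have pt: "\<bar>f z * F (x - z)\<bar> <= A * (\<bar>f z\<bar> * w (x - z))" if "!!y. y \<in> S' ==> \<bar>F y\<bar> <= A * w y" "x \<in> S" for F :: "'a => real" and A x z
  proof (cases "f z = 0")
    case False
    then have "\<bar>f z\<bar> * \<bar>F (x - z)\<bar> <= \<bar>f z\<bar> * (A * w (x - z))" using that sub by (intro mult_left_mono) auto
    then show ?thesis by (simp add: abs_mult ac_simps)
  qed simp
  have integ: "integrable lborel (%z. f z * F (x - z))"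
    if hyp: "continuous_on S' F" "!!y. y \<in> S' ==> \<bar>F y\<bar> <= A * w y" "x \<in> S" "0 <= A" for F :: "'a => real" and A x
  proof (rule integrableI_bounded)
    show "(%z. f z * F (x - z)) \<in> borel_measurable lborel" using meas[OF hyp(1,3)] by simp
    obtain d G where G: "0 < d" "integrable lborel G" "\<forall>y\<in>ball x d. \<forall>z. \<bar>f z\<bar> * w (y - z) <= G z" using dom[OF hyp(3)] by blast
    have "(NN z. ennreal (norm (f z * F (x - z)))) <= (NN z. ennreal (norm (A * G z)))"
    proof (intro nn_integral_mono ennreal_leI)
      fix z
      have "\<bar>f z\<bar> * w (x - z) <= G z" using G by auto
      then have "A * (\<bar>f z\<bar> * w (x - z)) <= A * G z" using hyp(4) by (rule mult_left_mono)
      then show "norm (f z * F (x - z)) <= norm (A * G z)" using pt[OF hyp(2,3), of z] by simp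
    qed
    also have "... < \<infinity>" using integrable_mult_right[OF G(2), of A] unfolding integrable_iff_bounded by blast
    finally show "(NN z. ennreal (norm (f z * F (x - z)))) < \<infinity>" .
  qed
  have bound: "\<bar>LINT z|lborel. f z * F (x - z)\<bar> <= A * W * 1"
    if hyp: "continuous_on S' F" "!!y. y \<in> S' ==> \<bar>F y\<bar> <= A * w y" "x \<in> S" "0 <= A" for F :: "'a => real" and A x
  proof -
    have "ennreal (norm (LINT z|lborel. f z * F (x - z))) <= (NN z. ennreal (norm (f z * F (x - z))))"
      by (rule integral_norm_bound_ennreal[OF integ[OF hyp]])
    also have "... <= (NN z. ennreal (A * (\<bar>f z\<bar> * w (x - z))))"
      using pt[OF hyp(2,3)] by (intro nn_integral_mono ennreal_leI) simp
    also have "... <= ennreal A * (NN z. ennreal (\<bar>f z\<bar> * w (x - z)))"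
      using hyp(4) w by (simp add: ennreal_mult nn_integral_cmult)
    also have "... <= ennreal A * ennreal W" by (intro mult_left_mono bd hyp) simp
    finally show ?thesis using hyp(4) W by (simp add: ennreal_mult[symmetric])
  qed
  {
    case 0
    then have c: "continuous_on S' F" and b: "!!y. y \<in> S' ==> \<bar>F y\<bar> <= A * w y" by auto
    have "continuous (at x within S) (%x. LINT z|lborel. f z * F (x - z))" if x: "x \<in> S" for x
      unfolding continuous_within_sequentially comp_def
    proof (intro allI impI, elim conjE)
      fix u :: "nat => 'a" assume u: "\<forall>n. u n \<in> S" "u \<longlonglongrightarrow> x"
      obtain d G where G: "0 < d" "integrable lborel G" "\<forall>y\<in>ball x d. \<forall>z. \<bar>f z\<bar> * w (y - z) <= G z" using dom[OF x] by blast
      obtain n0 where n0: "!!n. n \<ge> n0 ==> dist (u n) x < d" using u(2) G(1) unfolding lim_sequentially by blast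
      have "(%n. LINT z|lborel. f z * F (u (n + n0) - z)) \<longlonglongrightarrow> (LINT z|lborel. f z * F (x - z))"
      proof (rule integral_dominated_convergence[where w="%z. A * G z"])
        show "AE z in lborel. (%n. f z * F (u (n + n0) - z)) \<longlonglongrightarrow> f z * F (x - z)"
        proof (intro AE_I2)
          fix z
          show "(%n. f z * F (u (n + n0) - z)) \<longlonglongrightarrow> f z * F (x - z)"
          proof (cases "f z = 0")
            case False
            then have "isCont F (x - z)" using c S' sub[OF x] by (simp add: continuous_on_eq_continuous_at)
            then show ?thesis
              by (intro tendsto_mult tendsto_const isCont_tendsto_compose[of _ F] tendsto_diff LIMSEQ_ignore_initial_segment u(2))
          qed simp
        qed
        show "AE z in lborel. norm (f z * F (u (n + n0) - z)) <= A * G z" for n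
        proof (intro AE_I2)
          fix z
          have "\<bar>f z\<bar> * w (u (n + n0) - z) <= G z" using G(3) n0[of "n + n0"] by (auto simp: dist_commute)
          then have "A * (\<bar>f z\<bar> * w (u (n + n0) - z)) <= A * G z" using 0 by (intro mult_left_mono) auto
          then show "norm (f z * F (u (n + n0) - z)) <= A * G z" using pt[OF b, of "u (n + n0)" z] u(1) by simp
        qed
      qed (use meas[OF c] u(1) x G(2) in auto)
      then show "(%n. LINT z|lborel. f z * F (u n - z)) \<longlonglongrightarrow> (LINT z|lborel. f z * F (x - z))"
        by (rule LIMSEQ_offset)
    qed
    then show ?case using bound[OF c b _ 0(2)] by (simp add: continuous_on_eq_continuous_within)
  next
    case (Suc k)
    note cF = wbnd_continuous[OF Suc.prems(1)] and bF = wbnd_bound[OF Suc.prems(1)]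
    define D where "D y = frechet_derivative F (at y)" for y
    have der: "(F has_derivative D y) (at y)" if "y \<in> S'" for y
      unfolding D_def by (rule wbnd_has_derivative[OF Suc.prems(1) that])
    have wD: "wbnd k l (A * l) w S' (%y. D y b)" if "b \<in> Basis" for b
      using Suc.prems that by (simp add: D_def)
    have Al: "0 <= A * l" using Suc.prems l by simp
    have bD: "\<bar>D y h\<bar> <= real DIM('a) * (A * l * w y) * norm h" if "y \<in> S'" for y h
      using wbnd_bound[OF wD that] has_derivative_linear[OF der[OF that]] by (intro abs_frechet_le) auto
    define T where "T b x = (LINT z|lborel. f z * D (x - z) b)" for b x
    have wT: "cbnd k l (A * l * W) S (T b)" if "b \<in> Basis" for b
      unfolding T_def by (rule Suc.IH[OF wD[OF that] Al])
    have iD: "integrable lborel (%z. f z * D (x - z) b)" if "x \<in> S" "b \<in> Basis" for x b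
      by (rule integ[OF wbnd_continuous[OF wD[OF that(2)]] wbnd_bound[OF wD[OF that(2)]] that(1) Al])
    \<comment> \<open>Assembling the candidate from partial derivatives makes it bounded linear at
      once; \<open>L_eq\<close> identifies it with the integral of the derivatives.\<close>
    define L where "L x h = (\<Sum>b\<in>Basis. (h \<bullet> b) * T b x)" for x h
    have lin: "bounded_linear (L x)" for x
      unfolding L_def by (intro bounded_linear_sum bounded_linear_mult_const bounded_linear_inner_left)
    have L_eq: "L x h = (LINT z|lborel. f z * D (x - z) h)" and iDh: "integrable lborel (%z. f z * D (x - z) h)" if x: "x \<in> S" for x h
    proof -
      have e: "f z * D (x - z) h = (\<Sum>b\<in>Basis. (h \<bullet> b) * (f z * D (x - z) b))" for z
      proof (cases "f z = 0")
        case False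
        have ln: "linear (D (x - z))" using has_derivative_linear[OF der[OF sub[OF x False]]] .
        have "D (x - z) h = (\<Sum>b\<in>Basis. (h \<bullet> b) * D (x - z) b)"
          by (subst euclidean_representation[of h, symmetric], subst linear_sum[OF ln]) (simp add: linear_scale[OF ln])
        then show ?thesis by (simp add: sum_distrib_left ac_simps)
      qed simp
      show "L x h = (LINT z|lborel. f z * D (x - z) h)"
        unfolding e L_def T_def using iD[OF x] by (subst Bochner_Integration.integral_sum) (auto intro!: integrable_mult_right)
      show "integrable lborel (%z. f z * D (x - z) h)"
        unfolding e using iD[OF x] by (intro Bochner_Integration.integrable_sum integrable_mult_right) auto
    qed
    have hd: "((%x. LINT z|lborel. f z * F (x - z)) has_derivative L x) (at x)" if x: "x \<in> S" for x
      unfolding has_derivative_at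
    proof (intro conjI lin)
      define R where "R h z = f z * F (x + h - z) - f z * F (x - z) - f z * D (x - z) h" for h z
      obtain d G where G: "0 < d" "integrable lborel G" "ball x d \<subseteq> S" "\<forall>y\<in>ball x d. \<forall>z. \<bar>f z\<bar> * w (y - z) <= G z" using dom[OF x] by blast
      have R_int: "(LINT z|lborel. f z * F (x + h - z)) - (LINT z|lborel. f z * F (x - z)) - L x h = (LINT z|lborel. R h z)"
        and R_meas: "R h \<in> borel_measurable lborel" if h: "norm h < d" for h
      proof -
        have xh: "x + h \<in> S" using G(3) h by (auto simp: subset_eq dist_norm)
        note i = integ[OF cF bF xh Suc.prems(2)] integ[OF cF bF x Suc.prems(2)] iDh[OF x, of h]
        show "(LINT z|lborel. f z * F (x + h - z)) - (LINT z|lborel. f z * F (x - z)) - L x h = (LINT z|lborel. R h z)"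
          unfolding R_def L_eq[OF x] using i by simp
        show "R h \<in> borel_measurable lborel" unfolding R_def[abs_def] using i by (intro borel_measurable_diff borel_measurable_integrable)
      qed
      define c where "c = real DIM('a) * (A * l)"
      have c: "0 <= c" using Al by (simp add: c_def)
      have R_bd: "\<bar>R h z\<bar> <= (2 * c * G z) * norm h" if h: "norm h < d" for h z
      proof (cases "f z = 0")
        case True
        have "\<bar>f z\<bar> * w (x - z) <= G z" using G(1,4) by auto
        then have "0 <= G z" using True by simp
        then show ?thesis using True c by (simp add: R_def)
      next
        case False
        \<comment> \<open>\<open>G\<close> controls the product of \<open>\<bar>f z\<bar>\<close>
          with the weight; dividing by \<open>\<bar>f z\<bar>\<close> bounds the derivative of
          \<open>F\<close> along the ball, as the mean value inequality requires.\<close>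
        define B where "B = c * G z / \<bar>f z\<bar>"
        have D_bd: "\<bar>D (y - z) v\<bar> <= B * norm v" if y: "y \<in> ball x d" for y v
        proof -
          have "y - z \<in> S'" using sub[OF _ False, of y] G(3) y by blast
          then have "\<bar>D (y - z) v\<bar> <= c * w (y - z) * norm v" using bD[of "y - z" v] by (simp add: c_def ac_simps)
          also have "c * w (y - z) <= B"
          proof -
            have "\<bar>f z\<bar> * w (y - z) <= G z" using G(4) y by blast
            then have "w (y - z) <= G z / \<bar>f z\<bar>" using False by (simp add: field_simps)
            then have "c * w (y - z) <= c * (G z / \<bar>f z\<bar>)" using c by (rule mult_left_mono)
            then show ?thesis by (simp add: B_def)
          qed
          finally show ?thesis by (simp add: mult_right_mono)
        qed
        have "norm (F ((x + h) - z) - F (x - z)) <= B * norm ((x + h) - x)"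
        proof (rule differentiable_bound[where S="ball x d" and f="%y. F (y - z)" and f'="%y. D (y - z)"])
          fix y assume y: "y \<in> ball x d"
          have "y - z \<in> S'" using sub[OF _ False, of y] G(3) y by blast
          then have "((%y. F (y - z)) has_derivative (%h. D (y - z) (h - 0))) (at y)"
            by (intro has_derivative_compose[OF has_derivative_diff[OF has_derivative_ident has_derivative_const] der])
          then show "((%y. F (y - z)) has_derivative D (y - z)) (at y within ball x d)"
            by (simp add: has_derivative_at_withinI)
          show "onorm (D (y - z)) <= B" using D_bd[OF y] by (intro onorm_le) auto
        qed (use G(1) h in \<open>auto simp: dist_norm\<close>)
        moreover have "\<bar>D (x - z) h\<bar> <= B * norm h" using D_bd[of x h] G(1) by simp
        ultimately have "\<bar>F (x + h - z) - F (x - z) - D (x - z) h\<bar> <= 2 * B * norm h" by simp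
        then have "\<bar>f z\<bar> * \<bar>F (x + h - z) - F (x - z) - D (x - z) h\<bar> <= \<bar>f z\<bar> * (2 * B * norm h)"
          by (rule mult_left_mono) simp
        moreover have "\<bar>f z\<bar> * (2 * B * norm h) = 2 * c * G z * norm h" using False by (simp add: B_def)
        moreover have "\<bar>R h z\<bar> = \<bar>f z\<bar> * \<bar>F (x + h - z) - F (x - z) - D (x - z) h\<bar>"
          by (simp add: R_def abs_mult[symmetric] right_diff_distrib)
        ultimately show ?thesis by simp
      qed
      show "(%h. norm ((LINT z|lborel. f z * F (x + h - z)) - (LINT z|lborel. f z * F (x - z)) - L x h) / norm h) \<midarrow>0\<rightarrow> 0"
        unfolding tendsto_at_iff_sequentially comp_def
      proof (intro allI impI)
        fix u :: "nat => 'a" assume u: "\<forall>i. u i \<in> UNIV - {0}" "u \<longlonglongrightarrow> 0"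
        obtain n0 where n0: "!!n. n \<ge> n0 ==> norm (u n) < d" using u(2) G(1) unfolding lim_sequentially by (auto simp: dist_norm)
        have "(%n. LINT z|lborel. R (u (n + n0)) z / norm (u (n + n0))) \<longlonglongrightarrow> (LINT z|(lborel::'a measure). (0::real))"
        proof (rule integral_dominated_convergence[where w="%z. 2 * c * G z"])
          show "AE z in lborel. (%n. R (u (n + n0)) z / norm (u (n + n0))) \<longlonglongrightarrow> 0"
          proof (intro AE_I2)
            fix z
            show "(%n. R (u (n + n0)) z / norm (u (n + n0))) \<longlonglongrightarrow> 0"
            proof (cases "f z = 0")
              case False
              have "(%h. norm (F (x - z + h) - F (x - z) - D (x - z) h) / norm h) \<midarrow>0\<rightarrow> 0"
                using der[OF sub[OF x False]] unfolding has_derivative_at by blast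
              then have "(%n. norm (F (x - z + u n) - F (x - z) - D (x - z) (u n)) / norm (u n)) \<longlonglongrightarrow> 0"
                using u unfolding tendsto_at_iff_sequentially comp_def by blast
              then have "(%n. \<bar>f z\<bar> * (norm (F (x - z + u n) - F (x - z) - D (x - z) (u n)) / norm (u n))) \<longlonglongrightarrow> 0"
                by (rule tendsto_mult_right_zero)
              then have "(%n. R (u n) z / norm (u n)) \<longlonglongrightarrow> 0"
                by (rule tendsto_rabs_zero_cancel[OF Lim_transform_eventually])
                   (simp add: R_def abs_mult[symmetric] right_diff_distrib algebra_simps)
              then show ?thesis by (rule LIMSEQ_ignore_initial_segment)
            qed (simp add: R_def)
          qed
          show "AE z in lborel. norm (R (u (n + n0)) z / norm (u (n + n0))) <= 2 * c * G z" for n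
          proof (intro AE_I2)
            fix z
            have "norm (u (n + n0)) > 0" using u(1) by simp
            then show "norm (R (u (n + n0)) z / norm (u (n + n0))) <= 2 * c * G z"
              using R_bd[OF n0[of "n + n0"], of z] by (simp add: divide_le_eq)
          qed
        qed (use R_meas[OF n0] G(2) in auto)
        then have "(%n. norm (LINT z|lborel. R (u (n + n0)) z / norm (u (n + n0)))) \<longlonglongrightarrow> 0"
          by (intro tendsto_norm_zero) simp
        then have "(%n. norm ((LINT z|lborel. f z * F (x + u (n + n0) - z)) - (LINT z|lborel. f z * F (x - z)) - L x (u (n + n0))) / norm (u (n + n0))) \<longlonglongrightarrow> 0"
          using R_int[OF n0] by (simp add: abs_mult)
        then show "(%n. norm ((LINT z|lborel. f z * F (x + u n - z)) - (LINT z|lborel. f z * F (x - z)) - L x (u n)) / norm (u n)) \<longlonglongrightarrow> 0"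
          by (rule LIMSEQ_offset)
      qed
    qed
    show ?case
    proof (rule wbnd_Suc_has_derivativeI[OF S hd])
      show "\<bar>LINT z|lborel. f z * F (x - z)\<bar> <= A * W * 1" if "x \<in> S" for x by (rule bound[OF cF bF that Suc.prems(2)])
      fix b :: 'a assume b: "b \<in> Basis"
      have "L x b = T b x" for x using b by (simp add: L_def inner_Basis if_distrib[of "%c. c * _"] cong: if_cong)
      then show "cbnd k l (A * W * l) S (%x. L x b)" using wT[OF b] by (simp add: ac_simps)
    qed
  }
qed

text \<open>Telescoping with summable bounds: Weierstrass gives uniform convergence, and the
  induction treats the partial derivatives in the same way. Scale 1 keeps the same bounds at every
  order.\<close>

lemma wbnd_limit:
  fixes F :: "nat => 'a::euclidean_space => real"
  assumes S: "open S" "convex S" and a: "summable a"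
    and "cbnd k 1 A S (F 0)" "!!n. cbnd k 1 (a n) S (%x. F (Suc n) x - F n x)"
    and "!!x. x \<in> S ==> (%n. F n x) \<longlonglongrightarrow> f x"
  shows "cbnd k 1 (A + suminf a) S f"
  using assms(4-6)
proof (induction k arbitrary: F f)
  have unif: "uniform_limit S (%n x. F n x - F 0 x) (%x. \<Sum>i. F (Suc i) x - F i x) sequentially"
    if "!!n x. x \<in> S ==> \<bar>F (Suc n) x - F n x\<bar> <= a n" for F :: "nat => 'a => real"
  proof -
    have "uniform_limit S (%n x. \<Sum>i<n. F (Suc i) x - F i x) (%x. \<Sum>i. F (Suc i) x - F i x) sequentially"
      by (rule Weierstrass_m_test[OF _ a]) (use that in auto)
    also have "(%n x. \<Sum>i<n. F (Suc i) x - F i x) = (%n x. F n x - F 0 x)"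
      by (intro ext sum_lessThan_telescope)
    finally show ?thesis .
  qed
  have lims: "(%n. F n x) \<longlonglongrightarrow> F 0 x + (\<Sum>i. F (Suc i) x - F i x)" "\<bar>\<Sum>i. F (Suc i) x - F i x\<bar> <= suminf a"
    if "!!n x. x \<in> S ==> \<bar>F (Suc n) x - F n x\<bar> <= a n" "x \<in> S" for F :: "nat => 'a => real" and x
  proof -
    have "(%n. F 0 x + (F n x - F 0 x)) \<longlonglongrightarrow> F 0 x + (\<Sum>i. F (Suc i) x - F i x)"
      by (intro tendsto_intros tendsto_uniform_limitI[OF unif[of F, OF that(1)] that(2)])
    then show "(%n. F n x) \<longlonglongrightarrow> F 0 x + (\<Sum>i. F (Suc i) x - F i x)" by simp
    have "norm (\<Sum>i. F (Suc i) x - F i x) <= suminf a"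
      using that by (intro norm_suminf_le a) auto
    then show "\<bar>\<Sum>i. F (Suc i) x - F i x\<bar> <= suminf a" by simp
  qed
  have f_eq: "f x = F 0 x + (\<Sum>i. F (Suc i) x - F i x)"
    if "!!n x. x \<in> S ==> \<bar>F (Suc n) x - F n x\<bar> <= a n" "!!x. x \<in> S ==> (%n. F n x) \<longlonglongrightarrow> f x" "x \<in> S"
    for F :: "nat => 'a => real" and f x
    by (rule LIMSEQ_unique[OF that(2)[OF that(3)] lims(1)[of F x, OF that(1,3)]])
  have f_bd: "\<bar>f x\<bar> <= (A + suminf a) * 1"
    if "!!n x. x \<in> S ==> \<bar>F (Suc n) x - F n x\<bar> <= a n" "!!x. x \<in> S ==> (%n. F n x) \<longlonglongrightarrow> f x" "x \<in> S" "\<bar>F 0 x\<bar> <= A"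
    for F :: "nat => 'a => real" and f x
    using f_eq[of F f x, OF that(1-3)] lims(2)[of F x, OF that(1,3)] that(4) by simp
  {
    case (0 F f)
    have d: "\<bar>F (Suc n) x - F n x\<bar> <= a n" if "x \<in> S" for n x using 0(2)[of n] that by simp
    have "continuous_on S (%x. F n x - F 0 x)" for n
    proof -
      have "continuous_on S (%x. \<Sum>i<n. F (Suc i) x - F i x)"
        using 0 by (intro continuous_on_sum) auto
      also have "(%x. \<Sum>i<n. F (Suc i) x - F i x) = (%x. F n x - F 0 x)"
        by (intro ext sum_lessThan_telescope)
      finally show ?thesis .
    qed
    then have "continuous_on S (%x. \<Sum>i. F (Suc i) x - F i x)"
      by (intro uniform_limit_theorem[OF _ unif[of F, OF d]]) auto
    then have "continuous_on S (%x. F 0 x + (\<Sum>i. F (Suc i) x - F i x))"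
      using 0 by (intro continuous_on_add) auto
    then have "continuous_on S f" using f_eq[of F f, OF d 0(3)] by (simp cong: continuous_on_cong)
    then show ?case using f_bd[of F f, OF d 0(3)] 0(1) by simp
  next
    case (Suc k F f)
    have d: "\<bar>F (Suc n) x - F n x\<bar> <= a n" if "x \<in> S" for n x using wbnd_bound[OF Suc.prems(2) that, of n] by simp
    note prem2 = Suc.prems(2)
    have dF: "\<exists>D. (F n has_derivative D) (at x)" if x: "x \<in> S" for n x
    proof (induction n)
      case 0
      show ?case using wbnd_has_derivative[OF Suc.prems(1) x] by blast
    next
      case (Suc j)
      then obtain D where "(F j has_derivative D) (at x)" by blast
      from has_derivative_add[OF this wbnd_has_derivative[OF prem2[of j] x]]
      show ?case by auto
    qed
    define D where "D n x = frechet_derivative (F n) (at x)" for n x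
    have D: "(F n has_derivative D n x) (at x)" if "x \<in> S" for n x
      using dF[OF that] unfolding D_def by (metis frechet_derivative_at)
    have w0: "cbnd k 1 A S (%x. D 0 x b)" if "b \<in> Basis" for b
      using Suc.prems(1) that by (simp add: D_def)
    have wn: "cbnd k 1 (a n) S (%x. D (Suc n) x b - D n x b)" if "b \<in> Basis" for b n
    proof (rule wbnd_cong[OF S(1)])
      show "cbnd k 1 (a n) S (%x. frechet_derivative (%x. F (Suc n) x - F n x) (at x) b)"
        using Suc.prems(2) that by simp
      show "frechet_derivative (%x. F (Suc n) x - F n x) (at x) b = D (Suc n) x b - D n x b" if "x \<in> S" for x
        using frechet_derivative_at[OF has_derivative_diff[OF D[OF that] D[OF that]], of "Suc n" n, symmetric] by simp
    qed
    have dn: "\<bar>D (Suc n) x b - D n x b\<bar> <= a n" if "b \<in> Basis" "x \<in> S" for b n x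
      using wbnd_bound[OF wn[OF that(1)] that(2)] by simp
    define g where "g b x = D 0 x b + (\<Sum>i. D (Suc i) x b - D i x b)" for b x
    have glim: "(%n. D n x b) \<longlonglongrightarrow> g b x" if "b \<in> Basis" "x \<in> S" for b x
      unfolding g_def using dn that by (intro lims(1)[of "%n x. D n x b"]) auto
    have wg: "cbnd k 1 (A + suminf a) S (g b)" if "b \<in> Basis" for b
      by (rule Suc.IH[of "%n x. D n x b", OF w0[OF that] wn[OF that] glim[OF that]])
    have ug: "uniform_limit S (%n x. D n x b) (g b) sequentially" if "b \<in> Basis" for b
    proof -
      have "uniform_limit S (%n x. D 0 x b + (D n x b - D 0 x b)) (g b) sequentially"
        unfolding g_def using dn that by (intro uniform_limit_intros unif[of "%n x. D n x b"]) auto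
      then show ?thesis by simp
    qed
    define g' where "g' x h = (\<Sum>b\<in>Basis. (h \<bullet> b) * g b x)" for x h
    have lg: "linear (g' x)" for x
      unfolding g'_def by (intro bounded_linear.linear bounded_linear_sum bounded_linear_mult_const bounded_linear_inner_left)
    have g'_basis: "g' x b = g b x" if "b \<in> Basis" for b x
      using that by (simp add: g'_def inner_Basis if_distrib[of "%c. c * _"] cong: if_cong)
    have fd: "(f has_derivative g' x) (at x)" if x: "x \<in> S" for x
    proof -
      have "\<exists>G. \<forall>x\<in>S. (%n. F n x) \<longlonglongrightarrow> G x \<and> (G has_derivative g' x) (at x within S)"
      proof (rule has_derivative_sequence[where f=F and f'=D, OF S(2) _ _ x Suc.prems(3)[OF x]])
        show "(F n has_derivative D n x) (at x within S)" if "x \<in> S" for n x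
          using D[OF that] by (rule has_derivative_at_withinI)
        fix e :: real assume e: "0 < e"
        define e' where "e' = e / real DIM('a)"
        have e': "0 < e'" using e by (simp add: e'_def)
        have "\<forall>\<^sub>F n in sequentially. \<forall>b\<in>Basis. \<forall>x\<in>S. dist (D n x b) (g b x) < e'"
          using ug e' by (intro eventually_ball_finite) (auto simp: uniform_limit_iff)
        then show "\<forall>\<^sub>F n in sequentially. \<forall>x\<in>S. \<forall>h. norm (D n x h - g' x h) <= e * norm h"
        proof eventually_elim
          case (elim n)
          show ?case
          proof (intro ballI allI)
            fix x h assume x: "x \<in> S"
            have "\<bar>D n x h - g' x h\<bar> <= real DIM('a) * e' * norm h"
            proof (rule abs_frechet_le[of "%h. D n x h - g' x h"])
              show "linear (%h. D n x h - g' x h)"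
                by (intro linear_compose_sub lg has_derivative_linear[OF D[OF x]])
              show "\<bar>D n x b - g' x b\<bar> <= e'" if "b \<in> Basis" for b
                using elim that x by (force simp: g'_basis dist_real_def)
            qed
            then show "norm (D n x h - g' x h) <= e * norm h" by (simp add: e'_def)
          qed
        qed
      qed
      then obtain G where G: "\<forall>x\<in>S. (%n. F n x) \<longlonglongrightarrow> G x \<and> (G has_derivative g' x) (at x within S)" by blast
      have "G y = f y" if "y \<in> S" for y using LIMSEQ_unique G Suc.prems(3) that by blast
      moreover have "(G has_derivative g' x) (at x)"
        using bspec[OF G x] at_within_open[OF x S(1)] by simp
      ultimately show ?thesis by (metis has_derivative_transform_within_open S(1) x)
    qed
    show ?case
    proof (rule wbnd_Suc_has_derivativeI[OF S(1) fd])
      show "\<bar>f x\<bar> <= (A + suminf a) * 1" if "x \<in> S" for x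
        using f_bd[of F f, OF d Suc.prems(3) that] wbnd_bound[OF Suc.prems(1) that] by simp
      show "cbnd k 1 ((A + suminf a) * 1) S (%x. g' x b)" if "b \<in> Basis" for b
        using wg[OF that] that by (simp add: g'_basis)
    qed
  }
qed

lemma has_derivative_powr_const:
  fixes f :: "'a::euclidean_space => real"
  assumes "(f has_derivative D) (at x)" "0 < f x"
  shows "((%x. f x powr \<gamma>) has_derivative (%h. \<gamma> * (f x powr (\<gamma> - 1) * D h))) (at x)"
  using has_derivative_powr[OF assms(1) has_derivative_const[of \<gamma>] assms(2)] assms(2)
  by (simp add: powr_diff field_simps)

text \<open>\<open>C\<close> precedes \<open>l\<close> and \<open>f\<close> because the estimate is
  used along a whole sequence of scales; values between \<open>c\<close> and \<open>M\<close> keep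
  every lower power bounded.\<close>

lemma wbnd_powr:
  fixes S :: "'a::euclidean_space set"
  assumes S: "open S" and c: "0 < c" and M1: "0 <= M1"
  shows "\<exists>C\<ge>0. \<forall>l\<ge>0. \<forall>f. cbnd k l M1 S f --> (\<forall>x\<in>S. c <= f x \<and> f x <= M) --> cbnd k l C S (%x. f x powr \<gamma>)"
proof (induction k arbitrary: \<gamma>)
  have bd: "y powr \<gamma> <= c powr \<gamma> + M powr \<gamma>" if "c <= y" "y <= M" for y \<gamma> :: real
  proof (cases "0 <= \<gamma>")
    case True
    then have "y powr \<gamma> <= M powr \<gamma>" using that c by (intro powr_mono2) auto
    then show ?thesis using powr_ge_zero[of c \<gamma>] by linarith
  next
    case False
    then have "y powr \<gamma> <= c powr \<gamma>" using that c by (intro powr_mono2') auto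
    then show ?thesis using powr_ge_zero[of M \<gamma>] by linarith
  qed
  {
    case (0 \<gamma>)
    show ?case
    proof (intro exI conjI allI impI)
      show "0 <= c powr \<gamma> + M powr \<gamma>" by simp
      fix l :: real and f :: "'a => real" assume *: "cbnd 0 l M1 S f" "\<forall>x\<in>S. c <= f x \<and> f x <= M"
      then have "continuous_on S (%x. f x powr \<gamma>)" using c by (intro continuous_intros) auto
      then show "cbnd 0 l (c powr \<gamma> + M powr \<gamma>) S (%x. f x powr \<gamma>)" using * bd by auto
    qed
  next
    case (Suc k \<gamma>)
    obtain C where C: "0 <= C" "!!l f. 0 <= l ==> cbnd k l M1 S f ==> (\<forall>x\<in>S. c <= f x \<and> f x <= M) ==> cbnd k l C S (%x. f x powr (\<gamma> - 1))"
      using Suc[of "\<gamma> - 1"] by blast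
    define C' where "C' = c powr \<gamma> + M powr \<gamma> + \<bar>\<gamma>\<bar> * (2 ^ k * C * M1)"
    have p: "0 <= \<bar>\<gamma>\<bar> * (2 ^ k * C * M1)" using C(1) M1 by simp
    show ?case
    proof (intro exI[of _ C'] conjI allI impI)
      show "0 <= C'" using p by (simp add: C'_def add_nonneg_nonneg)
      fix l :: real and f :: "'a => real" assume l: "0 <= l" and f: "cbnd (Suc k) l M1 S f" and fb: "\<forall>x\<in>S. c <= f x \<and> f x <= M"
      show "wbnd (Suc k) l C' (%_. 1) S (%x. f x powr \<gamma>)"
      proof (rule wbnd_Suc_has_derivativeI[OF S has_derivative_powr_const[OF wbnd_has_derivative[OF f]]])
        show "0 < f x" if "x \<in> S" for x using fb c that by force
        show "\<bar>f x powr \<gamma>\<bar> <= C' * 1" if "x \<in> S" for x using bd[of "f x" \<gamma>] fb that p by (auto simp: C'_def)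
        fix b :: 'a assume b: "b \<in> Basis"
        have "wbnd k l (2 ^ k * C * (M1 * l)) (%x. 1 * 1) S (%x. f x powr (\<gamma> - 1) * fd f x b)"
          using f fb b l C(1) M1 by (intro wbnd_mult[OF S C(2)[OF l wbnd_Suc_D[OF f]]]) auto
        from wbnd_cmult[OF S this, of \<gamma>]
        show "cbnd k l (C' * l) S (%x. \<gamma> * (f x powr (\<gamma> - 1) * fd f x b))"
          by (rule wbnd_mono) (use l in \<open>auto simp: C'_def algebra_simps\<close>)
      qed
    qed
  }
qed

lemma powr_diff_bound:
  fixes c M \<gamma> :: real
  assumes c: "0 < c"
  shows "\<exists>C\<ge>0. \<forall>u\<in>{c..M}. \<forall>v\<in>{c..M}. \<bar>u powr \<gamma> - v powr \<gamma>\<bar> <= C * \<bar>u - v\<bar>"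
proof (intro exI conjI ballI)
  define C where "C = \<bar>\<gamma>\<bar> * (c powr (\<gamma> - 1) + M powr (\<gamma> - 1))"
  show "0 <= C" by (simp add: C_def)
  fix u v assume uv: "u \<in> {c..M}" "v \<in> {c..M}"
  have "norm (u powr \<gamma> - v powr \<gamma>) <= C * norm (u - v)"
  proof (rule differentiable_bound[where f="%t. t powr \<gamma>" and f'="%t h. h * (\<gamma> * t powr (\<gamma> - 1))", OF convex_real_interval(5) _ _ uv])
    fix t assume t: "t \<in> {c..M}"
    have "(%h. h * (\<gamma> * t powr (\<gamma> - 1))) = (*) (\<gamma> * t powr (\<gamma> - 1))" by (simp add: fun_eq_iff)
    then show "((%t. t powr \<gamma>) has_derivative (%h. h * (\<gamma> * t powr (\<gamma> - 1)))) (at t within {c..M})"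
      using has_real_derivative_powr[of t \<gamma>] t c has_derivative_at_withinI
      unfolding has_field_derivative_def by fastforce
    have "t powr (\<gamma> - 1) <= c powr (\<gamma> - 1) + M powr (\<gamma> - 1)"
    proof (cases "0 <= \<gamma> - 1")
      case True
      then have "t powr (\<gamma> - 1) <= M powr (\<gamma> - 1)" using t c by (intro powr_mono2) auto
      then show ?thesis using powr_ge_zero[of c "\<gamma> - 1"] by linarith
    next
      case False
      then have "t powr (\<gamma> - 1) <= c powr (\<gamma> - 1)" using t c by (intro powr_mono2') auto
      then show ?thesis using powr_ge_zero[of M "\<gamma> - 1"] by linarith
    qed
    then have "\<bar>\<gamma>\<bar> * t powr (\<gamma> - 1) <= C" unfolding C_def by (rule mult_left_mono) simp
    then have "norm (h * (\<gamma> * t powr (\<gamma> - 1))) <= C * norm h" for h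
      by (simp add: abs_mult mult.commute[of "\<bar>h\<bar>"] mult_right_mono)
    then show "onorm (%h. h * (\<gamma> * t powr (\<gamma> - 1))) <= C" by (intro onorm_le) auto
  qed
  then show "\<bar>u powr \<gamma> - v powr \<gamma>\<bar> <= C * \<bar>u - v\<bar>" by simp
qed

text \<open>Up to the factor \<open>\<gamma>\<close>, a derivative of the difference is
  \<open>(f powr (\<gamma> - 1) - g powr (\<gamma> - 1)) * f'\<close> plus
  \<open>g powr (\<gamma> - 1) * (f' - g')\<close>. Both terms are linear in
  \<open>\<delta>\<close>, the first by induction with exponent \<open>\<gamma> - 1\<close>.\<close>

lemma wbnd_powr_diff:
  fixes S :: "'a::euclidean_space set"
  assumes S: "open S" and c: "0 < c" and M1: "0 <= M1"
  shows "\<exists>C\<ge>0. \<forall>l\<ge>0. \<forall>\<delta>\<ge>0. \<forall>f g. cbnd k l M1 S f --> (\<forall>x\<in>S. c <= f x \<and> f x <= M) -->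
    cbnd k l M1 S g --> (\<forall>x\<in>S. c <= g x \<and> g x <= M) --> wbnd k l \<delta> (%_. 1) S (%x. f x - g x) -->
    cbnd k l (C * \<delta>) S (%x. f x powr \<gamma> - g x powr \<gamma>)"
proof (induction k arbitrary: \<gamma>)
  case (0 \<gamma>)
  obtain C where C: "0 <= C" "!!u v. u \<in> {c..M} ==> v \<in> {c..M} ==> \<bar>u powr \<gamma> - v powr \<gamma>\<bar> <= C * \<bar>u - v\<bar>"
    using powr_diff_bound[OF c, of M \<gamma>] by blast
  show ?case
  proof (intro exI[of _ C] conjI allI impI C(1))
    fix l \<delta> :: real and f g :: "'a => real"
    assume *: "0 <= \<delta>" "cbnd 0 l M1 S f" "\<forall>x\<in>S. c <= f x \<and> f x <= M" "cbnd 0 l M1 S g" "\<forall>x\<in>S. c <= g x \<and> g x <= M"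
      "wbnd 0 l \<delta> (%_. 1) S (%x. f x - g x)"
    have "continuous_on S (%x. f x powr \<gamma> - g x powr \<gamma>)" using * c by (intro continuous_intros) auto
    moreover have "\<bar>f x powr \<gamma> - g x powr \<gamma>\<bar> <= C * \<delta> * 1" if "x \<in> S" for x
    proof -
      have "\<bar>f x powr \<gamma> - g x powr \<gamma>\<bar> <= C * \<bar>f x - g x\<bar>" using * that by (intro C(2)) auto
      also have "... <= C * \<delta>" using * that C(1) by (intro mult_left_mono) auto
      finally show ?thesis by simp
    qed
    ultimately show "cbnd 0 l (C * \<delta>) S (%x. f x powr \<gamma> - g x powr \<gamma>)" by simp
  qed
next
  case (Suc k \<gamma>)
  obtain C0 where C0: "0 <= C0" "!!u v. u \<in> {c..M} ==> v \<in> {c..M} ==> \<bar>u powr \<gamma> - v powr \<gamma>\<bar> <= C0 * \<bar>u - v\<bar>"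
    using powr_diff_bound[OF c, of M \<gamma>] by blast
  obtain C1 where C1: "0 <= C1" "\<forall>l\<ge>0. \<forall>\<delta>\<ge>0. \<forall>f g. cbnd k l M1 S f --> (\<forall>x\<in>S. c <= f x \<and> f x <= M) -->
      cbnd k l M1 S g --> (\<forall>x\<in>S. c <= g x \<and> g x <= M) --> wbnd k l \<delta> (%_. 1) S (%x. f x - g x) -->
      cbnd k l (C1 * \<delta>) S (%x. f x powr (\<gamma> - 1) - g x powr (\<gamma> - 1))"
    using Suc[of "\<gamma> - 1"] by (elim exE conjE)
  obtain C2 where C2: "0 <= C2" "!!l f. 0 <= l ==> cbnd k l M1 S f ==> (\<forall>x\<in>S. c <= f x \<and> f x <= M) ==>
      cbnd k l C2 S (%x. f x powr (\<gamma> - 1))"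
    using wbnd_powr[OF S c M1, of k M "\<gamma> - 1"] by blast
  define C where "C = C0 + \<bar>\<gamma>\<bar> * (2 ^ k * C1 * M1 + 2 ^ k * C2)"
  have p: "0 <= \<bar>\<gamma>\<bar> * (2 ^ k * C1 * M1 + 2 ^ k * C2)" using C1(1) C2(1) M1 by simp
  show ?case
  proof (intro exI[of _ C] conjI allI impI)
    show "0 <= C" using p C0(1) by (simp add: C_def)
    fix l \<delta> :: real and f g :: "'a => real"
    assume l: "0 <= l" and \<delta>: "0 <= \<delta>" and f: "cbnd (Suc k) l M1 S f" "\<forall>x\<in>S. c <= f x \<and> f x <= M"
      and g: "cbnd (Suc k) l M1 S g" "\<forall>x\<in>S. c <= g x \<and> g x <= M" and fg: "wbnd (Suc k) l \<delta> (%_. 1) S (%x. f x - g x)"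
    have pos: "0 < f x" "0 < g x" if "x \<in> S" for x using f(2) g(2) c that by force+
    show "cbnd (Suc k) l (C * \<delta>) S (%x. f x powr \<gamma> - g x powr \<gamma>)"
    proof (rule wbnd_Suc_has_derivativeI[OF S has_derivative_diff[OF
          has_derivative_powr_const[OF wbnd_has_derivative[OF f(1)] pos(1)] has_derivative_powr_const[OF wbnd_has_derivative[OF g(1)] pos(2)]]])
      fix x assume x: "x \<in> S"
      have "\<bar>f x powr \<gamma> - g x powr \<gamma>\<bar> <= C0 * \<bar>f x - g x\<bar>" using f(2) g(2) x by (intro C0(2)) auto
      also have "... <= C0 * \<delta>" using wbnd_bound[OF fg x] C0(1) by (intro mult_left_mono) auto
      also have "... <= C * \<delta>" using p \<delta> by (intro mult_right_mono) (auto simp: C_def)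
      finally show "\<bar>f x powr \<gamma> - g x powr \<gamma>\<bar> <= C * \<delta> * 1" by simp
    next
      fix b :: 'a assume b: "b \<in> Basis"
      have dfg: "cbnd k l (\<delta> * l) S (%x. fd f x b - fd g x b)"
      proof (rule wbnd_cong[OF S])
        show "cbnd k l (\<delta> * l) S (%x. frechet_derivative (%x. f x - g x) (at x) b)" using fg b by simp
        show "frechet_derivative (%x. f x - g x) (at x) b = fd f x b - fd g x b" if "x \<in> S" for x
          using frechet_derivative_at[OF has_derivative_diff[OF wbnd_has_derivative[OF f(1) that] wbnd_has_derivative[OF g(1) that]]] by metis
      qed
      have d1: "cbnd k l (C1 * \<delta>) S (%x. f x powr (\<gamma> - 1) - g x powr (\<gamma> - 1))"
        using C1(2) l \<delta> wbnd_Suc_D[OF f(1)] f(2) wbnd_Suc_D[OF g(1)] g(2) wbnd_Suc_D[OF fg] by (elim allE impE) assumption+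
      have e1: "wbnd k l (2 ^ k * (C1 * \<delta>) * (M1 * l)) (%x. 1 * 1) S (%x. (f x powr (\<gamma> - 1) - g x powr (\<gamma> - 1)) * fd f x b)"
        using f(1) b l \<delta> C1(1) M1 by (intro wbnd_mult[OF S d1]) auto
      have e2: "wbnd k l (2 ^ k * C2 * (\<delta> * l)) (%x. 1 * 1) S (%x. g x powr (\<gamma> - 1) * (fd f x b - fd g x b))"
        using l \<delta> C2(1) by (intro wbnd_mult[OF S C2(2)[OF l wbnd_Suc_D[OF g(1)] g(2)] dfg]) auto
      have "wbnd k l (\<bar>\<gamma>\<bar> * (2 ^ k * (C1 * \<delta>) * (M1 * l) + 2 ^ k * C2 * (\<delta> * l))) (%x. 1 * 1) S
          (%x. \<gamma> * (f x powr (\<gamma> - 1) * fd f x b) - \<gamma> * (g x powr (\<gamma> - 1) * fd g x b))"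
        by (rule wbnd_cong[OF S _ wbnd_cmult[OF S wbnd_add[OF S e1 e2]]]) (simp add: algebra_simps)
      then show "cbnd k l (C * \<delta> * l) S
          (%x. \<gamma> * (f x powr (\<gamma> - 1) * fd f x b) - \<gamma> * (g x powr (\<gamma> - 1) * fd g x b))"
        by (rule wbnd_mono) (use l \<delta> C0(1) in \<open>auto simp: C_def algebra_simps\<close>)
    qed
  qed
qed

subsection \<open>A cutoff function and the splitting of the Riesz kernel\<close>

lemma has_real_derivative_pos_part_power:
  "((%t::real. max 0 t ^ Suc (Suc n)) has_real_derivative real (Suc (Suc n)) * max 0 t ^ Suc n) (at t)"
proof -
  consider "0 < t" | "t < 0" | "t = 0" by linarith
  then show ?thesis
  proof cases
    case 1
    have "((%t::real. t ^ Suc (Suc n)) has_real_derivative real (Suc (Suc n)) * t ^ Suc n) (at t)"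
      using DERIV_pow[of "Suc (Suc n)" t UNIV] by simp
    then have "((%t::real. max 0 t ^ Suc (Suc n)) has_real_derivative real (Suc (Suc n)) * t ^ Suc n) (at t)"
      by (rule has_field_derivative_transform_within_open[of _ _ _ "{0<..}"]) (use 1 in auto)
    then show ?thesis using 1 by simp
  next
    case 2
    have "((%t::real. 0) has_real_derivative 0) (at t)" by simp
    then have "((%t::real. max 0 t ^ Suc (Suc n)) has_real_derivative 0) (at t)"
      by (rule has_field_derivative_transform_within_open[of _ _ _ "{..<0}"]) (use 2 in auto)
    then show ?thesis using 2 by simp
  next
    case 3
    have "((%h::real. (max 0 (0 + h) ^ Suc (Suc n) - max 0 0 ^ Suc (Suc n)) / h) \<longlongrightarrow> 0) (at 0)"
    proof (rule Lim_null_comparison[where g="%h. \<bar>h\<bar> ^ Suc n"])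
      have "norm (max 0 h ^ Suc (Suc n) / h) <= \<bar>h\<bar> ^ Suc n" for h :: real
        by (cases "0 < h") (auto simp: mult_nonpos_nonneg)
      then show "\<forall>\<^sub>F h in at 0. norm ((max 0 (0 + h) ^ Suc (Suc n) - max 0 0 ^ Suc (Suc n)) / h) <= \<bar>h\<bar> ^ Suc n"
        by (intro always_eventually) simp
      show "((%h::real. \<bar>h\<bar> ^ Suc n) \<longlongrightarrow> 0) (at 0)"
        by (rule tendsto_eq_intros | simp)+
    qed
    then show ?thesis using 3 by (simp add: DERIV_def)
  qed
qed

text \<open>A positive part raised to a power above \<open>k\<close> has \<open>k\<close> continuous
  derivatives, since differentiation lowers power and order together.\<close>

lemma wbnd_pos_part_power:
  fixes S :: "'a::euclidean_space set"
  assumes S: "open S" and f: "cbnd k 1 A S f" and A: "0 <= A"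
  shows "\<exists>C\<ge>0. cbnd k 1 C S (%x. max 0 (f x) ^ Suc (k + n))"
  using f
proof (induction k arbitrary: n)
  case (0 n)
  have "\<bar>max 0 (f x) ^ Suc n\<bar> <= A ^ Suc n" if "x \<in> S" for x
    using 0 that A unfolding power_abs by (intro power_mono) auto
  then show ?case using 0 A by (intro exI[of _ "A ^ Suc n"]) (auto intro!: continuous_intros simp del: power_Suc)
next
  case (Suc k n)
  obtain C where C: "0 <= C" "cbnd k 1 C S (%x. max 0 (f x) ^ Suc (k + n))"
    using Suc.IH[OF wbnd_Suc_D[OF Suc.prems]] by blast
  let ?M = "Suc (Suc (k + n))"
  define B where "B = A ^ ?M + real ?M * (2 ^ k * C * A)"
  have p: "0 <= real ?M * (2 ^ k * C * A)" using C A by simp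
  have "cbnd (Suc k) 1 B S (%x. max 0 (f x) ^ ?M)"
  proof (rule wbnd_Suc_has_derivativeI[OF S])
    show "((%x. max 0 (f x) ^ ?M) has_derivative (%h. real ?M * (max 0 (f x) ^ Suc (k + n) * fd f x h))) (at x)"
      if "x \<in> S" for x
      using has_derivative_compose[OF wbnd_has_derivative[OF Suc.prems that]
          has_real_derivative_pos_part_power[of "k + n" "f x", unfolded has_field_derivative_def]]
      by (simp add: mult.assoc)
    show "\<bar>max 0 (f x) ^ ?M\<bar> <= B * 1" if "x \<in> S" for x
    proof -
      have "\<bar>max 0 (f x) ^ ?M\<bar> <= A ^ ?M"
        using wbnd_bound[OF Suc.prems that] A unfolding power_abs by (intro power_mono) auto
      then show ?thesis using p by (simp add: B_def)
    qed
    fix b :: 'a assume b: "b \<in> Basis"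
    have "wbnd k 1 (2 ^ k * C * A) (%x. 1 * 1) S (%x. max 0 (f x) ^ Suc (k + n) * fd f x b)"
      using Suc.prems b C A by (intro wbnd_mult[OF S C(2)]) auto
    from wbnd_cmult[OF S this, of "real ?M"]
    show "cbnd k 1 (B * 1) S (%x. real ?M * (max 0 (f x) ^ Suc (k + n) * fd f x b))"
      by (rule wbnd_mono) (use A in \<open>auto simp: B_def simp del: power_Suc of_nat_Suc\<close>)
  qed
  moreover have "0 <= B" using p A by (simp add: B_def del: power_Suc of_nat_Suc)
  ultimately show ?case by auto
qed

lemma wbnd_inner:
  fixes b :: "'a::euclidean_space"
  assumes S: "open S" and A: "0 <= A" "!!x. x \<in> S ==> 0 <= w x" and 1: "!!x. x \<in> S ==> \<bar>x \<bullet> b\<bar> <= A * w x" "!!x. x \<in> S ==> norm b <= A * w x"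
  shows "wbnd k 1 A w S (%x. x \<bullet> b)"
proof (cases k)
  case 0
  then show ?thesis using 1 by (auto intro!: continuous_intros)
next
  case (Suc j)
  show ?thesis unfolding Suc
  proof (rule wbnd_Suc_has_derivativeI[OF S])
    show "((%x. x \<bullet> b) has_derivative (%h. h \<bullet> b)) (at x)" for x by (auto intro!: derivative_eq_intros)
    show "wbnd j 1 (A * 1) w S (%x. i \<bullet> b)" if "i \<in> Basis" for i
    proof (rule wbnd_const[OF S])
      show "\<bar>i \<bullet> b\<bar> <= A * 1 * w x" if x: "x \<in> S" for x
        using Basis_le_norm[OF \<open>i \<in> Basis\<close>, of b] 1(2)[OF x] by (simp add: inner_commute)
    qed (use A in auto)
  qed (use 1 in auto)
qed

text \<open>Built from truncated powers, hence of class \<open>k\<close>. \<open>P\<close> lives in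
  the unit ball, and for \<open>norm x <= 1 / 2\<close> the value \<open>(4 / 3) ^ M * P x\<close>
  is at least 1, which makes the outer truncated power vanish.\<close>

lemma cutoff_exists:
  "\<exists>\<phi>::'a::euclidean_space => real. (\<forall>x. 0 <= \<phi> x \<and> \<phi> x <= 1) \<and> (\<forall>x. norm x <= 1 / 2 --> \<phi> x = 1) \<and> (\<forall>x. 1 <= norm x --> \<phi> x = 0)
    \<and> (\<exists>C\<ge>0. cbnd k 1 C UNIV \<phi>)"
proof -
  define M where "M = Suc k"
  define P where "P x = max 0 (1 - x \<bullet> x) ^ M" for x :: 'a
  define \<phi> where "\<phi> x = 1 - max 0 (1 - (4 / 3) ^ M * P x) ^ M" for x
  let ?B = "ball 0 2 :: 'a set"
  have o: "open ?B" by simp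
  have sq: "cbnd k 1 8 ?B (%x. x \<bullet> x)"
  proof -
    have bd: "\<bar>x \<bullet> x\<bar> <= 4" if "x \<in> ?B" for x
      using that power_mono[of "norm x" 2 2] by (simp add: dot_square_norm)
    show ?thesis
    proof (cases k)
      case 0
      then show ?thesis using bd by (force intro!: continuous_intros)
    next
      case (Suc j)
      show ?thesis unfolding Suc
      proof (rule wbnd_Suc_has_derivativeI[OF o])
        show "((%x. x \<bullet> x) has_derivative (%h. 2 * (x \<bullet> h))) (at x)" for x :: 'a
          by (auto intro!: derivative_eq_intros simp: inner_commute)
        show "\<bar>x \<bullet> x\<bar> <= 8 * 1" if "x \<in> ?B" for x using bd[OF that] by simp
        fix b :: 'a assume b: "b \<in> Basis"
        have "cbnd j 1 4 ?B (%x. x \<bullet> b)"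
        proof (rule wbnd_inner[OF o])
          show "\<bar>x \<bullet> b\<bar> <= 4 * 1" if "x \<in> ?B" for x using Basis_le_norm[OF b, of x] that by simp
        qed (use b in auto)
        from wbnd_cmult[OF o this, of 2] show "cbnd j 1 (8 * 1) ?B (%x. 2 * (x \<bullet> b))" by simp
      qed
    qed
  qed
  have "cbnd k 1 (1 + 8) ?B (%x. 1 - x \<bullet> x)"
    by (intro wbnd_diff[OF o] sq wbnd_const[OF o]) auto
  from wbnd_pos_part_power[OF o this, of 0] obtain C1 where C1: "0 <= C1" "cbnd k 1 C1 ?B P"
    by (auto simp: P_def[abs_def] M_def simp del: power_Suc)
  have "cbnd k 1 (1 + \<bar>(4 / 3) ^ M\<bar> * C1) ?B (%x. 1 - (4 / 3) ^ M * P x)"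
    by (intro wbnd_diff[OF o] wbnd_cmult[OF o] C1(2) wbnd_const[OF o]) auto
  moreover have "0 <= 1 + \<bar>(4 / 3::real) ^ M\<bar> * C1" using C1(1) by simp
  ultimately obtain C2 where C2: "0 <= C2" "cbnd k 1 C2 ?B (%x. max 0 (1 - (4 / 3) ^ M * P x) ^ M)"
    using wbnd_pos_part_power[OF o, of k _ _ 0] unfolding M_def add_0_right by blast
  have wB: "cbnd k 1 (1 + C2) ?B \<phi>"
    unfolding \<phi>_def by (intro wbnd_diff[OF o] C2(2) wbnd_const[OF o]) auto
  have P0: "P x = 0" if "1 <= norm x" for x
    using that one_le_power[OF that, of 2] by (simp add: P_def M_def dot_square_norm)
  have ge1: "\<phi> x = 0" if "1 <= norm x" for x using P0[OF that] by (simp add: \<phi>_def)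
  \<comment> \<open>Polynomials in \<open>x\<close> are bounded only on bounded sets, so the
    formulas are estimated on the ball of radius 2; beyond the unit ball \<open>\<phi>\<close> is 0,
    and the two open sets are glued.\<close>
  have o2: "open {x::'a. 1 < norm x}" by (intro open_Collect_less continuous_intros)
  have "cbnd k 1 (1 + C2) {x::'a. 1 < norm x} \<phi>"
    by (rule wbnd_cong[OF o2 _ wbnd_zero[OF o2]]) (use ge1 C2 in auto)
  then have "cbnd k 1 (1 + C2) (?B \<union> {x. 1 < norm x}) \<phi>" by (intro wbnd_glue o o2 wB)
  moreover have "?B \<union> {x. 1 < norm x} = UNIV" by auto
  ultimately have w: "cbnd k 1 (1 + C2) UNIV \<phi>" by simp
  have P_nn: "0 <= P x" for x by (simp add: P_def)
  have "max 0 (1 - (4 / 3) ^ M * P x) ^ M <= 1" for x using P_nn[of x] by (intro power_le_one) auto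
  then have bd: "0 <= \<phi> x \<and> \<phi> x <= 1" for x by (simp add: \<phi>_def)
  have "\<phi> x = 1" if "norm x <= 1 / 2" for x
  proof -
    have "x \<bullet> x <= (1 / 2)\<^sup>2" unfolding dot_square_norm using that by (intro power_mono) auto
    then have "3 / 4 <= 1 - x \<bullet> x" by (simp add: power2_eq_square)
    then have "(3 / 4) ^ M <= P x" unfolding P_def by (intro power_mono) auto
    then have "(4 / 3) ^ M * (3 / 4) ^ M <= (4 / 3) ^ M * P x" by (intro mult_left_mono) auto
    then show ?thesis by (simp add: \<phi>_def M_def power_mult_distrib[symmetric] del: power_Suc)
  qed
  then show ?thesis using w bd ge1 C2(1) by (intro exI[of _ \<phi>]) (auto intro!: exI[of _ "1 + C2"])
qed

lemma open_norm_greater: "open {x::'a::real_normed_vector. \<delta> < norm x}"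
  by (intro open_Collect_less continuous_intros)

text \<open>A partial derivative is \<open>- a * norm x powr - (a + 2)\<close> times a coordinate,
  so the induction runs over all \<open>a\<close>; the lower bound \<open>\<delta>\<close> on the
  norm absorbs the extra decay.\<close>

lemma wbnd_norm_powr:
  assumes \<delta>: "0 < \<delta>"
  shows "\<exists>C\<ge>0. wbnd k 1 C (%x. norm x powr - a) {x::'a::euclidean_space. \<delta> < norm x} (%x. norm x powr - a)"
proof (induction k arbitrary: a)
  case 0
  show ?case by (intro exI[of _ 1]) (use \<delta> in \<open>auto intro!: continuous_intros\<close>)
next
  case (Suc k)
  let ?S = "{x::'a. \<delta> < norm x}"
  note S = open_norm_greater[where 'a='a, of \<delta>]
  obtain C where C: "0 <= C" "wbnd k 1 C (%x. norm x powr - (a + 2)) ?S (%x. norm x powr - (a + 2))"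
    using Suc[of "a + 2"] by blast
  define A where "A = 1 + 1 / \<delta>"
  define B where "B = 1 + \<bar>a\<bar> * (2 ^ k * C * A) / \<delta>"
  have A: "0 <= A" and AC: "0 <= \<bar>a\<bar> * (2 ^ k * C * A)" using \<delta> C(1) by (auto simp: A_def)
  have "wbnd (Suc k) 1 B (%x. norm x powr - a) ?S (%x. norm x powr - a)"
  proof (rule wbnd_Suc_has_derivativeI[OF S])
    show "((%x. norm x powr - a) has_derivative (%h. - a * (norm x powr - (a + 2) * (x \<bullet> h)))) (at x)" if "x \<in> ?S" for x
    proof -
      have x: "x ~= 0" using that \<delta> by auto
      have "norm x powr (- a - 1) = norm x powr (- (a + 2)) * norm x"
        using powr_mult_base[of "norm x" "- (a + 2)"] by (simp add: mult.commute minus_diff_commute)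
      then have "norm x powr (- a - 1) * (sgn x \<bullet> h) = norm x powr - (a + 2) * (x \<bullet> h)" for h
        using x by (simp add: sgn_div_norm)
      then show ?thesis
        using has_derivative_powr_const[OF has_derivative_norm[OF x], of "- a"] x by (simp add: inner_commute)
    qed
    show "\<bar>norm x powr - a\<bar> <= B * norm x powr - a" if "x \<in> ?S" for x
      using AC \<delta> by (simp add: B_def distrib_right)
    fix b :: 'a assume b: "b \<in> Basis"
    have "wbnd k 1 (2 ^ k * C * A) (%x. norm x powr - (a + 2) * norm x) ?S (%x. norm x powr - (a + 2) * (x \<bullet> b))"
    proof (intro wbnd_mult[OF S C(2) wbnd_inner[OF S A]])
      show "\<bar>x \<bullet> b\<bar> <= A * norm x" if "x \<in> ?S" for x
        using Basis_le_norm[OF b, of x] mult_right_mono[of 1 A "norm x"] \<delta> by (simp add: A_def)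
      show "norm b <= A * norm x" if "x \<in> ?S" for x
      proof -
        have "1 <= 1 / \<delta> * norm x" using that \<delta> by (simp add: field_simps)
        also have "... <= A * norm x" by (intro mult_right_mono) (auto simp: A_def)
        finally show ?thesis using b by simp
      qed
    qed (use C A in auto)
    from wbnd_cmult[OF S this, of "- a"]
    show "wbnd k 1 (B * 1) (%x. norm x powr - a) ?S (%x. - a * (norm x powr - (a + 2) * (x \<bullet> b)))"
    proof (rule wbnd_mono)
      fix x assume x: "x \<in> ?S"
      have "norm x powr - (a + 2) * norm x <= norm x powr - a / \<delta>"
      proof -
        have "norm x powr - a = norm x powr - (a + 2) * norm x * norm x"
          using x \<delta> powr_mult_base[of "norm x" "- (a + 2)"] powr_mult_base[of "norm x" "- (a + 2) + 1"] by (simp add: ac_simps add.commute)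
        moreover have "norm x powr - (a + 2) * norm x * \<delta> <= norm x powr - (a + 2) * norm x * norm x"
          using x by (intro mult_left_mono) auto
        ultimately show ?thesis using \<delta> by (simp add: le_divide_eq)
      qed
      from mult_left_mono[OF this AC]
      have "\<bar>- a\<bar> * (2 ^ k * C * A) * (norm x powr - (a + 2) * norm x) <= \<bar>a\<bar> * (2 ^ k * C * A) * (norm x powr - a / \<delta>)" by simp
      also have "... <= B * 1 * norm x powr - a" by (simp add: B_def distrib_right)
      finally show "\<bar>- a\<bar> * (2 ^ k * C * A) * (norm x powr - (a + 2) * norm x) <= B * 1 * norm x powr - a" .
    qed auto
  qed
  moreover have "0 <= B" using AC \<delta> by (simp add: B_def)
  ultimately show ?case by blast
qed

lemma distr_lborel_reflect: "distr lborel borel (%z. x - z) = (lborel :: 'a::euclidean_space measure)"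
proof (rule measure_eqI)
  fix A :: "'a set" assume "A \<in> sets (distr lborel borel (%z. x - z))"
  then have A[measurable]: "A \<in> sets borel" by simp
  have "emeasure (distr lborel borel (%z. x - z)) A = (NN z. indicator A (x - z))"
    by (subst nn_integral_indicator[symmetric], simp, subst nn_integral_distr) auto
  also have "... = (NN z. indicator A z)"
    by (rule nn_integral_lborel_reflect) simp
  finally show "emeasure (distr lborel borel (%z. x - z)) A = emeasure lborel A" by simp
qed simp

lemma
  fixes h :: "'a::euclidean_space => real"
  assumes [measurable]: "h \<in> Borel"
  shows integral_lborel_reflect: "(LINT z|lborel. h (x - z)) = (LINT z|lborel. h z)"
    and integrable_lborel_reflect: "integrable lborel (%z. h (x - z)) \<longleftrightarrow> integrable lborel h"
  using integral_distr[of "%z. x - z" lborel borel h] integrable_distr_eq[of "%z. x - z" lborel borel h]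
  by (simp_all add: distr_lborel_reflect)

context riesz
begin

lemma K_scale: "0 < t ==> K (t *\<^sub>R (x::'a)) = t powr - (N - s) * K x"
  by (simp add: K_eq powr_mult)

text \<open>The far part \<open>G\<close> is smooth with the decay of the kernel. By homogeneity the
  annulus is \<open>2 powr (N - s) * G (2 *\<^sub>R x) - G x\<close>, so its bounds follow from
  those of \<open>G\<close>.\<close>

lemma kernel_split:
  "\<exists>\<phi>::'a => real. \<exists>C\<ge>0. (\<forall>x. 0 <= \<phi> x \<and> \<phi> x <= 1) \<and> (\<forall>x. 1 <= norm x --> \<phi> x = 0) \<and> \<phi> \<in> Borel
    \<and> wbnd k 1 C (%x. (1 + norm x) powr - (N - s)) UNIV (%x. K x * (1 - \<phi> x))
    \<and> wbnd k 1 C (indicator (cball 0 1)) UNIV (%x. K x * (\<phi> x - \<phi> (2 *\<^sub>R x)))"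
proof -
  obtain \<phi> :: "'a => real" and C0 where \<phi>: "!!x. 0 <= \<phi> x \<and> \<phi> x <= 1" "!!x. norm x <= 1 / 2 ==> \<phi> x = 1"
      "!!x. 1 <= norm x ==> \<phi> x = 0" and C0: "0 <= C0" "cbnd k 1 C0 UNIV \<phi>"
    using cutoff_exists[where 'a='a, of k] by metis
  define w where "w x = (1 + norm x) powr - (N - s)" for x :: 'a
  define G where "G x = K x * (1 - \<phi> x)" for x
  have Ns: "0 < N - s" using s_less by simp
  have w0: "0 <= w x" "w x <= 1" for x
  proof -
    show "0 <= w x" by (simp add: w_def)
    have "w x <= 1 powr - (N - s)" unfolding w_def using Ns by (intro powr_mono2') auto
    then show "w x <= 1" by simp
  qed
  have m\<phi>: "\<phi> \<in> Borel"
    by (rule borel_measurable_continuous_onI[OF wbnd_continuous[OF C0(2)]])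
  let ?S = "{x::'a. 1 / 4 < norm x}"
  note S = open_norm_greater[where 'a='a, of "1/4"]
  obtain C1 where C1: "0 <= C1" "wbnd k 1 C1 (%x. norm x powr - (N - s)) ?S (%x. norm x powr - (N - s))"
    using wbnd_norm_powr[where 'a='a, of "1/4" k "N - s"] by auto
  have "cbnd k 1 (1 + C0) UNIV (%x. 1 - \<phi> x)"
    by (intro wbnd_diff C0(2) wbnd_const) auto
  then have wphi: "cbnd k 1 (1 + C0) ?S (%x. 1 - \<phi> x)" by (rule wbnd_mono) auto
  define C2 where "C2 = 2 ^ k * (\<bar>kc\<bar> * C1) * (1 + C0)"
  have C2: "0 <= C2" using C0 C1 by (simp add: C2_def)
  have "wbnd k 1 C2 (%x. norm x powr - (N - s) * 1) ?S (%x. (kc * norm x powr - (N - s)) * (1 - \<phi> x))"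
    unfolding C2_def using C0(1) C1(1) by (intro wbnd_mult[OF S wbnd_cmult[OF S C1(2)] wphi]) auto
  then have GS: "wbnd k 1 (C2 * 5 powr (N - s)) w ?S G"
  proof (intro wbnd_cong[OF S _ wbnd_mono])
    fix x :: 'a assume x: "x \<in> ?S"
    have "(5 * norm x) powr - (N - s) <= w x"
      unfolding w_def using x Ns by (intro powr_mono2') auto
    then have le: "5 powr (N - s) * ((5 * norm x) powr - (N - s)) <= 5 powr (N - s) * w x" by (intro mult_left_mono) auto
    have "norm x powr - (N - s) = 5 powr (N - s) * ((5 * norm x) powr - (N - s))"
      by (simp add: powr_mult mult.assoc[symmetric] powr_add[symmetric])
    also note le
    finally have "norm x powr - (N - s) <= 5 powr (N - s) * w x" by simp
    from mult_left_mono[OF this C2]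
    show "C2 * (norm x powr - (N - s) * 1) <= C2 * 5 powr (N - s) * w x" by (simp add: mult.assoc)
  qed (auto simp: G_def K_eq)
  have "wbnd k 1 (C2 * 5 powr (N - s)) w (ball 0 (1/2)) G"
    by (rule wbnd_cong[OF _ _ wbnd_zero]) (use C2 \<phi>(2) w0 in \<open>auto simp: G_def\<close>)
  with GS have "wbnd k 1 (C2 * 5 powr (N - s)) w (?S \<union> ball 0 (1/2)) G" by (intro wbnd_glue S) auto
  moreover have "?S \<union> ball 0 (1/2) = UNIV" by auto
  ultimately have wG: "wbnd k 1 (C2 * 5 powr (N - s)) w UNIV G" by simp
  define C3 where "C3 = C2 * 5 powr (N - s)"
  define C4 where "C4 = \<bar>2 powr (N - s)\<bar> * (C3 * 2 ^ k) + C3"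
  have C3: "0 <= C3" using C2 by (simp add: C3_def)
  have C4: "0 <= C4" "C3 <= C4" using C3 by (auto simp: C4_def)
  have "wbnd k 1 (C3 * 2 ^ k) (%x. w (2 *\<^sub>R x)) UNIV (%x. G (2 *\<^sub>R x))"
    using wG C3 w0 by (intro wbnd_rescale[where c=2 and l=2]) (auto intro!: wbnd_dilate simp: C3_def)
  then have "wbnd k 1 (C3 * 2 ^ k) w UNIV (%x. G (2 *\<^sub>R x))"
  proof (rule wbnd_mono)
    fix x
    have "w (2 *\<^sub>R x) <= w x" unfolding w_def using Ns by (intro powr_mono2') (auto simp: add_pos_nonneg)
    then show "C3 * 2 ^ k * w (2 *\<^sub>R x) <= C3 * 2 ^ k * w x" using C3 by (intro mult_left_mono) auto
  qed auto
  then have "wbnd k 1 C4 w UNIV (%x. 2 powr (N - s) * G (2 *\<^sub>R x) - G x)"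
    unfolding C4_def using wG by (intro wbnd_diff wbnd_cmult) (auto simp: C3_def)
  moreover have "2 powr (N - s) * G (2 *\<^sub>R x) - G x = K x * (\<phi> x - \<phi> (2 *\<^sub>R x))" for x
  proof -
    have "2 powr (N - s) * K (2 *\<^sub>R x) = K x"
      using K_scale[of 2 x] by (simp add: mult.assoc[symmetric] powr_add[symmetric])
    then have "2 powr (N - s) * G (2 *\<^sub>R x) = K x * (1 - \<phi> (2 *\<^sub>R x))" by (simp add: G_def mult.assoc[symmetric])
    then show ?thesis by (simp add: G_def algebra_simps)
  qed
  ultimately have "wbnd k 1 C4 w UNIV (%x. K x * (\<phi> x - \<phi> (2 *\<^sub>R x)))" by simp
  \<comment> \<open>The annulus vanishes outside the unit ball, so the decaying weight may be
    replaced by an indicator.\<close>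
  from wbnd_restrict_weight[OF open_norm_greater[of 1] this] \<phi>(3)
  have "wbnd k 1 C4 (%x. w x * indicator (- {x. 1 < norm x}) x) UNIV (%x. K x * (\<phi> x - \<phi> (2 *\<^sub>R x)))" by simp
  then have d: "wbnd k 1 C4 (indicator (cball 0 1)) UNIV (%x. K x * (\<phi> x - \<phi> (2 *\<^sub>R x)))"
    by (rule wbnd_mono) (use w0 C4 in \<open>auto simp: indicator_def mult_left_le\<close>)
  have "wbnd k 1 C4 w UNIV G"
    by (rule wbnd_mono[OF wG]) (use C4 w0 in \<open>auto simp: C3_def intro: mult_right_mono\<close>)
  then show ?thesis using d \<phi>(1,3) C4(1) m\<phi> unfolding w_def G_def by blast
qed

end

text \<open>\<open>\<phi>\<close> cuts the kernel into the singular part \<open>Kg t\<close>, supported in the ball of radius \<open>1 / t\<close>,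
  and the smooth part \<open>Ks t\<close>; \<open>Kd t\<close> is the dyadic annulus \<open>Kg t - Kg (2 * t)\<close>.\<close>

locale riesz_split = riesz s T N for s :: real and T :: "'a::euclidean_space itself" and N :: real +
  fixes k :: nat and \<phi> :: "'a => real" and Cs :: real
  assumes phi_nonneg: "0 <= \<phi> x" and phi_le: "\<phi> x <= 1" and phi_0: "1 <= norm x ==> \<phi> x = 0"
    and phi_measurable[measurable]: "\<phi> \<in> Borel" and Cs: "0 <= Cs"
    and wbnd_smooth: "wbnd k 1 Cs (%x. (1 + norm x) powr - (N - s)) UNIV (%x. K x * (1 - \<phi> x))"
    and wbnd_annulus: "wbnd k 1 Cs (indicator (cball 0 1)) UNIV (%x. K x * (\<phi> x - \<phi> (2 *\<^sub>R x)))"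
begin

definition Kg :: "real => 'a => real" where "Kg t x = K x * \<phi> (t *\<^sub>R x)"
definition Ks :: "real => 'a => real" where "Ks t x = K x * (1 - \<phi> (t *\<^sub>R x))"
definition Kd :: "real => 'a => real" where "Kd t x = K x * (\<phi> (t *\<^sub>R x) - \<phi> ((2 * t) *\<^sub>R x))"

lemma kernel_parts_measurable[measurable]:
  "Kg t \<in> Borel" "Ks t \<in> Borel" "Kd t \<in> Borel"
  unfolding Kg_def[abs_def] Ks_def[abs_def] Kd_def[abs_def] by measurable

lemma Kg_nonneg: "0 <= Kg t x" by (simp add: Kg_def phi_nonneg)
lemma Ks_nonneg: "0 <= Ks t x" by (simp add: Ks_def phi_le)
lemma Kg_le: "Kg t x <= K x" using mult_left_le[OF phi_le K_nonneg] by (simp add: Kg_def)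
lemma Ks_le: "Ks t x <= K x" using mult_left_le[of "1 - \<phi> (t *\<^sub>R x)", OF _ K_nonneg] by (simp add: Ks_def phi_nonneg)

lemma Kg_eq_0: "0 < t ==> 1 / t <= norm x ==> Kg t x = 0"
  using phi_0[of "t *\<^sub>R x"] by (simp add: Kg_def field_simps)

lemma wbnd_Ks:
  assumes t: "0 < t"
  shows "wbnd k t (t powr (N - s) * Cs) (%x. (1 + norm (t *\<^sub>R x)) powr - (N - s)) UNIV (Ks t)"
proof -
  have "t powr (N - s) * K (t *\<^sub>R x) = K x" for x :: 'a
    using K_scale[OF t, of x] t by (simp add: mult.assoc[symmetric] powr_add[symmetric])
  then have "Ks t x = t powr (N - s) * (K (t *\<^sub>R x) * (1 - \<phi> (t *\<^sub>R x)))" for x by (simp add: Ks_def mult.assoc[symmetric])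
  then show ?thesis using wbnd_cong[OF open_UNIV _ wbnd_cmult[OF open_UNIV wbnd_dilate[OF wbnd_smooth t], of "t powr (N - s)"], of "Ks t"] t by simp
qed

lemma wbnd_Kd:
  assumes t: "0 < t"
  shows "wbnd k t (t powr (N - s) * Cs) (%x. indicator (cball 0 1) (t *\<^sub>R x)) UNIV (Kd t)"
proof -
  have "t powr (N - s) * K (t *\<^sub>R x) = K x" for x :: 'a
    using K_scale[OF t, of x] t by (simp add: mult.assoc[symmetric] powr_add[symmetric])
  then have "Kd t x = t powr (N - s) * (K (t *\<^sub>R x) * (\<phi> (t *\<^sub>R x) - \<phi> (2 *\<^sub>R (t *\<^sub>R x))))" for x
    by (simp add: Kd_def mult.assoc[symmetric])
  then show ?thesis using wbnd_cong[OF open_UNIV _ wbnd_cmult[OF open_UNIV wbnd_dilate[OF wbnd_annulus t], of "t powr (N - s)"], of "Kd t"] by simp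
qed

text \<open>The L^1 norm of the part of radius \<open>1 / t\<close> is of order
  \<open>t powr - s\<close>; this is the gain of \<open>s\<close> orders in
  \<open>reg_conv\<close>.\<close>

lemma Kg_integral: "\<exists>C\<ge>0. \<forall>t>0. (NN z. ennreal (Kg t z)) <= ennreal (C * t powr - s)"
proof -
  obtain C where C: "0 <= C" "!!r. 0 < r ==> (NN x. ennreal (norm x powr - (N - s)) * indicator (ball (0::'a) r) x) <= ennreal (C * r powr (N - (N - s)))"
    using nn_integral_norm_powr_ball[where 'a='a and b="N - s", folded N_eq] s_pos by auto
  show ?thesis
  proof (intro exI[of _ "kc * C"] conjI allI impI)
    show "0 <= kc * C" using kc_pos C(1) by simp
    fix t :: real assume t: "0 < t"
    have "(NN z. ennreal (Kg t z)) <= (NN z. ennreal kc * (ennreal (norm z powr - (N - s)) * indicator (ball (0::'a) (1 / t)) z))"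
    proof (rule nn_integral_mono)
      fix z :: 'a
      show "ennreal (Kg t z) <= ennreal kc * (ennreal (norm z powr - (N - s)) * indicator (ball 0 (1 / t)) z)"
        using Kg_le[of t z] Kg_eq_0[OF t, of z] kc_pos
        by (cases "1 / t <= norm z") (auto simp: K_eq ennreal_mult[symmetric] intro!: ennreal_leI)
    qed
    also have "... = ennreal kc * (NN z. ennreal (norm z powr - (N - s)) * indicator (ball (0::'a) (1 / t)) z)"
      by (rule nn_integral_cmult) (auto intro!: borel_measurable_times_ennreal borel_measurable_indicator)
    also have "... <= ennreal kc * ennreal (C * (1 / t) powr (N - (N - s)))" using t by (intro mult_left_mono C(2)) auto
    also have "(1 / t) powr (N - (N - s)) = t powr - s" using t by (simp add: powr_divide powr_minus_divide)
    also have "ennreal kc * ennreal (C * t powr - s) = ennreal (kc * C * t powr - s)"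
      using kc_pos C(1) by (simp add: ennreal_mult[symmetric] mult.assoc)
    finally show "(NN z. ennreal (Kg t z)) <= ennreal (kc * C * t powr - s)" .
  qed
qed

lemma Kg_integrable: "0 < t ==> integrable lborel (Kg t)"
  using Kg_integral by (intro integrableI_nonneg) (auto simp: Kg_nonneg intro: le_less_trans)

text \<open>The near kernel has radius \<open>1 / t <= r - r'\<close>, so on the smaller ball it
  sees \<open>F\<close> in the larger ball alone.\<close>

lemma wbnd_conv_Kg:
  assumes t: "0 < t" "1 / t <= r - r'" and F: "cbnd k l A (ball 0 r) F" "0 <= A" and l: "0 <= l"
    and W: "0 <= W" "(NN z. ennreal (Kg t z)) <= ennreal W"
  shows "cbnd k l (A * W) (ball 0 r') (%x. LINT z|lborel. Kg t z * F (x - z))"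
proof (rule wbnd_conv[where w="%_. 1" and S'="ball 0 r"])
  show "x - z \<in> ball 0 r" if "x \<in> ball 0 r'" "Kg t z ~= 0" for x z
  proof -
    have "norm z < 1 / t" using Kg_eq_0[OF t(1), of z] that(2) by force
    then show ?thesis using that(1) t(2) norm_triangle_ineq4[of x z] by auto
  qed
  show "\<exists>d>0. \<exists>G. integrable lborel G \<and> ball x d \<subseteq> ball 0 r' \<and> (\<forall>y\<in>ball x d. \<forall>z. \<bar>Kg t z\<bar> * 1 <= G z)" if x: "x \<in> ball 0 r'" for x
  proof -
    obtain d where "0 < d" "ball x d \<subseteq> ball 0 r'" using openE[OF open_ball x] by blast
    then show ?thesis using Kg_integrable[OF t(1)] by (intro exI[of _ d] conjI exI[of _ "Kg t"]) (auto simp: Kg_nonneg)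
  qed
qed (use assms in \<open>auto simp: Kg_nonneg\<close>)

lemma Kd_integral:
  fixes F :: "'a => real" and x :: 'a
  assumes F: "F \<in> Borel" "!!z. \<bar>F z\<bar> <= B" and t: "0 < t"
  shows "(NN z. ennreal (\<bar>F z\<bar> * indicator (cball 0 1) (t *\<^sub>R (x - z))))
    <= ennreal (B * (t powr - N * measure lborel (cball (0::'a) 1)))"
proof -
  have [measurable]: "F \<in> Borel" by fact
  have B: "0 <= B" using F(2)[of 0] by simp
  have [measurable]: "(%z. indicator (cball (0::'a) 1) (t *\<^sub>R z) :: ennreal) \<in> Borel"
    by (rule measurable_compose[of "%z. t *\<^sub>R z" _ borel]) auto
  have "(NN z. ennreal (\<bar>F z\<bar> * indicator (cball 0 1) (t *\<^sub>R (x - z))))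
      <= (NN z. ennreal B * indicator (cball 0 1) (t *\<^sub>R (x - z)))"
    using F(2) by (intro nn_integral_mono) (auto simp: indicator_def intro!: ennreal_leI)
  also have "... = ennreal B * (NN z. indicator (cball 0 1) (t *\<^sub>R (x - z)))"
    by (rule nn_integral_cmult) measurable
  also have "(NN z. indicator (cball (0::'a) 1) (t *\<^sub>R (x - z))) = (NN z. indicator (cball (0::'a) 1) (t *\<^sub>R z))"
    by (rule nn_integral_lborel_reflect) simp
  also have "... = ennreal (t powr - real DIM('a)) * (NN z. indicator (cball (0::'a) 1) z)"
    by (rule nn_integral_lborel_scale) (use t in auto)
  also have "(NN z. indicator (cball (0::'a) 1) z) = ennreal (measure lborel (cball (0::'a) 1))"
    by (simp, subst emeasure_eq_ennreal_measure) (use emeasure_lborel_cball_finite[of "0::'a" 1] in auto)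
  finally show ?thesis using B by (simp add: ennreal_mult[symmetric] N_eq)
qed

text \<open>Derivatives fall on the annulus at the cost of \<open>t\<close> each. Its height is of
  order \<open>t powr (N - s)\<close> and its volume of order \<open>t powr - N\<close>, which
  leaves \<open>t powr - s\<close>.\<close>

lemma wbnd_conv_Kd:
  fixes F :: "'a => real"
  assumes t: "0 < t" and F: "F \<in> Borel" "!!z. \<bar>F z\<bar> <= B" "!!z. r <= norm z ==> F z = 0"
  shows "cbnd k t (Cs * measure lborel (cball (0::'a) 1) * B * t powr - s) (ball 0 r') (%x. LINT z|lborel. F z * Kd t (x - z))"
proof -
  have B: "0 <= B" using F(2)[of 0] by simp
  have "wbnd k t (t powr (N - s) * Cs * (B * (t powr - N * measure lborel (cball (0::'a) 1)))) (%_. 1) (ball 0 r') (%x. LINT z|lborel. F z * Kd t (x - z))"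
  proof (rule wbnd_conv[where w="%x. indicator (cball 0 1) (t *\<^sub>R x)" and S'=UNIV])
    show "(%x. indicat_real (cball (0::'a) 1) (t *\<^sub>R x)) \<in> Borel"
      by (rule measurable_compose[of "%z. t *\<^sub>R z" _ borel]) auto
    show "\<exists>d>0. \<exists>G. integrable lborel G \<and> ball x d \<subseteq> ball 0 r' \<and> (\<forall>y\<in>ball x d. \<forall>z. \<bar>F z\<bar> * indicator (cball 0 1) (t *\<^sub>R (y - z)) <= G z)"
      if x: "x \<in> ball 0 r'" for x
    proof -
      obtain d where d: "0 < d" "ball x d \<subseteq> ball 0 r'" using openE[OF open_ball x] by blast
      have G: "integrable lborel (%z::'a. B * indicator (cball 0 r) z)"
        using emeasure_lborel_cball_finite[of "0::'a" r] by (intro integrable_mult_right integrable_real_indicator) auto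
      have "\<bar>F z\<bar> * indicator (cball 0 1) (t *\<^sub>R (y - z)) <= B * indicator (cball 0 r) z" for y z
        using F(2)[of z] F(3)[of z] B by (auto simp: indicator_def)
      with d G show ?thesis by blast
    qed
  qed (use F Kd_integral[OF F(1,2) t] wbnd_Kd[OF t] t Cs B in auto)
  moreover have "t powr (N - s) * Cs * (B * (t powr - N * measure lborel (cball (0::'a) 1))) = Cs * measure lborel (cball (0::'a) 1) * B * t powr - s"
  proof -
    have "t powr (N - s) * t powr - N = t powr - s" by (simp add: powr_add[symmetric])
    then show ?thesis by (metis (no_types, lifting) mult.assoc mult.commute)
  qed
  ultimately show ?thesis by simp
qed

text \<open>The far kernel is smooth, so \<open>f\<close> contributes through integrability only.
  The constant may depend on \<open>t\<close>, as the estimate serves at a single starting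
  scale.\<close>

lemma wbnd_conv_Ks:
  assumes t: "1 <= t" and r: "0 <= r" and f: "f \<in> Borel" "!!z. 0 <= f z" "rpot s f (0::'a) < \<infinity>"
  shows "\<exists>C\<ge>0. cbnd k 1 C (ball 0 r) (%x. LINT z|lborel. f z * Ks t (x - z))"
proof -
  have [measurable]: "f \<in> Borel" by fact
  define w where "w x = (1 + norm (t *\<^sub>R x)) powr - (N - s)" for x :: 'a
  \<comment> \<open>For \<open>x\<close> in the ball,
    \<open>norm z <= (1 + r) * (1 + norm (x - z))\<close>; this compares the weight with the
    integrand of the potential at the origin, whose integral is finite.\<close>
  define G where "G z = (1 + r) powr (N - s) * (norm z powr - (N - s) * f z)" for z
  have iG: "integrable lborel G" unfolding G_def
  proof (rule integrable_mult_right)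
    have "integrable lborel (%y. 1 / kc * (K (0 - y) * f y))"
      by (intro integrable_mult_right rpotr_eq_integral f)
    then show "integrable lborel (%z. norm z powr - (N - s) * f z)" using kc_pos by (simp add: K_eq)
  qed
  have G_nn: "0 <= G z" for z using f(2) by (simp add: G_def)
  have fin: "(NN z. ennreal (G z)) < \<infinity>"
    using iG G_nn by (simp add: integrable_iff_bounded)
  have wG: "\<bar>f z\<bar> * w (x - z) <= G z" if x: "x \<in> ball 0 r" and z: "z ~= 0" for x z
  proof -
    have "norm z <= norm x + norm (x - z)" using norm_triangle_ineq2[of z x] by (simp add: norm_minus_commute)
    also have "... <= (1 + r) * (1 + norm (x - z))" using x mult_nonneg_nonneg[OF r norm_ge_zero[of "x - z"]] by (simp add: distrib_left distrib_right)
    also have "... <= (1 + r) * (1 + norm (t *\<^sub>R (x - z)))"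
      using t r mult_right_mono[of 1 t "norm (x - z)"] by (intro mult_left_mono) auto
    finally have "((1 + r) * (1 + norm (t *\<^sub>R (x - z)))) powr - (N - s) <= norm z powr - (N - s)"
      using z s_less by (intro powr_mono2') auto
    then have le: "(1 + r) powr (N - s) * ((1 + r) powr - (N - s) * w (x - z)) <= (1 + r) powr (N - s) * norm z powr - (N - s)"
      using r by (intro mult_left_mono) (auto simp: w_def powr_mult)
    have "w (x - z) = (1 + r) powr (N - s) * ((1 + r) powr - (N - s) * w (x - z))"
      using r by (simp add: mult.assoc[symmetric] powr_add[symmetric])
    also note le
    finally have "f z * w (x - z) <= f z * ((1 + r) powr (N - s) * norm z powr - (N - s))"
      using f(2) by (intro mult_left_mono) auto
    then show ?thesis using f(2) by (simp add: G_def ac_simps)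
  qed
  have w01: "0 <= w x" "w x <= 1" for x
  proof -
    show "0 <= w x" by (simp add: w_def)
    have "w x <= 1 powr - (N - s)" unfolding w_def using s_less by (intro powr_mono2') auto
    then show "w x <= 1" by simp
  qed
  \<comment> \<open>At \<open>z = 0\<close> the comparison fails because
    \<open>0 powr - (N - s)\<close> is 0; an indicator of the origin repairs it without changing
    integrals.\<close>
  define G' where "G' z = G z + f 0 * indicator {0} z" for z
  have iG': "integrable lborel G'" unfolding G'_def
    by (intro Bochner_Integration.integrable_add iG integrable_mult_right integrable_real_indicator) auto
  have wG': "\<bar>f z\<bar> * w (x - z) <= G' z" if x: "x \<in> ball 0 r" for x z
  proof (cases "z = 0")
    case True
    have "f 0 * w x <= f 0 * 1" using w01 f(2) by (intro mult_left_mono) auto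
    then show ?thesis using True f(2) G_nn[of 0] by (simp add: G'_def)
  qed (use wG[OF x] in \<open>auto simp: G'_def\<close>)
  define W where "W = enn2real (NN z. ennreal (G' z))"
  have G'_nn: "0 <= G' z" for z using G_nn f(2) by (simp add: G'_def)
  have W: "(NN z. ennreal (G' z)) = ennreal W"
    using iG' G'_nn by (simp add: W_def integrable_iff_bounded less_top[symmetric])
  have "cbnd k t (t powr (N - s) * Cs * W) (ball 0 r) (%x. LINT z|lborel. f z * Ks t (x - z))"
  proof (rule wbnd_conv[where w=w and S'=UNIV])
    show "\<exists>d>0. \<exists>G. integrable lborel G \<and> ball x d \<subseteq> ball 0 r \<and> (\<forall>y\<in>ball x d. \<forall>z. \<bar>f z\<bar> * w (y - z) <= G z)" if x: "x \<in> ball 0 r" for x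
    proof -
      obtain d where d: "0 < d" "ball x d \<subseteq> ball 0 r" using openE[OF open_ball x] by blast
      then show ?thesis using iG' wG' by blast
    qed
    show "(NN z. ennreal (\<bar>f z\<bar> * w (x - z))) <= ennreal W" if "x \<in> ball 0 r" for x
      unfolding W[symmetric] by (intro nn_integral_mono ennreal_leI wG' that)
    show "w \<in> Borel" unfolding w_def[abs_def] by measurable
    show "wbnd k t (t powr (N - s) * Cs) w UNIV (Ks t)" using wbnd_Ks[of t] t unfolding w_def by simp
  qed (use f t Cs w01 in \<open>auto simp: W_def\<close>)
  then have "cbnd k 1 (t powr (N - s) * Cs * W * t ^ k) (ball 0 r) (%x. LINT z|lborel. f z * Ks t (x - z))"
    by (rule wbnd_rescale) (use t Cs in \<open>auto simp: W_def\<close>)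
  then show ?thesis using t Cs by (intro exI[of _ "t powr (N - s) * Cs * W * t ^ k"]) (auto simp: W_def)
qed

end

lemma Ck_local:
  assumes "!!x. x \<in> S ==> \<exists>U. open U \<and> x \<in> U \<and> Ck k U f"
  shows "Ck k S f"
  using assms
proof (induction k arbitrary: f)
  case 0
  have "isCont f x" if x: "x \<in> S" for x
  proof -
    obtain U where "open U" "x \<in> U" "continuous_on U f" using 0[OF x] by auto
    then show ?thesis by (simp add: continuous_on_eq_continuous_at)
  qed
  then show ?case by (simp add: continuous_at_imp_continuous_on)
next
  case (Suc k)
  have ex: "\<exists>U. open U \<and> x \<in> U \<and> f differentiable (at x) \<and> (\<forall>b\<in>Basis. Ck k U (%x. fd f x b))"
    if x: "x \<in> S" for x
  proof -
    obtain U where "open U" "x \<in> U" "Ck (Suc k) U f" using Suc.prems[OF x] by blast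
    then show ?thesis unfolding Ck.simps by blast
  qed
  have "Ck k S (%x. fd f x b)" if b: "b \<in> Basis" for b
  proof (rule Suc.IH)
    fix x assume "x \<in> S"
    from ex[OF this] b show "\<exists>U. open U \<and> x \<in> U \<and> Ck k U (%x. fd f x b)" by blast
  qed
  then show ?case unfolding Ck.simps using ex by blast
qed

section \<open>Dyadic smoothness scale and its gain under Riesz convolution\<close>

context riesz
begin

text \<open>A dyadic smoothness scale: \<open>f\<close> is approximated to order \<open>2 powr -(l * \<sigma>)\<close> by functions whose
  derivatives of order \<open>j\<close> grow like \<open>2 ^ (l * j)\<close>. Convolution with \<open>K\<close> gains \<open>s\<close>.\<close>

definition reg :: "nat => real => 'a set => ('a => real) => bool" where
  "reg k \<sigma> S f \<longleftrightarrow> (\<exists>F C. 0 <= C \<and> cbnd k 1 C S (F (0::nat))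
     \<and> (\<forall>l. cbnd k (2 ^ l) (C * 2 powr - (real l * \<sigma>)) S (%x. F (Suc l) x - F l x))
     \<and> (\<forall>l. \<forall>x\<in>S. \<bar>f x - F l x\<bar> <= C * 2 powr - (real l * \<sigma>)))"

lemma reg_0:
  assumes "open S" "0 <= M" "!!x. x \<in> S ==> \<bar>f x\<bar> <= M"
  shows "reg k 0 S f"
  unfolding reg_def using assms by (intro exI[of _ "%_ _. 0"] exI[of _ M]) (auto intro!: wbnd_zero)

lemma reg_cong:
  assumes "reg k \<sigma> S f" "!!x. x \<in> S ==> f x = g x"
  shows "reg k \<sigma> S g"
  using assms unfolding reg_def by auto

lemma reg_affine:
  assumes S: "open S" and "reg k \<sigma> S f"
  shows "reg k \<sigma> S (%x. a * (f x - b))"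
proof -
  obtain F C where C: "0 <= C" and F0: "cbnd k 1 C S (F (0::nat))"
    and Fd: "!!l. cbnd k (2 ^ l) (C * 2 powr - (real l * \<sigma>)) S (%x. F (Suc l) x - F l x)"
    and err: "!!l x. x \<in> S ==> \<bar>f x - F l x\<bar> <= C * 2 powr - (real l * \<sigma>)"
    using assms(2) unfolding reg_def by blast
  define C' where "C' = \<bar>a\<bar> * (C + \<bar>b\<bar>)"
  have le: "\<bar>a\<bar> * (C * 2 powr - (real l * \<sigma>)) <= C' * 2 powr - (real l * \<sigma>)" for l
    by (simp add: C'_def algebra_simps)
  show ?thesis unfolding reg_def
  proof (intro exI[of _ "%l x. a * (F l x - b)"] exI[of _ C'] conjI allI ballI)
    show "0 <= C'" using C by (simp add: C'_def)
    show "wbnd k 1 C' (%_. 1) S (%x. a * (F 0 x - b))"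
      unfolding C'_def by (intro wbnd_cmult[OF S] wbnd_diff[OF S] F0 wbnd_const[OF S]) auto
    fix l
    have "cbnd k (2 ^ l) (\<bar>a\<bar> * (C * 2 powr - (real l * \<sigma>))) S (%x. a * (F (Suc l) x - F l x))"
      by (rule wbnd_cmult[OF S Fd])
    then have "cbnd k (2 ^ l) (C' * 2 powr - (real l * \<sigma>)) S (%x. a * (F (Suc l) x - F l x))"
      by (rule wbnd_mono) (use le in auto)
    then show "cbnd k (2 ^ l) (C' * 2 powr - (real l * \<sigma>)) S (%x. a * (F (Suc l) x - b) - a * (F l x - b))"
      by (simp add: algebra_simps)
    fix x assume "x \<in> S"
    have "\<bar>a * (f x - b) - a * (F l x - b)\<bar> = \<bar>a\<bar> * \<bar>f x - F l x\<bar>" by (simp add: abs_mult[symmetric] algebra_simps)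
    also have "... <= \<bar>a\<bar> * (C * 2 powr - (real l * \<sigma>))" by (rule mult_left_mono[OF err[OF \<open>x \<in> S\<close>]]) simp
    also note le
    finally show "\<bar>a * (f x - b) - a * (F l x - b)\<bar> <= C' * 2 powr - (real l * \<sigma>)" .
  qed
qed

lemma two_powr_summable: "0 < \<sigma> ==> summable (%l. 2 powr - (real l * \<sigma>))"
proof -
  assume \<sigma>: "0 < \<sigma>"
  have "2 powr - (real l * \<sigma>) = (2 powr - \<sigma>) ^ l" for l
    by (simp add: powr_realpow[symmetric] powr_powr mult.commute)
  moreover have "2 powr - \<sigma> < 2 powr (0::real)" using \<sigma> by (intro powr_less_mono) auto
  ultimately show ?thesis by (simp add: summable_geometric)
qed

text \<open>The \<open>k\<close>-th derivatives of the increments are of size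
  \<open>2 powr - (l * (\<sigma> - k))\<close>, summable because
  \<open>\<sigma> > k\<close>.\<close>

lemma reg_Ck:
  assumes S: "open S" "convex S" and f: "reg k \<sigma> S f" and \<sigma>: "real k < \<sigma>"
  shows "Ck k S f"
proof -
  obtain F C where C: "0 <= C" and F0: "cbnd k 1 C S (F (0::nat))"
    and Fd: "!!l. cbnd k (2 ^ l) (C * 2 powr - (real l * \<sigma>)) S (%x. F (Suc l) x - F l x)"
    and err: "!!l x. x \<in> S ==> \<bar>f x - F l x\<bar> <= C * 2 powr - (real l * \<sigma>)"
    using f unfolding reg_def by blast
  have eq: "2 powr - (real l * \<sigma>) * (2 ^ l) ^ k = 2 powr - (real l * (\<sigma> - real k))" for l
  proof -
    have "((2::real) ^ l) ^ k = 2 powr (real l * real k)" by (subst power_mult[symmetric], subst powr_realpow[symmetric]) auto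
    then show ?thesis by (simp add: powr_add[symmetric] algebra_simps)
  qed
  have "wbnd k 1 (C + suminf (%l. C * 2 powr - (real l * (\<sigma> - real k)))) (%_. 1) S f"
  proof (rule wbnd_limit[where F=F, OF S _ F0])
    show "summable (%l. C * 2 powr - (real l * (\<sigma> - real k)))"
      using \<sigma> by (intro summable_mult two_powr_summable) simp
    show "cbnd k 1 (C * 2 powr - (real l * (\<sigma> - real k))) S (%x. F (Suc l) x - F l x)" for l
      using wbnd_rescale[OF Fd[of l], of "2 ^ l" 1] C by (simp add: eq mult.assoc)
    fix x assume x: "x \<in> S"
    have "(%l. C * 2 powr - (real l * \<sigma>)) \<longlonglongrightarrow> 0"
      using \<sigma> by (intro tendsto_mult_right_zero summable_LIMSEQ_zero two_powr_summable) auto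
    then have "(%l. f x - F l x) \<longlonglongrightarrow> 0"
      by (rule Lim_null_comparison[rotated]) (use err[OF x] in auto)
    then have "(%l. f x - (f x - F l x)) \<longlonglongrightarrow> f x - 0" by (intro tendsto_intros)
    then show "(%l. F l x) \<longlonglongrightarrow> f x" by simp
  qed
  then show ?thesis by (rule wbnd_Ck)
qed

text \<open>The approximations take values between \<open>c / 2\<close> and \<open>M + c / 2\<close>
  only from some \<open>l0\<close> on. Shifting the sequence by \<open>l0\<close> changes the
  constants by powers of 2.\<close>

lemma reg_powr:
  assumes S: "open S" and f: "reg k \<sigma> S f" and \<sigma>: "0 < \<sigma>" and c: "0 < c" and fb: "!!x. x \<in> S ==> c <= f x" "!!x. x \<in> S ==> f x <= M"
  shows "reg k \<sigma> S (%x. f x powr \<gamma>)"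
proof -
  obtain F C where C: "0 <= C" and F0: "cbnd k 1 C S (F (0::nat))"
    and Fd: "!!l. cbnd k (2 ^ l) (C * 2 powr - (real l * \<sigma>)) S (%x. F (Suc l) x - F l x)"
    and err: "!!l x. x \<in> S ==> \<bar>f x - F l x\<bar> <= C * 2 powr - (real l * \<sigma>)"
    using f unfolding reg_def by blast
  define e where "e l = 2 powr - (real l * \<sigma>)" for l
  have sum_e: "summable e" unfolding e_def by (rule two_powr_summable[OF \<sigma>])
  have e0: "0 <= e l" for l by (simp add: e_def)
  define M1 where "M1 = C + C * suminf e"
  have M1: "0 <= M1" using C e0 sum_e by (simp add: M1_def suminf_nonneg)
  have part: "cbnd k (2 ^ l) (C + C * (\<Sum>i<l. e i)) S (F l)" for l
  proof (induction l)
    case 0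
    then show ?case using F0 by simp
  next
    case (Suc l)
    have p: "0 <= C + C * (\<Sum>i<l. e i)" using C e0 by (simp add: sum_nonneg)
    have 1: "cbnd k (2 ^ Suc l) (C + C * (\<Sum>i<l. e i)) S (F l)"
      by (rule wbnd_scale_mono[OF Suc]) (use p in auto)
    have 2: "cbnd k (2 ^ Suc l) (C * e l) S (%x. F (Suc l) x - F l x)"
      by (rule wbnd_scale_mono[OF Fd[of l, folded e_def]]) (use C e0 in auto)
    show ?case using wbnd_add[OF S 1 2] by (simp add: algebra_simps)
  qed
  have F: "cbnd k (2 ^ l) M1 S (F l)" for l
  proof (rule wbnd_mono[OF part])
    show "(C + C * (\<Sum>i<l. e i)) * 1 <= M1 * 1" for x :: 'a
      using sum_le_suminf[OF sum_e] e0 C by (simp add: M1_def mult_left_mono)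
  qed auto
  have c2: "0 < c / 2" using c by simp
  have "(%l. C * e l) \<longlonglongrightarrow> 0" by (intro tendsto_mult_right_zero summable_LIMSEQ_zero sum_e)
  from LIMSEQ_D[OF this c2] obtain l0 where l0: "!!l. l \<ge> l0 ==> \<bar>C * e l\<bar> < c / 2" by auto
  have Fc: "c / 2 <= F l x" "F l x <= M + c / 2" if "l \<ge> l0" "x \<in> S" for l x
    using err[OF that(2), of l, folded e_def] l0[OF that(1)] fb[OF that(2)] C e0[of l] by (auto simp: abs_le_iff abs_less_iff)
  obtain C1 where C1: "0 <= C1" "!!l F. 0 <= l ==> cbnd k l M1 S F ==> (\<forall>x\<in>S. c / 2 <= F x \<and> F x <= M + c / 2) ==>
      cbnd k l C1 S (%x. F x powr \<gamma>)"
    using wbnd_powr[OF S c2 M1, of k "M + c / 2" \<gamma>] by blast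
  obtain C2 where C2: "0 <= C2" "\<forall>l\<ge>0. \<forall>\<delta>\<ge>0. \<forall>f g. cbnd k l M1 S f --> (\<forall>x\<in>S. c / 2 <= f x \<and> f x <= M + c / 2) -->
      cbnd k l M1 S g --> (\<forall>x\<in>S. c / 2 <= g x \<and> g x <= M + c / 2) --> wbnd k l \<delta> (%_. 1) S (%x. f x - g x) -->
      cbnd k l (C2 * \<delta>) S (%x. f x powr \<gamma> - g x powr \<gamma>)"
    using wbnd_powr_diff[OF S c2 M1, of k "M + c / 2" \<gamma>] by (elim exE conjE)
  obtain C3 where C3: "0 <= C3" "!!u v. u \<in> {c / 2..M + c / 2} ==> v \<in> {c / 2..M + c / 2} ==> \<bar>u powr \<gamma> - v powr \<gamma>\<bar> <= C3 * \<bar>u - v\<bar>"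
    using powr_diff_bound[OF c2, of "M + c / 2" \<gamma>] by blast
  define D1 where "D1 = C1 * (2 ^ l0) ^ k"
  define D2 where "D2 = C2 * C * (2 ^ Suc l0) ^ k"
  define D3 where "D3 = C3 * C"
  have D: "0 <= D1" "0 <= D2" "0 <= D3" using C1(1) C2(1) C3(1) C by (auto simp: D1_def D2_def D3_def simp del: power_Suc)
  have e_shift: "e (l + l0) <= e l" for l
    unfolding e_def using \<sigma> by (intro powr_mono) (auto simp: mult_right_mono)
  show ?thesis unfolding reg_def
  proof (intro exI[of _ "%l x. F (l + l0) x powr \<gamma>"] exI[of _ "D1 + D2 + D3"] conjI allI ballI)
    show "0 <= D1 + D2 + D3" using D by simp
    have "cbnd k (2 ^ l0) C1 S (%x. F l0 x powr \<gamma>)"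
      by (rule C1(2)[OF _ F]) (use Fc in auto)
    then have "cbnd k 1 D1 S (%x. F l0 x powr \<gamma>)"
      unfolding D1_def by (rule wbnd_rescale) (use C1 in auto)
    then show "cbnd k 1 (D1 + D2 + D3) S (%x. F (0 + l0) x powr \<gamma>)"
      unfolding add_0 by (rule wbnd_mono) (use D in auto)
    fix l
    have F': "cbnd k (2 ^ Suc (l + l0)) M1 S (F (l + l0))"
      by (rule wbnd_scale_mono[OF F]) (use M1 in auto)
    have Fd': "cbnd k (2 ^ Suc (l + l0)) (C * e (l + l0)) S (%x. F (Suc (l + l0)) x - F (l + l0) x)"
      by (rule wbnd_scale_mono[OF Fd[folded e_def]]) (use C e0 in auto)
    have b1: "\<forall>x\<in>S. c / 2 <= F (Suc (l + l0)) x \<and> F (Suc (l + l0)) x <= M + c / 2"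
      and b2: "\<forall>x\<in>S. c / 2 <= F (l + l0) x \<and> F (l + l0) x <= M + c / 2" using Fc by auto
    have nn: "0 <= (2::real) ^ Suc (l + l0)" "0 <= C * e (l + l0)" using C e0 by auto
    have "cbnd k (2 ^ Suc (l + l0)) (C2 * (C * e (l + l0))) S (%x. F (Suc (l + l0)) x powr \<gamma> - F (l + l0) x powr \<gamma>)"
      by (rule C2(2)[THEN spec, THEN mp, THEN spec, THEN mp, THEN spec, THEN spec, THEN mp, THEN mp, THEN mp, THEN mp, THEN mp,
            OF nn F[of "Suc (l + l0)"] b1 F' b2 Fd'])
    then have "cbnd k (2 ^ l) (C2 * (C * e (l + l0)) * (2 ^ Suc l0) ^ k) S (%x. F (Suc (l + l0)) x powr \<gamma> - F (l + l0) x powr \<gamma>)"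
    proof (rule wbnd_rescale)
      show "(2::real) ^ Suc (l + l0) <= 2 ^ Suc l0 * 2 ^ l" by (simp add: power_add)
      show "(1::real) <= 2 ^ Suc l0" by (rule one_le_power) simp
    qed (use C2(1) nn in auto)
    then show "cbnd k (2 ^ l) ((D1 + D2 + D3) * 2 powr - (real l * \<sigma>)) S (%x. F (Suc l + l0) x powr \<gamma> - F (l + l0) x powr \<gamma>)"
      unfolding add_Suc
    proof (rule wbnd_mono)
      have "C2 * (C * e (l + l0)) * (2 ^ Suc l0) ^ k = D2 * e (l + l0)" by (simp add: D2_def ac_simps)
      also have "... <= D2 * e l" using D(2) e_shift by (rule mult_left_mono[rotated])
      also have "... <= (D1 + D2 + D3) * e l" using D e0[of l] by (intro mult_right_mono) auto
      finally show "C2 * (C * e (l + l0)) * (2 ^ Suc l0) ^ k * 1 <= (D1 + D2 + D3) * 2 powr - (real l * \<sigma>) * 1" for x :: 'a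
        by (simp add: e_def del: power_Suc)
    qed auto
    fix x assume x: "x \<in> S"
    have "\<bar>f x powr \<gamma> - F (l + l0) x powr \<gamma>\<bar> <= C3 * \<bar>f x - F (l + l0) x\<bar>"
      using fb[OF x] b2 x c by (intro C3(2)) auto
    also have "... <= C3 * (C * e (l + l0))" using err[OF x, folded e_def] C3(1) by (rule mult_left_mono)
    also have "... <= C3 * (C * e l)" using e_shift C C3(1) by (intro mult_left_mono) auto
    also have "... <= (D1 + D2 + D3) * e l" using D e0[of l] by (simp add: D3_def distrib_right)
    finally show "\<bar>f x powr \<gamma> - F (l + l0) x powr \<gamma>\<bar> <= (D1 + D2 + D3) * 2 powr - (real l * \<sigma>)" by (simp add: e_def)
  qed
qed

text \<open>In the approximation \<open>F' l\<close> the near kernel acts on \<open>E l\<close> and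
  the far kernel on \<open>f\<close> itself. Then \<open>F' (Suc l) - F' l\<close> is the near
  kernel applied to \<open>E (Suc l) - E l\<close> plus the annulus applied to the error
  \<open>f - E l\<close>, and both are of order \<open>2 powr - (l * (\<sigma> + s))\<close>. The
  smaller ball makes room for the width of the near kernel.\<close>

lemma reg_conv:
  fixes f :: "'a => real"
  assumes r: "0 <= r'" "r' < r" and f: "f \<in> Borel" "!!x. 0 <= f x" "!!x. f x <= M"
    and fin: "!!x::'a. rpot s f x < \<infinity>" and \<sigma>: "0 <= \<sigma>" and reg: "reg k \<sigma> (ball 0 r) f"
  shows "reg k (\<sigma> + s) (ball 0 r') (rpotr s f)"
proof -
  have [measurable]: "f \<in> Borel" by fact
  obtain \<phi> :: "'a => real" and Cs where \<phi>: "0 <= Cs" "!!x. 0 <= \<phi> x \<and> \<phi> x <= 1" "!!x. 1 <= norm x ==> \<phi> x = 0" "\<phi> \<in> Borel"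
    "wbnd k 1 Cs (%x. (1 + norm x) powr - (N - s)) UNIV (%x. K x * (1 - \<phi> x))"
    "wbnd k 1 Cs (indicator (cball 0 1)) UNIV (%x. K x * (\<phi> x - \<phi> (2 *\<^sub>R x)))"
    using kernel_split[of k] by blast
  interpret riesz_split s T N k \<phi> Cs
    by unfold_locales (use \<phi> in auto)
  let ?B = "ball 0 r :: 'a set"
  obtain F C where C: "0 <= C" and F0: "cbnd k 1 C ?B (F (0::nat))"
    and Fd: "!!l. cbnd k (2 ^ l) (C * 2 powr - (real l * \<sigma>)) ?B (%x. F (Suc l) x - F l x)"
    and err: "!!l x. x \<in> ?B ==> \<bar>f x - F l x\<bar> <= C * 2 powr - (real l * \<sigma>)"
    using reg unfolding reg_def by blast
  define e where "e l = 2 powr - (real l * \<sigma>)" for l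
  have e: "0 <= e l" "e l <= 1" for l
    using \<sigma> powr_mono[of "- (real l * \<sigma>)" 0 2] by (auto simp: e_def)
  \<comment> \<open>Extension by 0 makes the approximations globally measurable and bounded; their
    derivatives are used inside the ball.\<close>
  define E where "E l x = indicator ?B x *\<^sub>R F l x" for l x
  have E0: "cbnd k 1 C ?B (E 0)"
    by (rule wbnd_cong[OF _ _ F0]) (auto simp: E_def)
  have Ed: "cbnd k (2 ^ l) (C * e l) ?B (%x. E (Suc l) x - E l x)" for l
    by (rule wbnd_cong[OF _ _ Fd[of l, folded e_def]]) (auto simp: E_def)
  have "continuous_on ?B (F l)" for l
  proof (induction l)
    case 0 show ?case by (rule wbnd_continuous[OF F0])
  next
    case (Suc l)
    from continuous_on_add[OF this wbnd_continuous[OF Fd[of l]]] show ?case by simp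
  qed
  then have [measurable]: "E l \<in> Borel" for l
    unfolding E_def[abs_def] by (intro borel_measurable_continuous_on_indicator) auto
  have E_err: "\<bar>f x - E l x\<bar> <= C * e l" if "x \<in> ?B" for l x
    using err[OF that, of l] that by (simp add: E_def e_def)
  have E_out: "E l x = 0" if "x \<notin> ?B" for l x using that by (simp add: E_def)
  have Ce: "0 <= C * e l" "C * e l <= C" for l using C e[of l] by (auto simp: mult_left_le)
  have M: "0 <= M" using f(2,3)[of 0] by simp
  have E_bd: "\<bar>E l x\<bar> <= M + C" for l x
    using E_err[of x l] E_out[of x l] f(2,3)[of x] Ce[of l] M C by (cases "x \<in> ?B") (auto simp: abs_le_iff)
  have f_bd: "\<bar>f x\<bar> <= M + C" for x using f(2,3)[of x] C by simp
  \<comment> \<open>Makes the widest near kernel fit into the collar of width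
    \<open>r - r'\<close>.\<close>
  define t0 where "t0 = max 1 (1 / (r - r'))"
  define t where "t l = t0 * 2 ^ l" for l
  have t0: "1 <= t0" "1 / (r - r') <= t0" by (auto simp: t0_def)
  have t: "1 <= t l" "1 / t l <= r - r'" "t (Suc l) = 2 * t l" for l
  proof -
    have "t0 * 1 <= t l" unfolding t_def using t0 by (intro mult_left_mono) auto
    then have tt: "t0 <= t l" by simp
    then show "1 <= t l" using t0(1) by simp
    have "1 <= t0 * (r - r')" using t0(2) r by (simp add: field_simps)
    also have "... <= t l * (r - r')" using tt r by (intro mult_right_mono) auto
    finally show "1 / t l <= r - r'" using \<open>1 <= t l\<close> by (simp add: divide_le_eq mult.commute)
  qed (simp add: t_def)
  have t_pos: "0 < t l" for l using t(1)[of l] by simp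
  define d where "d l = 2 powr - (real l * s)" for l
  have d: "0 <= d l" "d (Suc l) <= d l" "d 0 = 1" for l
    using s_pos by (auto simp: d_def intro!: powr_mono mult_right_mono)
  have td: "t l powr - s = t0 powr - s * d l" for l
    using t0 by (simp add: t_def d_def powr_mult powr_realpow[symmetric] powr_powr)
  obtain Ck where Ck: "0 <= Ck" "!!t. 0 < t ==> (NN z. ennreal (Kg t z)) <= ennreal (Ck * t powr - s)"
    using Kg_integral by blast
  define A where "A = Ck * t0 powr - s"
  have A: "0 <= A" using Ck by (simp add: A_def)
  have W: "(NN z. ennreal (Kg (t l) z)) <= ennreal (A * d l)" for l
    using Ck(2)[OF t_pos[of l]] by (simp add: td A_def mult.assoc)
  have iKg: "integrable lborel (%z. Kg u z * H (x - z))"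
    if "H \<in> Borel" "!!z. \<bar>H z\<bar> <= M + C" "0 < u" for H u x
  proof (rule Bochner_Integration.integrable_bound[of lborel "%z. (M + C) * Kg u z"])
    have [measurable]: "H \<in> Borel" by fact
    show "(%z. Kg u z * H (x - z)) \<in> borel_measurable lborel" by simp
    show "AE z in lborel. norm (Kg u z * H (x - z)) <= norm ((M + C) * Kg u z)"
    proof (intro AE_I2)
      fix z
      have "Kg u z * \<bar>H (x - z)\<bar> <= Kg u z * (M + C)" using that(2) Kg_nonneg by (intro mult_left_mono) auto
      then show "norm (Kg u z * H (x - z)) <= norm ((M + C) * Kg u z)" using Kg_nonneg M C by (simp add: abs_mult ac_simps)
    qed
  qed (use Kg_integrable[OF that(3)] in auto)
  have iKg': "integrable lborel (%z. H z * Kg u (x - z))"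
    if H: "H \<in> Borel" "!!z. \<bar>H z\<bar> <= M + C" "0 < u" for H u x
  proof -
    have [measurable]: "H \<in> Borel" by fact
    show ?thesis using iKg[OF H, of x] integrable_lborel_reflect[of "%z. H z * Kg u (x - z)" x] by (simp add: mult.commute)
  qed
  have Kg_diff: "Kg (t l) z = Kg (t (Suc l)) z + Kd (t l) z" for l z
    by (simp add: Kg_def Kd_def t(3) algebra_simps)
  have iKd: "integrable lborel (%z. H z * Kd (t l) (x - z))"
    if H: "H \<in> Borel" "!!z. \<bar>H z\<bar> <= M + C" for H l x
  proof -
    have "integrable lborel (%z. H z * Kg (t l) (x - z) - H z * Kg (t (Suc l)) (x - z))"
      by (rule Bochner_Integration.integrable_diff[OF iKg'[OF H t_pos] iKg'[OF H t_pos]])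
    then show ?thesis by (simp add: Kg_diff[of l] algebra_simps)
  qed
  note iK = rpotr_eq_integral[OF f(1,2) fin]
  have iKs: "integrable lborel (%z. f z * Ks u (x - z))" for u x
  proof (rule Bochner_Integration.integrable_bound[OF iK(1)])
    show "AE z in lborel. norm (f z * Ks u (x - z)) <= norm (K (x - z) * f z)"
    proof (intro AE_I2)
      fix z
      show "norm (f z * Ks u (x - z)) <= norm (K (x - z) * f z)"
        using mult_left_mono[OF Ks_le[of u "x - z"] f(2)[of z]] Ks_nonneg[of u "x - z"] K_nonneg[of "x - z"] f(2)[of z]
        by (simp add: abs_mult mult.commute)
    qed
  qed simp
  define F' where "F' l x = (LINT z|lborel. Kg (t l) z * E l (x - z)) + (LINT z|lborel. f z * Ks (t l) (x - z))" for l x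
  define V where "V = measure lborel (cball (0::'a) 1)"
  define B where "B = Cs * V * C * t0 powr - s * t0 ^ k"
  have B: "0 <= B" using Cs C t0(1) by (simp add: B_def V_def)
  obtain C1 where C1: "0 <= C1" "cbnd k 1 C1 (ball 0 r') (%x. LINT z|lborel. f z * Ks (t 0) (x - z))"
    using wbnd_conv_Ks[OF t(1)[of 0] r(1) f(1,2) fin] by blast
  define C' where "C' = C * A + C1 + B"
  have C': "0 <= C'" "C * A + C1 <= C'" "C * A + B <= C'" "C * A <= C'" using C A C1 B by (auto simp: C'_def)
  have ed: "2 powr - (real l * (\<sigma> + s)) = e l * d l" for l
    by (simp add: e_def d_def powr_add[symmetric] algebra_simps)
  show ?thesis unfolding reg_def
  proof (intro exI[of _ F'] exI[of _ C'] conjI allI ballI C'(1))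
    have "cbnd k 1 (C * (A * d 0)) (ball 0 r') (%x. LINT z|lborel. Kg (t 0) z * E 0 (x - z))"
      by (rule wbnd_conv_Kg[OF t_pos t(2) E0 C _ _ W]) (use A d in auto)
    from wbnd_add[OF open_ball this C1(2)]
    have "cbnd k 1 (C * A + C1) (ball 0 r') (F' 0)" by (simp add: F'_def[abs_def] d)
    then show "wbnd k 1 C' (%_. 1) (ball 0 r') (F' 0)" by (rule wbnd_mono) (use C' in auto)
    fix l
    have w1: "cbnd k (2 ^ l) (C * e l * (A * d (Suc l))) (ball 0 r') (%x. LINT z|lborel. Kg (t (Suc l)) z * (E (Suc l) (x - z) - E l (x - z)))"
      by (rule wbnd_conv_Kg[OF t_pos t(2) Ed _ _ _ W]) (use A d Ce in auto)
    \<comment> \<open>Outside the ball the error is not small, but the annulus does not reach there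
      from the smaller ball, so cutting it off changes nothing.\<close>
    define D where "D z = indicator ?B z * (f z - E l z)" for z
    have [measurable]: "D \<in> Borel" unfolding D_def[abs_def] by measurable
    have D_bd: "\<bar>D z\<bar> <= C * e l" for z using E_err[of z l] Ce[of l] by (simp add: D_def indicator_def)
    have w2: "cbnd k (2 ^ l) (B * (e l * d l)) (ball 0 r') (%x. LINT z|lborel. D z * Kd (t l) (x - z))"
    proof -
      have "cbnd k (t l) (Cs * V * (C * e l) * t l powr - s) (ball 0 r') (%x. LINT z|lborel. D z * Kd (t l) (x - z))"
        unfolding V_def by (rule wbnd_conv_Kd[where r=r, OF t_pos _ D_bd]) (auto simp: D_def)
      then have "cbnd k (2 ^ l) (Cs * V * (C * e l) * t l powr - s * t0 ^ k) (ball 0 r') (%x. LINT z|lborel. D z * Kd (t l) (x - z))"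
        by (rule wbnd_rescale) (use t_pos[of l] t0 Cs Ce in \<open>auto simp: V_def t_def\<close>)
      moreover have "Cs * V * (C * e l) * t l powr - s * t0 ^ k = B * (e l * d l)" by (simp add: B_def td ac_simps)
      ultimately show ?thesis by simp
    qed
    have diff: "F' (Suc l) x - F' l x = (LINT z|lborel. Kg (t (Suc l)) z * (E (Suc l) (x - z) - E l (x - z))) + (LINT z|lborel. D z * Kd (t l) (x - z))"
      if x: "x \<in> ball 0 r'" for x
    proof -
      have s1: "(LINT z|lborel. f z * Ks (t (Suc l)) (x - z)) - (LINT z|lborel. f z * Ks (t l) (x - z)) = (LINT z|lborel. f z * Kd (t l) (x - z))"
        by (subst Bochner_Integration.integral_diff[symmetric, OF iKs iKs]) (simp add: Ks_def Kd_def t(3) algebra_simps)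
      have "(LINT z|lborel. E l z * Kg (t l) (x - z)) = (LINT z|lborel. E l z * Kg (t (Suc l)) (x - z)) + (LINT z|lborel. E l z * Kd (t l) (x - z))"
        using E_bd by (subst Bochner_Integration.integral_add[symmetric, OF iKg' iKd]) (auto simp: Kg_diff[of l] distrib_left t_pos)
      then have s2: "(LINT z|lborel. Kg (t l) z * E l (x - z)) = (LINT z|lborel. Kg (t (Suc l)) z * E l (x - z)) + (LINT z|lborel. E l z * Kd (t l) (x - z))"
        using integral_lborel_reflect[of "%z. E l z * Kg (t l) (x - z)" x] integral_lborel_reflect[of "%z. E l z * Kg (t (Suc l)) (x - z)" x]
        by (simp add: mult.commute)
      have s3: "(LINT z|lborel. Kg (t (Suc l)) z * E (Suc l) (x - z)) - (LINT z|lborel. Kg (t (Suc l)) z * E l (x - z))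
          = (LINT z|lborel. Kg (t (Suc l)) z * (E (Suc l) (x - z) - E l (x - z)))"
        using E_bd by (subst Bochner_Integration.integral_diff[symmetric, OF iKg iKg]) (auto simp: t_pos right_diff_distrib)
      have s4: "(LINT z|lborel. f z * Kd (t l) (x - z)) - (LINT z|lborel. E l z * Kd (t l) (x - z)) = (LINT z|lborel. D z * Kd (t l) (x - z))"
      proof (subst Bochner_Integration.integral_diff[symmetric, OF iKd iKd])
        have "f z * Kd (t l) (x - z) - E l z * Kd (t l) (x - z) = D z * Kd (t l) (x - z)" for z
        proof (cases "z \<in> ?B")
          case False
          then have "r - r' < norm (x - z)" using x norm_triangle_ineq2[of z x] by (simp add: norm_minus_commute)
          then have n: "1 / t l <= norm (x - z)" using t(2)[of l] by simp
          have "1 / t (Suc l) <= 1 / t l" using t_pos[of l] by (simp add: t(3) field_simps)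
          then have "Kd (t l) (x - z) = 0" using Kg_diff[of l "x - z"] Kg_eq_0[OF t_pos n] Kg_eq_0[OF t_pos[of "Suc l"], of "x - z"] n by simp
          then show ?thesis by simp
        qed (simp add: D_def left_diff_distrib)
        then show "(LINT z|lborel. f z * Kd (t l) (x - z) - E l z * Kd (t l) (x - z)) = (LINT z|lborel. D z * Kd (t l) (x - z))" by simp
      qed (use f_bd E_bd in auto)
      show ?thesis using s1 s2 s3 s4 by (simp add: F'_def)
    qed
    have "cbnd k (2 ^ l) (C * e l * (A * d (Suc l)) + B * (e l * d l)) (ball 0 r') (%x. F' (Suc l) x - F' l x)"
      by (rule wbnd_cong[OF open_ball diff[symmetric] wbnd_add[OF open_ball w1 w2]])
    then show "cbnd k (2 ^ l) (C' * 2 powr - (real l * (\<sigma> + s))) (ball 0 r') (%x. F' (Suc l) x - F' l x)"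
    proof (rule wbnd_mono)
      have "C * e l * (A * d (Suc l)) <= C * e l * (A * d l)" using A d(2)[of l] Ce(1)[of l] by (intro mult_left_mono) auto
      then have "C * e l * (A * d (Suc l)) + B * (e l * d l) <= (C * A + B) * (e l * d l)" by (simp add: algebra_simps)
      also have "... <= C' * (e l * d l)" using C'(3) e d by (intro mult_right_mono) auto
      finally show "(C * e l * (A * d (Suc l)) + B * (e l * d l)) * 1 <= C' * 2 powr - (real l * (\<sigma> + s)) * 1" for x :: 'a
        by (simp add: ed)
    qed auto
    fix x :: 'a assume x: "x \<in> ball 0 r'"
    have "rpotr s f x = (LINT z|lborel. f z * Kg (t l) (x - z) + f z * Ks (t l) (x - z))"
      unfolding iK(2) by (intro Bochner_Integration.integral_cong) (auto simp: Kg_def Ks_def algebra_simps)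
    also have "... = (LINT z|lborel. f z * Kg (t l) (x - z)) + (LINT z|lborel. f z * Ks (t l) (x - z))"
      by (intro Bochner_Integration.integral_add iKs iKg' f_bd t_pos) auto
    also have "(LINT z|lborel. f z * Kg (t l) (x - z)) = (LINT z|lborel. Kg (t l) z * f (x - z))"
      using integral_lborel_reflect[of "%z. f z * Kg (t l) (x - z)" x] by (simp add: mult.commute)
    finally have "rpotr s f x - F' l x = (LINT z|lborel. Kg (t l) z * f (x - z)) - (LINT z|lborel. Kg (t l) z * E l (x - z))"
      by (simp add: F'_def)
    also have "... = (LINT z|lborel. Kg (t l) z * (f (x - z) - E l (x - z)))"
      using E_bd f_bd by (subst Bochner_Integration.integral_diff[symmetric, OF iKg iKg]) (auto simp: t_pos right_diff_distrib)
    finally have eq: "rpotr s f x - F' l x = (LINT z|lborel. Kg (t l) z * (f (x - z) - E l (x - z)))" .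
    have i: "integrable lborel (%z. Kg (t l) z * (f (x - z) - E l (x - z)))"
      unfolding right_diff_distrib by (intro Bochner_Integration.integrable_diff iKg f_bd E_bd t_pos) auto
    have "ennreal \<bar>rpotr s f x - F' l x\<bar> <= (NN z. ennreal (norm (Kg (t l) z * (f (x - z) - E l (x - z)))))"
      unfolding eq using integral_norm_bound_ennreal[OF i] by simp
    also have "... <= (NN z. ennreal (C * e l) * ennreal (Kg (t l) z))"
    proof (rule nn_integral_mono)
      fix z
      have "norm (Kg (t l) z * (f (x - z) - E l (x - z))) <= C * e l * Kg (t l) z"
      proof (cases "1 / t l <= norm z")
        case False
        then have "norm z < r - r'" using t(2)[of l] by simp
        then have "x - z \<in> ?B" using x norm_triangle_ineq4[of x z] by simp
        from mult_right_mono[OF E_err[OF this, of l] Kg_nonneg[of "t l" z]]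
        show ?thesis using Kg_nonneg[of "t l" z] by (simp add: abs_mult mult.commute)
      qed (simp add: Kg_eq_0 t_pos)
      then show "ennreal (norm (Kg (t l) z * (f (x - z) - E l (x - z)))) <= ennreal (C * e l) * ennreal (Kg (t l) z)"
        using Ce Kg_nonneg by (simp add: ennreal_mult[symmetric] ennreal_leI)
    qed
    also have "... = ennreal (C * e l) * (NN z. ennreal (Kg (t l) z))" by (rule nn_integral_cmult) simp
    also have "... <= ennreal (C * e l) * ennreal (A * d l)" by (intro mult_left_mono W) simp
    finally have "\<bar>rpotr s f x - F' l x\<bar> <= C * e l * (A * d l)"
      using Ce A d by (simp add: ennreal_mult[symmetric])
    also have "... = C * A * (e l * d l)" by simp
    also have "... <= C' * (e l * d l)" using C'(4) e d by (intro mult_right_mono) auto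
    finally show "\<bar>rpotr s f x - F' l x\<bar> <= C' * 2 powr - (real l * (\<sigma> + s))" by (simp add: ed)
  qed
qed

end

section \<open>Interior smoothness of the regular profile\<close>

context hls
begin

text \<open>Each round runs through the potential, the power \<open>q - 1\<close>, the second
  potential and the power \<open>1 / (m - 1)\<close>, and the two convolutions gain
  \<open>2 * s\<close>. Powers are smooth only away from 0, so lower bounds on smaller balls are
  required, and each round shrinks the ball.\<close>

lemma regular_profile_smooth:
  assumes g: "regular_profile g a C" and supp: "{x. g x ~= 0} = ball (0::'a) R"
  shows "smooth_on (ball 0 R) g"
proof -
  have [measurable]: "g \<in> Borel" and aC: "0 < a" "0 < C" and nn: "!!x. 0 <= g x"
    and mono: "!!x y. norm x <= norm y ==> g y <= g x" and nz: "mass g ~= 0"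
    and EL: "!!x. g x powr (m - 1) = a * max 0 (enn2real (Psi g x) - C)"
    using g by (auto simp: regular_profile_def)
  obtain M where M: "!!x. g x <= M" using g by (auto simp: regular_profile_def)
  obtain B where B: "!!x. rpot s g x <= ennreal B" using g by (auto simp: regular_profile_def)
  obtain L where L: "!!x. Psi g x <= ennreal L" using g by (auto simp: regular_profile_def)
  obtain Md D where Md: "0 <= Md" "!!x. dens g x <= Md" using regular_profile_dens[OF g] by blast
  have fin: "rpot s g x < \<infinity>" "Psi g x < \<infinity>" for x
    using B[of x] L[of x] by (auto intro: le_less_trans)
  have u_le: "rpotr s g x <= max 0 B" for x
    unfolding rpotr_def using B[of x] by (intro enn2real_leI) (auto intro: order_trans ennreal_leI)
  have P_le: "enn2real (Psi g x) <= max 0 L" for x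
    using L[of x] by (intro enn2real_leI) (auto intro: order_trans ennreal_leI)
  have g_out: "g x = 0" if "x \<notin> ball 0 R" for x using that supp by blast
  have g_pos: "0 < g x" if "x \<in> ball 0 R" for x using that supp nn[of x] by force
  have u_ge: "\<exists>c>0. \<forall>x\<in>ball 0 r. c <= rpotr s g x" if "0 < r" "r < R" for r
  proof -
    \<comment> \<open>Points of the ball of radius \<open>R\<close> are at distance at most
      \<open>2 * R\<close>, so off the diagonal the kernel is at least \<open>c\<close> between
      them.\<close>
    define c where "c = kc * (2 * R) powr - (N - s)"
    have c: "0 < c" using kc_pos that by (simp add: c_def)
    have low: "ennreal c * mass g <= rpot s g x" if x: "x \<in> ball 0 r" for x
    proof -
      have "ennreal c * mass g = (NN y. ennreal c * ennreal (g y))"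
        unfolding mass_def by (rule nn_integral_cmult[symmetric]) simp
      also have "... <= rpot s g x" unfolding rpot_def
      proof (rule nn_integral_mono_AE)
        show "AE y in lborel. ennreal c * ennreal (g y) <= ennreal (K (x - y) * g y)"
          using AE_lborel_singleton[of x]
        proof eventually_elim
          case (elim y)
          show ?case
          proof (cases "y \<in> ball 0 R")
            case True
            have "norm (x - y) <= 2 * R" using True x \<open>r < R\<close> norm_triangle_ineq4[of x y] by simp
            then have "c <= K (x - y)" unfolding c_def K_eq
              using elim s_less kc_pos by (intro mult_left_mono powr_mono2') auto
            then show ?thesis using nn[of y] c by (simp add: ennreal_mult[symmetric] ennreal_leI mult_right_mono)
          qed (simp add: g_out)
        qed
      qed
      finally show ?thesis .
    qed
    have "enn2real (ennreal c * mass g) <= rpotr s g x" if x: "x \<in> ball 0 r" for x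
      unfolding rpotr_def by (rule enn2real_mono[OF low[OF x]]) (use fin(1)[of x] in simp)
    moreover have lt: "ennreal c * mass g < \<infinity>"
      by (rule le_less_trans[OF low[of 0] fin(1)]) (use \<open>0 < r\<close> in simp)
    moreover have "ennreal c * mass g ~= 0" using c nz by simp
    ultimately have "0 < enn2real (ennreal c * mass g)"
      by (simp add: enn2real_positive_iff zero_less_iff_neq_zero)
    with \<open>!!x. x \<in> ball 0 r ==> enn2real (ennreal c * mass g) <= rpotr s g x\<close> show ?thesis by blast
  qed
  have reg: "reg k (real n * (2 * s)) (ball 0 r) g" if "0 < r" "r < R" for k n r
    using that
  proof (induction n arbitrary: r)
    case 0
    have "reg k 0 (ball 0 r) g"
      by (rule reg_0[where M=M, OF open_ball order_trans[OF nn M]]) (use nn M in simp)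
    then show ?case by simp
  next
    case (Suc n)
    define r2 where "r2 = (r + R) / 2"
    define r1 where "r1 = (r + r2) / 2"
    have r2: "r < r2" "r2 < R" using Suc.prems by (auto simp: r2_def)
    then have r: "r < r1" "r1 < r2" "r2 < R" "0 < r1" "0 < r2" using Suc.prems by (auto simp: r1_def)
    let ?\<sigma> = "real n * (2 * s)"
    have \<sigma>: "0 <= ?\<sigma>" using s_pos by simp
    have "reg k (?\<sigma> + s) (ball 0 r1) (rpotr s g)"
      using r M nn fin(1) \<sigma> Suc.IH[of r2] by (intro reg_conv[of r1 r2]) auto
    moreover obtain c where c: "0 < c" "!!x. x \<in> ball 0 r1 ==> c <= rpotr s g x" using u_ge[of r1] r by auto
    ultimately have "reg k (?\<sigma> + s) (ball 0 r1) (dens g)"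
      unfolding dens_def[abs_def] using add_nonneg_pos[OF \<sigma> s_pos] u_le by (intro reg_powr[OF open_ball _ _ c(1,2)]) auto
    then have "reg k (?\<sigma> + s + s) (ball 0 r) (rpotr s (dens g))"
      using r Suc.prems Md(2) fin(2) \<sigma> s_pos by (intro reg_conv[of r r1 "dens g" Md]) (auto simp: Psi_def)
    then have P: "reg k (?\<sigma> + s + s) (ball 0 r) (%x. a * (enn2real (Psi g x) - C))"
      unfolding Psi_def rpotr_def[abs_def] by (intro reg_affine open_ball)
    \<comment> \<open>The value of \<open>g\<close> on the sphere of radius \<open>r\<close> bounds
      it from below on the ball; this positivity also removes the positive part from the
      equation.\<close>
    obtain y :: 'a where y: "norm y = r" using vector_choose_size[of r] Suc.prems(1) by auto
    have gy: "0 < g y" using g_pos[of y] y Suc.prems(2) by simp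
    have eq: "g x powr (m - 1) = a * (enn2real (Psi g x) - C)" and ge: "g y powr (m - 1) <= g x powr (m - 1)" if "x \<in> ball 0 r" for x
    proof -
      show "g y powr (m - 1) <= g x powr (m - 1)"
        using mono[of x y] that y nn m_gt_1 by (intro powr_mono2) auto
      moreover have "0 < g y powr (m - 1)" using gy by simp
      ultimately have "0 < a * max 0 (enn2real (Psi g x) - C)" by (simp only: EL[symmetric])
      then have "0 < enn2real (Psi g x) - C" using aC by (auto simp: zero_less_mult_iff max_def split: if_splits)
      then show "g x powr (m - 1) = a * (enn2real (Psi g x) - C)" unfolding EL[of x] by simp
    qed
    have "reg k (?\<sigma> + s + s) (ball 0 r) (%x. (a * (enn2real (Psi g x) - C)) powr (1 / (m - 1)))"
    proof (rule reg_powr[OF open_ball P, where c="g y powr (m - 1)" and M="a * max 0 L"])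
      show "g y powr (m - 1) <= a * (enn2real (Psi g x) - C)" if "x \<in> ball 0 r" for x using eq[OF that] ge[OF that] by simp
      show "a * (enn2real (Psi g x) - C) <= a * max 0 L" for x using P_le[of x] aC by (intro mult_left_mono) auto
    qed (use gy add_nonneg_pos[OF \<sigma>, of "s + s"] s_pos in \<open>auto simp: add.assoc\<close>)
    then have "reg k (?\<sigma> + s + s) (ball 0 r) g"
    proof (rule reg_cong)
      show "(a * (enn2real (Psi g x) - C)) powr (1 / (m - 1)) = g x" if "x \<in> ball 0 r" for x
        unfolding eq[OF that, symmetric] using nn m_gt_1 by (simp add: powr_powr)
    qed
    then show ?case by (simp add: algebra_simps)
  qed
  show ?thesis unfolding smooth_on_def
  proof
    fix k
    obtain n :: nat where n: "real k < real n * (2 * s)" using reals_Archimedean3[of "2 * s"] s_pos by auto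
    have "open (ball (0::'a) r) \<and> Ck k (ball 0 r) g" if "0 < r" "r < R" for r
      by (intro conjI open_ball reg_Ck[OF open_ball convex_ball reg[OF that] n])
    moreover have "\<exists>r>0. r < R \<and> x \<in> ball 0 r" if "x \<in> ball 0 R" for x :: 'a
    proof -
      have x: "0 <= norm x" "norm x < R" using that by simp_all
      have "0 < (norm x + R) / 2" "(norm x + R) / 2 < R" "norm x < (norm x + R) / 2" using x by argo+
      then show ?thesis unfolding mem_ball_0 by blast
    qed
    ultimately show "Ck k (ball 0 R) g" by (intro Ck_local) blast
  qed
qed

end

subsection \<open>Passage between Lebesgue and Borel measurable functions\<close>

lemma lebesgue_measurable_AE_eq:
  fixes h g :: "'a::euclidean_space => 'b::topological_space"
  assumes g[measurable]: "g \<in> Borel" and ae: "AE x in lborel. h x = g x"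
  shows "h \<in> borel_measurable lebesgue"
proof (rule measurableI)
  fix A :: "'b set" assume A: "A \<in> sets borel"
  have "g -` A \<inter> space borel \<in> sets borel" by (rule measurable_sets[OF g A])
  then have g_sets: "g -` A \<in> sets lebesgue" by simp
  have eq: "AE x in lebesgue. x \<in> g -` A \<longleftrightarrow> x \<in> h -` A"
    using AE_completion[OF ae] by eventually_elim auto
  have "h -` A \<in> sets lebesgue" by (rule completion.in_sets_AE[OF eq g_sets]) simp
  then show "h -` A \<inter> space lebesgue \<in> sets lebesgue" by simp
qed simp

lemma integral_lebesgue_AE_eq:
  fixes h g :: "'a::euclidean_space => 'b::{banach, second_countable_topology}"
  assumes g: "g \<in> Borel" and ae: "AE x in lborel. h x = g x"
  shows "(LINT x|lebesgue. h x) = (LINT x|lborel. g x)" "integrable lebesgue h \<longleftrightarrow> integrable lborel g"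
proof -
  have h: "h \<in> borel_measurable lebesgue" and gl: "g \<in> borel_measurable lebesgue"
    using lebesgue_measurable_AE_eq[OF g ae] lebesgue_measurable_AE_eq[OF g, of g] by auto
  have "(LINT x|lebesgue. h x) = (LINT x|lebesgue. g x)"
    by (rule integral_cong_AE[OF h gl AE_completion[OF ae]])
  also have "... = (LINT x|lborel. g x)" using g by (intro integral_completion) simp
  finally show "(LINT x|lebesgue. h x) = (LINT x|lborel. g x)" .
  have "integrable lebesgue h \<longleftrightarrow> integrable lebesgue g"
    by (rule integrable_cong_AE[OF h gl AE_completion[OF ae]])
  also have "... \<longleftrightarrow> integrable lborel g" using g by (intro integrable_completion) simp
  finally show "integrable lebesgue h \<longleftrightarrow> integrable lborel g" .
qed

lemma AE_lborel_affine:
  fixes t :: "'a::euclidean_space"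
  assumes ae: "AE x in lborel. P x" and c: "0 < c"
  shows "AE x in lborel. P (c *\<^sub>R (x - t))"
proof -
  from ae obtain S where S: "{x. \<not> P x} \<subseteq> S" "emeasure lborel S = 0" "S \<in> sets lborel" by (auto elim: AE_E)
  have [measurable]: "S \<in> sets borel" using S(3) by simp
  have [measurable]: "(%x. indicator S (c *\<^sub>R x) :: ennreal) \<in> Borel"
    by (rule measurable_compose[of "%x. c *\<^sub>R x" _ borel]) auto
  have "(NN x. indicator S (c *\<^sub>R (x - t))) = (NN x. indicator S (c *\<^sub>R x))"
    using nn_integral_lborel_translate[of "%x. indicator S (c *\<^sub>R x)" "- t"] by simp
  also have "... = 0" using S(2) by (subst nn_integral_lborel_scale) (auto simp: c)
  finally have "(NN x. indicator S (c *\<^sub>R (x - t))) = 0" .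
  moreover have "(%x. indicator S (c *\<^sub>R (x - t)) :: ennreal) \<in> Borel"
    by (rule measurable_compose[of "%x. c *\<^sub>R (x - t)" _ borel]) auto
  ultimately have "AE x in lborel. (indicator S (c *\<^sub>R (x - t)) :: ennreal) = 0"
    by (subst (asm) nn_integral_0_iff_AE) auto
  then show ?thesis by eventually_elim (use S(1) in \<open>auto simp: indicator_def split: if_splits\<close>)
qed

lemma dilate_one: "dilate 1 h = h" by (simp add: dilate_def fun_eq_iff)

lemma has_derivative_shift_iff:
  fixes f :: "'a::real_normed_vector => 'b::real_normed_vector"
  shows "((%x. f (x - a)) has_derivative D) (at x) \<longleftrightarrow> (f has_derivative D) (at (x - a))"
proof -
  have shift: "((%x. f (x - a)) has_derivative D) (at x)" if "(f has_derivative D) (at (x - a))"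
    for f :: "'a => 'b" and a x
  proof -
    have "((%x. x - a) has_derivative (%h. h)) (at x)" by (auto intro!: derivative_eq_intros)
    from has_derivative_compose[OF this that] show ?thesis .
  qed
  show ?thesis using shift[of f x a] shift[of "%x. f (x - a)" "x - a" "- a"] by auto
qed

lemma Ck_shift: "Ck k S f ==> Ck k {x. x - a \<in> S} (%x. f (x - a))"
proof (induction k arbitrary: f)
  case 0
  then show ?case by (auto intro!: continuous_on_compose2[of S f] continuous_intros)
next
  case (Suc k)
  have "frechet_derivative (%x. f (x - a)) (at x) = frechet_derivative f (at (x - a))" for x
    by (simp add: frechet_derivative_def has_derivative_shift_iff)
  then show ?case using Suc by (auto simp: differentiable_def has_derivative_shift_iff)
qed

text \<open>With \<open>u\<close> the tangent value, \<open>ln y < y - 1\<close> at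
  \<open>y = t / u\<close> and \<open>ln y <= y - 1\<close> at \<open>y = 1 / u\<close> are averaged
  with the weights \<open>\<tau>\<close> and \<open>1 - \<tau>\<close>.\<close>

lemma powr_less_tangent:
  fixes t \<tau> :: real
  assumes "0 < \<tau>" "\<tau> < 1" "0 <= t" "t ~= 1"
  shows "t powr \<tau> < 1 - \<tau> + \<tau> * t"
proof (cases "t = 0")
  case False
  define u where "u = 1 - \<tau> + \<tau> * t"
  have t: "0 < t" using False assms by simp
  have u: "0 < u" unfolding u_def using assms t by (intro add_pos_pos mult_pos_pos) auto
  have "t - u = (1 - \<tau>) * (t - 1)" by (simp add: u_def algebra_simps)
  then have "t ~= u" using assms by auto
  then have "t / u ~= 1" using u by simp
  then have a: "ln (t / u) < t / u - 1"
    using ln_le_minus_one[of "t / u"] ln_eq_minus_one[of "t / u"] t u by (auto simp: less_le)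
  have b: "ln (1 / u) <= 1 / u - 1" using u by (intro ln_le_minus_one) simp
  have "(1 - \<tau>) * ln (1 / u) + \<tau> * ln (t / u) < (1 - \<tau>) * (1 / u - 1) + \<tau> * (t / u - 1)"
    using a b assms by (intro add_le_less_mono mult_left_mono mult_strict_left_mono) auto
  also have "... = 0" using u by (simp add: field_simps) (simp add: u_def algebra_simps)
  finally have "\<tau> * ln t < ln u" using t u by (simp add: ln_div algebra_simps)
  then have "exp (\<tau> * ln t) < exp (ln u)" by simp
  also have "exp (ln u) = u" using u by simp
  finally show ?thesis using t by (simp add: powr_def u_def)
qed (use assms in simp)

context hls
begin

text \<open>Bridge between the Lebesgue measurable functions and a.e. conditions of the statement
  and the Borel functions of the argument.\<close>

definition rep :: "('a => real) => ('a => real) => bool" where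
  "rep h g \<longleftrightarrow> (AE x in lborel. h x = g x) \<and> adm g"

lemma rep_ex:
  assumes "Lp 1 h" "Lp m h" "AE x in lebesgue. 0 <= h x"
  shows "\<exists>g. rep h g"
proof -
  obtain g0 where [measurable]: "g0 \<in> Borel" and g0: "AE x in lborel. h x = g0 x"
    using completion_ex_borel_measurable_real[of h lborel] assms(1) by (auto simp: Lp_def)
  define g where "g x = max 0 (g0 x)" for x
  have [measurable]: "g \<in> Borel" unfolding g_def[abs_def] by measurable
  have eq: "AE x in lborel. h x = g x"
    using g0 assms(3)[unfolded AE_completion_iff] by eventually_elim (simp add: g_def)
  have g_nn: "0 <= g x" for x by (simp add: g_def)
  have fin: "(NN x. ennreal (g x powr r)) < \<infinity>" if "Lp r h" for r
  proof -
    have "AE x in lborel. \<bar>h x\<bar> powr r = \<bar>g x\<bar> powr r" using eq by eventually_elim simp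
    then have "integrable lborel (%x. \<bar>g x\<bar> powr r)"
      using that integral_lebesgue_AE_eq(2)[of "%x. \<bar>g x\<bar> powr r" "%x. \<bar>h x\<bar> powr r"] by (auto simp: Lp_def)
    then show ?thesis by (simp add: integrable_iff_bounded g_nn)
  qed
  have "adm g" using fin[OF assms(1)] fin[OF assms(2)] g_nn by (auto simp: adm_def mass_def mpow_def)
  then show ?thesis using eq by (auto simp: rep_def)
qed

lemma rep_Lp:
  assumes "rep h g"
  shows "Lp 1 h" "Lp m h" "AE x in lebesgue. 0 <= h x"
proof -
  have [measurable]: "g \<in> Borel" and nn: "!!x. 0 <= g x" and fin: "mass g < \<infinity>" "mpow g < \<infinity>"
    and eq: "AE x in lborel. h x = g x" using assms by (auto simp: rep_def adm_def)
  have h: "h \<in> borel_measurable lebesgue" by (rule lebesgue_measurable_AE_eq[OF _ eq]) simp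
  have "integrable lborel (%x. \<bar>g x\<bar> powr r)" if "(NN x. ennreal (g x powr r)) < \<infinity>" for r
    using that nn by (simp add: integrable_iff_bounded)
  then have I: "integrable lebesgue (%x. \<bar>h x\<bar> powr r)" if "(NN x. ennreal (g x powr r)) < \<infinity>" for r
    using that eq by (subst integral_lebesgue_AE_eq(2)[of "%x. \<bar>g x\<bar> powr r"]) auto
  then show "Lp 1 h" "Lp m h" using h fin nn I[of 1] I[of m] by (auto simp: Lp_def mass_def mpow_def)
  show "AE x in lebesgue. 0 <= h x" unfolding AE_completion_iff using eq by eventually_elim (simp add: nn)
qed

lemma conv_eq_rpotr:
  fixes h :: "'a => real"
  assumes [measurable]: "g \<in> Borel" and nn: "!!x. 0 <= g x" and eq: "AE x in lborel. h x = g x"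
  shows "conv (riesz_kernel (s / 2)) h x = rpotr s g x"
proof -
  have "conv K h x = (LINT y|lborel. K (x - y) * g y)"
    unfolding conv_def by (rule integral_lebesgue_AE_eq) (use eq in \<open>auto elim: eventually_mono\<close>)
  also have "... = rpotr s g x"
    unfolding rpotr_def rpot_def using nn by (intro integral_eq_nn_integral) auto
  finally show ?thesis .
qed

lemma rep_integrals:
  assumes "rep h g"
  shows "(LINT x|lebesgue. \<bar>h x\<bar> powr r) = enn2real (NN x. ennreal (g x powr r))"
    and "(LINT x|lebesgue. h x powr r) = enn2real (NN x. ennreal (g x powr r))"
    and "(LINT x|lebesgue. h x) = enn2real (mass g)"
    and "conv (riesz_kernel (s / 2)) h x = rpotr s g x"
proof -
  have [measurable]: "g \<in> Borel" and nn: "!!x. 0 <= g x"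
    and eq: "AE x in lborel. h x = g x" using assms by (auto simp: rep_def adm_def)
  have i: "(LINT x|lborel. f (g x)) = enn2real (NN x. ennreal (f (g x)))"
    if "f \<in> Borel" "!!y. 0 <= y ==> 0 <= f y" for f :: "real => real"
  proof (rule integral_eq_nn_integral)
    show "(%x. f (g x)) \<in> borel_measurable lborel" by (rule measurable_compose[OF _ that(1)]) simp
  qed (use that nn in auto)
  have "(LINT x|lebesgue. \<bar>h x\<bar> powr r) = (LINT x|lborel. \<bar>g x\<bar> powr r)"
    by (rule integral_lebesgue_AE_eq) (use eq in auto)
  then show "(LINT x|lebesgue. \<bar>h x\<bar> powr r) = enn2real (NN x. ennreal (g x powr r))"
    using i[of "%y. \<bar>y\<bar> powr r"] nn by simp
  have "(LINT x|lebesgue. h x powr r) = (LINT x|lborel. g x powr r)"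
    by (rule integral_lebesgue_AE_eq) (use eq in auto)
  then show "(LINT x|lebesgue. h x powr r) = enn2real (NN x. ennreal (g x powr r))"
    using i[of "%y. y powr r"] by simp
  have "(LINT x|lebesgue. h x) = (LINT x|lborel. g x)"
    by (rule integral_lebesgue_AE_eq) (use eq in auto)
  then show "(LINT x|lebesgue. h x) = enn2real (mass g)" using i[of "%y. y"] by (simp add: mass_def)
  show "conv (riesz_kernel (s / 2)) h x = rpotr s g x" by (rule conv_eq_rpotr) (use nn eq in auto)
qed

lemma rep_Lnorm:
  assumes "rep h g"
  shows "Lnorm 1 h = enn2real (mass g)" "Lnorm m h = enn2real (mpow g) powr (1 / m)"
  using rep_integrals(1)[OF assms, of 1] rep_integrals(1)[OF assms, of m] assms
  by (auto simp: Lnorm_def mass_def mpow_def rep_def adm_def)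

lemma pstar_eq: "pstar N s p = N / (N - b0)"
proof -
  have e: "N - b0 = (N - s * p) / p" using p_gt_1 by (simp add: b0_eq field_simps)
  show ?thesis unfolding e pstar_def by simp
qed

lemma theta0_exponents: "q * theta0 N s p m = \<alpha>" "q * (1 - theta0 N s p m) = m * \<tau>"
proof -
  have "1 - theta0 N s p m = m / (m - 1) * ((N - b0) / N)" by (simp add: theta0_def pstar_eq conj_exp_def)
  then show e: "q * (1 - theta0 N s p m) = m * \<tau>" by (simp add: \<tau>_def ac_simps)
  then show "q * theta0 N s p m = \<alpha>" by (simp add: \<alpha>_def algebra_simps)
qed

lemma nrm_pos:
  assumes "adm g" "mass g ~= 0"
  shows "0 < nrm g"
proof -
  have "0 < enn2real (mass g)" "0 < enn2real (mpow g)"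
    using assms mass_0_iff[OF assms(1)] mpow_0_iff[OF assms(1)]
    by (auto simp: adm_def enn2real_positive_iff zero_less_iff_neq_zero)
  then show ?thesis by (simp add: nrm_def)
qed

lemma rep_quot:
  assumes h: "rep h g"
  shows "hls_quot s p m h = energy s q g * ennreal (1 / nrm g)"
proof -
  have "(\<integral>\<^sup>+x. ennreal (\<bar>conv (riesz_kernel (s / 2)) h x\<bar> powr conj_exp p) \<partial>lebesgue) = energy s q g"
    unfolding rep_integrals(4)[OF h] nn_integral_completion energy_def by (simp add: q_def)
  moreover have "Lnorm 1 h powr (conj_exp p * theta0 N s p m) * Lnorm m h powr (conj_exp p * (1 - theta0 N s p m)) = nrm g"
    using m_gt_1 unfolding rep_Lnorm[OF h] q_def[symmetric] theta0_exponents nrm_def by (simp add: powr_powr)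
  ultimately show ?thesis by (simp add: hls_quot_def N_eq)
qed

lemma rep_hls_adm:
  assumes h: "rep h g"
  shows "hls_adm m h \<longleftrightarrow> mass g ~= 0"
proof -
  have eq: "AE x in lborel. h x = g x" and a: "adm g" using h by (auto simp: rep_def)
  have "(AE x in lebesgue. h x = 0) \<longleftrightarrow> (AE x in lborel. g x = 0)"
    unfolding AE_completion_iff using eq by (auto elim: eventually_elim2)
  then show ?thesis using rep_Lp[OF h] mass_0_iff[OF a] by (simp add: hls_adm_def)
qed

text \<open>Sign changes can only lower the quotient: the modulus of the potential is at most the
  potential of \<open>\<bar>h\<bar>\<close>, while the norms agree.\<close>

lemma hls_quot_le:
  fixes h :: "'a => real"
  assumes h: "hls_adm m h"
  shows "hls_quot s p m h <= ennreal Hr"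
proof -
  have Lh: "Lp 1 h" "Lp m h" and hm: "h \<in> borel_measurable lebesgue" using h by (auto simp: hls_adm_def Lp_def)
  have L: "Lp 1 (%x. \<bar>h x\<bar>)" "Lp m (%x. \<bar>h x\<bar>)" using Lh by (auto simp: Lp_def)
  obtain g where g: "rep (%x. \<bar>h x\<bar>) g" using rep_ex[OF L] by auto
  have "\<not> (AE x in lebesgue. \<bar>h x\<bar> = 0)" using h by (simp add: hls_adm_def)
  then have "hls_adm m (%x. \<bar>h x\<bar>)" using L by (simp add: hls_adm_def)
  then have nz: "mass g ~= 0" using rep_hls_adm[OF g] by simp
  have ag: "adm g" using g by (simp add: rep_def)
  have "\<bar>conv (riesz_kernel (s / 2)) h x\<bar> <= \<bar>conv (riesz_kernel (s / 2)) (%x. \<bar>h x\<bar>) x\<bar>" for x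
  proof -
    have "norm (conv K h x) <= (LINT y|lebesgue. norm (K (x - y) * h y))" unfolding conv_def by (rule integral_norm_bound)
    also have "... = conv K (%x. \<bar>h x\<bar>) x" by (simp add: conv_def abs_mult K_nonneg)
    finally show ?thesis by simp
  qed
  then have "(\<integral>\<^sup>+x. ennreal (\<bar>conv (riesz_kernel (s / 2)) h x\<bar> powr conj_exp p) \<partial>lebesgue)
      <= (\<integral>\<^sup>+x. ennreal (\<bar>conv (riesz_kernel (s / 2)) (%x. \<bar>h x\<bar>) x\<bar> powr conj_exp p) \<partial>lebesgue)"
    using q_gt_1 unfolding q_def[symmetric] by (intro nn_integral_mono ennreal_leI powr_mono2) auto
  then have "hls_quot s p m h <= hls_quot s p m (%x. \<bar>h x\<bar>)"
    unfolding hls_quot_def by (intro mult_mono) (auto simp: Lnorm_def)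
  also have "... = energy s q g * ennreal (1 / nrm g)" by (rule rep_quot[OF g])
  also have "... <= ennreal (nrm g * Hr) * ennreal (1 / nrm g)" by (intro mult_right_mono energy_le[OF ag]) simp
  also have "... = ennreal Hr" using nrm_pos[OF ag nz] Hr_pos by (simp add: ennreal_mult[symmetric])
  finally show ?thesis .
qed

lemma rep_self: "adm g ==> rep g g" by (simp add: rep_def)

lemma Hstar_eq: "Hstar TYPE('a) s p m = ennreal Hr"
proof (rule antisym)
  show "Hstar TYPE('a) s p m <= ennreal Hr" unfolding Hstar_def by (rule SUP_least) (simp add: hls_quot_le)
  obtain f :: "'a => real" where f: "adm f" "mass f = 1" "mpow f = 1" "energy s q f = ennreal Hr" using maximizer_exists by blast
  have "hls_adm m f" using rep_hls_adm[OF rep_self[OF f(1)]] f by simp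
  then have "hls_quot s p m f <= Hstar TYPE('a) s p m" unfolding Hstar_def by (intro SUP_upper) simp
  then show "ennreal Hr <= Hstar TYPE('a) s p m" using f rep_quot[OF rep_self[OF f(1)]] by (simp add: nrm_def)
qed

lemma rep_maximizer:
  assumes h: "rep h g"
  shows "hls_maximizer s p m h \<longleftrightarrow> ismax g"
proof (cases "mass g = 0")
  case True
  then show ?thesis using rep_hls_adm[OF h] by (simp add: hls_maximizer_def ismax_def)
next
  case False
  have a: "adm g" using h by (simp add: rep_def)
  note n = nrm_pos[OF a False]
  obtain E where E: "energy s q g = ennreal E" "0 <= E" using energy_finite[OF a] by (cases "energy s q g") auto
  have "hls_quot s p m h = ennreal (E / nrm g)"
    using n E by (simp add: rep_quot[OF h] ennreal_mult[symmetric])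
  then have "hls_quot s p m h = Hstar TYPE('a) s p m \<longleftrightarrow> E = nrm g * Hr"
    using n E Hr_pos by (auto simp: Hstar_eq field_simps)
  then show ?thesis using rep_hls_adm[OF h] False a E n Hr_pos by (auto simp: hls_maximizer_def ismax_def)
qed

subsection \<open>Structure of the maximizers\<close>

lemma regular_profile_norm_cong:
  "regular_profile G a C ==> norm x = norm y ==> G x = G y"
  unfolding regular_profile_def by (metis order_antisym order_refl)

text \<open>Bounded support gives integrability; evenness makes the integral its own
  negative.\<close>

lemma regular_profile_moment:
  assumes G: "regular_profile G a C"
  shows "integrable lborel (%x. G x *\<^sub>R x)" "(LINT x|lborel. G x *\<^sub>R x) = 0"
proof -
  have [measurable]: "G \<in> Borel" and nn: "!!x. 0 <= G x" using G by (auto simp: regular_profile_def)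
  obtain M R where M: "!!x. G x <= M" and R: "0 < R" "!!x. R < norm x ==> G x = 0"
    using G by (auto simp: regular_profile_def)
  show "integrable lborel (%x. G x *\<^sub>R x)"
  proof (rule Bochner_Integration.integrable_bound)
    show "integrable lborel (%x::'a. M * R * indicator (cball 0 R) x)"
      using emeasure_lborel_cball_finite[of "0::'a" R] by (intro integrable_mult_right integrable_real_indicator) auto
    show "AE x in lborel. norm (G x *\<^sub>R x) <= norm (M * R * indicator (cball 0 R) x)"
    proof (intro AE_I2)
      fix x
      have "0 <= M" using order_trans[OF nn M] .
      moreover have "G x * norm x <= M * R" if "norm x <= R" using nn M that \<open>0 <= M\<close> by (intro mult_mono) auto
      ultimately show "norm (G x *\<^sub>R x) <= norm (M * R * indicator (cball 0 R) x)"
        using nn[of x] R(1) R(2)[of x] by (auto simp: indicator_def)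
    qed
  qed simp
  define v where "v = (LINT x|lborel. G x *\<^sub>R x)"
  have "v = (LINT x|distr lborel borel (%z. 0 - z). G x *\<^sub>R x)" unfolding distr_lborel_reflect v_def ..
  also have "... = (LINT x|lborel. G (0 - x) *\<^sub>R (0 - x))" by (rule integral_distr) auto
  also have "... = - v"
    using regular_profile_norm_cong[OF G, of "- _" _] by (simp add: v_def)
  finally have "v + v = 0" by (metis add.right_inverse)
  then have "2 *\<^sub>R v = 0" by (simp add: scaleR_2)
  then show "(LINT x|lborel. G x *\<^sub>R x) = 0" by (simp add: v_def)
qed

lemma maximizer_profile:
  assumes g: "ismax g"
  shows "\<exists>b G a C. (AE x in lborel. g (x + b) = G x) \<and> regular_profile G a C"
proof -
  obtain b where b: "AE x in lborel. g (b - x) = g (b + x)" using maximizer_centered[OF g] by blast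
  then have "AE x in lborel. g (- x + b) = g (x + b)" by eventually_elim (simp add: add.commute)
  from maximizer_regular[OF ismax_translate[OF g] this] show ?thesis by blast
qed

lemma Yclass_rep:
  assumes h: "rep h g"
  shows "Yclass m M h \<longleftrightarrow> enn2real (mass g) = M \<and> integrable lborel (%x. g x *\<^sub>R x) \<and> (LINT x|lborel. g x *\<^sub>R x) = 0"
proof -
  have [measurable]: "g \<in> Borel" and eq: "AE x in lborel. h x = g x" using h by (auto simp: rep_def adm_def)
  have "AE x in lborel. h x *\<^sub>R x = g x *\<^sub>R x" using eq by eventually_elim simp
  from integral_lebesgue_AE_eq[OF _ this] show ?thesis
    unfolding Yclass_def using rep_Lp[OF h] rep_integrals(3)[OF h] by simp
qed

text \<open>Energy and \<open>nrm\<close> are multiplied by the same power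
  \<open>l powr (N * (m - 1) * \<tau>)\<close>, so maximality and mass persist while
  \<open>mpow\<close> can be moved to any positive value.\<close>

lemma rep_translate_dilate:
  fixes y :: 'a
  assumes h: "rep h g" and g: "ismax g" and l: "0 < l"
  defines "g' \<equiv> %x. l powr N * g (l *\<^sub>R (x - y))"
  shows "rep (translate y (dilate l h)) g'" "ismax g'" "mass g' = mass g" "mpow g' = ennreal (l powr (N * (m - 1))) * mpow g"
proof -
  have a: "adm g" and [measurable]: "g \<in> Borel" and eq: "AE x in lborel. h x = g x"
    using h by (auto simp: rep_def adm_def)
  define c where "c = l powr N"
  have c: "0 < c" using l by (simp add: c_def)
  define f where "f x = c * g (l *\<^sub>R x)" for x
  note dil = adm_dilation[OF a c l, folded f_def]
  have g'_eq: "g' = (%x. f (x + - y))" by (simp add: g'_def f_def c_def)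
  have [measurable]: "f \<in> Borel" using dil(1) by (simp add: adm_def)
  have mf: "mass f = mass g" "mpow f = ennreal (l powr (N * (m - 1))) * mpow g"
    using l by (simp_all add: dil(2,3) c_def powr_add[symmetric] powr_powr algebra_simps)
  have "energy s q f = ennreal (nrm f * Hr)"
  proof -
    define A P where "A = enn2real (mass g)" and "P = enn2real (mpow g)"
    have AP: "0 <= A" "0 <= P" by (simp_all add: A_def P_def)
    have "nrm f = A powr \<alpha> * (l powr (N * (m - 1)) * P) powr \<tau>"
      by (simp add: nrm_def mf enn2real_mult A_def P_def)
    also have "... = l powr (N * (m - 1) * \<tau>) * nrm g" using AP by (simp add: powr_mult powr_powr nrm_def A_def P_def)
    finally have nf: "nrm f = l powr (N * (m - 1) * \<tau>) * nrm g" .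
    have e: "N * q + - (s * q + N) = N * (m - 1) * \<tau>" using q_tau N_pos by (simp add: field_simps)
    have "c powr q * l powr - (s * q + N) = l powr (N * q) * l powr - (s * q + N)" by (simp add: c_def powr_powr)
    also have "... = l powr (N * (m - 1) * \<tau>)" unfolding e[symmetric] by (rule powr_add[symmetric])
    finally have "c powr q * l powr - (s * q + N) = l powr (N * (m - 1) * \<tau>)" .
    then have "energy s q f = ennreal (l powr (N * (m - 1) * \<tau>)) * ennreal (nrm g * Hr)"
      using dil(4) g by (simp add: ismax_def)
    then show ?thesis using Hr_nonneg by (simp add: nf ennreal_mult[symmetric] mult.assoc)
  qed
  then have f: "ismax f" using dil(1) g mf by (simp add: ismax_def)
  show g': "ismax g'" unfolding g'_eq by (rule ismax_translate[OF f])
  have "mass g' = mass f" "mpow g' = mpow f"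
    unfolding g'_eq mass_def mpow_def
    using nn_integral_lborel_translate[of "%x. ennreal (f x)" "- y"] nn_integral_lborel_translate[of "%x. ennreal (f x powr m)" "- y"] by simp_all
  then show "mass g' = mass g" "mpow g' = ennreal (l powr (N * (m - 1))) * mpow g" using mf by simp_all
  have "AE x in lborel. translate y (dilate l h) x = g' x"
    using AE_lborel_affine[OF eq l, of y]
    by eventually_elim (use l in \<open>simp add: translate_def dilate_def g'_def N_eq powr_realpow\<close>)
  then show "rep (translate y (dilate l h)) g'" using g' by (simp add: rep_def ismax_def)
qed

text \<open>The admissible class demands an integrable first moment. A maximizer has one because, up
  to translation, it is a profile with bounded support.\<close>

lemma rep_center:
  assumes h: "rep h g" and g: "ismax g"
  shows "\<exists>y. Yclass m (enn2real (mass g)) (translate y h)"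
proof -
  obtain b G a C where b: "AE x in lborel. g (x + b) = G x" and G: "regular_profile G a C"
    using maximizer_profile[OF g] by blast
  have [measurable]: "g \<in> Borel" "G \<in> Borel"
    using h G by (auto simp: rep_def adm_def regular_profile_def)
  have r: "rep (translate (- b) h) (%x. g (x + b))" and mass: "mass (%x. g (x + b)) = mass g"
    using rep_translate_dilate(1,3)[where l=1 and y="- b", OF h g] by (simp_all add: dilate_one)
  have eq: "AE x in lborel. g (x + b) *\<^sub>R x = G x *\<^sub>R x" using b by eventually_elim simp
  have "integrable lborel (%x. g (x + b) *\<^sub>R x) \<longleftrightarrow> integrable lborel (%x. G x *\<^sub>R x)"
    by (rule integrable_cong_AE[OF _ _ eq]) auto
  moreover have "(LINT x|lborel. g (x + b) *\<^sub>R x) = (LINT x|lborel. G x *\<^sub>R x)"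
    by (rule integral_cong_AE[OF _ _ eq]) auto
  ultimately show ?thesis using Yclass_rep[OF r] regular_profile_moment[OF G] mass by auto
qed

text \<open>Two scaling parameters meet two constraints: the factor \<open>M\<close> sets the mass,
  the dilation by \<open>l\<close> then sets \<open>mpow\<close>.\<close>

lemma centered_maximizer:
  assumes "0 < M" "0 < A"
  shows "\<exists>f. ismax f \<and> mass f = ennreal M \<and> mpow f = ennreal A \<and> Yclass m M f"
proof -
  obtain f0 :: "'a => real" where f0: "adm f0" "mass f0 = 1" "mpow f0 = 1" "energy s q f0 = ennreal Hr" using maximizer_exists by blast
  have l0: "ismax f0" using f0 by (simp add: ismax_def nrm_def)
  have f1: "adm (%x. M * f0 (1 *\<^sub>R x))" "mass (%x. M * f0 (1 *\<^sub>R x)) = ennreal M" "mpow (%x. M * f0 (1 *\<^sub>R x)) = ennreal (M powr m)"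
    "energy s q (%x. M * f0 (1 *\<^sub>R x)) = ennreal (M powr q * Hr)"
    using adm_dilation[OF f0(1) assms(1), of 1] f0 Hr_nonneg by (simp_all add: ennreal_mult[symmetric])
  define f where "f x = M * f0 x" for x
  have "M powr \<alpha> * (M powr m) powr \<tau> = M powr q" by (simp add: powr_powr powr_add[symmetric] \<alpha>_def)
  then have f: "ismax f" "mass f = ennreal M" "mpow f = ennreal (M powr m)"
    using f1 assms(1) by (simp_all add: ismax_def f_def[abs_def] nrm_def)
  define l where "l = (A / M powr m) powr (1 / (N * (m - 1)))"
  have l: "0 < l" using assms by (simp add: l_def)
  have lA: "l powr (N * (m - 1)) = A / M powr m" using assms N_pos m_gt_1 by (simp add: l_def powr_powr)
  have rf: "rep f f" using f(1) by (simp add: ismax_def rep_def)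
  define h where "h = translate 0 (dilate l f)"
  define g where "g x = l powr N * f (l *\<^sub>R (x - 0))" for x
  note d = rep_translate_dilate[where y=0, OF rf f(1) l, folded g_def h_def]
  have mp: "mpow g = ennreal A" using d(4) assms by (simp add: f(3) lA ennreal_mult[symmetric])
  have ms: "mass g = ennreal M" using d(3) f(2) by simp
  have rg: "rep g g" using d(2) by (simp add: ismax_def rep_def)
  obtain y where y: "Yclass m M (translate y g)" using rep_center[OF rg d(2)] ms assms by auto
  define k where "k x = 1 powr N * g (1 *\<^sub>R (x - y))" for x
  have k: "k = translate y g" by (simp add: k_def translate_def fun_eq_iff)
  note e = rep_translate_dilate[where l=1 and y=y, OF rg d(2) zero_less_one, folded k_def]
  show ?thesis using e(2-4) ms mp y by (intro exI[of _ k]) (simp add: k)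
qed

subsection \<open>The free energy\<close>

text \<open>Free energy of a maximizer with mass \<open>M\<close> and \<open>mpow\<close> equal to
  \<open>A\<close>; a lower bound for every other function with these data.\<close>

definition psi :: "real => real => real => real" where
  "psi chi M A = 1 / (m - 1) * A - chi / q * (M powr \<alpha> * A powr \<tau> * Hr)"

lemma Fen_psi:
  assumes h: "rep h g" and chi: "0 < chi"
  shows "psi chi (enn2real (mass g)) (enn2real (mpow g)) <= Fen s p m chi h"
    and "mass g ~= 0 ==> Fen s p m chi h = psi chi (enn2real (mass g)) (enn2real (mpow g)) \<longleftrightarrow> ismax g"
proof -
  have a: "adm g" using h by (simp add: rep_def)
  obtain E where E: "energy s q g = ennreal E" "0 <= E" using energy_finite[OF a] by (cases "energy s q g") auto
  have "(LINT x|lebesgue. conv (riesz_kernel (s / 2)) h x powr conj_exp p) = (LINT x|lborel. rpotr s g x powr q)"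
    unfolding rep_integrals(4)[OF h] q_def[symmetric]
    by (rule integral_lebesgue_AE_eq) (use a in \<open>auto simp: adm_def\<close>)
  also have "... = enn2real (energy s q g)" unfolding energy_def
    by (rule integral_eq_nn_integral) (use a in \<open>auto simp: adm_def\<close>)
  finally have "(LINT x|lebesgue. conv (riesz_kernel (s / 2)) h x powr conj_exp p) = E" using E by simp
  then have F: "Fen s p m chi h = 1 / (m - 1) * enn2real (mpow g) - chi / q * E"
    by (simp add: Fen_def rep_integrals(2)[OF h] mpow_def q_def)
  have P: "psi chi (enn2real (mass g)) (enn2real (mpow g)) = 1 / (m - 1) * enn2real (mpow g) - chi / q * (nrm g * Hr)"
    by (simp add: psi_def nrm_def)
  have le: "E <= nrm g * Hr" using energy_le[OF a] E Hr_nonneg by (simp add: E)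
  have cq: "0 < chi / q" using chi q_gt_1 by simp
  show "psi chi (enn2real (mass g)) (enn2real (mpow g)) <= Fen s p m chi h"
    unfolding F P using mult_left_mono[OF le, of "chi / q"] cq by simp
  assume nz: "mass g ~= 0"
  have "ismax g \<longleftrightarrow> E = nrm g * Hr" using a nz E Hr_nonneg by (auto simp: ismax_def)
  also have "... \<longleftrightarrow> Fen s p m chi h = psi chi (enn2real (mass g)) (enn2real (mpow g))"
    unfolding F P using cq chi by auto
  finally show "Fen s p m chi h = psi chi (enn2real (mass g)) (enn2real (mpow g)) \<longleftrightarrow> ismax g" by simp
qed

text \<open>The centred profile is moved back by \<open>b\<close>. \<open>Kspot\<close> commutes
  with translations and agrees with \<open>Psi\<close> at every point, so the equation survives
  everywhere, and the support is a closed ball with known interior.\<close>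

lemma maximizer_structure:
  assumes h: "rep h g" and g: "ismax g"
  shows "\<exists>G x0 a C. (AE x in lebesgue. h x = G x) \<and> radial_nonincr_about x0 G \<and> compact (closure {x. G x ~= 0})
    \<and> holder_continuous G \<and> smooth_on (interior (closure {x. G x ~= 0})) G \<and> 0 < a \<and> 0 < C
    \<and> (\<forall>x. G x powr (m - 1) = a * max 0 (Kspot s p G x - C))"
proof -
  obtain b G a C where b: "AE x in lborel. g (x + b) = G x" and G: "regular_profile G a C"
    using maximizer_profile[OF g] by blast
  have [measurable]: "G \<in> Borel" and nn: "!!x. 0 <= G x" and aC: "0 < a" "0 < C"
    and mono: "!!x y. norm x <= norm y ==> G y <= G x"
    and EL: "!!x. G x powr (m - 1) = a * max 0 (enn2real (Psi G x) - C)"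
    using G by (auto simp: regular_profile_def)
  obtain R where R: "0 < R" "{x. G x ~= 0} = ball 0 R" using regular_profile_support[OF G] by blast
  define G1 where "G1 x = G (x - b)" for x
  have "AE x in lborel. g (x + - b + b) = G (x + - b)" using AE_translate[OF b, of "- b"] by simp
  moreover have "AE x in lborel. h x = g x" using h by (simp add: rep_def)
  ultimately have "AE x in lborel. h x = G1 x" by eventually_elim (simp add: G1_def)
  then have 1: "AE x in lebesgue. h x = G1 x" by (rule AE_completion)
  obtain e :: 'a where e: "norm e = 1" using vector_choose_size[of 1] by auto
  have 2: "radial_nonincr_about b G1" unfolding radial_nonincr_about_def
  proof (intro exI[of _ "%t. G (t *\<^sub>R e)"] conjI allI impI)
    show "G1 x = G (dist x b *\<^sub>R e)" for x
      unfolding G1_def by (rule regular_profile_norm_cong[OF G]) (simp add: e dist_norm)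
    show "G (t *\<^sub>R e) <= G (r *\<^sub>R e)" if "0 <= r" "r <= t" for r t using that by (intro mono) (simp add: e)
  qed
  have supp: "{x. G1 x ~= 0} = ball b R"
    using R(2) by (auto simp: G1_def set_eq_iff dist_norm norm_minus_commute)
  have cl: "closure {x. G1 x ~= 0} = cball b R" using R(1) by (simp add: supp)
  have 3: "holder_continuous G1"
    using regular_profile_holder[OF G] unfolding holder_continuous_def G1_def by (simp add: dist_norm) (metis diff_diff_eq2 diff_add_cancel add_diff_cancel_right)
  have "{x. x - b \<in> ball 0 R} = ball b R" by (auto simp: dist_norm norm_minus_commute)
  then have 4: "smooth_on (ball b R) G1"
    using regular_profile_smooth[OF G R(2)] Ck_shift[of _ "ball 0 R" G b] by (simp add: smooth_on_def G1_def[abs_def])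
  have r1: "rpotr s G1 x = rpotr s G (x - b)" for x by (simp add: rpotr_def G1_def[abs_def] rpot_translate)
  have "Kspot s p G1 x = enn2real (Psi G (x - b))" for x
  proof -
    have "conv K G1 y powr (conj_exp p - 1) = dens G (y - b)" for y
      using conv_eq_rpotr[of G1 G1 y] nn by (simp add: G1_def[abs_def] dens_def q_def r1[unfolded G1_def[abs_def]])
    then have "Kspot s p G1 x = conv K (%y. dens G (y - b)) x" by (simp add: Kspot_def)
    also have "... = rpotr s (%y. dens G (y - b)) x" by (rule conv_eq_rpotr) auto
    also have "... = enn2real (Psi G (x - b))" by (simp add: rpotr_def Psi_def rpot_translate)
    finally show ?thesis .
  qed
  then have 5: "G1 x powr (m - 1) = a * max 0 (Kspot s p G1 x - C)" for x by (simp add: G1_def EL)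
  show ?thesis using 1 2 3 4 5 aC by (intro exI[of _ G1] exI[of _ b] exI[of _ a] exI[of _ C]) (simp add: cl)
qed

text \<open>The scaling balance \<open>q_tau\<close> again; it converts the comparison of
  \<open>m\<close> with m_c into that of \<open>\<tau>\<close> with 1.\<close>

lemma m_minus_mcrit: "m - mcrit N s p = (m - 1) * (1 - \<tau>)"
  using q_tau N_pos by (simp add: mcrit_def q_def[symmetric] field_simps)

lemma Yclass_rep_ex:
  assumes Y: "Yclass m M \<rho>" and M: "0 < M"
  shows "\<exists>g. rep \<rho> g \<and> enn2real (mass g) = M \<and> mass g ~= 0 \<and> 0 < enn2real (mpow g)"
proof -
  obtain g where g: "rep \<rho> g" using rep_ex Y by (auto simp: Yclass_def)
  have a: "adm g" using g by (simp add: rep_def)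
  have ms: "enn2real (mass g) = M" using Y Yclass_rep[OF g] by simp
  then have nz: "mass g ~= 0" using M by auto
  then have "0 < enn2real (mpow g)"
    using a mass_0_iff[OF a] mpow_0_iff[OF a] by (auto simp: adm_def enn2real_positive_iff zero_less_iff_neq_zero)
  then show ?thesis using g ms nz by blast
qed

text \<open>Every positive \<open>A0\<close> is attained as \<open>mpow\<close> of a centred
  maximizer of mass \<open>M\<close>, so minimizing the free energy reduces to minimizing
  \<open>psi chi M\<close> in one variable.\<close>

lemma Fminimizer_iff:
  assumes chi: "0 < chi" and M: "0 < M" and A0: "0 < A0" "!!A. 0 <= A ==> psi chi M A0 <= psi chi M A"
    and Y: "Yclass m M \<rho>" and g: "rep \<rho> g"
  shows "Fminimizer s p m chi M \<rho> \<longleftrightarrow> ismax g \<and> psi chi M (enn2real (mpow g)) = psi chi M A0"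
proof -
  have ms: "enn2real (mass g) = M" using Y Yclass_rep[OF g] by simp
  then have nz: "mass g ~= 0" using M by auto
  note F = Fen_psi[OF g chi, unfolded ms]
  show ?thesis
  proof
    assume min: "Fminimizer s p m chi M \<rho>"
    obtain f where f: "ismax f" "mass f = ennreal M" "mpow f = ennreal A0" "Yclass m M f"
      using centered_maximizer[OF M A0(1)] by blast
    have rf: "rep f f" using f(1) by (simp add: ismax_def rep_def)
    have "Fen s p m chi f = psi chi M A0" using Fen_psi(2)[OF rf chi] f M A0(1) by simp
    then have "Fen s p m chi \<rho> <= psi chi M A0" using min f(4) by (auto simp: Fminimizer_def)
    moreover have "psi chi M A0 <= psi chi M (enn2real (mpow g))" by (intro A0(2)) simp
    ultimately show "ismax g \<and> psi chi M (enn2real (mpow g)) = psi chi M A0" using F(1) F(2)[OF nz] by auto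
  next
    assume g': "ismax g \<and> psi chi M (enn2real (mpow g)) = psi chi M A0"
    have "Fen s p m chi \<rho> <= Fen s p m chi \<sigma>" if \<sigma>: "Yclass m M \<sigma>" for \<sigma> :: "'a => real"
    proof -
      obtain f where f: "rep \<sigma> f" "enn2real (mass f) = M" using Yclass_rep_ex[OF \<sigma> M] by blast
      have "Fen s p m chi \<rho> = psi chi M A0" using g' F(2)[OF nz] by simp
      also have "... <= psi chi M (enn2real (mpow f))" by (intro A0(2)) simp
      also have "... <= Fen s p m chi \<sigma>" using Fen_psi(1)[OF f(1) chi] f(2) by simp
      finally show ?thesis .
    qed
    then show "Fminimizer s p m chi M \<rho>" using Y by (simp add: Fminimizer_def)
  qed
qed

lemma Fminimizer_maximizer:
  fixes \<rho> :: "'a => real"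
  assumes "0 < chi" "0 < M" "0 < A0" "!!A. 0 <= A ==> psi chi M A0 <= psi chi M A"
  shows "\<exists>\<rho> :: 'a => real. Fminimizer s p m chi M \<rho>" "Fminimizer s p m chi M \<rho> ==> hls_maximizer s p m \<rho>"
proof -
  obtain f where f: "ismax f" "mpow f = ennreal A0" "Yclass m M f"
    using centered_maximizer[OF assms(2,3)] by blast
  have rf: "rep f f" using f(1) by (simp add: ismax_def rep_def)
  show "\<exists>\<rho> :: 'a => real. Fminimizer s p m chi M \<rho>" using Fminimizer_iff[OF assms f(3) rf] f assms(3) by auto
  assume \<rho>: "Fminimizer s p m chi M \<rho>"
  then have Y: "Yclass m M \<rho>" by (simp add: Fminimizer_def)
  obtain g where g: "rep \<rho> g" using Yclass_rep_ex[OF Y assms(2)] by blast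
  show "hls_maximizer s p m \<rho>" using Fminimizer_iff[OF assms Y g] \<rho> rep_maximizer[OF g] by simp
qed

lemma psi_min:
  assumes \<tau>: "\<tau> < 1" and chi: "0 < chi" and M: "0 < M"
  shows "\<exists>A0>0. \<forall>A\<ge>0. A ~= A0 --> psi chi M A0 < psi chi M A"
proof -
  define a b where "a = 1 / (m - 1)" and "b = chi / q * M powr \<alpha> * Hr"
  have ab: "0 < a" "0 < b" using m_gt_1 chi q_gt_1 M Hr_pos by (auto simp: a_def b_def)
  have psi: "psi chi M A = a * A - b * A powr \<tau>" for A by (simp add: psi_def a_def b_def ac_simps)
  \<comment> \<open>Critical point of \<open>a * A - b * A powr \<tau>\<close>, that is, the
    solution of \<open>a = b * \<tau> * A powr (\<tau> - 1)\<close>.\<close>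
  define A0 where "A0 = (b * \<tau> / a) powr (1 / (1 - \<tau>))"
  have A0: "0 < A0" using ab tau_pos by (simp add: A0_def)
  have e: "A0 powr (1 - \<tau>) = b * \<tau> / a" using ab tau_pos \<tau> by (simp add: A0_def powr_powr)
  have "A0 = A0 powr (1 - \<tau>) * A0 powr \<tau>" using A0 by (simp add: powr_add[symmetric])
  then have "a * A0 = a * (A0 powr (1 - \<tau>) * A0 powr \<tau>)" by (rule arg_cong)
  also have "... = b * \<tau> * A0 powr \<tau>" unfolding e using ab by simp
  finally have crit: "a * A0 = b * \<tau> * A0 powr \<tau>" .
  have "psi chi M A0 < psi chi M A" if A: "0 <= A" "A ~= A0" for A
  proof -
    define t where "t = A / A0"
    have t: "0 <= t" "t ~= 1" "A = t * A0" using A A0 by (auto simp: t_def)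
    have "b * A0 powr \<tau> * t powr \<tau> < b * A0 powr \<tau> * (1 - \<tau> + \<tau> * t)"
      using ab A0 powr_less_tangent[OF tau_pos \<tau> t(1,2)] by (intro mult_strict_left_mono) auto
    moreover have "a * A = b * \<tau> * A0 powr \<tau> * t" using crit t(3) by (metis mult.assoc mult.commute)
    moreover have "A powr \<tau> = t powr \<tau> * A0 powr \<tau>" using t A0 by (simp add: powr_mult)
    ultimately show ?thesis unfolding psi crit by (simp add: algebra_simps)
  qed
  then show ?thesis using A0 by blast
qed

text \<open>Dilation multiplies \<open>mpow\<close> by \<open>lam powr (N * (m - 1))\<close>,
  strictly increasing in \<open>lam\<close>, and \<open>psi\<close> has a strict minimum, so exactly
  one \<open>lam\<close> hits it. The translation restores the centre of mass.\<close>

lemma unique_dilation: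
  assumes \<tau>: "\<tau> < 1" and chi: "0 < chi" and h: "rep h g" and g: "ismax g"
  shows "\<exists>!lam. 0 < lam \<and> (\<exists>y. Fminimizer s p m chi (Lnorm 1 h) (translate y (dilate lam h)))"
proof -
  define M A where "M = enn2real (mass g)" and "A = enn2real (mpow g)"
  have ag: "adm g" "mass g ~= 0" using g by (auto simp: ismax_def)
  have MA: "0 < M" "0 < A"
    using ag mass_0_iff[OF ag(1)] mpow_0_iff[OF ag(1)]
    by (auto simp: M_def A_def adm_def enn2real_positive_iff zero_less_iff_neq_zero)
  obtain A0 where A0: "0 < A0" "!!A. 0 <= A ==> A ~= A0 ==> psi chi M A0 < psi chi M A"
    using psi_min[OF \<tau> chi MA(1)] by blast
  have A0': "psi chi M A0 <= psi chi M A" if "0 <= A" for A using A0(2)[OF that] by (cases "A = A0") auto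
  define e where "e = N * (m - 1)"
  have e: "0 < e" using N_pos m_gt_1 by (simp add: e_def)
  have L: "Lnorm 1 h = M" using rep_Lnorm(1)[OF h] by (simp add: M_def)
  have iff: "Fminimizer s p m chi M (translate y (dilate lam h)) \<longleftrightarrow> lam powr e * A = A0"
    if Y: "Yclass m M (translate y (dilate lam h))" and lam: "0 < lam" for y lam
  proof -
    note d = rep_translate_dilate[where y=y, OF h g lam]
    have "enn2real (mpow (%x. lam powr N * g (lam *\<^sub>R (x - y)))) = lam powr e * A"
      using d(4) by (simp add: enn2real_mult e_def A_def)
    moreover have "psi chi M (lam powr e * A) = psi chi M A0 \<longleftrightarrow> lam powr e * A = A0"
    proof -
      have "0 <= lam powr e * A" using MA by simp
      from A0(2)[OF this] show ?thesis by force
    qed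
    ultimately show ?thesis using Fminimizer_iff[OF chi MA(1) A0(1) A0' Y d(1)] d(2) by simp
  qed
  define l where "l = (A0 / A) powr (1 / e)"
  have l: "0 < l" "l powr e * A = A0" using MA A0(1) e by (auto simp: l_def powr_powr)
  note d = rep_translate_dilate[where y=0, OF h g l(1)]
  have t0: "translate 0 (dilate l h) = dilate l h" by (simp add: translate_def fun_eq_iff)
  obtain y where y: "Yclass m M (translate y (dilate l h))"
    using rep_center[OF d(1,2)] d(3) by (auto simp: t0 M_def)
  show ?thesis unfolding L
  proof (intro ex1I[of _ l] conjI l(1) exI[of _ y])
    show "Fminimizer s p m chi M (translate y (dilate l h))" using iff[OF y l(1)] l(2) by simp
    fix lam assume "0 < lam \<and> (\<exists>y. Fminimizer s p m chi M (translate y (dilate lam h)))"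
    then obtain z where z: "0 < lam" "Fminimizer s p m chi M (translate z (dilate lam h))" by blast
    then have "lam powr e * A = l powr e * A" using iff[of z lam] l(2) by (auto simp: Fminimizer_def)
    then have "(lam powr e) powr (1 / e) = (l powr e) powr (1 / e)" using MA by simp
    then show "lam = l" using e z(1) l(1) by (simp add: powr_powr)
  qed
qed

text \<open>For \<open>\<tau> = 1\<close> the function \<open>psi\<close> is linear in
  \<open>A\<close>, and \<open>Mcrit\<close> is the mass at which its slope vanishes.\<close>

lemma critical_psi:
  assumes \<tau>: "\<tau> = 1" and chi: "0 < chi"
  shows "0 < Mcrit TYPE('a) s p chi"
    and "0 <= A ==> psi chi M A = A * (chi * Hr / q * (Mcrit TYPE('a) s p chi powr \<alpha> - M powr \<alpha>))"
proof -
  have m: "mcrit N s p = m" using m_minus_mcrit \<tau> by simp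
  have b: "q * (N - b0) = N * (m - 1)" using \<tau> N_pos m_gt_1 by (simp add: \<tau>_def field_simps)
  have ps: "0 < pstar N s p" "pstar N s p / q = 1 / (m - 1)"
  proof -
    show "0 < pstar N s p" using N_pos b0_less_N by (simp add: pstar_eq)
    have "N / (N - b0) / q = N / (q * (N - b0))" by simp
    then show "pstar N s p / q = 1 / (m - 1)" unfolding b pstar_eq using N_pos by simp
  qed
  have \<alpha>: "\<alpha> = s * q / N" using alpha_eq \<tau> by simp
  define X where "X = pstar N s p / (chi * Hr)"
  have X: "0 < X" using ps(1) chi Hr_pos by (simp add: X_def)
  have Mc: "Mcrit TYPE('a) s p chi = X powr (N / (s * q))"
    unfolding Mcrit_def N_eq[symmetric] m Hstar_eq X_def using Hr_pos by (simp add: q_def)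
  show "0 < Mcrit TYPE('a) s p chi" using X by (simp add: Mc)
  have "Mcrit TYPE('a) s p chi powr \<alpha> = X" using X s_pos q_gt_1 N_pos by (simp add: Mc \<alpha> powr_powr)
  then have "chi * Hr / q * Mcrit TYPE('a) s p chi powr \<alpha> = 1 / (m - 1)"
    using chi Hr_pos ps(2) by (simp add: X_def)
  moreover assume "0 <= A"
  ultimately show "psi chi M A = A * (chi * Hr / q * (Mcrit TYPE('a) s p chi powr \<alpha> - M powr \<alpha>))"
    unfolding right_diff_distrib by (simp add: psi_def \<tau>)
qed

text \<open>With a positive slope \<open>k\<close> the infimum is approached as \<open>A\<close>
  tends to 0 and not attained; with a negative one the energy is unbounded below. Existence forces
  slope 0.\<close>

lemma critical_minimizer_iff:
  assumes \<tau>: "\<tau> = 1" and chi: "0 < chi" and M: "0 < M"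
  shows "(\<exists>\<rho> :: 'a => real. Fminimizer s p m chi M \<rho>) \<longleftrightarrow> M = Mcrit TYPE('a) s p chi"
proof
  note cp = critical_psi[OF \<tau> chi]
  show "\<exists>\<rho> :: 'a => real. Fminimizer s p m chi M \<rho>" if "M = Mcrit TYPE('a) s p chi"
    by (rule Fminimizer_maximizer(1)[OF chi M zero_less_one]) (simp add: cp(2) that)
  assume "\<exists>\<rho> :: 'a => real. Fminimizer s p m chi M \<rho>"
  then obtain \<rho> :: "'a => real" where \<rho>: "Fminimizer s p m chi M \<rho>" by blast
  then have Y: "Yclass m M \<rho>" by (simp add: Fminimizer_def)
  obtain g where g: "rep \<rho> g" "enn2real (mass g) = M" "0 < enn2real (mpow g)" using Yclass_rep_ex[OF Y M] by blast
  define k where "k = chi * Hr / q * (Mcrit TYPE('a) s p chi powr \<alpha> - M powr \<alpha>)"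
  have low: "Fen s p m chi \<rho> <= A * k" if A: "0 < A" for A
  proof -
    obtain f where f: "ismax f" "mass f = ennreal M" "mpow f = ennreal A" "Yclass m M f"
      using centered_maximizer[OF M A] by blast
    have rf: "rep f f" using f(1) by (simp add: ismax_def rep_def)
    have "Fen s p m chi f = A * k" using Fen_psi(2)[OF rf chi] f M A by (simp add: cp(2) k_def)
    then show ?thesis using \<rho> f(4) by (auto simp: Fminimizer_def)
  qed
  have up: "enn2real (mpow g) * k <= Fen s p m chi \<rho>" using Fen_psi(1)[OF g(1) chi] g(2) by (simp add: cp(2) k_def)
  have "k = 0"
  proof (rule ccontr)
    assume "k ~= 0"
    then consider "0 < k" | "k < 0" by linarith
    then show False
    proof cases
      case 1
      have "enn2real (mpow g) * k <= enn2real (mpow g) / 2 * k"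
        by (rule order_trans[OF up low]) (use g(3) in simp)
      then show False using mult_pos_pos[OF g(3) 1] by linarith
    next
      case 2
      define A where "A = (\<bar>Fen s p m chi \<rho>\<bar> + 1) / - k"
      have "0 < A" "A * k = - (\<bar>Fen s p m chi \<rho>\<bar> + 1)" using 2 by (auto simp: A_def divide_simps)
      then show False using low[of A] by linarith
    qed
  qed
  then have "Mcrit TYPE('a) s p chi powr \<alpha> = M powr \<alpha>" using chi Hr_pos q_gt_1 by (simp add: k_def)
  then have "(Mcrit TYPE('a) s p chi powr \<alpha>) powr (1 / \<alpha>) = (M powr \<alpha>) powr (1 / \<alpha>)" by simp
  then show "M = Mcrit TYPE('a) s p chi" using alpha_pos M cp(1) by (simp add: powr_powr)
qed

lemma critical_maximizer:
  assumes \<tau>: "\<tau> = 1" and chi: "0 < chi" and h: "rep h g" and g: "ismax g" and M: "Lnorm 1 h = Mcrit TYPE('a) s p chi"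
  shows "\<exists>y. Fminimizer s p m chi (Mcrit TYPE('a) s p chi) (translate y h)" "Fen s p m chi h = 0"
proof -
  note cp = critical_psi[OF \<tau> chi]
  define Mc where "Mc = Mcrit TYPE('a) s p chi"
  have psi0: "psi chi Mc A = 0" if "0 <= A" for A using that by (simp add: cp(2) Mc_def)
  have ms: "enn2real (mass g) = Mc" using M rep_Lnorm(1)[OF h] by (simp add: Mc_def)
  have nz: "mass g ~= 0" using g by (simp add: ismax_def)
  show "Fen s p m chi h = 0" using Fen_psi(2)[OF h chi nz] g by (simp add: ms psi0)
  obtain y where y: "Yclass m Mc (translate y h)" using rep_center[OF h g] ms by auto
  note d = rep_translate_dilate[where y=y, OF h g zero_less_one, unfolded dilate_one]
  have "Fminimizer s p m chi Mc (translate y h)"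
    using Fminimizer_iff[of chi Mc 1, OF chi _ _ _ y d(1)] d(2) cp(1) by (simp add: psi0 Mc_def[symmetric])
  then show "\<exists>y. Fminimizer s p m chi (Mcrit TYPE('a) s p chi) (translate y h)" by (auto simp: Mc_def)
qed

end

theorem theorem1:
  fixes p s chi m :: real
  defines "N \<equiv> real DIM('a::euclidean_space)"
  assumes p: "1 < p" and sp: "0 < s * p" "s * p < N" and chi: "0 < chi"
    and m: "m > conj_exp (pstar N s p)"
  shows

   "(Hstar TYPE('a) s p m < \<infinity>
     \<and> (\<exists>h :: 'a \<Rightarrow> real. hls_maximizer s p m h)
     \<and> (\<forall>h :: 'a \<Rightarrow> real. hls_maximizer s p m h \<and> (AE x in lebesgue. 0 \<le> h x) \<longrightarrow>
          (\<exists>g x0 a C. (AE x in lebesgue. h x = g x)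
             \<and> radial_nonincr_about x0 g
             \<and> compact (closure {x. g x \<noteq> 0})
             \<and> holder_continuous g
             \<and> smooth_on (interior (closure {x. g x \<noteq> 0})) g
             \<and> 0 < a \<and> 0 < C
             \<and> (\<forall>x. g x powr (m - 1) = a * max 0 (Kspot s p g x - C)))))
   \<and>
   (m > mcrit N s p \<longrightarrow>
      (\<forall>h :: 'a \<Rightarrow> real. hls_maximizer s p m h \<and> (AE x in lebesgue. 0 \<le> h x) \<longrightarrow>
          (\<exists>!lam. 0 < lam \<and> (\<exists>y. Fminimizer s p m chi (Lnorm 1 h) (translate y (dilate lam h)))))
    \<and> (\<forall>M > 0. (\<exists>\<rho> :: 'a \<Rightarrow> real. Fminimizer s p m chi M \<rho>)
          \<and> (\<forall>\<rho> :: 'a \<Rightarrow> real. Fminimizer s p m chi M \<rho> \<longrightarrow> hls_maximizer s p m \<rho>)))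
   \<and>
   (m = mcrit N s p \<longrightarrow>
      (\<forall>h :: 'a \<Rightarrow> real. hls_maximizer s p m h \<and> (AE x in lebesgue. 0 \<le> h x)
           \<and> Lnorm 1 h = Mcrit TYPE('a) s p chi \<longrightarrow>
          (\<exists>y. Fminimizer s p m chi (Mcrit TYPE('a) s p chi) (translate y h))
          \<and> Fen s p m chi h = 0)
    \<and> (\<forall>M > 0. (\<exists>\<rho> :: 'a \<Rightarrow> real. Fminimizer s p m chi M \<rho>) \<longleftrightarrow> M = Mcrit TYPE('a) s p chi)
    \<and> (\<forall>M > 0. \<forall>\<rho> :: 'a \<Rightarrow> real. Fminimizer s p m chi M \<rho> \<longrightarrow> hls_maximizer s p m \<rho>))"
proof -
  have "0 < s" using p sp(1) by (simp add: zero_less_mult_iff)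
  moreover have "s < N"
  proof -
    have "s * 1 <= s * p" using p \<open>0 < s\<close> by (intro mult_left_mono) auto
    then show ?thesis using sp(2) by simp
  qed
  ultimately interpret hls s "TYPE('a)" N p m
    by unfold_locales (use p sp m in \<open>auto simp: N_def\<close>)
  have max_rep: "\<exists>g. rep h g \<and> ismax g" if hm: "hls_maximizer s p m h \<and> (AE x in lebesgue. 0 <= h x)" for h :: "'a => real"
  proof -
    have "Lp 1 h" "Lp m h" using hm by (auto simp: hls_maximizer_def hls_adm_def)
    then obtain g where "rep h g" using rep_ex hm by blast
    then show ?thesis using rep_maximizer hm by blast
  qed
  have \<tau>: "m > mcrit N s p \<longleftrightarrow> \<tau> < 1" "m = mcrit N s p \<longleftrightarrow> \<tau> = 1"
  proof -
    have "m > mcrit N s p \<longleftrightarrow> 0 < (m - 1) * (1 - \<tau>)" "m = mcrit N s p \<longleftrightarrow> (m - 1) * (1 - \<tau>) = 0"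
      unfolding m_minus_mcrit[symmetric] by auto
    then show "m > mcrit N s p \<longleftrightarrow> \<tau> < 1" "m = mcrit N s p \<longleftrightarrow> \<tau> = 1"
      using m_gt_1 by (auto simp: zero_less_mult_iff)
  qed
  show ?thesis
  proof (intro conjI impI allI)
    show "Hstar TYPE('a) s p m < \<infinity>" by (simp add: Hstar_eq)
    obtain f :: "'a => real" where "ismax f" using centered_maximizer[of 1 1] by auto
    then show "\<exists>h :: 'a => real. hls_maximizer s p m h" using rep_maximizer[of f f] by (auto simp: rep_def ismax_def)
  next
    fix h :: "'a => real" assume "hls_maximizer s p m h \<and> (AE x in lebesgue. 0 <= h x)"
    then obtain g where "rep h g" "ismax g" using max_rep by blast
    then show "\<exists>g x0 a C. (AE x in lebesgue. h x = g x) \<and> radial_nonincr_about x0 g \<and> compact (closure {x. g x ~= 0})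
       \<and> holder_continuous g \<and> smooth_on (interior (closure {x. g x ~= 0})) g \<and> 0 < a \<and> 0 < C
       \<and> (\<forall>x. g x powr (m - 1) = a * max 0 (Kspot s p g x - C))"
      by (rule maximizer_structure)
  next
    fix h :: "'a => real" assume "m > mcrit N s p" "hls_maximizer s p m h \<and> (AE x in lebesgue. 0 <= h x)"
    then show "\<exists>!lam. 0 < lam \<and> (\<exists>y. Fminimizer s p m chi (Lnorm 1 h) (translate y (dilate lam h)))"
      using max_rep unique_dilation[OF _ chi] \<tau>(1) by blast
  next
    fix M :: real assume "m > mcrit N s p" "0 < M"
    then obtain A0 where A0: "0 < A0" "!!A. 0 <= A ==> A ~= A0 ==> psi chi M A0 < psi chi M A"
      using psi_min[OF _ chi] \<tau>(1) by blast
    have le: "psi chi M A0 <= psi chi M A" if "0 <= A" for A using A0(2)[OF that] by (cases "A = A0") auto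
    show "\<exists>\<rho> :: 'a => real. Fminimizer s p m chi M \<rho>" by (rule Fminimizer_maximizer(1)[OF chi \<open>0 < M\<close> A0(1)]) (rule le)
    show "hls_maximizer s p m \<rho>" if "Fminimizer s p m chi M \<rho>" for \<rho> :: "'a => real" by (rule Fminimizer_maximizer(2)[OF chi \<open>0 < M\<close> A0(1) _ that]) (rule le)
  next
    fix h :: "'a => real" assume "m = mcrit N s p"
      and h: "hls_maximizer s p m h \<and> (AE x in lebesgue. 0 <= h x) \<and> Lnorm 1 h = Mcrit TYPE('a) s p chi"
    then obtain g where "rep h g" "ismax g" using max_rep by blast
    note cm = critical_maximizer[OF \<tau>(2)[THEN iffD1, OF \<open>m = mcrit N s p\<close>] chi this]
    show "\<exists>y. Fminimizer s p m chi (Mcrit TYPE('a) s p chi) (translate y h)" using cm(1) h by blast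
    show "Fen s p m chi h = 0" using cm(2) h by blast
  next
    fix M :: real assume "m = mcrit N s p" "0 < M"
    then show "(\<exists>\<rho> :: 'a => real. Fminimizer s p m chi M \<rho>) \<longleftrightarrow> M = Mcrit TYPE('a) s p chi"
      using critical_minimizer_iff[OF _ chi] \<tau>(2) by blast
  next
    fix M :: real and \<rho> :: "'a => real" assume mc: "m = mcrit N s p" and M: "0 < M" and \<rho>: "Fminimizer s p m chi M \<rho>"
    have t: "\<tau> = 1" using \<tau>(2) mc by blast
    have "M = Mcrit TYPE('a) s p chi" using critical_minimizer_iff[OF t chi M] \<rho> by blast
    \<comment> \<open>At the critical mass \<open>psi\<close> is constant, so any positive value,
      here 1, qualifies as \<open>A0\<close>.\<close>
    then have "psi chi M A = 0" if "0 <= A" for A using that by (simp add: critical_psi(2)[OF t chi])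
    then show "hls_maximizer s p m \<rho>" using \<rho> by (intro Fminimizer_maximizer(2)[OF chi M zero_less_one]) auto
  qed
qed

end
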